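(* Let $\Omega\subset\mathbb{R}^N$ ($N\ge2$) be a connected, bounded domain with smooth boundary, let $\gamma\ge0$ and $b_0>0$ be constants, and let $q\in C^1(\mathbb{R};\mathbb{R})$, $\mathcal{A}\in C^3(\mathbb{R};(0,\infty))$, $f\in C^2(\mathbb{R};\mathbb{R})$ with $\inf_{\mathbb{R}}f'>0$ and $f(0)=0$. For sufficiently small $\varepsilon>0$ let $u=u_\varepsilon$ be the unique solution of $$\varepsilon^2\mathcal{A}\Big(\fint_\Omega q(u)\,dx\Big)\Delta u=f(u)\ \text{ in }\Omega,\qquad u+\varepsilon\gamma\,\partial_{\vec n}u=b_0\ \text{ on }\partial\Omega.$$ Then, as $\varepsilon\downarrow0$, uniformly for $x\in\partial\Omega$, $$\left|\frac{u(x)-b_*}{\varepsilon}-\frac{\gamma\,\mathcal{G}(x)}{\frac{\gamma f(b_* )}{\sqrt{\mathcal{A}(q(0))}}+\sqrt{2F(b_* )}}\right|+\left|\partial_{\vec n}u(x)-\left(\frac1\varepsilon\sqrt{\frac{2F(b_* )}{\mathcal{A}(q(0))}}-\frac{\mathcal{G}(x)}{\frac{\gamma f(b_* )}{\sqrt{\mathcal{A}(q(0))}}+\sqrt{2F(b_* )}}\right)\right|\longrightarrow0,$$ where $$\mathcal{G}(x)=\frac{|\partial\Omega|\,\mathcal{A}'(q(0))}{|\Omega|\,\mathcal{A}(q(0))}F(b_* )\,\mathcal{Q}_F(b_* )+(N-1)\mathcal{H}_{\partial\Omega}(x)\int_0^{b_*}\sqrt{2F(s)}\,ds,\qquad \mathcal{Q}_F(b_*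 )=\int_0^{b_*}\frac{q(s)-q(0)}{\sqrt{2F(s)}}\,ds.$$
   Context: Under these hypotheses there is $\mathfrak{e}^*>0$ such that for each $\varepsilon\in(0,\mathfrak{e}^* )$ the boundary value problem has a unique solution $u\in C^{2,\alpha}(\Omega)\cap C^{1,\alpha}(\overline\Omega)$ for some $\alpha\in(0,1)$. Notation. $\fint_\Omega=\frac1{|\Omega|}\int_\Omega$; $|\Omega|$ is Lebesgue measure and $|\partial\Omega|$ the surface measure; $\partial_{\vec n}$ is the outward normal derivative. $\mathcal{H}_{\partial\Omega}(x)=\frac1{N-1}\sum_{i=1}^{N-1}\kappa_i(x)$ is the mean curvature of $\partial\Omega$, with $\kappa_i$ the principal curvatures (sign convention: positive for the boundary of a ball). $F(t)=\int_0^t f(s)\,ds$. The number $b_*\in(0,b_0]$ is the unique solution of $b_*+\gamma\sqrt{2F(b_* )/\mathcal{A}(q(0))}=b_0$. *)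

theory Defs
  imports "HOL-Analysis.Analysis"
begin

section \<open>Differentiability classes\<close>

definition pd :: "'a::euclidean_space \<Rightarrow> ('a \<Rightarrow> real) \<Rightarrow> 'a \<Rightarrow> real" where
  "pd i g x = frechet_derivative g (at x) i"

definition grad :: "('a::euclidean_space \<Rightarrow> real) \<Rightarrow> 'a \<Rightarrow> 'a" where
  "grad g x = (\<Sum>i\<in>Basis. pd i g x *\<^sub>R i)"

definition laplacian :: "('a::euclidean_space \<Rightarrow> real) \<Rightarrow> 'a \<Rightarrow> real" where
  "laplacian g x = (\<Sum>i\<in>Basis. pd i (pd i g) x)"

text \<open>The class \<open>C^k(S)\<close>; only meant for open \<open>S\<close>.\<close>

primrec Ck_on :: "nat \<Rightarrow> ('a::euclidean_space \<Rightarrow> real) \<Rightarrow> 'a set \<Rightarrow> bool" where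
  "Ck_on 0 g S \<longleftrightarrow> continuous_on S g"
| "Ck_on (Suc k) g S \<longleftrightarrow> g differentiable_on S \<and> (\<forall>i\<in>Basis. Ck_on k (pd i g) S)"

definition holder_on :: "real \<Rightarrow> ('a::metric_space \<Rightarrow> real) \<Rightarrow> 'a set \<Rightarrow> bool" where
  "holder_on \<alpha> g S \<longleftrightarrow> (\<exists>C. \<forall>x\<in>S. \<forall>y\<in>S. \<bar>g x - g y\<bar> \<le> C * dist x y powr \<alpha>)"

text \<open>\<open>C^{2,\<alpha>}(\<Omega>)\<close> for open \<open>\<Omega>\<close>: the second derivatives are \<open>\<alpha>\<close>-Hoelder on compact subsets
  (the convention of Gilbarg and Trudinger).\<close>

definition C2_holder :: "real \<Rightarrow> ('a::euclidean_space \<Rightarrow> real) \<Rightarrow> 'a set \<Rightarrow> bool" where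
  "C2_holder \<alpha> g \<Omega> \<longleftrightarrow> Ck_on 2 g \<Omega> \<and>
     (\<forall>i\<in>Basis. \<forall>j\<in>Basis. \<forall>K. compact K \<and> K \<subseteq> \<Omega> \<longrightarrow> holder_on \<alpha> (pd j (pd i g)) K)"

text \<open>\<open>C^{1,\<alpha>}\<close> up to the boundary: the first derivatives, which are taken in the open set \<open>\<Omega>\<close> only,
  extend to \<open>\<alpha>\<close>-Hoelder functions on the closure. The values of \<open>g\<close> outside \<open>closure \<Omega>\<close> are
  irrelevant.\<close>

definition C1_holder_closure :: "real \<Rightarrow> ('a::euclidean_space \<Rightarrow> real) \<Rightarrow> 'a set \<Rightarrow> bool" where
  "C1_holder_closure \<alpha> g \<Omega> \<longleftrightarrow> Ck_on 1 g \<Omega> \<and> continuous_on (closure \<Omega>) g \<and>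
     (\<forall>i\<in>Basis. \<exists>h. (\<forall>x\<in>\<Omega>. h x = pd i g x) \<and> holder_on \<alpha> h (closure \<Omega>))"


section \<open>Domains with smooth boundary\<close>

text \<open>Inside \<open>U\<close>, the set \<open>\<Omega>\<close> is the region below a smooth graph over the hyperplane orthogonal to the
  unit vector \<open>e\<close>. A function on that hyperplane is encoded as a function on the whole space that
  does not depend on the \<open>e\<close>-coordinate; \<open>grad g\<close> is then orthogonal to \<open>e\<close>.\<close>

definition graph_chart ::
  "'a::euclidean_space set \<Rightarrow> 'a \<Rightarrow> ('a \<Rightarrow> real) \<Rightarrow> 'a set \<Rightarrow> bool" where
  "graph_chart \<Omega> e g U \<longleftrightarrow> open U \<and> norm e = 1 \<and> (\<forall>k. Ck_on k g UNIV) \<and>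
     (\<forall>x t. g (x + t *\<^sub>R e) = g x) \<and> \<Omega> \<inter> U = {x \<in> U. x \<bullet> e < g x}"

definition smooth_boundary :: "'a::euclidean_space set \<Rightarrow> bool" where
  "smooth_boundary \<Omega> \<longleftrightarrow> (\<forall>p\<in>frontier \<Omega>. \<exists>e g U. p \<in> U \<and> graph_chart \<Omega> e g U)"

text \<open>The outward direction of the graph of \<open>g\<close> is \<open>e - grad g\<close>, of length
  \<open>sqrt (1 + (norm (grad g x))\<^sup>2)\<close>. The result does not depend on the chart.\<close>

definition outward_normal :: "'a::euclidean_space set \<Rightarrow> 'a \<Rightarrow> 'a" where
  "outward_normal \<Omega> x = (THE n. \<exists>e g U. graph_chart \<Omega> e g U \<and> x \<in> U \<and>
     n = (e - grad g x) /\<^sub>R sqrt (1 + (norm (grad g x))\<^sup>2))"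

definition normal_deriv :: "'a::euclidean_space set \<Rightarrow> ('a \<Rightarrow> real) \<Rightarrow> 'a \<Rightarrow> real" where
  "normal_deriv \<Omega> u x = vector_derivative (\<lambda>t. u (x + t *\<^sub>R outward_normal \<Omega> x)) (at_left 0)"

text \<open>The surface measure is the Borel measure carried by the boundary that on the graph of \<open>g\<close> has
  density \<open>sqrt (1 + (norm (grad g y))\<^sup>2)\<close> with respect to \<open>(N-1)\<close>-dimensional Lebesgue measure \<open>dy\<close>
  on the hyperplane orthogonal to \<open>e\<close>. The integral over that hyperplane is written as an integral
  over the slab of thickness one above it, all integrands being independent of the \<open>e\<close>-coordinate;
  \<open>x + (g x - x \<bullet> e) *\<^sub>R e\<close> is the point of the graph lying over \<open>x\<close>.\<close>

definition is_surface_measure :: "'a::euclidean_space set \<Rightarrow> 'a measure \<Rightarrow> bool" where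
  "is_surface_measure \<Omega> \<sigma> \<longleftrightarrow> sets \<sigma> = sets borel \<and> emeasure \<sigma> (- frontier \<Omega>) = 0 \<and>
     (\<forall>e g U. graph_chart \<Omega> e g U \<longrightarrow> (\<forall>B\<in>sets borel. B \<subseteq> frontier \<Omega> \<inter> U \<longrightarrow>
        emeasure \<sigma> B =
          (\<integral>\<^sup>+ x \<in> {x. 0 \<le> x \<bullet> e \<and> x \<bullet> e \<le> 1 \<and> x + (g x - x \<bullet> e) *\<^sub>R e \<in> B}.
             ennreal (sqrt (1 + (norm (grad g x))\<^sup>2)) \<partial>lborel)))"

definition surface_measure :: "'a::euclidean_space set \<Rightarrow> 'a measure" where
  "surface_measure \<Omega> = (THE \<sigma>. is_surface_measure \<Omega> \<sigma>)"

definition surface_area :: "'a::euclidean_space set \<Rightarrow> real" where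
  "surface_area \<Omega> = measure (surface_measure \<Omega>) (frontier \<Omega>)"

text \<open>The derivative of the normal field along the boundary. A derivative within \<open>frontier \<Omega>\<close> is
  determined on tangent vectors only, so it must not be applied to other vectors. With the outward
  normal, its eigenvalues are positive for a ball.\<close>

definition shape_operator :: "'a::euclidean_space set \<Rightarrow> 'a \<Rightarrow> 'a \<Rightarrow> 'a" where
  "shape_operator \<Omega> x = frechet_derivative (outward_normal \<Omega>) (at x within frontier \<Omega>)"

definition curvature_space :: "'a::euclidean_space set \<Rightarrow> 'a \<Rightarrow> real \<Rightarrow> 'a set" where
  "curvature_space \<Omega> x \<kappa> =
     {v. v \<bullet> outward_normal \<Omega> x = 0 \<and> shape_operator \<Omega> x v = \<kappa> *\<^sub>R v}"

definition principal_curvatures :: "'a::euclidean_space set \<Rightarrow> 'a \<Rightarrow> real set" where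
  "principal_curvatures \<Omega> x = {\<kappa>. curvature_space \<Omega> x \<kappa> \<noteq> {0}}"

text \<open>Each principal curvature is counted with its multiplicity, so there are \<open>N-1\<close> of them.\<close>

definition mean_curvature :: "'a::euclidean_space set \<Rightarrow> 'a \<Rightarrow> real" where
  "mean_curvature \<Omega> x =
     (\<Sum>\<kappa>\<in>principal_curvatures \<Omega> x. real (dim (curvature_space \<Omega> x \<kappa>)) * \<kappa>) / (real DIM('a) - 1)"


section \<open>The boundary value problem\<close>

definition average :: "'a::euclidean_space set \<Rightarrow> ('a \<Rightarrow> real) \<Rightarrow> real" where
  "average \<Omega> h = (LINT x:\<Omega>|lborel. h x) / measure lborel \<Omega>"

definition bvp_solution ::
  "'a::euclidean_space set \<Rightarrow> (real \<Rightarrow> real) \<Rightarrow> (real \<Rightarrow> real) \<Rightarrow> (real \<Rightarrow> real) \<Rightarrow>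
   real \<Rightarrow> real \<Rightarrow> real \<Rightarrow> ('a \<Rightarrow> real) \<Rightarrow> bool" where
  "bvp_solution \<Omega> A q f \<gamma> b0 \<epsilon> u \<longleftrightarrow>
     (\<exists>\<alpha>. 0 < \<alpha> \<and> \<alpha> < 1 \<and> C2_holder \<alpha> u \<Omega> \<and> C1_holder_closure \<alpha> u \<Omega>) \<and>
     (\<forall>x\<in>\<Omega>. \<epsilon>\<^sup>2 * A (average \<Omega> (\<lambda>y. q (u y))) * laplacian u x = f (u x)) \<and>
     (\<forall>x\<in>frontier \<Omega>. u x + \<epsilon> * \<gamma> * normal_deriv \<Omega> u x = b0)"

definition primitive :: "(real \<Rightarrow> real) \<Rightarrow> real \<Rightarrow> real" where
  "primitive f t = (LBINT s=0..t. f s)"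

definition Q_F :: "(real \<Rightarrow> real) \<Rightarrow> (real \<Rightarrow> real) \<Rightarrow> real \<Rightarrow> real" where
  "Q_F q f b = (LBINT s=0..b. (q s - q 0) / sqrt (2 * primitive f s))"

definition G_term ::
  "'a::euclidean_space set \<Rightarrow> (real \<Rightarrow> real) \<Rightarrow> (real \<Rightarrow> real) \<Rightarrow> (real \<Rightarrow> real) \<Rightarrow>
   real \<Rightarrow> 'a \<Rightarrow> real" where
  "G_term \<Omega> A q f b x =
     surface_area \<Omega> * deriv A (q 0) / (measure lborel \<Omega> * A (q 0)) * primitive f b * Q_F q f b
     + (real DIM('a) - 1) * mean_curvature \<Omega> x * (LBINT s=0..b. sqrt (2 * primitive f s))"

end

theory Submission
  imports Defs
begin

text \<open>
  Let \<open>l = \<epsilon> sqrt (A (avg))\<close>, with \<open>avg\<close> the average of \<open>q (u)\<close>, so that \<open>l\<^sup>2 \<Delta>u = f (u)\<close>. Near a boundary point,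
  \<open>W (\<rho> / l)\<close> with \<open>W' = - p (W)\<close> and \<open>\<rho>\<close> close to the distance to the boundary is an upper or lower barrier
  as soon as \<open>p p' + l \<kappa> p - f\<close> has the right sign, where \<open>\<kappa>\<close> is slightly larger or smaller than
  \<open>- \<Delta>\<rho>\<close>, which is \<open>N - 1\<close> times the mean curvature on the boundary. For \<open>p\<close> a multiple, with factor close
  to one, of \<open>p0 = sqrt (2 F)\<close>, these barriers give the leading order profile of \<open>u\<close> in the boundary layer, and
  integrating it over the layer gives \<open>avg\<close> up to \<open>o (\<epsilon>)\<close>. For \<open>p = p0 - l \<kappa> p1\<close>, where \<open>p0 p1\<close> is
  the primitive of \<open>p0\<close>, they determine \<open>u\<close> on the boundary up to \<open>o (\<epsilon>)\<close>; the Robin condition, or for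
  \<open>\<gamma> = 0\<close> the fact that the barriers touch \<open>u\<close> at the boundary point, then gives the normal derivative.
\<close>

section \<open>Calculus with partial derivatives\<close>

text \<open>The nonlocal coefficient is handled by freezing it: once \<open>u\<close> is given,
  \<open>A (avg)\<close> is a number, the equation becomes local, and comparison applies. The
  coupling returns only through the first-order expansion of \<open>1 / sqrt (A (avg))\<close>,
  which produces the first summand of \<open>G_term\<close>; the correction \<open>p1\<close> of the
  profile produces the second. Both perturb the Robin balance between boundary value and flux, and
  its linearisation at \<open>bs\<close> gives the common denominator. Two objects are definite
  descriptions and must be shown to exist. The normal is fixed by which rays enter
  \<open>\<Omega>\<close>. For the surface measure, the agreement of two charts needs no change of
  variables between them: integrals of \<open>exp (- dist / l) / l\<close> against a test function
  do not mention a chart, and their limit computed in a chart is the graph integral. The expansion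
  is proved along arbitrary sequences \<open>\<epsilon> n\<close> tending to zero, so that dominated
  convergence is available. Near a boundary point the same profile serves all centres in a
  neighbourhood, and compactness of the boundary gives uniformity.\<close>

lemma pd_eqI: "(g has_derivative D) (at x) \<Longrightarrow> pd i g x = D i"
  unfolding pd_def by (metis frechet_derivative_at)

lemma differentiable_has_pd:
  "g differentiable at x \<Longrightarrow> (g has_derivative (\<lambda>v. \<Sum>i\<in>Basis. (v \<bullet> i) * pd i g x)) (at x)"
proof -
  assume g: "g differentiable at x"
  then have D: "(g has_derivative frechet_derivative g (at x)) (at x)"
    by (simp add: frechet_derivative_works)
  interpret linear "frechet_derivative g (at x)" using D has_derivative_linear by blast
  have "frechet_derivative g (at x) v = (\<Sum>i\<in>Basis. (v \<bullet> i) * pd i g x)" for v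
  proof -
    have "frechet_derivative g (at x) (\<Sum>i\<in>Basis. (v \<bullet> i) *\<^sub>R i) = (\<Sum>i\<in>Basis. (v \<bullet> i) *\<^sub>R frechet_derivative g (at x) i)"
      by (simp add: sum scale)
    then show ?thesis by (simp add: euclidean_representation pd_def)
  qed
  then show ?thesis using D by presburger
qed

lemma grad_inner: "grad g x \<bullet> v = (\<Sum>i\<in>Basis. (v \<bullet> i) * pd i g x)"
  by (simp add: grad_def inner_sum_left mult.commute inner_commute[of v])

lemma grad_inner_Basis: "i \<in> Basis \<Longrightarrow> grad g x \<bullet> i = pd i g x"
  by (simp add: grad_def inner_sum_left_Basis)

lemma differentiable_has_grad:
  "g differentiable at x \<Longrightarrow> (g has_derivative (\<lambda>v. grad g x \<bullet> v)) (at x)"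
  using differentiable_has_pd by (simp add: grad_inner)

lemma grad_eqI:
  assumes "(g has_derivative (\<lambda>v. w \<bullet> v)) (at x)"
  shows "grad g x = w"
proof (rule euclidean_eqI)
  fix b :: 'a assume "b \<in> Basis"
  then show "grad g x \<bullet> b = w \<bullet> b"
    using pd_eqI[OF assms, of b] by (simp add: grad_inner_Basis)
qed

text \<open>\<open>frechet_derivative\<close> is a choice among the derivatives at the point, and
  functions that agree near the point have the same ones; the equality thus covers points where
  neither is differentiable.\<close>

lemma pd_cong_open:
  assumes "open S" "x \<in> S" "\<And>y. y \<in> S \<Longrightarrow> f y = g y"
  shows "pd i f x = pd i g x"
proof -
  have "(f has_derivative D) (at x) \<longleftrightarrow> (g has_derivative D) (at x)" for D
    using has_derivative_transform_within_open[of f D x UNIV S g]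
      has_derivative_transform_within_open[of g D x UNIV S f] assms by auto
  then show ?thesis unfolding pd_def frechet_derivative_def by simp
qed

lemma differentiable_cong_open:
  assumes "open S" "x \<in> S" "\<And>y. y \<in> S \<Longrightarrow> f y = g y" "f differentiable at x"
  shows "g differentiable at x"
  using assms has_derivative_transform_within_open[of f _ x UNIV S g]
  unfolding differentiable_def by auto

lemma has_frechet_derivative:
  "f differentiable at x \<Longrightarrow> (f has_derivative frechet_derivative f (at x)) (at x)"
  by (simp add: frechet_derivative_works)

lemma pd_const [simp]: "pd i (\<lambda>x. c) x = 0"
  by (rule pd_eqI[where D="\<lambda>_. 0"]) simp

lemma pd_add:
  assumes "f differentiable at x" "g differentiable at x"
  shows "pd i (\<lambda>y. f y + g y) x = pd i f x + pd i g x"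
  using pd_eqI[OF has_derivative_add[OF has_frechet_derivative[OF assms(1)] has_frechet_derivative[OF assms(2)]]]
  by (simp add: pd_def)

lemma pd_mult:
  assumes "f differentiable at x" "g differentiable at x"
  shows "pd i (\<lambda>y. f y * g y) x = pd i f x * g x + f x * pd i g x"
  using pd_eqI[OF has_derivative_mult[OF has_frechet_derivative[OF assms(1)] has_frechet_derivative[OF assms(2)]]]
  by (simp add: pd_def algebra_simps)

lemma pd_cmult:
  assumes "f differentiable at x"
  shows "pd i (\<lambda>y. c * f y) x = c * pd i f x"
  using pd_mult[of "\<lambda>_. c" x f i] assms by simp

lemma pd_compose:
  assumes "f differentiable at x" "(W has_real_derivative w) (at (f x))"
  shows "pd i (\<lambda>y. W (f y)) x = w * pd i f x"
  using pd_eqI[OF has_derivative_compose[OF has_frechet_derivative[OF assms(1)]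
        assms(2)[unfolded has_field_derivative_def]]]
  by (simp add: pd_def)

lemma differentiable_compose_real:
  assumes "f differentiable at x" "(W has_real_derivative w) (at (f x))"
  shows "(\<lambda>y. W (f y)) differentiable at x"
  using has_derivative_compose[OF has_frechet_derivative[OF assms(1)]
        assms(2)[unfolded has_field_derivative_def]] unfolding differentiable_def by blast

lemma pd_inner: "pd i (\<lambda>x. x \<bullet> e) x = i \<bullet> e"
  by (rule pd_eqI) (auto intro!: derivative_eq_intros)

subsection \<open>Smooth functions\<close>

lemma Ck_on_differentiable:
  "Ck_on (Suc k) g S \<Longrightarrow> open S \<Longrightarrow> x \<in> S \<Longrightarrow> g differentiable at x"
  by (auto simp: differentiable_on_eq_differentiable_at)

lemma Ck_on_SucD: "Ck_on (Suc k) g S \<Longrightarrow> Ck_on k g S"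
  by (induction k arbitrary: g) (auto intro: differentiable_imp_continuous_on)

lemma Ck_on_continuous: "Ck_on k g S \<Longrightarrow> continuous_on S g"
  by (cases k) (auto intro: differentiable_imp_continuous_on)

lemma Ck_on_cong:
  "open S \<Longrightarrow> (\<And>x. x \<in> S \<Longrightarrow> f x = g x) \<Longrightarrow> Ck_on k f S \<Longrightarrow> Ck_on k g S"
proof (induction k arbitrary: f g)
  case 0
  then show ?case using continuous_on_cong[of S S f g] by auto
next
  case (Suc k)
  have "g differentiable_on S"
    using Suc.prems differentiable_cong_open[of S _ f g]
    by (auto simp: differentiable_on_eq_differentiable_at)
  moreover have "Ck_on k (pd i g) S" if "i \<in> Basis" for i
    using Suc.IH[of "pd i f" "pd i g"] Suc.prems that pd_cong_open[of S _ f g i] by auto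
  ultimately show ?case by simp
qed

lemma Ck_on_const: "Ck_on k (\<lambda>x. c) S"
proof (induction k arbitrary: c)
  case (Suc k)
  have "pd i (\<lambda>x. c) = (\<lambda>x. 0)" for i :: 'a by (rule ext) simp
  then show ?case using Suc by simp
qed simp

lemma Ck_on_add:
  "open S \<Longrightarrow> Ck_on k f S \<Longrightarrow> Ck_on k g S \<Longrightarrow> Ck_on k (\<lambda>x. f x + g x) S"
proof (induction k arbitrary: f g)
  case 0
  then show ?case by (auto intro: continuous_on_add)
next
  case (Suc k)
  have "Ck_on k (pd i (\<lambda>x. f x + g x)) S" if "i \<in> Basis" for i
  proof (rule Ck_on_cong[OF \<open>open S\<close>])
    show "Ck_on k (\<lambda>x. pd i f x + pd i g x) S" using Suc that by auto
    show "pd i f x + pd i g x = pd i (\<lambda>x. f x + g x) x" if "x \<in> S" for x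
      using Suc.prems that by (simp add: pd_add Ck_on_differentiable del: Ck_on.simps)
  qed
  then show ?case using Suc.prems by (auto intro: differentiable_on_add)
qed

lemma Ck_on_mult:
  "open S \<Longrightarrow> Ck_on k f S \<Longrightarrow> Ck_on k g S \<Longrightarrow> Ck_on k (\<lambda>x. f x * g x) S"
proof (induction k arbitrary: f g)
  case 0
  then show ?case by (auto intro: continuous_on_mult)
next
  case (Suc k)
  have "Ck_on k (pd i (\<lambda>x. f x * g x)) S" if i: "i \<in> Basis" for i
  proof (rule Ck_on_cong[OF \<open>open S\<close>])
    show "Ck_on k (\<lambda>x. pd i f x * g x + f x * pd i g x) S"
      using Suc.prems i Ck_on_SucD[OF Suc.prems(2)] Ck_on_SucD[OF Suc.prems(3)]
      by (intro Ck_on_add Suc.IH) auto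
    show "pd i f x * g x + f x * pd i g x = pd i (\<lambda>x. f x * g x) x" if "x \<in> S" for x
      using Suc.prems that by (simp add: pd_mult Ck_on_differentiable del: Ck_on.simps)
  qed
  then show ?case using Suc.prems by (auto simp: differentiable_on_eq_differentiable_at)
qed

text \<open>With \<open>h = 1 / sqrt f\<close> the derivative is
  \<open>- (1/2) * h ^ 3 * pd i f\<close>, again built from \<open>h\<close> itself, so the
  induction on the order closes by the product rule.\<close>

lemma Ck_on_inverse_sqrt:
  "open S \<Longrightarrow> (\<And>x. x \<in> S \<Longrightarrow> f x > 0) \<Longrightarrow> Ck_on k f S \<Longrightarrow> Ck_on k (\<lambda>x. 1 / sqrt (f x)) S"
proof (induction k)
  case 0
  then have "continuous_on S (\<lambda>x. 1 / sqrt (f x))"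
    by (intro continuous_intros) (auto simp: less_le)
  then show ?case by simp
next
  case (Suc k)
  have der: "((\<lambda>t. 1 / sqrt t) has_real_derivative - (1/2) * (1 / sqrt t) ^ 3) (at t)" if "t > 0" for t
    using that by (auto intro!: derivative_eq_intros simp: field_simps power3_eq_cube)
  let ?h = "\<lambda>x. 1 / sqrt (f x)"
  have h: "Ck_on k ?h S" using Suc.IH Suc.prems Ck_on_SucD by blast
  have d: "f differentiable at x" if "x \<in> S" for x
    using Suc.prems that Ck_on_differentiable by blast
  have "Ck_on k (pd i ?h) S" if i: "i \<in> Basis" for i
  proof (rule Ck_on_cong[OF \<open>open S\<close>])
    show "Ck_on k (\<lambda>x. - (1/2) * (?h x * (?h x * ?h x)) * pd i f x) S"
      using Suc.prems i h by (intro Ck_on_mult Ck_on_const) auto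
    show "- (1/2) * (?h x * (?h x * ?h x)) * pd i f x = pd i ?h x" if "x \<in> S" for x
      using pd_compose[OF d[OF that] der[of "f x"], of i] Suc.prems that
      by (simp add: power3_eq_cube mult_ac)
  qed
  moreover have "?h differentiable_on S"
    using differentiable_compose_real[OF d der] Suc.prems
    by (auto simp: differentiable_on_eq_differentiable_at)
  ultimately show ?case by simp
qed

definition smooth :: "('a::euclidean_space \<Rightarrow> real) \<Rightarrow> bool" where
  "smooth g \<longleftrightarrow> (\<forall>k. Ck_on k g UNIV)"

lemma smooth_const [simp]: "smooth (\<lambda>x. c)"
  by (simp add: smooth_def Ck_on_const)

lemma smooth_add: "smooth f \<Longrightarrow> smooth g \<Longrightarrow> smooth (\<lambda>x. f x + g x)"
  by (simp add: smooth_def Ck_on_add)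

lemma smooth_mult: "smooth f \<Longrightarrow> smooth g \<Longrightarrow> smooth (\<lambda>x. f x * g x)"
  by (simp add: smooth_def Ck_on_mult)

lemma smooth_uminus: "smooth g \<Longrightarrow> smooth (\<lambda>x. - g x)"
  using smooth_mult[of "\<lambda>_. -1" g] by simp

lemma smooth_diff: "smooth f \<Longrightarrow> smooth g \<Longrightarrow> smooth (\<lambda>x. f x - g x)"
  using smooth_add[of f "\<lambda>x. - g x"] smooth_uminus[of g] by simp

lemma smooth_sum: "(\<And>i. i \<in> I \<Longrightarrow> smooth (f i)) \<Longrightarrow> smooth (\<lambda>x. \<Sum>i\<in>I. f i x)"
  by (induction I rule: infinite_finite_induct) (auto intro: smooth_add)

lemma smooth_pd: "smooth g \<Longrightarrow> i \<in> Basis \<Longrightarrow> smooth (pd i g)"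
  unfolding smooth_def by (metis Ck_on.simps(2))

lemma smooth_inverse_sqrt: "smooth f \<Longrightarrow> (\<And>x. f x > 0) \<Longrightarrow> smooth (\<lambda>x. 1 / sqrt (f x))"
  by (simp add: smooth_def Ck_on_inverse_sqrt)

lemma smooth_differentiable: "smooth g \<Longrightarrow> g differentiable at x"
  unfolding smooth_def by (metis Ck_on_differentiable open_UNIV UNIV_I)

lemma smooth_continuous: "smooth g \<Longrightarrow> continuous_on S g"
  unfolding smooth_def by (meson Ck_on_continuous continuous_on_subset subset_UNIV)

lemma smooth_isCont: "smooth g \<Longrightarrow> isCont g x"
  by (metis smooth_continuous continuous_on_eq_continuous_at open_UNIV UNIV_I)

lemma smooth_inner: "smooth (\<lambda>x. x \<bullet> e)"
proof -
  have "Ck_on k (\<lambda>x. x \<bullet> e) UNIV" for k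
  proof (cases k)
    case 0
    then show ?thesis by (simp add: continuous_intros)
  next
    case (Suc j)
    have "pd i (\<lambda>x. x \<bullet> e) = (\<lambda>x. i \<bullet> e)" for i by (rule ext) (rule pd_inner)
    then show ?thesis using Suc by (auto simp: Ck_on_const differentiable_on_def
          intro!: bounded_linear_imp_differentiable bounded_linear_inner_left)
  qed
  then show ?thesis by (simp add: smooth_def)
qed

text \<open>The inner product of the gradients (\<open>gdot_eq_inner\<close>), written in
  coordinates so that its smoothness follows from that of the partial derivatives.\<close>

definition gdot :: "('a::euclidean_space \<Rightarrow> real) \<Rightarrow> ('a \<Rightarrow> real) \<Rightarrow> 'a \<Rightarrow> real" where
  "gdot f g x = (\<Sum>i\<in>Basis. pd i f x * pd i g x)"

lemma gdot_eq_inner: "gdot f g x = grad f x \<bullet> grad g x"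
  by (simp add: gdot_def grad_inner[of f] grad_inner_Basis mult.commute)

lemma gdot_commute: "gdot f g x = gdot g f x"
  by (simp add: gdot_def mult.commute)

lemma gdot_add_right:
  assumes "g differentiable at x" "h differentiable at x"
  shows "gdot f (\<lambda>y. g y + h y) x = gdot f g x + gdot f h x"
  using assms by (simp add: gdot_def pd_add algebra_simps sum.distrib)

lemma gdot_mult_right:
  assumes "g differentiable at x" "h differentiable at x"
  shows "gdot f (\<lambda>y. g y * h y) x = g x * gdot f h x + h x * gdot f g x"
  using assms by (simp add: gdot_def pd_mult algebra_simps sum.distrib sum_distrib_left)

lemma smooth_gdot: "smooth f \<Longrightarrow> smooth g \<Longrightarrow> smooth (gdot f g)"
  unfolding gdot_def[abs_def] by (intro smooth_sum smooth_mult smooth_pd)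

lemma smooth_laplacian: "smooth f \<Longrightarrow> smooth (laplacian f)"
  unfolding laplacian_def[abs_def] by (intro smooth_sum smooth_pd)

subsection \<open>Twice differentiable functions and the Laplacian\<close>

text \<open>Pointwise regularity under which the sum, product and chain rules for the Laplacian
  hold. It covers solutions, smooth functions and one-dimensional profiles composed with smooth
  functions alike.\<close>

definition diff2_on :: "('a::euclidean_space \<Rightarrow> real) \<Rightarrow> 'a set \<Rightarrow> bool" where
  "diff2_on g S \<longleftrightarrow> (\<forall>x\<in>S. g differentiable at x \<and> (\<forall>i\<in>Basis. pd i g differentiable at x))"

lemma diff2_on_subset: "diff2_on g S \<Longrightarrow> T \<subseteq> S \<Longrightarrow> diff2_on g T"
  by (auto simp: diff2_on_def)

lemma Ck_on_2_diff2_on: "Ck_on 2 g S \<Longrightarrow> open S \<Longrightarrow> diff2_on g S"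
  unfolding diff2_on_def numeral_2_eq_2
  by (metis Ck_on.simps(2) Ck_on_differentiable)

lemma smooth_diff2_on: "smooth g \<Longrightarrow> diff2_on g S"
  by (simp add: diff2_on_def smooth_differentiable smooth_pd)

lemma diff2_on_add:
  assumes S: "open S" and f: "diff2_on f S" and g: "diff2_on g S"
  shows "diff2_on (\<lambda>y. f y + g y) S"
    and "x \<in> S \<Longrightarrow> laplacian (\<lambda>y. f y + g y) x = laplacian f x + laplacian g x"
proof -
  have e: "pd i (\<lambda>y. f y + g y) y = pd i f y + pd i g y" if "y \<in> S" for i y
    using f g that by (simp add: diff2_on_def pd_add)
  have "pd i (\<lambda>y. f y + g y) differentiable at x" if "x \<in> S" "i \<in> Basis" for x i
    using differentiable_cong_open[OF S \<open>x \<in> S\<close>, of "\<lambda>y. pd i f y + pd i g y" "pd i (\<lambda>y. f y + g y)"]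
      e that f g by (auto simp: diff2_on_def)
  then show "diff2_on (\<lambda>y. f y + g y) S" using f g by (auto simp: diff2_on_def)
  show "laplacian (\<lambda>y. f y + g y) x = laplacian f x + laplacian g x" if x: "x \<in> S"
  proof -
    have "pd i (pd i (\<lambda>y. f y + g y)) x = pd i (pd i f) x + pd i (pd i g) x" if "i \<in> Basis" for i
      using pd_cong_open[OF S x, of "pd i (\<lambda>y. f y + g y)" "\<lambda>y. pd i f y + pd i g y" i] e
        pd_add[of "pd i f" x "pd i g" i] f g x that by (auto simp: diff2_on_def)
    then show ?thesis by (simp add: laplacian_def sum.distrib)
  qed
qed

lemma diff2_on_mult:
  assumes S: "open S" and f: "diff2_on f S" and g: "diff2_on g S"
  shows "diff2_on (\<lambda>y. f y * g y) S"
    and "x \<in> S \<Longrightarrow> laplacian (\<lambda>y. f y * g y) x = laplacian f x * g x + 2 * gdot f g x + f x * laplacian g x"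
proof -
  have e: "pd i (\<lambda>y. f y * g y) y = pd i f y * g y + f y * pd i g y" if "y \<in> S" for i y
    using f g that by (simp add: diff2_on_def pd_mult)
  have "pd i (\<lambda>y. f y * g y) differentiable at x" if "x \<in> S" "i \<in> Basis" for x i
    using differentiable_cong_open[OF S \<open>x \<in> S\<close>, of "\<lambda>y. pd i f y * g y + f y * pd i g y" "pd i (\<lambda>y. f y * g y)"]
      e that f g by (auto simp: diff2_on_def)
  then show "diff2_on (\<lambda>y. f y * g y) S" using f g by (auto simp: diff2_on_def)
  show "laplacian (\<lambda>y. f y * g y) x = laplacian f x * g x + 2 * gdot f g x + f x * laplacian g x" if x: "x \<in> S"
  proof -
    have "pd i (pd i (\<lambda>y. f y * g y)) x
        = pd i (pd i f) x * g x + 2 * (pd i f x * pd i g x) + f x * pd i (pd i g) x" if "i \<in> Basis" for i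
    proof -
      have "pd i (pd i (\<lambda>y. f y * g y)) x = pd i (\<lambda>y. pd i f y * g y + f y * pd i g y) x"
        by (rule pd_cong_open[OF S x e])
      also have "\<dots> = pd i (\<lambda>y. pd i f y * g y) x + pd i (\<lambda>y. f y * pd i g y) x"
        using f g x that by (intro pd_add) (auto simp: diff2_on_def)
      also have "\<dots> = pd i (pd i f) x * g x + 2 * (pd i f x * pd i g x) + f x * pd i (pd i g) x"
        using f g x that by (simp add: pd_mult diff2_on_def)
      finally show ?thesis .
    qed
    then show ?thesis
      by (simp add: laplacian_def gdot_def sum.distrib sum_distrib_left sum_distrib_right)
  qed
qed

lemma laplacian_const [simp]: "laplacian (\<lambda>x. c) x = 0"
proof -
  have "pd i (\<lambda>x. c) = (\<lambda>x. 0)" for i :: 'a and c by (rule ext) simp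
  then show ?thesis by (simp add: laplacian_def)
qed

lemma diff2_on_const [simp]: "diff2_on (\<lambda>x. c) S"
  by (simp add: smooth_diff2_on)

lemma diff2_on_cmult:
  assumes S: "open S" and f: "diff2_on f S"
  shows "diff2_on (\<lambda>y. c * f y) S"
    and "x \<in> S \<Longrightarrow> laplacian (\<lambda>y. c * f y) x = c * laplacian f x"
proof -
  show "diff2_on (\<lambda>y. c * f y) S" using diff2_on_mult(1)[OF S _ f, of "\<lambda>_. c"] by simp
  show "laplacian (\<lambda>y. c * f y) x = c * laplacian f x" if "x \<in> S"
    using diff2_on_mult(2)[OF S _ f that, of "\<lambda>_. c"] by (simp add: gdot_def)
qed

lemma diff2_on_compose:
  assumes S: "open S" and f: "diff2_on f S"
    and W: "\<And>x. x \<in> S \<Longrightarrow> (W has_real_derivative W' (f x)) (at (f x))"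
    and W': "\<And>x. x \<in> S \<Longrightarrow> (W' has_real_derivative W'' (f x)) (at (f x))"
  shows "diff2_on (\<lambda>y. W (f y)) S"
    and "x \<in> S \<Longrightarrow> laplacian (\<lambda>y. W (f y)) x = W'' (f x) * gdot f f x + W' (f x) * laplacian f x"
proof -
  have e: "pd i (\<lambda>y. W (f y)) y = W' (f y) * pd i f y" if "y \<in> S" for i y
    using pd_compose[where W=W and f=f, OF _ W[OF that]] f that by (simp add: diff2_on_def)
  have d: "(\<lambda>y. W (f y)) differentiable at y" "(\<lambda>y. W' (f y)) differentiable at y" if "y \<in> S" for y
    using differentiable_compose_real[where W=W and f=f, OF _ W[OF that]]
      differentiable_compose_real[where W=W' and f=f, OF _ W'[OF that]] f that
    by (auto simp: diff2_on_def)
  have "pd i (\<lambda>y. W (f y)) differentiable at y" if "y \<in> S" "i \<in> Basis" for y i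
    using differentiable_cong_open[OF S \<open>y \<in> S\<close>, of "\<lambda>y. W' (f y) * pd i f y" "pd i (\<lambda>y. W (f y))"]
      e that f d by (auto simp: diff2_on_def)
  then show "diff2_on (\<lambda>y. W (f y)) S" using d by (auto simp: diff2_on_def)
  show "laplacian (\<lambda>y. W (f y)) x = W'' (f x) * gdot f f x + W' (f x) * laplacian f x" if x: "x \<in> S"
  proof -
    have "pd i (pd i (\<lambda>y. W (f y))) x = W'' (f x) * (pd i f x * pd i f x) + W' (f x) * pd i (pd i f) x"
      if "i \<in> Basis" for i
    proof -
      have "pd i (pd i (\<lambda>y. W (f y))) x = pd i (\<lambda>y. W' (f y) * pd i f y) x"
        by (rule pd_cong_open[OF S x e])
      also have "\<dots> = pd i (\<lambda>y. W' (f y)) x * pd i f x + W' (f x) * pd i (pd i f) x"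
        using f x d that by (intro pd_mult) (auto simp: diff2_on_def)
      finally show ?thesis
        using pd_compose[where W=W' and f=f, OF _ W'[OF x], of i] f x by (simp add: diff2_on_def)
    qed
    then show ?thesis
      by (simp add: laplacian_def gdot_def sum.distrib sum_distrib_left)
  qed
qed

lemma gdot_smooth_simps:
  assumes "smooth f" "smooth g" "smooth h"
  shows "gdot f (\<lambda>y. g y + h y) x = gdot f g x + gdot f h x"
    and "gdot (\<lambda>y. g y + h y) f x = gdot g f x + gdot h f x"
    and "gdot f (\<lambda>y. g y * h y) x = g x * gdot f h x + h x * gdot f g x"
    and "gdot (\<lambda>y. g y * h y) f x = g x * gdot h f x + h x * gdot g f x"
proof -
  have d: "f differentiable at x" "g differentiable at x" "h differentiable at x"
    using assms by (simp_all add: smooth_differentiable)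
  show "gdot f (\<lambda>y. g y + h y) x = gdot f g x + gdot f h x"
    and "gdot f (\<lambda>y. g y * h y) x = g x * gdot f h x + h x * gdot f g x"
    using d by (simp_all only: gdot_add_right gdot_mult_right)
  then show "gdot (\<lambda>y. g y + h y) f x = gdot g f x + gdot h f x"
    and "gdot (\<lambda>y. g y * h y) f x = g x * gdot h f x + h x * gdot g f x"
    by (metis gdot_commute)+
qed

lemma gdot_const [simp]: "gdot f (\<lambda>x. c) x = 0" "gdot (\<lambda>x. c) f x = 0"
  by (simp_all add: gdot_def)

lemma laplacian_smooth_simps:
  assumes "smooth f" "smooth g"
  shows "laplacian (\<lambda>y. f y + g y) x = laplacian f x + laplacian g x"
    and "laplacian (\<lambda>y. f y * g y) x = laplacian f x * g x + 2 * gdot f g x + f x * laplacian g x"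
  using diff2_on_add(2)[of UNIV f g x] diff2_on_mult(2)[of UNIV f g x] assms
  by (auto simp: smooth_diff2_on)

lemma laplacian_norm_square:
  "smooth (\<lambda>x. (norm (x - p))\<^sup>2)"
  "laplacian (\<lambda>x. (norm (x - p))\<^sup>2) x = 2 * real DIM('a)" for x p :: "'a::euclidean_space"
proof -
  have e: "(\<lambda>x. (norm (x - p))\<^sup>2) = (\<lambda>x. \<Sum>i\<in>Basis. (x \<bullet> i - p \<bullet> i) * (x \<bullet> i - p \<bullet> i))"
    by (rule ext, subst power2_norm_eq_inner, subst euclidean_inner) (simp add: inner_diff_left)
  show "smooth (\<lambda>x. (norm (x - p))\<^sup>2)"
    unfolding e by (intro smooth_sum smooth_mult smooth_diff smooth_inner smooth_const)
  have "pd i (\<lambda>x. (norm (x - p))\<^sup>2) x = 2 * (x \<bullet> i - p \<bullet> i)" for i x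
  proof -
    have "((\<lambda>y. (norm (y - p))\<^sup>2) has_derivative (\<lambda>h. (x - p) \<bullet> (h - 0) + (h - 0) \<bullet> (x - p))) (at x)"
      unfolding power2_norm_eq_inner
      by (intro has_derivative_inner has_derivative_diff has_derivative_ident has_derivative_const)
    then show ?thesis by (simp add: pd_eqI inner_diff_left inner_diff_right inner_commute)
  qed
  then have "pd i (\<lambda>x. (norm (x - p))\<^sup>2) = (\<lambda>x. 2 * (x \<bullet> i - p \<bullet> i))" for i by auto
  moreover have "pd i (\<lambda>x. 2 * (x \<bullet> i - p \<bullet> i)) x = 2 * (i \<bullet> i)" for i
    by (rule trans[OF pd_eqI[where D="\<lambda>h. 2 * (h \<bullet> i)"]]) (auto intro!: derivative_eq_intros)
  ultimately show "laplacian (\<lambda>x. (norm (x - p))\<^sup>2) x = 2 * real DIM('a)"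
    by (simp add: laplacian_def)
qed

section \<open>Restriction to lines and symmetry of second derivatives\<close>

lemma has_derivative_along_line:
  assumes "g differentiable at (x + t *\<^sub>R v)"
  shows "((\<lambda>t. g (x + t *\<^sub>R v)) has_real_derivative grad g (x + t *\<^sub>R v) \<bullet> v) (at t)"
proof -
  have "((\<lambda>t. x + t *\<^sub>R v) has_derivative (\<lambda>h. h *\<^sub>R v)) (at t)"
    by (auto intro!: derivative_eq_intros)
  then have "((\<lambda>t. g (x + t *\<^sub>R v)) has_derivative (\<lambda>h. grad g (x + t *\<^sub>R v) \<bullet> (h *\<^sub>R v))) (at t)"
    by (rule has_derivative_compose) (rule differentiable_has_grad[OF assms])
  then show ?thesis
    unfolding has_field_derivative_def by (rule has_derivative_eq_rhs) (simp add: fun_eq_iff)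
qed

lemma has_derivative_along_Basis:
  assumes "g differentiable at (x + t *\<^sub>R i)" "i \<in> Basis"
  shows "((\<lambda>t. g (x + t *\<^sub>R i)) has_real_derivative pd i g (x + t *\<^sub>R i)) (at t)"
  using has_derivative_along_line[OF assms(1)] assms(2) by (simp add: grad_inner_Basis)

text \<open>The mean value theorem twice: in direction \<open>i\<close> for the difference of two
  parallel restrictions, then in direction \<open>j\<close>. The left side is symmetric in
  \<open>i\<close> and \<open>j\<close>, the right side is not.\<close>

lemma second_difference_eq:
  assumes g: "smooth g" and i: "i \<in> Basis" and j: "j \<in> Basis" and h: "h > 0"
  obtains \<xi> \<eta> where "0 < \<xi>" "\<xi> < h" "0 < \<eta>" "\<eta> < h"
    "g (x + h *\<^sub>R i + h *\<^sub>R j) - g (x + h *\<^sub>R i) - g (x + h *\<^sub>R j) + g x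
      = h * h * pd j (pd i g) (x + \<xi> *\<^sub>R i + \<eta> *\<^sub>R j)"
proof -
  let ?k = "\<lambda>s. g (x + h *\<^sub>R j + s *\<^sub>R i) - g (x + s *\<^sub>R i)"
  let ?k' = "\<lambda>s. pd i g (x + h *\<^sub>R j + s *\<^sub>R i) - pd i g (x + s *\<^sub>R i)"
  have "(?k has_real_derivative ?k' s) (at s)" for s
    by (rule DERIV_diff) (rule has_derivative_along_Basis[OF smooth_differentiable[OF g] i])+
  then obtain \<xi> where \<xi>: "0 < \<xi>" "\<xi> < h"
    and e1: "?k h - ?k 0 = (h - 0) * ?k' \<xi>"
    using MVT2[of 0 h ?k ?k'] h by blast
  let ?l = "\<lambda>t. pd i g (x + \<xi> *\<^sub>R i + t *\<^sub>R j)" and ?l' = "\<lambda>t. pd j (pd i g) (x + \<xi> *\<^sub>R i + t *\<^sub>R j)"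
  have "(?l has_real_derivative ?l' t) (at t)" for t
    by (rule has_derivative_along_Basis[OF smooth_differentiable[OF smooth_pd[OF g i]] j])
  then obtain \<eta> where \<eta>: "0 < \<eta>" "\<eta> < h" and e2: "?l h - ?l 0 = (h - 0) * ?l' \<eta>"
    using MVT2[of 0 h ?l ?l'] h by blast
  show ?thesis
    using that[OF \<xi> \<eta>] e1 e2 by (simp add: algebra_simps)
qed

text \<open>Schwarz's theorem. Equal second differences force the two mixed derivatives to agree at
  two points near \<open>x\<close>; if their values at \<open>x\<close> differed, continuity with
  tolerance half the gap would exclude this.\<close>

lemma pd_commute:
  assumes g: "smooth g" and i: "i \<in> Basis" and j: "j \<in> Basis"
  shows "pd i (pd j g) x = pd j (pd i g) x"
proof (rule ccontr)
  let ?a = "pd j (pd i g)" and ?b = "pd i (pd j g)"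
  define d where "d = \<bar>?a x - ?b x\<bar> / 2"
  assume "?b x \<noteq> ?a x"
  then have d: "d > 0" by (simp add: d_def)
  have "isCont ?a x" "isCont ?b x" by (intro smooth_isCont smooth_pd g i j)+
  then have "\<exists>r>0. \<forall>y. dist y x < r \<longrightarrow> dist (?a y) (?a x) < d"
    "\<exists>r>0. \<forall>y. dist y x < r \<longrightarrow> dist (?b y) (?b x) < d"
    using d unfolding continuous_at_eps_delta by blast+
  then obtain r1 r2 where r: "r1 > 0" "r2 > 0"
    "\<And>y. dist y x < r1 \<Longrightarrow> dist (?a y) (?a x) < d"
    "\<And>y. dist y x < r2 \<Longrightarrow> dist (?b y) (?b x) < d"
    by blast
  \<comment> \<open>The intermediate points are displaced by less than \<open>h\<close> in each of
    two directions, hence by less than \<open>2 * h\<close>, which stays below both radii.\<close>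
  define h where "h = min r1 r2 / 3"
  have h: "h > 0" "2 * h < r1" "2 * h < r2" using r by (auto simp: h_def)
  have close: "dist (x + \<xi> *\<^sub>R i' + \<eta> *\<^sub>R j') x < 2 * h"
    if "0 < \<xi>" "\<xi> < h" "0 < \<eta>" "\<eta> < h" "i' \<in> Basis" "j' \<in> Basis" for \<xi> \<eta> i' j'
    using norm_triangle_ineq[of "\<xi> *\<^sub>R i'" "\<eta> *\<^sub>R j'"] that by (simp add: dist_norm add.assoc)
  obtain \<xi> \<eta> where 1: "0 < \<xi>" "\<xi> < h" "0 < \<eta>" "\<eta> < h"
    "g (x + h *\<^sub>R i + h *\<^sub>R j) - g (x + h *\<^sub>R i) - g (x + h *\<^sub>R j) + g x
      = h * h * ?a (x + \<xi> *\<^sub>R i + \<eta> *\<^sub>R j)"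
    using second_difference_eq[OF g i j h(1)] by blast
  obtain \<xi>' \<eta>' where 2: "0 < \<xi>'" "\<xi>' < h" "0 < \<eta>'" "\<eta>' < h"
    "g (x + h *\<^sub>R j + h *\<^sub>R i) - g (x + h *\<^sub>R j) - g (x + h *\<^sub>R i) + g x
      = h * h * ?b (x + \<xi>' *\<^sub>R j + \<eta>' *\<^sub>R i)"
    using second_difference_eq[OF g j i h(1)] by blast
  have sw: "x + h *\<^sub>R j + h *\<^sub>R i = x + h *\<^sub>R i + h *\<^sub>R j" by simp
  have "h * h * ?a (x + \<xi> *\<^sub>R i + \<eta> *\<^sub>R j) = h * h * ?b (x + \<xi>' *\<^sub>R j + \<eta>' *\<^sub>R i)"
    using 1(5) 2(5) unfolding sw by linarith
  then have eq: "?a (x + \<xi> *\<^sub>R i + \<eta> *\<^sub>R j) = ?b (x + \<xi>' *\<^sub>R j + \<eta>' *\<^sub>R i)" using h by simp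
  have "dist (?a (x + \<xi> *\<^sub>R i + \<eta> *\<^sub>R j)) (?a x) < d"
    using r(3) close[OF 1(1-4) i j] h by force
  moreover have "dist (?b (x + \<xi>' *\<^sub>R j + \<eta>' *\<^sub>R i)) (?b x) < d"
    using r(4) close[OF 2(1-4) j i] h by force
  ultimately have "\<bar>?a x - ?b x\<bar> < d + d" using eq unfolding dist_real_def by linarith
  then show False by (simp add: d_def)
qed

section \<open>Self-adjoint operators on a subspace\<close>

text \<open>A maximiser \<open>v\<close> of the Rayleigh quotient on the unit sphere of
  \<open>T\<close> works: \<open>L v\<close> turns out orthogonal to every unit vector of
  \<open>T\<close> that is orthogonal to \<open>v\<close>, so it is a multiple of
  \<open>v\<close>.\<close>

lemma self_adjoint_has_eigenvector:
  fixes L :: "'a::euclidean_space \<Rightarrow> 'a"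
  assumes T: "subspace T" "T \<noteq> {0}" and L: "linear L" "\<And>v. v \<in> T \<Longrightarrow> L v \<in> T"
    and sa: "\<And>v w. v \<in> T \<Longrightarrow> w \<in> T \<Longrightarrow> L v \<bullet> w = v \<bullet> L w"
  obtains v k where "v \<in> T" "norm v = 1" "L v = k *\<^sub>R v"
proof -
  let ?S = "T \<inter> sphere 0 1"
  have "compact ?S" using closed_subspace[OF T(1)] by (intro closed_Int_compact) auto
  moreover obtain w where "w \<in> T" "w \<noteq> 0" using T subspace_0 by blast
  then have "w /\<^sub>R norm w \<in> ?S" using T by (simp add: subspace_scale)
  then have "?S \<noteq> {}" by blast
  moreover have "continuous_on ?S (\<lambda>v. v \<bullet> L v)"
    using linear_continuous_on_compose[OF continuous_on_id L(1)] by (intro continuous_intros) auto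
  ultimately obtain v where v: "v \<in> T" "norm v = 1" and mx: "\<And>w. w \<in> ?S \<Longrightarrow> w \<bullet> L w \<le> v \<bullet> L v"
    using continuous_attains_sup[of ?S "\<lambda>v. v \<bullet> L v"] by (metis IntE mem_sphere_0)
  have vv: "v \<bullet> v = 1" using v by (simp add: dot_square_norm)
  have orth: "w \<bullet> L v = 0" if w: "w \<in> T" "norm w = 1" "v \<bullet> w = 0" for w
  proof -
    \<comment> \<open>A great circle from \<open>v\<close> towards \<open>w\<close>. The quadratic
      form along it is maximal at \<open>t = 0\<close>, where its derivative is
      \<open>2 * (w \<bullet> L v)\<close>.\<close>
    let ?c = "\<lambda>t::real. cos t *\<^sub>R v + sin t *\<^sub>R w"
    have ww: "w \<bullet> w = 1" using w by (simp add: dot_square_norm)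
    have "?c t \<in> ?S" for t
    proof -
      have "(norm (?c t))\<^sup>2 = (cos t)\<^sup>2 + (sin t)\<^sup>2"
        unfolding power2_norm_eq_inner using w vv ww
        by (simp add: inner_add_left inner_add_right inner_commute power2_eq_square)
      then have "norm (?c t) = 1" using norm_ge_zero[of "?c t"]
        by (metis power2_eq_iff_nonneg one_power2 zero_le_one sin_cos_squared_add2)
      then show ?thesis using T v w by (simp add: subspace_add subspace_scale)
    qed
    note mx' = mx[OF this]
    define \<phi> where "\<phi> t = (cos t)\<^sup>2 * (v \<bullet> L v) + 2 * (sin t * cos t) * (w \<bullet> L v) + (sin t)\<^sup>2 * (w \<bullet> L w)" for t
    have sw: "v \<bullet> L w = w \<bullet> L v" using sa[OF v(1) w(1)] by (simp add: inner_commute)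
    have "?c t \<bullet> L (?c t) = \<phi> t" for t
      by (simp add: \<phi>_def linear_add[OF L(1)] linear_cmul[OF L(1)] inner_add_left inner_add_right sw
          power2_eq_square algebra_simps)
    then have "\<phi> t \<le> \<phi> 0" for t using mx'[of t] by (simp add: \<phi>_def)
    moreover have "(\<phi> has_real_derivative 2 * (w \<bullet> L v)) (at 0)"
      unfolding \<phi>_def by (auto intro!: derivative_eq_intros)
    ultimately have "2 * (w \<bullet> L v) = 0" using DERIV_local_max[of \<phi> "2 * (w \<bullet> L v)" 0 1] by simp
    then show ?thesis by simp
  qed
  define r where "r = L v - (v \<bullet> L v) *\<^sub>R v"
  have r: "r \<in> T" "v \<bullet> r = 0"
    using T v L vv by (auto simp: r_def subspace_diff subspace_scale inner_diff_right)
  have "r = 0"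
  proof (rule ccontr)
    assume "r \<noteq> 0"
    then have "(r /\<^sub>R norm r) \<bullet> L v = 0" using T r by (intro orth) (auto simp: subspace_scale)
    then have "r \<bullet> L v = 0" using \<open>r \<noteq> 0\<close> by simp
    then have "r \<bullet> r = 0" using r by (simp add: r_def inner_diff_right inner_diff_left inner_commute)
    then show False using \<open>r \<noteq> 0\<close> by simp
  qed
  then show ?thesis using that[of v "v \<bullet> L v"] v by (simp add: r_def)
qed

text \<open>Split off one eigenvector and continue in its orthogonal complement within
  \<open>T\<close>, which is invariant because \<open>L\<close> is self-adjoint and has smaller
  dimension.\<close>

lemma self_adjoint_eigenbasis:
  fixes L :: "'a::euclidean_space \<Rightarrow> 'a"
  assumes "subspace T" "linear L" "\<And>v. v \<in> T \<Longrightarrow> L v \<in> T"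
    and "\<And>v w. v \<in> T \<Longrightarrow> w \<in> T \<Longrightarrow> L v \<bullet> w = v \<bullet> L w"
  shows "\<exists>B k. B \<subseteq> T \<and> pairwise orthogonal B \<and> (\<forall>b\<in>B. norm b = 1 \<and> L b = k b *\<^sub>R b) \<and> span B = T"
  using assms
proof (induction "dim T" arbitrary: T rule: less_induct)
  case less
  note T = less.prems
  show ?case
  proof (cases "T = {0}")
    case True
    then show ?thesis by (intro exI[of _ "{}"]) auto
  next
    case False
    obtain v k where v: "v \<in> T" "norm v = 1" "L v = k *\<^sub>R v"
      using self_adjoint_has_eigenvector[OF T(1) False T(2,3,4)] by blast
    have vv: "v \<bullet> v = 1" using v by (simp add: dot_square_norm)
    let ?T = "T \<inter> {w. v \<bullet> w = 0}"
    have s: "subspace ?T" by (rule subspace_inter[OF T(1) subspace_hyperplane])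
    have inv: "L w \<in> ?T" if "w \<in> ?T" for w
      using T that v by (auto simp: T(4)[OF v(1), symmetric])
    have "dim ?T < dim T"
    proof (rule dim_psubset)
      have "v \<notin> ?T" using vv by auto
      moreover have "span T = T" "span ?T = ?T" by (simp_all only: span_eq_iff T(1) s)
      ultimately show "span ?T \<subset> span T" using v(1) by blast
    qed
    then have "\<exists>B k. B \<subseteq> ?T \<and> pairwise orthogonal B \<and> (\<forall>b\<in>B. norm b = 1 \<and> L b = k b *\<^sub>R b) \<and> span B = ?T"
      by (rule less.hyps[OF _ s T(2) inv]) (use T(4) in blast)+
    then obtain B k' where B: "B \<subseteq> ?T" "pairwise orthogonal B"
      "\<forall>b\<in>B. norm b = 1 \<and> L b = k' b *\<^sub>R b" "span B = ?T" by blast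
    have "pairwise orthogonal (insert v B)"
      using B by (auto simp: pairwise_insert orthogonal_def inner_commute)
    moreover have "span (insert v B) = T"
    proof
      show "span (insert v B) \<subseteq> T" using B v T by (intro span_minimal) auto
      show "T \<subseteq> span (insert v B)"
      proof
        fix x assume x: "x \<in> T"
        have "x - (v \<bullet> x) *\<^sub>R v \<in> span B"
          using x v T vv unfolding B(4) by (auto simp: subspace_diff subspace_scale inner_diff_right)
        then show "x \<in> span (insert v B)" using span_insert by auto
      qed
    qed
    moreover have "v \<notin> B" using B vv by auto
    ultimately show ?thesis using B v
      by (intro exI[of _ "insert v B"] exI[of _ "k'(v := k)"]) auto
  qed
qed

text \<open>Independence of the trace from the orthonormal basis: expand \<open>b\<close> in
  \<open>Basis\<close>, exchange the sums, and apply Parseval's identity for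
  \<open>B\<close>.\<close>

lemma trace_orthonormal:
  fixes L :: "'a::euclidean_space \<Rightarrow> 'a"
  assumes B: "pairwise orthogonal B" "\<And>b. b \<in> B \<Longrightarrow> norm b = 1" "span B = UNIV" "finite B" and L: "linear L"
  shows "(\<Sum>b\<in>B. b \<bullet> L b) = (\<Sum>i\<in>Basis. i \<bullet> L i)"
proof -
  have parseval: "(\<Sum>b\<in>B. (x \<bullet> b) * (b \<bullet> y)) = x \<bullet> y" for x y
  proof -
    have "(\<Sum>b\<in>B. (x \<bullet> b) *\<^sub>R b) = x" using orthonormal_basis_expand[OF B(1,2)] B by auto
    then have "x \<bullet> y = (\<Sum>b\<in>B. (x \<bullet> b) *\<^sub>R b) \<bullet> y" by simp
    then show ?thesis by (simp add: inner_sum_left)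
  qed
  have "b \<bullet> L b = (\<Sum>i\<in>Basis. (i \<bullet> b) * (b \<bullet> L i))" for b
  proof -
    have "L b = (\<Sum>i\<in>Basis. (b \<bullet> i) *\<^sub>R L i)"
      by (metis (no_types, lifting) L euclidean_representation linear_scale linear_sum sum.cong)
    then have "b \<bullet> L b = b \<bullet> (\<Sum>i\<in>Basis. (b \<bullet> i) *\<^sub>R L i)" by simp
    then show ?thesis by (simp add: inner_sum_right inner_commute)
  qed
  then have "(\<Sum>b\<in>B. b \<bullet> L b) = (\<Sum>b\<in>B. \<Sum>i\<in>Basis. (i \<bullet> b) * (b \<bullet> L i))" by simp
  also have "\<dots> = (\<Sum>i\<in>Basis. \<Sum>b\<in>B. (i \<bullet> b) * (b \<bullet> L i))" by (rule sum.swap)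
  finally show ?thesis by (simp add: parseval)
qed

text \<open>Turns a sum over eigenvalues weighted by multiplicity, the form in which the mean
  curvature is defined, into a trace. Each eigenspace is spanned by the basis vectors with that
  eigenvalue.\<close>

lemma eigenspace_dim_sum:
  fixes L :: "'a::euclidean_space \<Rightarrow> 'a"
  assumes B: "B \<subseteq> T" "pairwise orthogonal B" "\<And>b. b \<in> B \<Longrightarrow> norm b = 1" "span B = T"
    and k: "\<And>b. b \<in> B \<Longrightarrow> L b = k b *\<^sub>R b" and L: "linear L"
  defines "E \<equiv> \<lambda>\<kappa>. {v \<in> T. L v = \<kappa> *\<^sub>R v}"
  shows "(\<Sum>\<kappa> | E \<kappa> \<noteq> {0}. real (dim (E \<kappa>)) * \<kappa>) = (\<Sum>b\<in>B. b \<bullet> L b)"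
proof -
  have B0: "0 \<notin> B" using B(3) by force
  have ind: "independent B" by (rule pairwise_orthogonal_independent[OF B(2) B0])
  then have fin: "finite B" by (rule independent_imp_finite)
  have E: "E \<kappa> = span {b\<in>B. k b = \<kappa>}" for \<kappa>
  proof
    show "span {b\<in>B. k b = \<kappa>} \<subseteq> E \<kappa>"
    proof (rule span_minimal)
      show "{b\<in>B. k b = \<kappa>} \<subseteq> E \<kappa>" using B k by (auto simp: E_def)
      show "subspace (E \<kappa>)" using L subspace_span[of B] unfolding E_def B(4)
        by (auto simp: subspace_def linear_add linear_cmul linear_0 scaleR_add_right)
    qed
    show "E \<kappa> \<subseteq> span {b\<in>B. k b = \<kappa>}"
    proof
      fix v assume "v \<in> E \<kappa>"
      then have v: "v \<in> span B" "L v = \<kappa> *\<^sub>R v" using B by (auto simp: E_def)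
      have ex: "(\<Sum>b\<in>B. (v \<bullet> b) *\<^sub>R b) = v" by (rule orthonormal_basis_expand[OF B(2,3) v(1) fin])
      have "v \<bullet> b = 0" if b: "b \<in> B" "k b \<noteq> \<kappa>" for b
      proof -
        have orth: "c \<bullet> b = (if c = b then 1 else 0)" if "c \<in> B" for c
          using B(2,3) b that by (auto simp: pairwise_def orthogonal_def dot_square_norm)
        \<comment> \<open>Computing \<open>L v\<close> in the basis and pairing it with
          \<open>b\<close> gives \<open>\<kappa> * (v \<bullet> b) = (v \<bullet> b) * k b\<close>;
          coefficients belonging to other eigenvalues vanish.\<close>
        have "L v = (\<Sum>c\<in>B. (v \<bullet> c) *\<^sub>R (k c *\<^sub>R c))"
        proof -
          have "L v = L (\<Sum>c\<in>B. (v \<bullet> c) *\<^sub>R c)" using ex by simp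
          also have "\<dots> = (\<Sum>c\<in>B. (v \<bullet> c) *\<^sub>R (k c *\<^sub>R c))"
            using k by (simp add: linear_sum[OF L] linear_cmul[OF L])
          finally show ?thesis .
        qed
        then have "L v \<bullet> b = (\<Sum>c\<in>B. (v \<bullet> c) * (k c * (c \<bullet> b)))"
          by (simp add: inner_sum_left mult.assoc)
        also have "\<dots> = (\<Sum>c\<in>B. if c = b then (v \<bullet> b) * k b else 0)"
          by (rule sum.cong) (auto simp: orth)
        also have "\<dots> = (v \<bullet> b) * k b" using b fin by simp
        finally have "\<kappa> * (v \<bullet> b) = (v \<bullet> b) * k b" using v by simp
        then show ?thesis using b by simp
      qed
      then have "v = (\<Sum>b\<in>{b\<in>B. k b = \<kappa>}. (v \<bullet> b) *\<^sub>R b)"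
        using ex sum.mono_neutral_right[OF fin, of "{b\<in>B. k b = \<kappa>}" "\<lambda>b. (v \<bullet> b) *\<^sub>R b"] by auto
      also have "\<dots> \<in> span {b\<in>B. k b = \<kappa>}" by (intro span_sum span_scale span_base) auto
      finally show "v \<in> span {b\<in>B. k b = \<kappa>}" .
    qed
  qed
  have dimE: "dim (E \<kappa>) = card {b\<in>B. k b = \<kappa>}" for \<kappa>
    unfolding E using independent_mono[OF ind, of "{b\<in>B. k b = \<kappa>}"]
    by (subst dim_span_eq_card_independent) auto
  have "E \<kappa> \<noteq> {0} \<longleftrightarrow> \<kappa> \<in> k ` B" for \<kappa>
  proof
    assume "\<kappa> \<in> k ` B"
    then obtain b where "b \<in> B" "k b = \<kappa>" by blast
    then have "b \<in> E \<kappa>" "b \<noteq> 0" using E span_base[of b "{b\<in>B. k b = \<kappa>}"] B0 by auto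
    then show "E \<kappa> \<noteq> {0}" by blast
  next
    assume "E \<kappa> \<noteq> {0}"
    then have "{b\<in>B. k b = \<kappa>} \<noteq> {}" using E span_empty by metis
    then show "\<kappa> \<in> k ` B" by blast
  qed
  then have "{\<kappa>. E \<kappa> \<noteq> {0}} = k ` B" by blast
  then have "(\<Sum>\<kappa> | E \<kappa> \<noteq> {0}. real (dim (E \<kappa>)) * \<kappa>)
      = (\<Sum>\<kappa>\<in>k ` B. \<Sum>b | b \<in> B \<and> k b = \<kappa>. k b)"
    by (simp add: dimE)
  also have "\<dots> = (\<Sum>b\<in>B. k b)" by (rule sum.image_gen[OF fin, symmetric])
  also have "\<dots> = (\<Sum>b\<in>B. b \<bullet> L b)"
    using k B(3) by (intro sum.cong) (auto simp: dot_square_norm)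
  finally show ?thesis .
qed

section \<open>Boundary charts and the outward normal\<close>

text \<open>\<open>nu\<close> extends the unit normal off the graph, independently of the \<open>e\<close>-coordinate.\<close>

locale chart =
  fixes \<Omega> :: "'a::euclidean_space set" and e g U
  assumes chart: "graph_chart \<Omega> e g U" and open_\<Omega>: "open \<Omega>"
begin

definition height :: "'a \<Rightarrow> real" where "height x = g x - x \<bullet> e"
text \<open>The cosine of the angle between \<open>e\<close> and the normal (\<open>nu_e\<close>);
  its reciprocal is the surface density over the hyperplane.\<close>

definition slope :: "'a \<Rightarrow> real" where "slope x = 1 / sqrt (1 + (norm (grad g x))\<^sup>2)"
definition nu :: "'a \<Rightarrow> 'a" where "nu x = slope x *\<^sub>R (e - grad g x)"
definition foot :: "'a \<Rightarrow> 'a" where "foot x = x + height x *\<^sub>R e"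

lemma open_U: "open U" and norm_e: "norm e = 1" and smooth_g: "smooth g"
  and g_shift: "g (x + t *\<^sub>R e) = g x"
  using chart by (auto simp: graph_chart_def smooth_def)

lemma e_e [simp]: "e \<bullet> e = 1"
  using norm_e by (simp add: dot_square_norm)

lemma in_\<Omega>_iff: "x \<in> U \<Longrightarrow> x \<in> \<Omega> \<longleftrightarrow> height x > 0"
  using chart by (auto simp: graph_chart_def height_def)

lemma smooth_height: "smooth height"
  unfolding height_def[abs_def] by (intro smooth_diff smooth_g smooth_inner)

lemma grad_g_shift: "grad g (x + t *\<^sub>R e) = grad g x"
proof (rule grad_eqI)
  have "((\<lambda>y. y + - t *\<^sub>R e) has_derivative (\<lambda>v. v)) (at (x + t *\<^sub>R e))"
    by (auto intro!: derivative_eq_intros)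
  moreover have "(g has_derivative (\<lambda>v. grad g x \<bullet> v)) (at (x + t *\<^sub>R e + - t *\<^sub>R e))"
    using differentiable_has_grad[OF smooth_differentiable[OF smooth_g, of x]] by simp
  ultimately have "((\<lambda>y. g (y + - t *\<^sub>R e)) has_derivative (\<lambda>v. grad g x \<bullet> v)) (at (x + t *\<^sub>R e))"
    by (rule has_derivative_compose)
  then show "(g has_derivative (\<lambda>v. grad g x \<bullet> v)) (at (x + t *\<^sub>R e))"
    unfolding g_shift .
qed

lemma grad_g_e [simp]: "grad g x \<bullet> e = 0"
proof -
  have "((\<lambda>t. g (x + t *\<^sub>R e)) has_real_derivative grad g (x + 0 *\<^sub>R e) \<bullet> e) (at 0)"
    by (rule has_derivative_along_line[OF smooth_differentiable[OF smooth_g]])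
  then have "((\<lambda>t. g x) has_real_derivative grad g x \<bullet> e) (at 0)"
    unfolding g_shift by simp
  then show ?thesis using DERIV_unique DERIV_const by blast
qed

lemma grad_height: "grad height x = grad g x - e"
proof (rule grad_eqI)
  have "(g has_derivative (\<lambda>v. grad g x \<bullet> v)) (at x)"
    by (rule differentiable_has_grad[OF smooth_differentiable[OF smooth_g]])
  then show "(height has_derivative (\<lambda>v. (grad g x - e) \<bullet> v)) (at x)"
    unfolding height_def[abs_def]
    by (auto intro!: derivative_eq_intros simp: inner_diff_left inner_diff_right inner_commute)
qed

lemma height_shift: "height (x + t *\<^sub>R e) = height x - t"
  by (simp add: height_def g_shift inner_add_left)

lemma slope_shift: "slope (x + t *\<^sub>R e) = slope x"
  by (simp add: slope_def grad_g_shift)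

lemma slope_foot [simp]: "slope (foot x) = slope x"
  by (simp add: foot_def slope_shift)

lemma height_foot [simp]: "height (foot x) = 0"
  by (simp add: foot_def height_shift)

lemma foot_eq: "height x = 0 \<Longrightarrow> foot x = x"
  by (simp add: foot_def)

lemma slope_pos: "slope x > 0"
  unfolding slope_def by (intro divide_pos_pos) (auto intro: add_pos_nonneg)

lemma slope_sq: "(slope x)\<^sup>2 * (1 + (norm (grad g x))\<^sup>2) = 1"
proof -
  have "1 + (norm (grad g x))\<^sup>2 > 0" by (intro add_pos_nonneg) auto
  then show ?thesis by (simp add: slope_def power_divide)
qed

lemma slope_inverse: "1 / slope x = sqrt (1 + (norm (grad g x))\<^sup>2)"
  by (simp add: slope_def)

lemma norm_grad_height: "grad height x \<bullet> grad height x = 1 + (norm (grad g x))\<^sup>2"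
proof -
  have "e \<bullet> grad g x = 0" using grad_g_e[of x] by (simp add: inner_commute)
  then show ?thesis
    by (simp add: grad_height inner_diff_left inner_diff_right power2_norm_eq_inner)
qed

lemma slope_gdot: "(slope x)\<^sup>2 * gdot height height x = 1"
  using slope_sq by (simp add: gdot_eq_inner norm_grad_height)

lemma smooth_slope: "smooth slope"
proof -
  have "smooth (\<lambda>x. 1 / sqrt (gdot height height x))"
  proof (rule smooth_inverse_sqrt)
    show "smooth (gdot height height)" by (intro smooth_gdot smooth_height)
    show "gdot height height x > 0" for x
      by (simp add: gdot_eq_inner norm_grad_height add_pos_nonneg)
  qed
  then show ?thesis by (simp add: slope_def[abs_def] gdot_eq_inner norm_grad_height)
qed

lemma nu_eq: "nu x = - slope x *\<^sub>R grad height x"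
  by (simp add: nu_def grad_height algebra_simps)

lemma nu_nu [simp]: "nu x \<bullet> nu x = 1"
  using slope_gdot[of x] by (simp add: nu_eq gdot_eq_inner power2_eq_square mult.assoc)

lemma nu_e: "nu x \<bullet> e = slope x"
  by (simp add: nu_def inner_diff_left)

lemma continuous_slope: "continuous_on S slope"
  by (rule smooth_continuous[OF smooth_slope])

lemma continuous_foot: "continuous_on S foot"
  unfolding foot_def[abs_def] by (intro continuous_intros smooth_continuous[OF smooth_height])

lemma height_along_line:
  "((\<lambda>t. height (x + t *\<^sub>R v)) has_real_derivative grad height (x + t *\<^sub>R v) \<bullet> v) (at t)"
  by (rule has_derivative_along_line[OF smooth_differentiable[OF smooth_height]])

lemma eventually_in_U:
  assumes "x \<in> U"
  shows "\<forall>\<^sub>F t in at_right 0. x + t *\<^sub>R v \<in> U"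
proof -
  have "((\<lambda>t. x + t *\<^sub>R v) \<longlongrightarrow> x + 0 *\<^sub>R v) (at_right 0)"
    by (intro tendsto_intros)
  then show ?thesis using topological_tendstoD[OF _ open_U] assms by auto
qed

text \<open>\<open>grad height\<close> is a negative multiple of \<open>nu\<close>, so a direction
  with negative \<open>nu\<close> component raises the height to first order.\<close>

lemma eventually_inside:
  assumes x: "x \<in> U" "height x = 0" and v: "v \<bullet> nu x < 0"
  shows "\<forall>\<^sub>F t in at_right 0. x + t *\<^sub>R v \<in> \<Omega>"
proof -
  have "grad height x \<bullet> v > 0" using v slope_pos[of x]
    by (simp add: nu_eq inner_commute zero_less_mult_iff)
  then obtain d where d: "d > 0" "\<And>t. t > 0 \<Longrightarrow> t < d \<Longrightarrow> height x < height (x + t *\<^sub>R v)"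
    using DERIV_pos_inc_right[OF height_along_line[of x v 0]] by auto
  then have "\<forall>\<^sub>F t in at_right 0. height (x + t *\<^sub>R v) > 0"
    using x unfolding eventually_at_right_field by (intro exI[of _ d]) auto
  then show ?thesis using eventually_in_U[OF x(1), of v]
    by eventually_elim (simp add: in_\<Omega>_iff)
qed

lemma eventually_outside:
  assumes x: "x \<in> U" "height x = 0" and v: "v \<bullet> nu x > 0"
  shows "\<forall>\<^sub>F t in at_right 0. x + t *\<^sub>R v \<notin> \<Omega>"
proof -
  have "- (grad height x \<bullet> v) > 0" using v slope_pos[of x]
    by (simp add: nu_eq inner_commute mult_less_0_iff)
  then obtain d where d: "d > 0" "\<And>t. t > 0 \<Longrightarrow> t < d \<Longrightarrow> - height x < - height (x + t *\<^sub>R v)"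
    using DERIV_pos_inc_right[OF DERIV_minus[OF height_along_line[of x v 0]]] by auto
  then have "\<forall>\<^sub>F t in at_right 0. height (x + t *\<^sub>R v) < 0"
    using x unfolding eventually_at_right_field by (intro exI[of _ d]) auto
  then show ?thesis using eventually_in_U[OF x(1), of v]
    by eventually_elim (simp add: in_\<Omega>_iff)
qed

text \<open>As \<open>\<Omega>\<close> is open, its frontier points have height at most zero, and
  negative height persists on a neighbourhood that misses \<open>\<Omega>\<close>. Conversely, from
  a point of height zero the ray along \<open>- nu\<close> enters \<open>\<Omega>\<close>.\<close>

lemma frontier_iff:
  assumes x: "x \<in> U"
  shows "x \<in> frontier \<Omega> \<longleftrightarrow> height x = 0"
proof
  assume f: "x \<in> frontier \<Omega>"
  then have "x \<notin> \<Omega>" using open_\<Omega> by (simp add: frontier_def interior_open)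
  then have "height x \<le> 0" using in_\<Omega>_iff[OF x] by simp
  moreover have "\<not> height x < 0"
  proof
    assume "height x < 0"
    have "open {y. height y < 0}"
      using smooth_continuous[OF smooth_height] by (simp add: open_Collect_less)
    then have "open (U \<inter> {y. height y < 0})" using open_U by blast
    moreover have "U \<inter> {y. height y < 0} \<inter> \<Omega> = {}" using in_\<Omega>_iff by force
    ultimately have "U \<inter> {y. height y < 0} \<inter> closure \<Omega> = {}" by (simp add: open_Int_closure_eq_empty)
    then show False using f x \<open>height x < 0\<close> by (auto simp: frontier_def)
  qed
  ultimately show "height x = 0" by simp
next
  assume h: "height x = 0"
  have "\<forall>\<^sub>F t in at_right 0. x + t *\<^sub>R - nu x \<in> \<Omega>" by (rule eventually_inside[OF x h]) simp
  moreover have "((\<lambda>t. x + t *\<^sub>R - nu x) \<longlongrightarrow> x + 0 *\<^sub>R - nu x) (at_right 0)"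
    by (intro tendsto_intros)
  ultimately have "x \<in> closure \<Omega>"
    by (intro Lim_in_closed_set[of "closure \<Omega>" "\<lambda>t. x + t *\<^sub>R - nu x" "at_right 0"])
      (auto elim!: eventually_mono intro: closure_subset[THEN subsetD])
  then show "x \<in> frontier \<Omega>" using in_\<Omega>_iff[OF x] h open_\<Omega> by (simp add: frontier_def interior_open)
qed

end

text \<open>If the unit normals differed, their difference would point inwards according to the
  first chart and outwards according to the second, so the ray along it would be both inside and
  outside \<open>\<Omega>\<close>.\<close>

lemma chart_normal_unique:
  assumes "chart \<Omega> e1 g1 U1" "chart \<Omega> e2 g2 U2" and x: "x \<in> U1" "x \<in> U2" "x \<in> frontier \<Omega>"
  shows "chart.nu e1 g1 x = chart.nu e2 g2 x"
proof (rule ccontr)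
  interpret c1: chart \<Omega> e1 g1 U1 by fact
  interpret c2: chart \<Omega> e2 g2 U2 by fact
  assume ne: "c1.nu x \<noteq> c2.nu x"
  let ?v = "c2.nu x - c1.nu x"
  have "?v \<bullet> ?v > 0" using ne by simp
  then have lt: "c1.nu x \<bullet> c2.nu x < 1"
    by (simp add: inner_diff_left inner_diff_right inner_commute)
  have "\<forall>\<^sub>F t in at_right 0. x + t *\<^sub>R ?v \<in> \<Omega>"
    using lt x c1.frontier_iff
    by (intro c1.eventually_inside) (auto simp: inner_diff_left inner_commute[of "c2.nu x"])
  moreover have "\<forall>\<^sub>F t in at_right 0. x + t *\<^sub>R ?v \<notin> \<Omega>"
    using lt x c2.frontier_iff by (intro c2.eventually_outside) (auto simp: inner_diff_left)
  ultimately have "\<forall>\<^sub>F t::real in at_right 0. False" by eventually_elim simp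
  then show False by (simp add: trivial_limit_at_right_real)
qed

context chart
begin

text \<open>Resolves the definite description in \<open>outward_normal\<close>: any other chart
  gives the same vector.\<close>

lemma outward_normal_eq:
  assumes "x \<in> U" "x \<in> frontier \<Omega>"
  shows "outward_normal \<Omega> x = nu x"
proof -
  have e: "(e' - grad g' x) /\<^sub>R sqrt (1 + (norm (grad g' x))\<^sup>2) = chart.nu e' g' x"
    if "graph_chart \<Omega> e' g' U'" for e' g' U'
  proof -
    interpret c: chart \<Omega> e' g' U' using that open_\<Omega> by unfold_locales
    show ?thesis by (simp add: c.nu_def c.slope_def divide_inverse)
  qed
  show ?thesis
    unfolding outward_normal_def
  proof (rule the_equality)
    show "\<exists>e' g' U'. graph_chart \<Omega> e' g' U' \<and> x \<in> U' \<and> nu x = (e' - grad g' x) /\<^sub>R sqrt (1 + (norm (grad g' x))\<^sup>2)"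
      using chart assms e by metis
    fix n assume "\<exists>e' g' U'. graph_chart \<Omega> e' g' U' \<and> x \<in> U' \<and> n = (e' - grad g' x) /\<^sub>R sqrt (1 + (norm (grad g' x))\<^sup>2)"
    then obtain e' g' U' where c: "graph_chart \<Omega> e' g' U'" "x \<in> U'" "n = chart.nu e' g' x" using e by metis
    show "n = nu x" unfolding c(3)
      by (rule chart_normal_unique[of \<Omega> e' g' U' e g U])
        (use c assms open_\<Omega> in \<open>auto intro: chart.intro chart_axioms\<close>)
  qed
qed

subsection \<open>The mean curvature as a divergence\<close>

lemma nu_component: "nu y \<bullet> i = - (slope y * pd i height y)" if "i \<in> Basis"
  using that by (simp add: nu_eq grad_inner_Basis)

lemma smooth_nu_component: "i \<in> Basis \<Longrightarrow> smooth (\<lambda>y. nu y \<bullet> i)"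
  by (simp add: nu_component smooth_uminus smooth_mult smooth_slope smooth_pd smooth_height)

definition Dnu :: "'a \<Rightarrow> 'a \<Rightarrow> 'a" where
  "Dnu x v = (\<Sum>j\<in>Basis. (grad (\<lambda>y. nu y \<bullet> j) x \<bullet> v) *\<^sub>R j)"

lemma Dnu_Basis: "j \<in> Basis \<Longrightarrow> Dnu x v \<bullet> j = grad (\<lambda>y. nu y \<bullet> j) x \<bullet> v"
  by (simp add: Dnu_def inner_sum_left_Basis)

lemma nu_has_derivative: "(nu has_derivative Dnu x) (at x within S)"
proof (rule has_derivative_at_withinI)
  show "(nu has_derivative Dnu x) (at x)"
    unfolding has_derivative_componentwise_within[of nu]
    using differentiable_has_grad[OF smooth_differentiable[OF smooth_nu_component]]
    by (auto simp: Dnu_Basis)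
qed

lemma linear_Dnu: "linear (Dnu x)"
  by (rule has_derivative_linear[OF nu_has_derivative[of x UNIV]])

text \<open>Differentiate the constant \<open>nu y \<bullet> nu y = 1\<close>, which holds off the
  graph as well.\<close>

lemma nu_Dnu: "nu x \<bullet> Dnu x v = 0"
proof -
  have "((\<lambda>y. nu y \<bullet> nu y) has_derivative (\<lambda>v. nu x \<bullet> Dnu x v + Dnu x v \<bullet> nu x)) (at x)"
    by (rule has_derivative_inner[OF nu_has_derivative nu_has_derivative])
  then have "((\<lambda>y. 1) has_derivative (\<lambda>v. nu x \<bullet> Dnu x v + Dnu x v \<bullet> nu x)) (at x)" by simp
  then have "(\<lambda>v. nu x \<bullet> Dnu x v + Dnu x v \<bullet> nu x) = (\<lambda>v. 0)"
    using has_derivative_unique has_derivative_const by blast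
  then have "nu x \<bullet> Dnu x v + Dnu x v \<bullet> nu x = 0" by meson
  then show ?thesis by (simp add: inner_commute)
qed

text \<open>Differentiating the factor \<open>slope\<close> of \<open>nu\<close> produces a multiple
  of \<open>grad height\<close>, which tangent vectors do not see. What remains is the Hessian of
  \<open>height\<close>, and its symmetry makes the operator self-adjoint.\<close>

lemma Dnu_tangent:
  assumes "w \<bullet> nu x = 0"
  shows "Dnu x v \<bullet> w = - slope x * (\<Sum>j\<in>Basis. \<Sum>i\<in>Basis. (w \<bullet> j) * (v \<bullet> i) * pd i (pd j height) x)"
proof -
  have w0: "grad height x \<bullet> w = 0" using assms slope_pos[of x] by (simp add: nu_eq inner_commute)
  have "pd i (\<lambda>y. nu y \<bullet> j) x = - (pd i slope x * pd j height x + slope x * pd i (pd j height) x)"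
    if "j \<in> Basis" for i j
  proof -
    have "pd i (\<lambda>y. -1 * (slope y * pd j height y)) x = -1 * pd i (\<lambda>y. slope y * pd j height y) x"
      by (rule pd_cmult) (intro smooth_differentiable smooth_mult smooth_slope smooth_pd smooth_height that)
    also have "pd i (\<lambda>y. slope y * pd j height y) x = pd i slope x * pd j height x + slope x * pd i (pd j height) x"
      by (intro pd_mult smooth_differentiable smooth_slope smooth_pd smooth_height that)
    finally show ?thesis using that by (simp add: nu_component)
  qed
  then have "Dnu x v \<bullet> w = (\<Sum>j\<in>Basis. (\<Sum>i\<in>Basis. (v \<bullet> i) *
      - (pd i slope x * pd j height x + slope x * pd i (pd j height) x)) * (w \<bullet> j))"
    by (subst euclidean_inner) (simp add: Dnu_Basis grad_inner)
  also have "\<dots> = - (\<Sum>j\<in>Basis. (w \<bullet> j) * pd j height x * (\<Sum>i\<in>Basis. (v \<bullet> i) * pd i slope x))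
     - slope x * (\<Sum>j\<in>Basis. \<Sum>i\<in>Basis. (w \<bullet> j) * (v \<bullet> i) * pd i (pd j height) x)"
    by (simp add: sum_distrib_left sum_distrib_right sum_subtractf sum_negf sum.distrib algebra_simps)
  also have "(\<Sum>j\<in>Basis. (w \<bullet> j) * pd j height x * (\<Sum>i\<in>Basis. (v \<bullet> i) * pd i slope x))
      = (grad height x \<bullet> w) * (\<Sum>i\<in>Basis. (v \<bullet> i) * pd i slope x)"
    by (simp add: grad_inner sum_distrib_right)
  finally show ?thesis using w0 by simp
qed

lemma Dnu_self_adjoint:
  assumes "v \<bullet> nu x = 0" "w \<bullet> nu x = 0"
  shows "Dnu x v \<bullet> w = v \<bullet> Dnu x w"
proof -
  have "(\<Sum>j\<in>Basis. \<Sum>i\<in>Basis. (w \<bullet> j) * (v \<bullet> i) * pd i (pd j height) x)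
      = (\<Sum>j\<in>Basis. \<Sum>i\<in>Basis. (v \<bullet> j) * (w \<bullet> i) * pd i (pd j height) x)"
    by (subst sum.swap) (intro sum.cong refl, simp add: pd_commute[OF smooth_height])
  then show ?thesis using Dnu_tangent[OF assms(2), of v] Dnu_tangent[OF assms(1), of w]
    by (simp add: inner_commute)
qed

text \<open>A derivative within the frontier is a choice among several linear maps. The difference
  of two of them is of smaller order than the increment along the frontier, so it vanishes on every
  velocity of a curve in the frontier, that is on tangent vectors.\<close>

lemma shape_operator_eq:
  assumes x: "x \<in> U" "x \<in> frontier \<Omega>" and v: "v \<bullet> nu x = 0"
  shows "shape_operator \<Omega> x v = Dnu x v"
proof -
  let ?F = "frontier \<Omega>" and ?D = "shape_operator \<Omega> x"
  have h0: "height x = 0" using frontier_iff x by blast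
  obtain d where d: "d > 0" "ball x d \<subseteq> U" using open_U x openE by blast
  have "(outward_normal \<Omega> has_derivative Dnu x) (at x within ?F)"
    by (rule has_derivative_transform_within[OF nu_has_derivative d(1) x(2)])
      (use outward_normal_eq d in \<open>auto simp: dist_commute subset_iff\<close>)
  then have "(outward_normal \<Omega> has_derivative ?D) (at x within ?F)"
    unfolding shape_operator_def using differentiableI frechet_derivative_works by blast
  then have "((\<lambda>y. outward_normal \<Omega> y - outward_normal \<Omega> y) has_derivative (\<lambda>v. ?D v - Dnu x v)) (at x within ?F)"
    by (rule has_derivative_diff) fact
  then have L: "((\<lambda>y. 0::'a) has_derivative (\<lambda>v. ?D v - Dnu x v)) (at x within ?F)" by simp
  let ?L = "\<lambda>v. ?D v - Dnu x v"
  have bl: "bounded_linear ?L" using L by (rule has_derivative_bounded_linear)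
  \<comment> \<open>The tangent line projected onto the graph along \<open>e\<close>: a curve in the
    frontier with velocity \<open>v\<close>, because the height changes by a smaller order along a
    tangent direction.\<close>
  define y where "y t = foot (x + t *\<^sub>R v)" for t
  have y_eq: "y t = x + (t *\<^sub>R v + height (x + t *\<^sub>R v) *\<^sub>R e)" for t by (simp add: y_def foot_def)
  have "grad height x \<bullet> v = 0" using v slope_pos[of x] by (simp add: nu_eq inner_commute)
  then have "((\<lambda>t. height (x + t *\<^sub>R v)) has_real_derivative 0) (at 0)"
    using height_along_line[of x v 0] by simp
  then have "((\<lambda>t. height (x + t *\<^sub>R v) / t) \<longlongrightarrow> 0) (at 0)"
    using h0 by (simp add: DERIV_def)
  then have h'': "((\<lambda>t. height (x + t *\<^sub>R v) / t) \<longlongrightarrow> 0) (at_right 0)" by (rule filterlim_mono) (auto simp: at_within_le_at)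
  have q: "((\<lambda>t. (y t - x) /\<^sub>R t) \<longlongrightarrow> v) (at_right 0)"
  proof (rule Lim_transform_eventually)
    show "((\<lambda>t. v + (height (x + t *\<^sub>R v) / t) *\<^sub>R e) \<longlongrightarrow> v) (at_right 0)"
      using tendsto_add[OF tendsto_const tendsto_scaleR[OF h'' tendsto_const], of v e] by simp
    show "\<forall>\<^sub>F t in at_right 0. v + (height (x + t *\<^sub>R v) / t) *\<^sub>R e = (y t - x) /\<^sub>R t"
      by (auto simp: eventually_at_right_field y_eq scaleR_add_right divide_inverse intro!: exI[of _ 1] simp: mult.commute)
  qed
  have yx: "(y \<longlongrightarrow> x) (at_right 0)"
  proof -
    have "((\<lambda>t. foot (x + t *\<^sub>R v)) \<longlongrightarrow> foot (x + 0 *\<^sub>R v)) (at_right 0)"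
      using continuous_foot[of UNIV] by (intro isCont_tendsto_compose[of _ foot] tendsto_intros)
        (auto simp: continuous_on_eq_continuous_at)
    then show ?thesis by (simp add: y_def[abs_def] foot_eq h0)
  qed
  have yF: "\<forall>\<^sub>F t in at_right 0. y t \<in> ?F"
    using topological_tendstoD[OF yx open_U x(1)]
    by eventually_elim (simp add: frontier_iff y_def)
  have small: "((\<lambda>z. ?L (z - x) /\<^sub>R norm (z - x)) \<longlongrightarrow> 0) (at x within ?F)"
    using tendsto_minus[OF L[unfolded has_derivative_at_within, THEN conjunct2]] by (simp add: scaleR_diff_right)
  have "norm (?L v) \<le> \<epsilon> * norm v" if \<epsilon>: "\<epsilon> > 0" for \<epsilon>
  proof -
    have "\<forall>\<^sub>F z in at x within ?F. norm (?L (z - x) /\<^sub>R norm (z - x)) < \<epsilon>"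
      using tendstoD[OF small \<epsilon>] by simp
    then obtain r where r: "r > 0"
      "\<And>z. z \<in> ?F \<Longrightarrow> z \<noteq> x \<Longrightarrow> dist z x < r \<Longrightarrow> norm (?L (z - x) /\<^sub>R norm (z - x)) < \<epsilon>"
      unfolding eventually_at by blast
    have le: "norm (?L (z - x)) \<le> \<epsilon> * norm (z - x)" if "z \<in> ?F" "dist z x < r" for z
    proof (cases "z = x")
      case True
      then show ?thesis using linear_0[OF bounded_linear.linear[OF bl]] by simp
    next
      case False
      then have "norm (?L (z - x)) / norm (z - x) < \<epsilon>"
        using r(2)[OF that(1) False that(2)] by (simp add: divide_inverse mult.commute)
      then show ?thesis using False by (simp add: pos_divide_less_eq)
    qed
    have "\<forall>\<^sub>F t in at_right 0. norm (?L ((y t - x) /\<^sub>R t)) \<le> \<epsilon> * norm ((y t - x) /\<^sub>R t)"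
      using yF tendstoD[OF yx r(1)] eventually_at_right_less[of 0]
    proof eventually_elim
      case (elim t)
      have "?L ((y t - x) /\<^sub>R t) = ?L (y t - x) /\<^sub>R t"
        using linear_cmul[OF bounded_linear.linear[OF bl]] by blast
      then have "norm (?L ((y t - x) /\<^sub>R t)) = norm (?L (y t - x)) / t"
        using elim(3) by (simp add: divide_inverse mult.commute)
      also have "\<dots> \<le> \<epsilon> * norm (y t - x) / t"
        using le[OF elim(1,2)] elim(3) by (intro divide_right_mono) auto
      also have "\<dots> = \<epsilon> * norm ((y t - x) /\<^sub>R t)"
        using elim(3) by (simp add: divide_inverse mult.commute)
      finally show ?case .
    qed
    moreover have "((\<lambda>t. norm (?L ((y t - x) /\<^sub>R t))) \<longlongrightarrow> norm (?L v)) (at_right 0)"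
      by (intro tendsto_norm bounded_linear.tendsto[OF bl] q)
    moreover have "((\<lambda>t. \<epsilon> * norm ((y t - x) /\<^sub>R t)) \<longlongrightarrow> \<epsilon> * norm v) (at_right 0)"
      by (intro tendsto_intros q)
    ultimately show ?thesis by (intro tendsto_le[OF trivial_limit_at_right_real]) auto
  qed
  note bd = this
  have "norm (?L v) \<le> 0"
  proof (rule field_le_epsilon)
    fix \<delta> :: real assume "\<delta> > 0"
    then have "norm (?L v) \<le> \<delta> / (norm v + 1) * norm v" by (intro bd) (simp add: add_nonneg_pos)
    also have "\<dots> = \<delta> * (norm v / (norm v + 1))" by simp
    also have "\<dots> \<le> \<delta>" using \<open>\<delta> > 0\<close>
      by (intro mult_left_le) (auto simp: divide_le_eq add_nonneg_pos)
    finally show "norm (?L v) \<le> 0 + \<delta>" by simp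
  qed
  then show ?thesis by simp
qed

text \<open>The principal curvatures sum to the trace of \<open>Dnu\<close> on the tangent space.
  Adding \<open>nu x\<close> to a tangent eigenbasis leaves the trace unchanged by
  \<open>nu_Dnu\<close>, and in the standard basis the full trace is the divergence of
  \<open>nu\<close>.\<close>

lemma mean_curvature_eq:
  assumes x: "x \<in> U" "x \<in> frontier \<Omega>" and dim: "DIM('a) \<ge> 2"
  shows "(real DIM('a) - 1) * mean_curvature \<Omega> x = (\<Sum>i\<in>Basis. pd i (\<lambda>y. nu y \<bullet> i) x)"
proof -
  let ?T = "{v. v \<bullet> nu x = 0}"
  have T: "subspace ?T" using subspace_hyperplane[of "nu x"] by (simp add: inner_commute)
  have "\<exists>B k. B \<subseteq> ?T \<and> pairwise orthogonal B \<and> (\<forall>b\<in>B. norm b = 1 \<and> Dnu x b = k b *\<^sub>R b) \<and> span B = ?T"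
    by (rule self_adjoint_eigenbasis[OF T linear_Dnu])
      (auto simp: Dnu_self_adjoint, simp add: nu_Dnu inner_commute)
  then obtain B k where B: "B \<subseteq> ?T" "pairwise orthogonal B" "\<And>b. b \<in> B \<Longrightarrow> norm b = 1"
    "\<And>b. b \<in> B \<Longrightarrow> Dnu x b = k b *\<^sub>R b" "span B = ?T" by blast
  have B0: "0 \<notin> B" using B(3) by force
  have fin: "finite B" by (rule independent_imp_finite[OF pairwise_orthogonal_independent[OF B(2) B0]])
  have curv: "curvature_space \<Omega> x \<kappa> = {v \<in> ?T. Dnu x v = \<kappa> *\<^sub>R v}" for \<kappa>
    using shape_operator_eq[OF x] by (auto simp: curvature_space_def outward_normal_eq[OF x])
  have "(\<Sum>\<kappa>\<in>principal_curvatures \<Omega> x. real (dim (curvature_space \<Omega> x \<kappa>)) * \<kappa>) = (\<Sum>b\<in>B. b \<bullet> Dnu x b)"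
    unfolding principal_curvatures_def curv
    by (rule eigenspace_dim_sum[OF B(1,2,3,5,4) linear_Dnu])
  also have "\<dots> = (\<Sum>b\<in>insert (nu x) B. b \<bullet> Dnu x b)"
    using B(1) fin by (subst sum.insert) (auto simp: nu_Dnu)
  also have "\<dots> = (\<Sum>i\<in>Basis. i \<bullet> Dnu x i)"
  proof (rule trace_orthonormal)
    show "pairwise orthogonal (insert (nu x) B)"
      using B(1,2) by (auto simp: pairwise_insert orthogonal_def inner_commute)
    show "norm b = 1" if "b \<in> insert (nu x) B" for b using that B(3) by (auto simp: norm_eq_1)
    show "span (insert (nu x) B) = UNIV"
    proof -
      have "y \<in> span (insert (nu x) B)" for y
      proof -
        have "y - (y \<bullet> nu x) *\<^sub>R nu x \<in> span B"
          unfolding B(5) by (simp add: inner_diff_left)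
        then show ?thesis using span_insert by auto
      qed
      then show ?thesis by blast
    qed
  qed (use fin linear_Dnu in auto)
  also have "\<dots> = (\<Sum>i\<in>Basis. pd i (\<lambda>y. nu y \<bullet> i) x)"
    by (intro sum.cong) (auto simp: inner_commute[of _ "Dnu x _"] Dnu_Basis grad_inner_Basis)
  finally show ?thesis using dim by (simp add: mean_curvature_def)
qed

lemma divergence_nu:
  "(\<Sum>i\<in>Basis. pd i (\<lambda>y. nu y \<bullet> i) x) = - (slope x * laplacian height x + gdot height slope x)"
proof -
  have "pd i (\<lambda>y. nu y \<bullet> i) x = - (pd i height x * pd i slope x + slope x * pd i (pd i height) x)"
    if i: "i \<in> Basis" for i
  proof -
    have "pd i (\<lambda>y. -1 * (slope y * pd i height y)) x = -1 * pd i (\<lambda>y. slope y * pd i height y) x"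
      by (rule pd_cmult) (intro smooth_differentiable smooth_mult smooth_slope smooth_pd smooth_height i)
    also have "pd i (\<lambda>y. slope y * pd i height y) x = pd i slope x * pd i height x + slope x * pd i (pd i height) x"
      by (intro pd_mult smooth_differentiable smooth_slope smooth_pd smooth_height i)
    finally show ?thesis using i by (simp add: nu_component)
  qed
  then show ?thesis
    by (simp add: laplacian_def gdot_def sum_negf sum_subtractf sum.distrib sum_distrib_left)
qed

end

section \<open>Defining functions adapted to barriers\<close>

text \<open>A substitute for the distance to the boundary, whose gradient has norm one: barriers only need
  an inequality, at most one for upper (\<open>\<sigma> = 1\<close>) and at least one for lower barriers (\<open>\<sigma> = -1\<close>).\<close>

definition defining_function :: "'a::euclidean_space set \<Rightarrow> 'a set \<Rightarrow> real \<Rightarrow> ('a \<Rightarrow> real) \<Rightarrow> bool" where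
  "defining_function \<Omega> V \<sigma> \<rho> \<longleftrightarrow> open V \<and> smooth \<rho> \<and>
     (\<forall>x\<in>V \<inter> frontier \<Omega>. \<rho> x = 0 \<and> grad \<rho> x = - outward_normal \<Omega> x \<and>
        laplacian \<rho> x = - ((real DIM('a) - 1) * mean_curvature \<Omega> x)) \<and>
     (\<forall>x\<in>V \<inter> \<Omega>. \<rho> x > 0) \<and> (\<forall>x\<in>V. \<sigma> * (gdot \<rho> \<rho> x - 1) \<le> 0)"

context chart
begin

lemma defining_function_exists:
  assumes p: "p \<in> U" "p \<in> frontier \<Omega>" and dim: "DIM('a) \<ge> 2" and \<sigma>: "\<sigma> = 1 \<or> \<sigma> = -1"
  shows "\<exists>V \<rho>. p \<in> V \<and> defining_function \<Omega> V \<sigma> \<rho>"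
proof -
  \<comment> \<open>\<open>\<rho> = h (a + b h + c h\<^sup>2)\<close> with \<open>h\<close> the height and \<open>a\<close> the slope: the choice of \<open>b\<close> removes the
    term of order \<open>h\<close> from \<open>\<bar>\<nabla>\<rho>\<bar>\<^sup>2 - 1\<close>, and the constant \<open>c\<close> fixes the sign of the next one.\<close>
  define b where "b = (\<lambda>x. - (1/2) * (slope x * (slope x * gdot height slope x)))"
  define \<theta> where "\<theta> c = (\<lambda>x. slope x + height x * (b x + c * height x))" for c
  define S where "S = gdot height height"
  define P where "P = gdot height slope"
  \<comment> \<open>The coefficient of the squared height in
    \<open>gdot (\<rho> c) (\<rho> c) - 1\<close>, as \<open>gdot_\<rho>\<close> confirms;
    \<open>K0\<close> below is the part of its value at \<open>p\<close> that is free of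
    \<open>c\<close>.\<close>
  define k where "k c = (\<lambda>x. (b x * b x + 2 * slope x * c + 2 * b x * c * height x + c * c * height x * height x) * S x
     + 2 * slope x * (gdot height b x + 2 * c * S x)
     + 2 * (b x + c * height x) * (P x + height x * gdot height b x + b x * S x + 2 * c * height x * S x)
     + gdot (\<theta> c) (\<theta> c) x)" for c
  define K0 where "K0 = b p * b p * S p + 2 * slope p * gdot height b p + 2 * b p * (P p + b p * S p)
     + (gdot slope slope p + 2 * b p * P p + b p * b p * S p)"
  note sm = smooth_height smooth_slope
  have b: "smooth b" unfolding b_def by (intro smooth_mult smooth_const smooth_gdot sm)
  have inner: "smooth (\<lambda>x. b x + c * height x)" for c
    by (intro smooth_add smooth_mult smooth_const b sm)
  have \<theta>: "smooth (\<theta> c)" for c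
    unfolding \<theta>_def by (intro smooth_add smooth_mult inner sm)
  have aS: "slope x * slope x * S x = 1" for x
    using slope_gdot[of x] by (simp add: S_def power2_eq_square)
  have bS: "2 * b x * S x = - P x" for x
  proof -
    have "2 * b x * S x = - (slope x * slope x * S x) * P x" by (simp add: b_def P_def)
    then show ?thesis by (simp add: aS)
  qed
  have \<theta>grad: "gdot f (\<theta> c) x = gdot f slope x + height x * (gdot f b x + c * gdot f height x)
     + (b x + c * height x) * gdot f height x" if f: "smooth f" for f c x
  proof -
    have "gdot f (\<theta> c) x = gdot f slope x + gdot f (\<lambda>x. height x * (b x + c * height x)) x"
      unfolding \<theta>_def by (intro gdot_smooth_simps f sm smooth_mult inner)
    also have "gdot f (\<lambda>x. height x * (b x + c * height x)) x
        = height x * gdot f (\<lambda>x. b x + c * height x) x + (b x + c * height x) * gdot f height x"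
      by (intro gdot_smooth_simps f sm inner)
    also have "gdot f (\<lambda>x. b x + c * height x) x = gdot f b x + gdot f (\<lambda>x. c * height x) x"
      by (intro gdot_smooth_simps f b smooth_mult smooth_const sm)
    also have "gdot f (\<lambda>x. c * height x) x = c * gdot f height x + height x * gdot f (\<lambda>x. c) x"
      by (intro gdot_smooth_simps f smooth_const sm)
    finally show ?thesis by (simp add: algebra_simps)
  qed
  define \<rho> where "\<rho> c = (\<lambda>x. height x * \<theta> c x)" for c
  have \<rho>: "smooth (\<rho> c)" for c unfolding \<rho>_def by (intro smooth_mult sm \<theta>)
  have \<rho>grad: "gdot f (\<rho> c) x = height x * gdot f (\<theta> c) x + \<theta> c x * gdot f height x" if "smooth f" for f c x
    unfolding \<rho>_def by (intro gdot_smooth_simps that sm \<theta>)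
  have gdot_\<rho>: "gdot (\<rho> c) (\<rho> c) x = 1 + height x * height x * k c x" for c x
  proof -
    have "gdot (\<rho> c) (\<rho> c) x = height x * gdot (\<theta> c) (\<rho> c) x + \<theta> c x * gdot height (\<rho> c) x"
      by (simp only: \<rho>grad[OF \<rho>] gdot_commute[of "\<rho> c" "\<theta> c"] gdot_commute[of "\<rho> c" height])
    also have "gdot (\<theta> c) (\<rho> c) x = height x * gdot (\<theta> c) (\<theta> c) x + \<theta> c x * gdot height (\<theta> c) x"
      by (simp only: \<rho>grad[OF \<theta>] gdot_commute[of "\<theta> c" height])
    also have "gdot height (\<rho> c) x = height x * gdot height (\<theta> c) x + \<theta> c x * S x"
      by (simp only: \<rho>grad[OF sm(1)] S_def)
    also have "gdot height (\<theta> c) x = P x + height x * (gdot height b x + c * S x) + (b x + c * height x) * S x"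
      by (simp add: \<theta>grad[OF sm(1)] P_def S_def)
    finally have e: "gdot (\<rho> c) (\<rho> c) x = slope x * slope x * S x
       + 2 * slope x * height x * (P x + 2 * b x * S x) + height x * height x * k c x"
      unfolding k_def \<theta>_def by (simp add: algebra_simps)
    show ?thesis unfolding e by (simp add: aS bS)
  qed
  have hp: "height p = 0" using frontier_iff p by blast
  have kp: "k c p = K0 + 6 * c / slope p" for c
  proof -
    have "gdot (\<theta> c) (\<theta> c) p = gdot slope slope p + 2 * b p * P p + b p * b p * S p"
    proof -
      have "gdot (\<theta> c) (\<theta> c) p = gdot (\<theta> c) slope p + b p * gdot (\<theta> c) height p"
        using \<theta>grad[OF \<theta>, of c c p] by (simp add: hp)
      also have "gdot (\<theta> c) slope p = gdot slope slope p + b p * P p"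
        using \<theta>grad[OF sm(2), of c p]
        by (simp add: hp gdot_commute[of "\<theta> c" slope] P_def gdot_commute[of slope height])
      also have "gdot (\<theta> c) height p = P p + b p * S p"
        using \<theta>grad[OF sm(1), of c p] by (simp add: hp gdot_commute[of "\<theta> c" height] P_def S_def)
      finally show ?thesis by (simp add: algebra_simps)
    qed
    then have "k c p = K0 + 6 * c * (slope p * S p)" by (simp add: k_def K0_def hp algebra_simps)
    also have "slope p * S p = 1 / slope p" using aS[of p] slope_pos[of p] by (simp add: field_simps)
    finally show ?thesis by simp
  qed
  \<comment> \<open>By \<open>kp\<close> the value at \<open>p\<close> is affine in \<open>c\<close>
    with coefficient \<open>6 / slope p\<close>; this choice makes \<open>\<sigma> * k c p\<close>
    equal to \<open>\<sigma> * K0 - (\<bar>K0\<bar> + 1)\<close>, which is negative, and by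
    continuity the sign persists near \<open>p\<close>.\<close>
  define c where "c = - \<sigma> * (\<bar>K0\<bar> + 1) * slope p / 6"
  have "\<sigma> * k c p < 0" using \<sigma> slope_pos[of p] by (auto simp: kp c_def abs_if)
  moreover have "smooth (k c)"
    unfolding k_def S_def P_def
    by (intro smooth_add smooth_mult smooth_const smooth_gdot b sm \<theta>)
  then have ck: "continuous_on UNIV (k c)" by (rule smooth_continuous)
  define V where "V = U \<inter> {x. \<sigma> * k c x < 0} \<inter> {x. 0 < \<theta> c x}"
  have "open V" unfolding V_def using open_U
    by (intro open_Int open_Collect_less continuous_intros ck smooth_continuous \<theta>)
  moreover have "p \<in> V"
    using p \<open>\<sigma> * k c p < 0\<close> slope_pos[of p] by (simp add: V_def \<theta>_def hp)
  moreover have "defining_function \<Omega> V \<sigma> (\<rho> c)"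
    unfolding defining_function_def
  proof (intro conjI ballI \<open>open V\<close> \<rho>)
    fix x assume x: "x \<in> V \<inter> frontier \<Omega>"
    then have xU: "x \<in> U" "x \<in> frontier \<Omega>" by (auto simp: V_def)
    then have h0: "height x = 0" using frontier_iff by blast
    have \<theta>x: "\<theta> c x = slope x" by (simp add: \<theta>_def h0)
    show "\<rho> c x = 0" by (simp add: \<rho>_def h0)
    have "pd i (\<rho> c) x = slope x * pd i height x" for i
      unfolding \<rho>_def by (simp add: pd_mult smooth_differentiable sm \<theta> h0 \<theta>x)
    then have "grad (\<rho> c) x = slope x *\<^sub>R grad height x"
      by (simp add: grad_def scaleR_sum_right)
    then show "grad (\<rho> c) x = - outward_normal \<Omega> x"
      by (simp add: outward_normal_eq[OF xU] nu_eq)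
    have "laplacian (\<rho> c) x = laplacian height x * \<theta> c x + 2 * gdot height (\<theta> c) x + height x * laplacian (\<theta> c) x"
      unfolding \<rho>_def by (rule laplacian_smooth_simps[OF sm(1) \<theta>])
    also have "\<dots> = slope x * laplacian height x + 2 * (P x + b x * S x)"
      using \<theta>grad[OF sm(1), of c x] by (simp add: h0 \<theta>x P_def S_def)
    \<comment> \<open>The same \<open>b\<close> gives \<open>2 * (P x + b x * S x) = P x\<close>, so
      the boundary Laplacian is exactly minus the divergence of \<open>nu\<close>, whatever
      \<open>c\<close> is.\<close>
    also have "\<dots> = slope x * laplacian height x + gdot height slope x"
      using bS[of x] by (simp add: P_def algebra_simps)
    finally show "laplacian (\<rho> c) x = - ((real DIM('a) - 1) * mean_curvature \<Omega> x)"
      unfolding mean_curvature_eq[OF xU dim] divergence_nu by simp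
  next
    fix x assume "x \<in> V \<inter> \<Omega>"
    then show "\<rho> c x > 0" using in_\<Omega>_iff by (auto simp: V_def \<rho>_def)
  next
    fix x assume "x \<in> V"
    then have "\<sigma> * k c x \<le> 0" by (simp add: V_def)
    then have "(height x * height x) * (\<sigma> * k c x) \<le> 0"
      using mult_nonneg_nonpos[of "height x * height x" "\<sigma> * k c x"] by simp
    then show "\<sigma> * (gdot (\<rho> c) (\<rho> c) x - 1) \<le> 0" unfolding gdot_\<rho> by (simp add: mult_ac)
  qed
  ultimately show ?thesis by blast
qed

end

section \<open>Comparison principle\<close>

text \<open>The second derivative test in each coordinate direction. A positive pure second
  derivative makes the first derivative positive just after \<open>z\<close>, and the mean value
  theorem then contradicts maximality.\<close>

lemma diff2_local_max_laplacian:
  fixes v :: "'a::euclidean_space \<Rightarrow> real"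
  assumes S: "open S" "diff2_on v S" "z \<in> S" and mx: "\<And>x. x \<in> S \<Longrightarrow> v x \<le> v z"
  shows "laplacian v z \<le> 0"
proof -
  have "pd i (pd i v) z \<le> 0" if i: "i \<in> Basis" for i
  proof (rule ccontr)
    assume "\<not> pd i (pd i v) z \<le> 0"
    then have pos: "pd i (pd i v) z > 0" by simp
    obtain d where d: "d > 0" "ball z d \<subseteq> S" using S openE by blast
    have inS: "z + t *\<^sub>R i \<in> S" if "\<bar>t\<bar> < d" for t
      using d(2) that i by (auto simp: dist_norm subset_iff)
    have D: "((\<lambda>t. v (z + t *\<^sub>R i)) has_real_derivative pd i v (z + t *\<^sub>R i)) (at t)" if "\<bar>t\<bar> < d" for t
      using S(2) inS[OF that] by (intro has_derivative_along_Basis i) (auto simp: diff2_on_def)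
    have D2: "((\<lambda>t. pd i v (z + t *\<^sub>R i)) has_real_derivative pd i (pd i v) (z + 0 *\<^sub>R i)) (at 0)"
      using S(2,3) i by (intro has_derivative_along_Basis i) (auto simp: diff2_on_def)
    have z0: "pd i v z = 0"
      using DERIV_local_max[OF D[of 0] d(1)] mx inS d(1) by simp
    obtain e where e: "e > 0" "\<And>t. t > 0 \<Longrightarrow> t < e \<Longrightarrow> pd i v z < pd i v (z + t *\<^sub>R i)"
      using DERIV_pos_inc_right[OF D2] pos by auto
    define t where "t = min d e / 2"
    have t: "0 < t" "t < d" "t < e" using d e by (auto simp: t_def)
    have "\<exists>s>0. s < t \<and> v (z + t *\<^sub>R i) - v (z + 0 *\<^sub>R i) = (t - 0) * pd i v (z + s *\<^sub>R i)"
      using t by (intro MVT2[of 0 t "\<lambda>t. v (z + t *\<^sub>R i)"] D) auto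
    then obtain s where s: "0 < s" "s < t" "v (z + t *\<^sub>R i) - v z = t * pd i v (z + s *\<^sub>R i)" by auto
    have "t * pd i v (z + s *\<^sub>R i) > 0" using s t e(2)[of s] z0 by simp
    moreover have "v (z + t *\<^sub>R i) \<le> v z" using mx inS t by simp
    ultimately show False using s(3) by simp
  qed
  then show ?thesis unfolding laplacian_def by (simp add: sum_nonpos)
qed

lemma left_derivative_at_max:
  assumes "(h has_vector_derivative a) (at_left 0)" "\<forall>\<^sub>F t in at_left (0::real). h t \<le> (h 0 :: real)"
  shows "a \<ge> 0"
proof -
  have "((\<lambda>t. (h t - h 0) / (t - 0)) \<longlongrightarrow> a) (at_left 0)"
    using assms(1) by (simp add: has_real_derivative_iff_has_vector_derivative[symmetric] has_field_derivative_iff)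
  moreover have "\<forall>\<^sub>F t in at_left (0::real). (h t - h 0) / (t - 0) \<ge> 0"
    using assms(2) eventually_at_left_real[of "-1::real" 0, simplified]
    by eventually_elim (auto intro: divide_nonpos_neg)
  ultimately show ?thesis by (intro tendsto_lowerbound[OF _ _ trivial_limit_at_left_real])
qed

lemma eventually_at_left_minus:
  "(\<forall>\<^sub>F t in at_left (0::real). P t) \<longleftrightarrow> (\<forall>\<^sub>F t in at_right 0. P (- t))"
  by (subst at_left_minus) (simp add: eventually_filtermap)

lemma eventually_inside_normal:
  assumes "open \<Omega>" "smooth_boundary \<Omega>" "x \<in> frontier \<Omega>"
  shows "\<forall>\<^sub>F t in at_left 0. x + t *\<^sub>R outward_normal \<Omega> x \<in> \<Omega>"
proof -
  obtain e g U where c: "x \<in> U" "graph_chart \<Omega> e g U" using assms by (auto simp: smooth_boundary_def)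
  interpret chart \<Omega> e g U using c assms by unfold_locales
  have "\<forall>\<^sub>F t in at_right 0. x + t *\<^sub>R - nu x \<in> \<Omega>"
    using frontier_iff c assms by (intro eventually_inside) auto
  then show ?thesis by (simp add: eventually_at_left_minus outward_normal_eq[OF c(1) assms(3)])
qed

lemma norm_outward_normal:
  assumes "open \<Omega>" "smooth_boundary \<Omega>" "x \<in> frontier \<Omega>"
  shows "norm (outward_normal \<Omega> x) = 1"
proof -
  obtain e g U where c: "x \<in> U" "graph_chart \<Omega> e g U" using assms by (auto simp: smooth_boundary_def)
  interpret chart \<Omega> e g U using c assms by unfold_locales
  show ?thesis by (simp add: outward_normal_eq[OF c(1) assms(3)] norm_eq_1)
qed

text \<open>Look at a positive maximum of \<open>v - w\<close>. Inside \<open>\<Omega>\<close> the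
  Laplacian of the difference is at most zero, contradicting the strict monotonicity of
  \<open>f\<close>; on the frontier the outward derivative of the difference is nonnegative,
  contradicting the Robin inequality; the sphere is excluded by assumption. Restriction to a ball
  lets barriers live near one boundary point only.\<close>

theorem comparison_principle:
  fixes \<Omega> :: "'a::euclidean_space set" and v w :: "'a \<Rightarrow> real"
  assumes \<Omega>: "open \<Omega>" "smooth_boundary \<Omega>" and f: "strict_mono f" and c: "c > 0" and k: "k \<ge> 0"
    and cont: "continuous_on (closure \<Omega> \<inter> cball p r) v" "continuous_on (closure \<Omega> \<inter> cball p r) w"
    and d2: "diff2_on v (\<Omega> \<inter> ball p r)" "diff2_on w (\<Omega> \<inter> ball p r)"
    and v: "\<And>x. x \<in> \<Omega> \<inter> ball p r \<Longrightarrow> f (v x) \<le> c * laplacian v x"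
    and w: "\<And>x. x \<in> \<Omega> \<inter> ball p r \<Longrightarrow> c * laplacian w x \<le> f (w x)"
    and sph: "\<And>x. x \<in> closure \<Omega> \<inter> sphere p r \<Longrightarrow> v x \<le> w x"
    and bd: "\<And>x. x \<in> frontier \<Omega> \<inter> ball p r \<Longrightarrow> \<exists>a b.
      ((\<lambda>t. v (x + t *\<^sub>R outward_normal \<Omega> x)) has_vector_derivative a) (at_left 0) \<and>
      ((\<lambda>t. w (x + t *\<^sub>R outward_normal \<Omega> x)) has_vector_derivative b) (at_left 0) \<and>
      v x + k * a \<le> w x + k * b"
    and x: "x \<in> closure \<Omega> \<inter> cball p r"
  shows "v x \<le> w x"
proof (rule ccontr)
  assume contr: "\<not> v x \<le> w x"
  let ?K = "closure \<Omega> \<inter> cball p r"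
  have "compact ?K" by (intro closed_Int_compact) auto
  moreover have "continuous_on ?K (\<lambda>x. v x - w x)" by (intro continuous_intros cont)
  ultimately obtain z where z: "z \<in> ?K" and mx: "\<And>y. y \<in> ?K \<Longrightarrow> v y - w y \<le> v z - w z"
    using continuous_attains_sup[of ?K "\<lambda>x. v x - w x"] x by blast
  have pos: "v z > w z" using mx[OF x] contr by simp
  then have zb: "z \<in> ball p r" using sph[of z] z by (auto simp: less_le)
  show False
  proof (cases "z \<in> \<Omega>")
    case True
    have op: "open (\<Omega> \<inter> ball p r)" using \<Omega> by blast
    have zz: "z \<in> \<Omega> \<inter> ball p r" using True zb by simp
    have d2w: "diff2_on (\<lambda>x. -1 * w x) (\<Omega> \<inter> ball p r)" by (rule diff2_on_cmult(1)[OF op d2(2)])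
    have "laplacian (\<lambda>x. v x + -1 * w x) z \<le> 0"
    proof (rule diff2_local_max_laplacian[OF op diff2_on_add(1)[OF op d2(1) d2w] zz])
      fix y assume "y \<in> \<Omega> \<inter> ball p r"
      then have "y \<in> ?K" using closure_subset by fastforce
      then show "v y + -1 * w y \<le> v z + -1 * w z" using mx by simp
    qed
    then have "laplacian v z - laplacian w z \<le> 0"
      using diff2_on_add(2)[OF op d2(1) d2w zz] diff2_on_cmult(2)[OF op d2(2) zz, of "-1"] by simp
    then have "c * laplacian v z \<le> c * laplacian w z" using c by simp
    then have "f (v z) \<le> f (w z)" using v[OF zz] w[OF zz] by linarith
    then show False using pos strict_mono_less[OF f, of "w z" "v z"] by simp
  next
    case False
    then have zf: "z \<in> frontier \<Omega>" using z \<Omega> by (simp add: frontier_def interior_open)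
    let ?n = "outward_normal \<Omega> z"
    obtain a b where ab: "((\<lambda>t. v (z + t *\<^sub>R ?n)) has_vector_derivative a) (at_left 0)"
      "((\<lambda>t. w (z + t *\<^sub>R ?n)) has_vector_derivative b) (at_left 0)" "v z + k * a \<le> w z + k * b"
      using bd zf zb by blast
    have "((\<lambda>t. z + t *\<^sub>R ?n) \<longlongrightarrow> z + 0 *\<^sub>R ?n) (at_left 0)" by (intro tendsto_intros)
    then have "\<forall>\<^sub>F t in at_left 0. z + t *\<^sub>R ?n \<in> ball p r"
      using topological_tendstoD[OF _ open_ball] zb by auto
    then have "\<forall>\<^sub>F t in at_left 0. z + t *\<^sub>R ?n \<in> ?K"
      using eventually_inside_normal[OF \<Omega> zf]
      by eventually_elim (use closure_subset in fastforce)
    then have "\<forall>\<^sub>F t in at_left 0. v (z + t *\<^sub>R ?n) - w (z + t *\<^sub>R ?n) \<le> v (z + 0 *\<^sub>R ?n) - w (z + 0 *\<^sub>R ?n)"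
      by eventually_elim (use mx in simp)
    then have "a - b \<ge> 0"
      by (intro left_derivative_at_max[OF has_vector_derivative_diff[OF ab(1,2)]])
    then have "k * a \<ge> k * b" using k by (intro mult_left_mono) auto
    then show False using ab(3) pos by linarith
  qed
qed

section \<open>Integrals over boundary layers\<close>

lemma smooth_lipschitz:
  assumes h: "smooth h" and S: "convex S" and B: "\<And>y. y \<in> S \<Longrightarrow> norm (grad h y) \<le> B" and xy: "x \<in> S" "y \<in> S"
  shows "\<bar>h x - h y\<bar> \<le> B * norm (x - y)"
proof -
  have "norm (h x - h y) \<le> B * norm (x - y)"
  proof (rule differentiable_bound[OF S _ _ xy])
    show "(h has_derivative (\<lambda>v. grad h z \<bullet> v)) (at z within S)" for z
      by (rule has_derivative_at_withinI[OF differentiable_has_grad[OF smooth_differentiable[OF h]]])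
    show "onorm (\<lambda>v. grad h z \<bullet> v) \<le> B" if "z \<in> S" for z
    proof (rule onorm_le)
      fix v
      have "norm (grad h z \<bullet> v) \<le> norm (grad h z) * norm v" by (simp add: Cauchy_Schwarz_ineq2)
      also have "\<dots> \<le> B * norm v" by (intro mult_right_mono B that) simp
      finally show "norm (grad h z \<bullet> v) \<le> B * norm v" .
    qed
  qed
  then show ?thesis by simp
qed

lemma smooth_continuous_grad: "smooth h \<Longrightarrow> continuous_on S (grad h)"
  unfolding grad_def[abs_def] by (intro continuous_intros smooth_continuous smooth_pd)

lemma exp_integral_atLeast:
  assumes "c > (0::real)"
  shows "(\<integral>\<^sup>+t. ennreal (exp (- (c * t))) * indicator {0..} t \<partial>lborel) = ennreal (1 / c)"
    and "integrable lborel (\<lambda>t. indicator {0..} t * exp (- (c * t)))"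
    and "(\<integral>t. indicator {0<..} t * exp (- (c * t)) \<partial>lborel) = 1 / c"
proof -
  have lim: "((\<lambda>t. - exp (- (c * t)) / c) \<longlongrightarrow> 0) at_top"
  proof -
    have "((\<lambda>t. exp (- (c * t))) \<longlongrightarrow> 0) at_top"
    proof (rule filterlim_compose[OF exp_at_bot])
      have "filterlim (\<lambda>t. c * t) at_top at_top"
        by (rule filterlim_tendsto_pos_mult_at_top[OF tendsto_const assms filterlim_ident])
      then show "filterlim (\<lambda>t. - (c * t)) at_bot at_top" by (simp add: filterlim_uminus_at_bot)
    qed
    from tendsto_divide[OF tendsto_minus[OF this] tendsto_const[of c]] show ?thesis using assms by simp
  qed
  have "(\<integral>\<^sup>+t. ennreal (exp (- (c * t))) * indicator {0..} t \<partial>lborel) = ennreal (0 - (- exp (- (c * 0)) / c))"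
    by (rule nn_integral_FTC_atLeast[OF _ _ _ lim])
      (use assms in \<open>auto intro!: derivative_eq_intros simp: field_simps\<close>)
  then show nn: "(\<integral>\<^sup>+t. ennreal (exp (- (c * t))) * indicator {0..} t \<partial>lborel) = ennreal (1 / c)" by simp
  have eq: "(\<integral>\<^sup>+t. ennreal (indicator {0..} t * exp (- (c * t))) \<partial>lborel) = ennreal (1 / c)"
    unfolding nn[symmetric] by (intro nn_integral_cong) (auto split: split_indicator)
  show "integrable lborel (\<lambda>t. indicator {0..} t * exp (- (c * t)))"
    by (rule integrableI_nonneg) (use eq in \<open>auto\<close>)
  have "(\<integral>t. indicator {0..} t * exp (- (c * t)) \<partial>lborel) = 1 / c"
    using eq assms by (subst integral_eq_nn_integral) auto
  moreover have "(\<integral>t. indicator {0<..} t * exp (- (c * t)) \<partial>lborel) = (\<integral>t. indicator {0..} t * exp (- (c * t)) \<partial>lborel)"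
    using AE_lborel_singleton[of "0::real"] by (intro integral_cong_AE) (auto split: split_indicator)
  ultimately show "(\<integral>t. indicator {0<..} t * exp (- (c * t)) \<partial>lborel) = 1 / c" by simp
qed

section \<open>Layer integrals in one chart\<close>

context chart
begin

definition slab :: "'a set" where "slab = {x. 0 \<le> x \<bullet> e \<and> x \<bullet> e \<le> 1}"

lemma slab_borel [measurable]: "slab \<in> sets borel"
proof -
  have "closed slab" unfolding slab_def
    by (intro closed_Collect_conj closed_Collect_le continuous_intros)
  then show ?thesis by simp
qed

lemma foot_measurable [measurable]: "foot \<in> borel_measurable borel"
  by (intro borel_measurable_continuous_onI continuous_foot)

lemma slope_measurable [measurable]: "slope \<in> borel_measurable borel"
  by (intro borel_measurable_continuous_onI continuous_slope)

text \<open>Averaging over the slab replaces integration over the hyperplane orthogonal to \<open>e\<close>, so that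
  Fubini's theorem in the direction \<open>e\<close> follows from translation invariance alone.\<close>

lemma slab_nn_integral:
  assumes [measurable]: "F \<in> borel_measurable borel" and l: "l > 0"
  shows "(\<integral>\<^sup>+x. \<integral>\<^sup>+\<tau>. ennreal l * (indicator slab x * F (foot x - (l * \<tau>) *\<^sub>R e)) \<partial>lborel \<partial>lborel)
    = (\<integral>\<^sup>+x. F x \<partial>lborel)"
proof -
  have inner: "(\<integral>\<^sup>+\<tau>. ennreal l * (indicator slab x * F (foot x - (l * \<tau>) *\<^sub>R e)) \<partial>lborel)
      = (\<integral>\<^sup>+s. indicator slab x * F (x + s *\<^sub>R e) \<partial>lborel)" for x
  proof -
    \<comment> \<open>The substitution \<open>s = height x - l * \<tau>\<close>: the parameter
      \<tau> is the depth below the graph along \<open>e\<close>, measured in units of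
      \<open>l\<close>.\<close>
    have "(\<integral>\<^sup>+s. indicator slab x * F (x + s *\<^sub>R e) \<partial>lborel)
      = ennreal \<bar>- l\<bar> * (\<integral>\<^sup>+\<tau>. indicator slab x * F (x + (height x + - l * \<tau>) *\<^sub>R e) \<partial>lborel)"
      by (rule nn_integral_real_affine) (use l in auto)
    also have "\<dots> = (\<integral>\<^sup>+\<tau>. ennreal l * (indicator slab x * F (x + (height x + - l * \<tau>) *\<^sub>R e)) \<partial>lborel)"
      using l by (subst nn_integral_cmult) auto
    also have "\<dots> = (\<integral>\<^sup>+\<tau>. ennreal l * (indicator slab x * F (foot x - (l * \<tau>) *\<^sub>R e)) \<partial>lborel)"
      by (intro nn_integral_cong) (simp add: foot_def scaleR_left_distrib algebra_simps)
    finally show ?thesis by simp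
  qed
  have shift: "(\<integral>\<^sup>+x. indicator slab x * F (x + s *\<^sub>R e) \<partial>lborel)
      = (\<integral>\<^sup>+x. indicator slab (- s *\<^sub>R e + x) * F x \<partial>lborel)" for s
  proof -
    have "(\<integral>\<^sup>+x. indicator slab x * F (x + s *\<^sub>R e) \<partial>lborel)
       = (\<integral>\<^sup>+x. indicator slab x * F (x + s *\<^sub>R e) \<partial>distr lborel borel ((+) (- s *\<^sub>R e)))"
      by (simp add: lborel_distr_plus)
    also have "\<dots> = (\<integral>\<^sup>+x. indicator slab (- s *\<^sub>R e + x) * F (- s *\<^sub>R e + x + s *\<^sub>R e) \<partial>lborel)"
      by (subst nn_integral_distr) auto
    finally show ?thesis by simp
  qed
  have "(\<integral>\<^sup>+x. \<integral>\<^sup>+s. indicator slab x * F (x + s *\<^sub>R e) \<partial>lborel \<partial>lborel)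
      = (\<integral>\<^sup>+s. \<integral>\<^sup>+x. indicator slab x * F (x + s *\<^sub>R e) \<partial>lborel \<partial>lborel)"
    by (rule lborel_pair.Fubini'[symmetric]) simp
  also have "\<dots> = (\<integral>\<^sup>+s. \<integral>\<^sup>+x. indicator slab (- s *\<^sub>R e + x) * F x \<partial>lborel \<partial>lborel)"
    by (simp add: shift)
  also have "\<dots> = (\<integral>\<^sup>+x. \<integral>\<^sup>+s. indicator slab (- s *\<^sub>R e + x) * F x \<partial>lborel \<partial>lborel)"
    by (rule lborel_pair.Fubini') simp
  also have "\<dots> = (\<integral>\<^sup>+x. F x \<partial>lborel)"
  proof (rule nn_integral_cong)
    fix x
    \<comment> \<open>For fixed \<open>x\<close> the shifts that bring it into the slab form an
      interval of length one; this is what the thickness of the slab is for.\<close>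
    have "(\<integral>\<^sup>+s. indicator slab (- s *\<^sub>R e + x) * F x \<partial>lborel)
        = (\<integral>\<^sup>+s. F x * indicator {x \<bullet> e - 1..x \<bullet> e} s \<partial>lborel)"
      by (intro nn_integral_cong) (auto simp: slab_def inner_add_left inner_diff_left split: split_indicator)
    also have "\<dots> = F x" by (simp add: nn_integral_cmult)
    finally show "(\<integral>\<^sup>+s. indicator slab (- s *\<^sub>R e + x) * F x \<partial>lborel) = F x" .
  qed
  finally show ?thesis by (simp add: inner)
qed

text \<open>The nonnegative case says that \<open>(x, \<tau>)\<close> mapped to
  \<open>foot x - (l * \<tau>) *\<^sub>R e\<close> pushes \<open>l\<close> times the product measure
  over the slab forward to Lebesgue measure; signed functions follow by change of variables.\<close>

lemma slab_integral:
  fixes H :: "'a \<Rightarrow> real"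
  assumes [measurable]: "H \<in> borel_measurable borel" and l: "l > 0"
  shows "(\<integral>z. indicator slab (fst z) * H (foot (fst z) - (l * snd z) *\<^sub>R e) \<partial>(lborel \<Otimes>\<^sub>M lborel))
    = (\<integral>x. H x \<partial>lborel) / l"
proof -
  let ?\<Theta> = "\<lambda>z. foot (fst z) - (l * snd z) *\<^sub>R e"
  let ?M = "density (lborel \<Otimes>\<^sub>M lborel) (\<lambda>z. ennreal (l * indicator slab (fst z)))"
  have \<Theta> [measurable]: "?\<Theta> \<in> borel_measurable (lborel \<Otimes>\<^sub>M lborel)" by simp
  have "distr ?M borel ?\<Theta> = lborel"
  proof (rule measure_eqI)
    fix B assume B: "B \<in> sets (distr ?M borel ?\<Theta>)"
    then have [measurable]: "B \<in> sets borel" by simp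
    have "emeasure (distr ?M borel ?\<Theta>) B = (\<integral>\<^sup>+y. indicator B y \<partial>distr ?M borel ?\<Theta>)"
      using B by (simp only: nn_integral_indicator)
    also have "\<dots> = (\<integral>\<^sup>+z. indicator B (?\<Theta> z) \<partial>?M)"
      by (rule nn_integral_distr) auto
    also have "\<dots> = (\<integral>\<^sup>+z. ennreal (l * indicator slab (fst z)) * indicator B (?\<Theta> z) \<partial>(lborel \<Otimes>\<^sub>M lborel))"
      by (rule nn_integral_density) auto
    also have "\<dots> = (\<integral>\<^sup>+x. \<integral>\<^sup>+\<tau>. ennreal (l * indicator slab x) * indicator B (foot x - (l * \<tau>) *\<^sub>R e) \<partial>lborel \<partial>lborel)"
      by (subst lborel.nn_integral_fst[symmetric]) auto
    also have "\<dots> = (\<integral>\<^sup>+x. \<integral>\<^sup>+\<tau>. ennreal l * (indicator slab x * indicator B (foot x - (l * \<tau>) *\<^sub>R e)) \<partial>lborel \<partial>lborel)"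
      by (intro nn_integral_cong) (auto split: split_indicator)
    also have "\<dots> = (\<integral>\<^sup>+x. indicator B x \<partial>lborel)"
      by (rule slab_nn_integral) (use l in auto)
    finally show "emeasure (distr ?M borel ?\<Theta>) B = emeasure lborel B" by simp
  qed simp
  then have "(\<integral>x. H x \<partial>lborel) = (\<integral>x. H x \<partial>distr ?M borel ?\<Theta>)" by simp
  also have "\<dots> = (\<integral>z. H (?\<Theta> z) \<partial>?M)"
    by (rule integral_distr) auto
  also have "\<dots> = (\<integral>z. (l * indicator slab (fst z)) *\<^sub>R H (?\<Theta> z) \<partial>(lborel \<Otimes>\<^sub>M lborel))"
    by (rule integral_density) (use l in auto)
  also have "\<dots> = l * (\<integral>z. indicator slab (fst z) * H (?\<Theta> z) \<partial>(lborel \<Otimes>\<^sub>M lborel))"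
    by (simp add: mult.assoc)
  finally show ?thesis using l by simp
qed

text \<open>If the nearest frontier point is within \<open>r\<close>, it lies in the chart and a
  Lipschitz bound for \<open>height\<close> applies; otherwise boundedness of \<open>height\<close>
  on \<open>K\<close> suffices. It converts decay in the distance into decay in the depth
  \<tau>.\<close>

lemma height_le_infdist:
  assumes K: "compact K" "K \<subseteq> U" and ne: "frontier \<Omega> \<noteq> {}"
  shows "\<exists>c>0. \<forall>x\<in>K. c * \<bar>height x\<bar> \<le> infdist x (frontier \<Omega>)"
proof (cases "K = {}")
  case True
  then show ?thesis by (auto intro: exI[of _ 1])
next
  case False
  obtain r where r: "r > 0" "(\<Union>x\<in>K. ball x r) \<subseteq> U"
    using compact_subset_open_imp_ball_epsilon_subset[OF K(1) open_U K(2)] by blast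
  obtain R where R: "K \<subseteq> cball 0 R"
    using compact_imp_bounded[OF K(1)] unfolding bounded_iff by (metis mem_cball_0 subsetI)
  have "compact (cball (0::'a) (R + r))" by simp
  then have "bounded (grad height ` cball 0 (R + r))" "bounded (height ` K)"
    by (auto intro!: compact_imp_bounded compact_continuous_image smooth_continuous_grad smooth_continuous smooth_height K(1))
  then obtain L S where LS: "\<And>y. y \<in> cball 0 (R + r) \<Longrightarrow> norm (grad height y) \<le> L" "\<And>y. y \<in> K \<Longrightarrow> \<bar>height y\<bar> \<le> S"
    unfolding bounded_iff by force
  define L' where "L' = max L 1"
  define S' where "S' = max S 1"
  have pos: "L' > 0" "S' > 0" by (auto simp: L'_def S'_def)
  show ?thesis
  proof (intro exI[of _ "min (1 / L') (r / S')"] conjI ballI)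
    show "min (1 / L') (r / S') > 0" using pos r by simp
    fix x assume x: "x \<in> K"
    obtain z where z: "z \<in> frontier \<Omega>" "infdist x (frontier \<Omega>) = dist x z"
      using infdist_attains_inf[of "frontier \<Omega>" x] ne by auto
    have "min (1 / L') (r / S') * \<bar>height x\<bar> \<le> dist x z"
    proof (cases "dist x z < r")
      case True
      then have "z \<in> U" using r x by (meson UN_I mem_ball subsetD)
      then have hz: "height z = 0" using frontier_iff z by blast
      have nx: "norm x \<le> R" using x R by auto
      have "norm z \<le> norm x + norm (z - x)" using norm_triangle_ineq[of x "z - x"] by simp
      then have "z \<in> cball 0 (R + r)" "x \<in> cball 0 (R + r)"
        using nx True r by (auto simp: dist_norm norm_minus_commute)
      then have "\<bar>height x - height z\<bar> \<le> L * norm (x - z)"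
        by (intro smooth_lipschitz[OF smooth_height convex_cball LS(1)])
      also have "\<dots> \<le> L' * norm (x - z)" by (intro mult_right_mono) (auto simp: L'_def)
      finally have "1 / L' * \<bar>height x\<bar> \<le> dist x z" using pos hz by (simp add: field_simps dist_norm)
      moreover have "min (1 / L') (r / S') * \<bar>height x\<bar> \<le> 1 / L' * \<bar>height x\<bar>"
        by (intro mult_right_mono) auto
      ultimately show ?thesis by linarith
    next
      case False
      have "min (1 / L') (r / S') * \<bar>height x\<bar> \<le> r / S' * \<bar>height x\<bar>"
        by (intro mult_right_mono) auto
      also have "\<dots> \<le> r / S' * S'"
        using LS(2)[OF x] r pos by (intro mult_left_mono) (auto simp: S'_def)
      finally show ?thesis using False pos by simp
    qed
    then show "min (1 / L') (r / S') * \<bar>height x\<bar> \<le> infdist x (frontier \<Omega>)" using z by simp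
  qed
qed

text \<open>In the coordinates \<open>foot x - (lam n * \<tau>) *\<^sub>R e\<close> the layer has a
  fixed width, the integrands converge pointwise and are dominated, and the limit factorises after
  rescaling \<tau> by \<open>slope\<close>, which leaves the surface density
  \<open>1 / slope\<close>.\<close>

lemma layer_limit:
  fixes \<zeta> :: "'a \<Rightarrow> real" and \<psi> :: "nat \<Rightarrow> 'a \<Rightarrow> real"
  assumes ne: "frontier \<Omega> \<noteq> {}" and K: "compact K" "K \<subseteq> U"
    and \<zeta>: "continuous_on UNIV \<zeta>" "\<And>x. x \<notin> K \<Longrightarrow> \<zeta> x = 0"
    and lam: "\<And>n. lam n > 0" "lam \<longlonglongrightarrow> 0"
    and \<psi>m: "\<And>n. (\<lambda>x. indicator \<Omega> x * \<psi> n x) \<in> borel_measurable borel"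
    and bnd: "\<And>n x. x \<in> \<Omega> \<Longrightarrow> \<bar>\<psi> n x\<bar> \<le> C * exp (- (\<mu> * infdist x (frontier \<Omega>) / lam n))" and \<mu>: "\<mu> > 0"
    and lim: "\<And>z \<tau>. z \<in> frontier \<Omega> \<Longrightarrow> z \<in> U \<Longrightarrow> \<tau> > 0 \<Longrightarrow>
      (\<lambda>n. \<psi> n (z - (lam n * \<tau>) *\<^sub>R e)) \<longlonglongrightarrow> \<psi>0 (slope z * \<tau>)"
  shows "(\<lambda>n. (\<integral>x. \<zeta> x * (indicator \<Omega> x * \<psi> n x) \<partial>lborel) / lam n)
    \<longlonglongrightarrow> (\<integral>x. indicator slab x * (\<zeta> (foot x) / slope x) \<partial>lborel) * (\<integral>t. indicator {0<..} t * \<psi>0 t \<partial>lborel)"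
proof -
  have [measurable]: "\<zeta> \<in> borel_measurable borel" using \<zeta>(1) by (rule borel_measurable_continuous_onI)
  obtain c where c: "c > 0" "\<And>x. x \<in> K \<Longrightarrow> c * \<bar>height x\<bar> \<le> infdist x (frontier \<Omega>)"
    using height_le_infdist[OF K ne] by blast
  obtain R where R: "K \<subseteq> cball 0 R"
    using compact_imp_bounded[OF K(1)] unfolding bounded_iff by (metis mem_cball_0 subsetI)
  have "bounded (\<zeta> ` K)"
    using compact_continuous_image[OF continuous_on_subset[OF \<zeta>(1)] K(1)] compact_imp_bounded by blast
  then obtain X where X: "X > 0" "\<And>x. x \<in> K \<Longrightarrow> \<bar>\<zeta> x\<bar> \<le> X" unfolding bounded_pos by auto
  have \<zeta>X: "\<bar>\<zeta> x\<bar> \<le> X" for x using X \<zeta>(2)[of x] by (cases "x \<in> K") auto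
  define H where "H n x = \<zeta> x * (indicator \<Omega> x * \<psi> n x)" for n x
  have [measurable]: "H n \<in> borel_measurable borel" for n
    unfolding H_def by (rule borel_measurable_times[OF _ \<psi>m]) simp
  define h where "h n z = indicator slab (fst z) * H n (foot (fst z) - (lam n * snd z) *\<^sub>R e)" for n and z :: "'a \<times> real"
  define \<phi> where "\<phi> z = indicator slab (fst z) * (\<zeta> (foot (fst z)) * (indicator {0<..} (snd z) * \<psi>0 (slope (fst z) * snd z)))" for z :: "'a \<times> real"
  \<comment> \<open>The dominating function. A point at depth \<tau> has height
    \<open>lam n * \<tau>\<close>, and \<open>c\<close> compares this with its distance to the
    frontier, so the factor \<open>lam n\<close> cancels in the exponent.\<close>
  define w where "w z = (indicator (cball 0 (\<bar>R\<bar> + 1)) (fst z) * (X * \<bar>C\<bar>)) * (indicator {0..} (snd z) * exp (- (\<mu> * c * snd z)))" for z :: "'a \<times> real"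
  have hm [measurable]: "h n \<in> borel_measurable (lborel \<Otimes>\<^sub>M lborel)" for n unfolding h_def by measurable
  have height_pt: "height (foot x - s *\<^sub>R e) = s" for x s
    using height_shift[of "foot x" "- s"] by simp
  have H0: "H n (foot x - s *\<^sub>R e) = 0" if "s \<le> 0" for n x s
  proof (cases "foot x - s *\<^sub>R e \<in> U")
    case True
    then show ?thesis using in_\<Omega>_iff[OF True] that by (simp add: H_def height_pt)
  next
    case False
    then show ?thesis using \<zeta>(2) K(2) by (auto simp: H_def)
  qed
  have dom: "norm (h n z) \<le> w z" for n z
  proof (cases "h n z = 0")
    case True
    then show ?thesis using X by (simp add: w_def split: split_indicator)
  next
    case False
    obtain x \<tau> where z: "z = (x, \<tau>)" by (cases z)
    let ?y = "foot x - (lam n * \<tau>) *\<^sub>R e"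
    have nz: "x \<in> slab" "H n ?y \<noteq> 0" using False by (auto simp: h_def z split: split_indicator_asm)
    then have y: "?y \<in> K" "?y \<in> \<Omega>" using \<zeta>(2) by (auto simp: H_def split: split_indicator_asm)
    have \<tau>: "\<tau> > 0"
    proof (rule ccontr)
      assume "\<not> \<tau> > 0"
      then have "lam n * \<tau> \<le> 0" using lam(1)[of n] by (intro mult_nonneg_nonpos) auto
      then show False using H0 nz(2) by blast
    qed
    \<comment> \<open>Moving along \<open>e\<close> does not change the component orthogonal to
      \<open>e\<close>, which is bounded since the moved point lies in \<open>K\<close>; the slab
      bounds the other component by one.\<close>
    have "norm x \<le> R + 1"
    proof -
      let ?P = "\<lambda>v. v - (v \<bullet> e) *\<^sub>R e"
      have "?P ?y = ?P x" by (simp add: foot_def inner_add_left inner_diff_left algebra_simps)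
      moreover have "norm (?P v) \<le> norm v" for v
      proof -
        have "(norm (?P v))\<^sup>2 = (norm v)\<^sup>2 - (v \<bullet> e)\<^sup>2"
          unfolding power2_norm_eq_inner by (simp add: inner_diff_left inner_diff_right inner_commute power2_eq_square)
        then have "(norm (?P v))\<^sup>2 \<le> (norm v)\<^sup>2" by simp
        then show ?thesis by (rule power2_le_imp_le) simp
      qed
      moreover have "norm ?y \<le> R" using y(1) R by auto
      ultimately have "norm (?P x) \<le> R" by (metis order.trans)
      moreover have "norm ((x \<bullet> e) *\<^sub>R e) \<le> 1" using nz(1) norm_e by (simp add: slab_def)
      moreover have "norm x \<le> norm (?P x) + norm ((x \<bullet> e) *\<^sub>R e)"
        using norm_triangle_ineq[of "?P x" "(x \<bullet> e) *\<^sub>R e"] by simp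
      ultimately show ?thesis by linarith
    qed
    then have xb: "x \<in> cball 0 (\<bar>R\<bar> + 1)" by simp
    have "\<mu> * c * \<tau> \<le> \<mu> * infdist ?y (frontier \<Omega>) / lam n"
    proof -
      have "c * (lam n * \<tau>) \<le> infdist ?y (frontier \<Omega>)"
        using c(2)[OF y(1)] \<tau> lam(1)[of n] by (simp add: height_pt)
      then have "\<mu> * (c * (lam n * \<tau>)) \<le> \<mu> * infdist ?y (frontier \<Omega>)" using \<mu> by simp
      then show ?thesis using lam(1)[of n] by (simp add: field_simps)
    qed
    then have "C * exp (- (\<mu> * infdist ?y (frontier \<Omega>) / lam n)) \<le> \<bar>C\<bar> * exp (- (\<mu> * c * \<tau>))"
      by (intro mult_mono) auto
    then have "\<bar>\<psi> n ?y\<bar> \<le> \<bar>C\<bar> * exp (- (\<mu> * c * \<tau>))"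
      using bnd[OF y(2), of n] by linarith
    then have "norm (h n z) \<le> X * (\<bar>C\<bar> * exp (- (\<mu> * c * \<tau>)))"
      using nz y \<zeta>X[of ?y] by (auto simp: h_def z H_def abs_mult intro!: mult_mono)
    then show ?thesis using xb \<tau> by (simp add: w_def z mult.assoc)
  qed
  have lim': "(\<lambda>n. h n z) \<longlonglongrightarrow> \<phi> z" for z
  proof -
    obtain x \<tau> where z: "z = (x, \<tau>)" by (cases z)
    let ?y = "\<lambda>n. foot x - (lam n * \<tau>) *\<^sub>R e"
    have yl: "?y \<longlonglongrightarrow> foot x"
      using tendsto_diff[OF tendsto_const tendsto_scaleR[OF tendsto_mult[OF lam(2) tendsto_const] tendsto_const], of "foot x" \<tau> e] by simp
    have \<zeta>l: "(\<lambda>n. \<zeta> (?y n)) \<longlonglongrightarrow> \<zeta> (foot x)"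
      using \<zeta>(1) yl by (intro isCont_tendsto_compose[of _ \<zeta>]) (auto simp: continuous_on_eq_continuous_at)
    consider "x \<notin> slab" | "\<tau> \<le> 0" | "x \<in> slab" "\<tau> > 0" "foot x \<in> U" | "x \<in> slab" "\<tau> > 0" "foot x \<notin> U" by linarith
    then show ?thesis
    proof cases
      case 2
      then have "lam n * \<tau> \<le> 0" for n using lam(1)[of n] by (simp add: mult_nonneg_nonpos)
      then show ?thesis using H0 2 by (simp add: h_def \<phi>_def z)
    next
      case 3
      have ff: "foot x \<in> frontier \<Omega>" using frontier_iff[OF 3(3)] by simp
      have "\<forall>\<^sub>F n in sequentially. ?y n \<in> U" using topological_tendstoD[OF yl open_U 3(3)] .
      then have A: "\<forall>\<^sub>F n in sequentially. \<zeta> (?y n) * \<psi> n (?y n) = h n z"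
      proof eventually_elim
        case (elim n)
        then have "?y n \<in> \<Omega>" using in_\<Omega>_iff[OF elim] 3 lam(1)[of n] by (simp add: height_pt)
        then show ?case using 3 by (simp add: h_def H_def z)
      qed
      have "(\<lambda>n. \<psi> n (?y n)) \<longlonglongrightarrow> \<psi>0 (slope x * \<tau>)"
        using lim[OF ff 3(3,2)] by simp
      note B = tendsto_mult[OF \<zeta>l this]
      have E: "\<phi> z = \<zeta> (foot x) * \<psi>0 (slope x * \<tau>)" using 3 by (simp add: \<phi>_def z)
      show ?thesis unfolding E by (rule Lim_transform_eventually[OF B A])
    next
      case 4
      \<comment> \<open>Outside the chart no limit of \<open>\<psi> n\<close> is known, but \<zeta>
        tends to zero there by continuity while \<open>\<psi> n\<close> stays bounded.\<close>
      then have "\<zeta> (foot x) = 0" using \<zeta>(2) K(2) by blast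
      have "norm (h n z) \<le> \<bar>\<zeta> (?y n)\<bar> * \<bar>C\<bar>" for n
      proof (cases "?y n \<in> \<Omega>")
        case True
        have "C * exp (- (\<mu> * infdist (?y n) (frontier \<Omega>) / lam n)) \<le> \<bar>C\<bar> * 1"
          using \<mu> lam(1)[of n] by (intro mult_mono) (auto simp: infdist_nonneg)
        then have "\<bar>\<psi> n (?y n)\<bar> \<le> \<bar>C\<bar>" using bnd[OF True, of n] by simp
        then show ?thesis using True 4 by (simp add: h_def H_def z abs_mult mult_left_mono)
      qed (simp add: h_def H_def z)
      moreover have "(\<lambda>n. \<bar>\<zeta> (?y n)\<bar> * \<bar>C\<bar>) \<longlonglongrightarrow> 0"
        using tendsto_mult[OF tendsto_rabs[OF \<zeta>l] tendsto_const, of "\<bar>C\<bar>"] \<open>\<zeta> (foot x) = 0\<close> by simp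
      ultimately have "(\<lambda>n. h n z) \<longlonglongrightarrow> 0"
        by (intro Lim_null_comparison[of "\<lambda>n. h n z" "\<lambda>n. \<bar>\<zeta> (?y n)\<bar> * \<bar>C\<bar>"]) (auto intro: always_eventually)
      then show ?thesis using \<open>\<zeta> (foot x) = 0\<close> by (simp add: \<phi>_def z)
    qed (simp add: h_def \<phi>_def z)
  qed
  have \<phi>m [measurable]: "\<phi> \<in> borel_measurable (lborel \<Otimes>\<^sub>M lborel)"
    by (rule borel_measurable_LIMSEQ_real[where u=h]) (use lim' hm in auto)
  have wint: "integrable (lborel \<Otimes>\<^sub>M lborel) w"
  proof (rule lborel_pair.Fubini_integrable)
    have [measurable]: "cball (0::'a) (\<bar>R\<bar> + 1) \<in> sets borel" by simp
    show "w \<in> borel_measurable (lborel \<Otimes>\<^sub>M lborel)"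
      unfolding w_def by (intro borel_measurable_times borel_measurable_const) measurable
    have mc: "\<mu> * c > 0" using \<mu> c by simp
    have "integrable lborel (\<lambda>x::'a. indicator (cball 0 (\<bar>R\<bar> + 1)) x * (X * \<bar>C\<bar> * (\<integral>\<tau>. indicator {0..} \<tau> * exp (- (\<mu> * c * \<tau>)) \<partial>lborel)))"
      using emeasure_bounded_finite[OF bounded_cball, of "0::'a" "\<bar>R\<bar> + 1"] by (intro integrable_mult_left) (auto simp: integrable_indicator_iff)
    moreover have "(\<integral>y. norm (w (x, y)) \<partial>lborel) = indicator (cball 0 (\<bar>R\<bar> + 1)) x * (X * \<bar>C\<bar> * (\<integral>\<tau>. indicator {0..} \<tau> * exp (- (\<mu> * c * \<tau>)) \<partial>lborel))" for x
      using X by (simp add: w_def abs_mult mult.assoc)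
    ultimately show "integrable lborel (\<lambda>x. \<integral>y. norm (w (x, y)) \<partial>lborel)" by simp
    show "AE x in lborel. integrable lborel (\<lambda>y. w (x, y))"
      using exp_integral_atLeast(2)[OF mc] by (auto simp: w_def)
  qed
  have \<phi>int: "integrable (lborel \<Otimes>\<^sub>M lborel) \<phi>"
    by (rule integrable_dominated_convergence[where s=h and w=w]) (use lim' dom wint in auto)
  have "(\<lambda>n. integral\<^sup>L (lborel \<Otimes>\<^sub>M lborel) (h n)) \<longlonglongrightarrow> integral\<^sup>L (lborel \<Otimes>\<^sub>M lborel) \<phi>"
    by (rule integral_dominated_convergence[where w=w]) (use lim' dom wint in auto)
  moreover have "integral\<^sup>L (lborel \<Otimes>\<^sub>M lborel) (h n) = (\<integral>x. H n x \<partial>lborel) / lam n" for n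
    unfolding h_def by (rule slab_integral) (use lam in auto)
  moreover have "integral\<^sup>L (lborel \<Otimes>\<^sub>M lborel) \<phi> = (\<integral>x. indicator slab x * (\<zeta> (foot x) / slope x) \<partial>lborel) * (\<integral>t. indicator {0<..} t * \<psi>0 t \<partial>lborel)"
  proof -
    have "integral\<^sup>L (lborel \<Otimes>\<^sub>M lborel) \<phi> = (\<integral>x. \<integral>\<tau>. \<phi> (x, \<tau>) \<partial>lborel \<partial>lborel)"
      by (rule lborel_pair.integral_fst'[symmetric, OF \<phi>int])
    moreover have "(\<integral>\<tau>. \<phi> (x, \<tau>) \<partial>lborel) = indicator slab x * (\<zeta> (foot x) / slope x) * (\<integral>t. indicator {0<..} t * \<psi>0 t \<partial>lborel)" for x
    proof -
      \<comment> \<open>The substitution \<open>t = slope x * \<tau>\<close> is the source of the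
        factor \<open>1 / slope x\<close>.\<close>
      have "(\<integral>t. indicator {0<..} t * \<psi>0 t \<partial>lborel) = \<bar>slope x\<bar> *\<^sub>R (\<integral>\<tau>. indicator {0<..} (0 + slope x * \<tau>) * \<psi>0 (0 + slope x * \<tau>) \<partial>lborel)"
        by (rule lborel_integral_real_affine) (use slope_pos[of x] in auto)
      also have "(\<integral>\<tau>. indicator {0<..} (0 + slope x * \<tau>) * \<psi>0 (0 + slope x * \<tau>) \<partial>lborel) = (\<integral>\<tau>. indicator {0<..} \<tau> * \<psi>0 (slope x * \<tau>) \<partial>lborel)"
        using slope_pos[of x] by (intro Bochner_Integration.integral_cong) (auto simp: zero_less_mult_iff split: split_indicator)
      finally have "(\<integral>\<tau>. indicator {0<..} \<tau> * \<psi>0 (slope x * \<tau>) \<partial>lborel) = (\<integral>t. indicator {0<..} t * \<psi>0 t \<partial>lborel) / slope x"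
        using slope_pos[of x] by (simp add: field_simps)
      then show ?thesis by (simp add: \<phi>_def)
    qed
    ultimately show ?thesis by (simp only: integral_mult_left_zero)
  qed
  ultimately show ?thesis by (simp add: H_def)
qed

text \<open>To first order the frontier is its tangent plane, whose distance from
  \<open>z - h *\<^sub>R e\<close> is \<open>h * slope z\<close>. The upper bound exhibits a
  frontier point; the lower bound uses that \<open>height\<close> equals \<open>h\<close> there and
  is Lipschitz near \<open>z\<close> with a constant close to \<open>1 / slope z\<close>.\<close>

lemma infdist_frontier_asymp:
  assumes z: "z \<in> U" "z \<in> frontier \<Omega>"
  shows "((\<lambda>h. infdist (z - h *\<^sub>R e) (frontier \<Omega>) / h) \<longlongrightarrow> slope z) (at_right 0)"
proof (rule order_tendstoI)
  let ?d = "\<lambda>h. infdist (z - h *\<^sub>R e) (frontier \<Omega>)"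
  have hz: "height z = 0" using frontier_iff z by blast
  show "\<forall>\<^sub>F h in at_right 0. ?d h / h < b" if b: "slope z < b" for b
  proof -
    define s where "s = (slope z + b) / 2"
    have s: "slope z < s" "s < b" using b by (auto simp: s_def)
    \<comment> \<open>Since \<open>?v \<bullet> nu z = s - slope z > 0\<close>, this ray leaves
      \<open>\<Omega>\<close>, while the ray along \<open>- e\<close> stays inside; the segment of
      length \<open>h * s\<close> joining them meets the frontier.\<close>
    let ?v = "- e + s *\<^sub>R nu z"
    have "\<forall>\<^sub>F h in at_right 0. z + h *\<^sub>R ?v \<notin> \<Omega>"
      using s nu_e[of z] by (intro eventually_outside z hz) (simp add: inner_diff_right inner_commute)
    moreover have "\<forall>\<^sub>F h in at_right 0. z + h *\<^sub>R - e \<in> \<Omega>"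
      using nu_e[of z] slope_pos[of z] by (intro eventually_inside z hz) (simp add: inner_commute)
    ultimately show ?thesis using eventually_at_right_less[of 0]
    proof eventually_elim
      case (elim h)
      let ?x = "z - h *\<^sub>R e" and ?y = "z + h *\<^sub>R ?v"
      have yx: "?y - ?x = (h * s) *\<^sub>R nu z" by (simp add: scaleR_add_right scaleR_diff_right)
      have "closed_segment ?x ?y \<inter> frontier \<Omega> \<noteq> {}"
        using elim by (intro connected_Int_frontier) (auto intro: exI[of _ ?x] ends_in_segment)
      then obtain w where w: "w \<in> closed_segment ?x ?y" "w \<in> frontier \<Omega>" by blast
      have "?d h \<le> dist ?x w" by (rule infdist_le[OF w(2)])
      also have "\<dots> \<le> norm (?y - ?x)" using segment_bound(1)[OF w(1)] by (simp add: dist_norm norm_minus_commute)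
      also have "\<dots> = h * s" using elim s slope_pos[of z] unfolding yx by (simp add: norm_eq_1[THEN iffD2])
      also have "\<dots> < h * b" using elim s by simp
      finally show ?case using elim by (simp add: divide_less_eq mult.commute)
    qed
  qed
  show "\<forall>\<^sub>F h in at_right 0. b < ?d h / h" if b: "b < slope z" for b
  proof -
    define s where "s = (max b 0 + slope z) / 2"
    have s: "0 < s" "b < s" "s < slope z" using b slope_pos[of z] by (auto simp: s_def)
    have "(norm (grad height z))\<^sup>2 = (1 / slope z)\<^sup>2"
      using slope_gdot[of z] slope_pos[of z] by (simp add: power2_norm_eq_inner gdot_eq_inner field_simps)
    then have "norm (grad height z) = 1 / slope z" using slope_pos[of z] by (simp add: power2_eq_iff_nonneg)
    then have "norm (grad height z) < 1 / s" using s by (simp add: frac_less2)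
    moreover have "isCont (\<lambda>y. norm (grad height y)) z"
      using smooth_continuous_grad[OF smooth_height, of UNIV] by (simp add: continuous_on_eq_continuous_at continuous_norm)
    ultimately obtain r1 where r1: "r1 > 0"
      "\<And>y. dist y z < r1 \<Longrightarrow> dist (norm (grad height y)) (norm (grad height z)) < 1 / s - norm (grad height z)"
      unfolding continuous_at_eps_delta by (metis diff_gt_0_iff_gt)
    obtain r2 where r2: "r2 > 0" "ball z r2 \<subseteq> U" using open_U z(1) openE by blast
    define r where "r = min r1 r2"
    have r: "r > 0" "norm (grad height y) < 1 / s \<and> y \<in> U" if "dist y z < r" for y
      using r1(1) r1(2)[of y] r2 that by (auto simp: r_def dist_real_def dist_commute subset_iff)
    have "r > 0" using r1 r2 by (simp add: r_def)
    note r = this r(2)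
    have "\<forall>\<^sub>F h in at_right 0. h < r / 2" using r(1) by (simp add: eventually_at_right_less eventually_at_right_field) (auto intro: exI[of _ "r/2"])
    then show ?thesis using eventually_at_right_less[of 0]
    proof eventually_elim
      case (elim h)
      let ?x = "z - h *\<^sub>R e"
      obtain w where w: "w \<in> frontier \<Omega>" "?d h = dist ?x w"
        using infdist_attains_inf[of "frontier \<Omega>" ?x] z by auto
      have "dist ?x w \<le> dist ?x z" using w infdist_le[OF z(2), of ?x] by simp
      also have xz: "dist ?x z = h" using elim by (simp add: dist_norm norm_e)
      finally have "dist w z < r" using dist_triangle[of w z ?x] elim xz by (simp add: dist_commute)
      then have wU: "w \<in> ball z r" "w \<in> U" using r by (auto simp: dist_commute)
      then have hw: "height w = 0" using frontier_iff w by blast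
      have xb: "?x \<in> ball z r" using elim xz r by (simp add: dist_commute)
      have "\<bar>height ?x - height w\<bar> \<le> 1 / s * norm (?x - w)"
        by (rule smooth_lipschitz[OF smooth_height convex_ball _ xb wU(1)])
          (use r(2) in \<open>force simp: dist_commute\<close>)
      then have "h \<le> 1 / s * ?d h" using hw hz height_shift[of z "- h"] elim w by (simp add: dist_norm)
      then have "s \<le> ?d h / h" using s elim by (simp add: field_simps)
      then show ?case using s by linarith
    qed
  qed
qed

end

section \<open>The surface measure\<close>

context chart
begin

text \<open>The image under \<open>foot\<close> of the weighted slab;
  \<open>emeasure_graph_measure\<close> recovers the formula of \<open>is_surface_measure\<close> on
  subsets of \<open>S\<close>.\<close>

definition graph_measure :: "'a set \<Rightarrow> 'a measure" where
  "graph_measure S = distr (density lborel (\<lambda>x. ennreal (indicator slab x * indicator S (foot x) / slope x))) borel foot"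

lemma sets_graph_measure [simp]: "sets (graph_measure S) = sets borel"
  by (simp add: graph_measure_def)

lemma space_graph_measure [simp]: "space (graph_measure S) = UNIV"
  by (simp add: graph_measure_def)

lemma emeasure_graph_measure:
  assumes [measurable]: "S \<in> sets borel" "B \<in> sets borel"
  shows "emeasure (graph_measure S) B = (\<integral>\<^sup>+ x \<in> {x. 0 \<le> x \<bullet> e \<and> x \<bullet> e \<le> 1 \<and> x + (g x - x \<bullet> e) *\<^sub>R e \<in> B \<inter> S}.
             ennreal (sqrt (1 + (norm (grad g x))\<^sup>2)) \<partial>lborel)"
proof -
  have "emeasure (graph_measure S) B = (\<integral>\<^sup>+ y. indicator B y \<partial>graph_measure S)"
    by (simp add: nn_integral_indicator)
  also have "\<dots> = (\<integral>\<^sup>+ x. ennreal (indicator slab x * indicator S (foot x) / slope x) * indicator B (foot x) \<partial>lborel)"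
    unfolding graph_measure_def by (subst nn_integral_distr) (auto simp: nn_integral_density)
  also have "\<dots> = (\<integral>\<^sup>+ x \<in> {x. 0 \<le> x \<bullet> e \<and> x \<bullet> e \<le> 1 \<and> x + (g x - x \<bullet> e) *\<^sub>R e \<in> B \<inter> S}.
             ennreal (sqrt (1 + (norm (grad g x))\<^sup>2)) \<partial>lborel)"
    by (intro nn_integral_cong)
      (auto simp: slab_def foot_def height_def slope_inverse split: split_indicator)
  finally show ?thesis .
qed

lemma emeasure_graph_measure_Int:
  assumes "S \<in> sets borel" "B \<in> sets borel" "S' \<in> sets borel" "B \<inter> S = B' \<inter> S'" "B' \<in> sets borel"
  shows "emeasure (graph_measure S) B = emeasure (graph_measure S') B'"
  using assms by (simp add: emeasure_graph_measure)

text \<open>\<open>foot\<close> changes only the component along \<open>e\<close>, which the slab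
  bounds, so the part of the slab lying over a bounded set is bounded, and the density is bounded on
  it.\<close>

lemma finite_graph_measure:
  assumes S: "S \<in> sets borel" "bounded S"
  shows "finite_measure (graph_measure S)"
proof
  obtain R where R: "\<And>x. x \<in> S \<Longrightarrow> norm x \<le> R" using S(2) bounded_iff by metis
  have sub: "x \<in> cball 0 (\<bar>R\<bar> + 1)" if "x \<in> slab" "foot x \<in> S" for x
  proof -
    let ?P = "\<lambda>v. v - (v \<bullet> e) *\<^sub>R e"
    have "?P (foot x) = ?P x" by (simp add: foot_def inner_add_left algebra_simps)
    moreover have "(norm (?P (foot x)))\<^sup>2 \<le> (norm (foot x))\<^sup>2"
      unfolding power2_norm_eq_inner by (simp add: inner_diff_left inner_diff_right inner_commute)
    then have "norm (?P (foot x)) \<le> norm (foot x)" by (rule power2_le_imp_le) simp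
    moreover have "norm ((x \<bullet> e) *\<^sub>R e) \<le> 1" using that(1) norm_e by (simp add: slab_def)
    moreover have "norm x \<le> norm (?P x) + norm ((x \<bullet> e) *\<^sub>R e)"
      using norm_triangle_ineq[of "?P x" "(x \<bullet> e) *\<^sub>R e"] by simp
    ultimately show ?thesis using R[OF that(2)] by auto
  qed
  have "compact ((\<lambda>x. 1 / slope x) ` cball 0 (\<bar>R\<bar> + 1))"
    using slope_pos by (intro compact_continuous_image continuous_intros continuous_slope) (auto simp: less_le)
  then obtain B where B: "\<And>x. x \<in> cball 0 (\<bar>R\<bar> + 1) \<Longrightarrow> 1 / slope x \<le> B"
    using compact_imp_bounded bounded_iff by (metis (no_types, lifting) abs_le_D1 image_eqI real_norm_def)
  have "emeasure (graph_measure S) UNIV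
      = (\<integral>\<^sup>+ x. ennreal (indicator slab x * indicator S (foot x) / slope x) \<partial>lborel)"
    unfolding graph_measure_def using S(1) by (simp add: emeasure_distr emeasure_density)
  also have "\<dots> \<le> (\<integral>\<^sup>+ x. ennreal B * indicator (cball (0::'a) (\<bar>R\<bar> + 1)) x \<partial>lborel)"
  proof (rule nn_integral_mono)
    fix x :: 'a
    show "ennreal (indicator slab x * indicator S (foot x) / slope x) \<le> ennreal B * indicator (cball 0 (\<bar>R\<bar> + 1)) x"
      using sub[of x] B[of x] by (cases "x \<in> slab \<and> foot x \<in> S") (auto intro: ennreal_leI)
  qed
  also have "\<dots> = ennreal B * emeasure lborel (cball (0::'a) (\<bar>R\<bar> + 1))"
    by (rule nn_integral_cmult_indicator) simp
  also have "\<dots> < \<infinity>"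
    using emeasure_bounded_finite[OF bounded_cball, of "0::'a" "\<bar>R\<bar> + 1"] by (simp add: ennreal_mult_less_top)
  finally show "emeasure (graph_measure S) (space (graph_measure S)) \<noteq> \<infinity>" by simp
qed

lemma integral_graph_measure:
  fixes \<zeta> :: "'a \<Rightarrow> real"
  assumes [measurable]: "S \<in> sets borel" "\<zeta> \<in> borel_measurable borel"
  shows "(\<integral>x. \<zeta> x \<partial>graph_measure S) = (\<integral>x. indicator slab x * (indicator S (foot x) * \<zeta> (foot x) / slope x) \<partial>lborel)"
  unfolding graph_measure_def using slope_pos
  by (subst integral_distr) (auto simp: integral_density less_imp_le mult.assoc)

lemma integral_graph_measure_support:
  fixes \<zeta> :: "'a \<Rightarrow> real"
  assumes S: "S \<in> sets borel" and m: "\<zeta> \<in> borel_measurable borel"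
    and supp: "\<And>x. \<zeta> x \<noteq> 0 \<Longrightarrow> x \<in> V" and V: "V \<subseteq> U" "V \<inter> frontier \<Omega> \<subseteq> S"
  shows "(\<integral>x. \<zeta> x \<partial>graph_measure S) = (\<integral>x. indicator slab x * (\<zeta> (foot x) / slope x) \<partial>lborel)"
proof -
  have "indicator S (foot x) * \<zeta> (foot x) = \<zeta> (foot x)" for x
  proof (cases "\<zeta> (foot x) = 0")
    case False
    then have "foot x \<in> V" using supp by blast
    moreover then have "foot x \<in> frontier \<Omega>" using frontier_iff V(1) by auto
    ultimately show ?thesis using V(2) by auto
  qed simp
  then show ?thesis by (simp only: integral_graph_measure[OF S m])
qed

lemma infdist_layer:
  assumes z: "z \<in> U" "z \<in> frontier \<Omega>" and \<tau>: "\<tau> > 0" and lam: "\<And>n. lam n > 0" "lam \<longlonglongrightarrow> 0"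
  shows "(\<lambda>n. infdist (z - (lam n * \<tau>) *\<^sub>R e) (frontier \<Omega>) / lam n) \<longlonglongrightarrow> slope z * \<tau>"
proof -
  have "filterlim (\<lambda>n. lam n * \<tau>) (at_right 0) sequentially"
    using tendsto_mult[OF lam(2) tendsto_const, of \<tau>] lam(1) \<tau>
    by (auto simp: filterlim_at intro!: always_eventually mult_pos_pos dest: less_imp_neq[symmetric])
  from filterlim_compose[OF infdist_frontier_asymp[OF z] this]
  have "(\<lambda>n. infdist (z - (lam n * \<tau>) *\<^sub>R e) (frontier \<Omega>) / (lam n * \<tau>) * \<tau>) \<longlonglongrightarrow> slope z * \<tau>"
    by (intro tendsto_mult tendsto_const)
  then show ?thesis using \<tau> by simp
qed

text \<open>The integrals on the left involve only the distance to the frontier. The graph integral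
  on the right is therefore the same for any two charts containing the support of \<zeta>.\<close>

lemma exp_layer_limit:
  fixes \<zeta> :: "'a \<Rightarrow> real"
  assumes ne: "frontier \<Omega> \<noteq> {}" and K: "compact K" "K \<subseteq> U"
    and \<zeta>: "continuous_on UNIV \<zeta>" "\<And>x. x \<notin> K \<Longrightarrow> \<zeta> x = 0"
    and lam: "\<And>n. lam n > 0" "lam \<longlonglongrightarrow> 0"
  shows "(\<lambda>n. (\<integral>x. \<zeta> x * (indicator \<Omega> x * exp (- (1 * infdist x (frontier \<Omega>) / lam n))) \<partial>lborel) / lam n)
    \<longlonglongrightarrow> (\<integral>x. indicator slab x * (\<zeta> (foot x) / slope x) \<partial>lborel)"
proof -
  have I0: "(\<integral>t. indicator {0<..} t * exp (- t) \<partial>lborel) = (1::real)"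
    using exp_integral_atLeast(3)[of 1] by simp
  have "(\<lambda>n. (\<integral>x. \<zeta> x * (indicator \<Omega> x * exp (- (1 * infdist x (frontier \<Omega>) / lam n))) \<partial>lborel) / lam n)
    \<longlonglongrightarrow> (\<integral>x. indicator slab x * (\<zeta> (foot x) / slope x) \<partial>lborel) * (\<integral>t. indicator {0<..} t * exp (- t) \<partial>lborel)"
  proof (rule layer_limit[OF ne K \<zeta> lam])
    show "(\<lambda>x. indicator \<Omega> x * exp (- (1 * infdist x (frontier \<Omega>) / lam n))) \<in> borel_measurable borel" for n
    proof (rule borel_measurable_times)
      show "indicator \<Omega> \<in> borel_measurable borel" using open_\<Omega> by simp
      show "(\<lambda>x. exp (- (1 * infdist x (frontier \<Omega>) / lam n))) \<in> borel_measurable borel"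
        using lam(1)[of n] by (intro borel_measurable_continuous_onI continuous_intros) auto
    qed
    show "\<bar>exp (- (1 * infdist x (frontier \<Omega>) / lam n))\<bar> \<le> 1 * exp (- (1 * infdist x (frontier \<Omega>) / lam n))" for n x
      by simp
    show "(\<lambda>n. exp (- (1 * infdist (z - (lam n * \<tau>) *\<^sub>R e) (frontier \<Omega>) / lam n))) \<longlonglongrightarrow> exp (- (slope z * \<tau>))"
      if "z \<in> frontier \<Omega>" "z \<in> U" "\<tau> > 0" for z \<tau>
      using tendsto_exp[OF tendsto_minus[OF infdist_layer[OF that(2,1,3) lam]]] by simp
  qed simp_all
  then show ?thesis unfolding I0 by simp
qed

end

section \<open>Agreement of charts and construction of the surface measure\<close>

lemma frontier_nonempty:
  fixes \<Omega> :: "'a::euclidean_space set"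
  shows "bounded \<Omega> \<Longrightarrow> \<Omega> \<noteq> {} \<Longrightarrow> frontier \<Omega> \<noteq> {}"
  using frontier_eq_empty not_bounded_UNIV by blast

lemma bounded_frontier:
  fixes \<Omega> :: "'a::euclidean_space set"
  shows "bounded \<Omega> \<Longrightarrow> bounded (frontier \<Omega>)"
  by (simp add: compact_frontier_bounded compact_imp_bounded)

text \<open>By \<open>exp_layer_limit\<close> both charts give the same integral to every continuous
  function with compact support in the overlap. Such functions approximate indicators of open sets,
  and finite Borel measures agreeing on open sets coincide.\<close>

lemma graph_measure_unique:
  fixes \<Omega> :: "'a::euclidean_space set"
  assumes c1: "chart \<Omega> e1 g1 U1" and c2: "chart \<Omega> e2 g2 U2" and \<Omega>: "bounded \<Omega>" "\<Omega> \<noteq> {}"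
  defines "W \<equiv> frontier \<Omega> \<inter> U1 \<inter> U2"
  shows "chart.graph_measure e1 g1 W = chart.graph_measure e2 g2 W"
proof -
  interpret c1: chart \<Omega> e1 g1 U1 by fact
  interpret c2: chart \<Omega> e2 g2 U2 by fact
  have ne: "frontier \<Omega> \<noteq> {}" by (rule frontier_nonempty[OF \<Omega>])
  have Wb: "W \<in> sets borel" using c1.open_U c2.open_U by (auto simp: W_def)
  obtain R where R: "frontier \<Omega> \<subseteq> ball 0 R"
    using bounded_subset_ballD[OF bounded_frontier[OF \<Omega>(1)]] by blast
  have "bounded W" using bounded_frontier[OF \<Omega>(1)] by (rule bounded_subset) (auto simp: W_def)
  then interpret f1: finite_measure "c1.graph_measure W" by (rule c1.finite_graph_measure[OF Wb])
  interpret f2: finite_measure "c2.graph_measure W" using \<open>bounded W\<close> by (rule c2.finite_graph_measure[OF Wb])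
  have eq: "emeasure (c1.graph_measure W) Q = emeasure (c2.graph_measure W) Q" if Q: "open Q" for Q
  proof -
    \<comment> \<open>The ball contains the frontier, so nothing is lost on \<open>W\<close>; it
      makes the supports of the test functions compact and the complement of \<open>O'\<close>
      nonempty.\<close>
    define O' where "O' = Q \<inter> U1 \<inter> U2 \<inter> ball 0 R"
    have O': "open O'" using Q c1.open_U c2.open_U by (auto simp: O'_def)
    have "- O' \<noteq> {}"
    proof
      assume "- O' = {}"
      then have "O' = UNIV" by blast
      then have "bounded (UNIV::'a set)" using bounded_ball[of "0::'a" R]
        by (metis O'_def bounded_Int)
      then show False using not_bounded_UNIV by blast
    qed
    then have in_O': "x \<in> O' \<longleftrightarrow> infdist x (- O') > 0" for x
      using in_closed_iff_infdist_zero[of "- O'" x] O' infdist_nonneg[of x "- O'"] by (auto simp: closed_def)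
    \<comment> \<open>Cutoffs supported at distance at least \<open>1 / Suc k\<close> from the
      complement of \<open>O'\<close> that converge pointwise to its indicator.\<close>
    define \<zeta> where "\<zeta> k x = max 0 (min 1 (real (Suc k) * infdist x (- O') - 1))" for k x
    have cont: "continuous_on UNIV (\<zeta> k)" for k unfolding \<zeta>_def by (intro continuous_intros)
    then have [measurable]: "\<zeta> k \<in> borel_measurable borel" for k by (rule borel_measurable_continuous_onI)
    define K where "K k = {x. infdist x (- O') \<ge> 1 / real (Suc k)}" for k
    have K0: "\<zeta> k x = 0" if "x \<notin> K k" for k x
      using that by (simp add: \<zeta>_def K_def field_simps)
    have KO: "K k \<subseteq> O'" for k
    proof
      fix x assume "x \<in> K k"
      then have "1 / real (Suc k) \<le> infdist x (- O')" unfolding K_def by blast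
      moreover have "0 < 1 / real (Suc k)" by simp
      ultimately show "x \<in> O'" unfolding in_O' by (rule order.strict_trans2[rotated])
    qed
    have Kc: "compact (K k)" for k
    proof -
      have "closed (K k)" unfolding K_def by (intro closed_Collect_le continuous_intros)
      moreover have "bounded (K k)" using KO[of k] bounded_ball[of "0::'a" R] by (auto simp: O'_def intro: bounded_subset)
      ultimately show ?thesis by (simp add: compact_eq_bounded_closed)
    qed
    have lim: "(\<lambda>k. \<zeta> k x) \<longlonglongrightarrow> indicator O' x" for x
    proof (cases "x \<in> O'")
      case True
      define d where "d = infdist x (- O')"
      have d: "d > 0" using True in_O' by (simp add: d_def)
      obtain k0 where k0: "real k0 * d > 2" using reals_Archimedean3[OF d] by blast
      have "\<zeta> k x = 1" if "k \<ge> k0" for k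
      proof -
        have "real k0 * d \<le> real (Suc k) * d" using that d by (intro mult_right_mono) auto
        then show ?thesis using k0 by (simp add: \<zeta>_def d_def)
      qed
      then show ?thesis using True by (intro tendsto_eventually) (auto simp: eventually_sequentially)
    next
      case False
      then have "\<not> 0 < infdist x (- O')" using in_O'[of x] by blast
      then have "infdist x (- O') = 0" using infdist_nonneg[of x "- O'"] by linarith
      then show ?thesis using False by (simp add: \<zeta>_def)
    qed
    define lam where "lam n = inverse (real (Suc n))" for n
    have lam: "lam n > 0" "lam \<longlonglongrightarrow> 0" for n
      unfolding lam_def using LIMSEQ_inverse_real_of_nat by auto
    let ?J = "\<lambda>k n. (\<integral>x. \<zeta> k x * (indicator \<Omega> x * exp (- (1 * infdist x (frontier \<Omega>) / lam n))) \<partial>lborel) / lam n"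
    have "(\<integral>x. indicator c1.slab x * (\<zeta> k (c1.foot x) / c1.slope x) \<partial>lborel)
        = (\<integral>x. indicator c2.slab x * (\<zeta> k (c2.foot x) / c2.slope x) \<partial>lborel)" for k
    proof (rule LIMSEQ_unique[of "?J k"])
      have K: "K k \<subseteq> U1" "K k \<subseteq> U2" using KO[of k] by (auto simp: O'_def)
      show "?J k \<longlonglongrightarrow> (\<integral>x. indicator c1.slab x * (\<zeta> k (c1.foot x) / c1.slope x) \<partial>lborel)"
        by (rule c1.exp_layer_limit[OF ne Kc K(1) cont K0 lam])
      show "?J k \<longlonglongrightarrow> (\<integral>x. indicator c2.slab x * (\<zeta> k (c2.foot x) / c2.slope x) \<partial>lborel)"
        by (rule c2.exp_layer_limit[OF ne Kc K(2) cont K0 lam])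
    qed
    note eq1 = this
    have supp: "x \<in> O'" if "\<zeta> k x \<noteq> 0" for k x using K0 KO that by blast
    have sub: "O' \<subseteq> U1" "O' \<subseteq> U2" "O' \<inter> frontier \<Omega> \<subseteq> W" by (auto simp: O'_def W_def)
    have \<zeta>m: "\<zeta> k \<in> borel_measurable borel" for k by measurable
    have "(\<integral>x. \<zeta> k x \<partial>c1.graph_measure W) = (\<integral>x. indicator c1.slab x * (\<zeta> k (c1.foot x) / c1.slope x) \<partial>lborel)" for k
      by (rule c1.integral_graph_measure_support[OF Wb \<zeta>m supp sub(1,3)])
    moreover note eq1
    moreover have "(\<integral>x. \<zeta> k x \<partial>c2.graph_measure W) = (\<integral>x. indicator c2.slab x * (\<zeta> k (c2.foot x) / c2.slope x) \<partial>lborel)" for k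
      by (rule c2.integral_graph_measure_support[OF Wb \<zeta>m supp sub(2,3)])
    ultimately have same: "(\<integral>x. \<zeta> k x \<partial>c1.graph_measure W) = (\<integral>x. \<zeta> k x \<partial>c2.graph_measure W)" for k by simp
    have O'b: "O' \<in> sets borel" using O' by simp
    have \<zeta>1: "norm (\<zeta> k x) \<le> 1" for k x by (simp add: \<zeta>_def)
    have ms: "\<zeta> k \<in> borel_measurable (c1.graph_measure W)" "\<zeta> k \<in> borel_measurable (c2.graph_measure W)"
      "indicat_real O' \<in> borel_measurable (c1.graph_measure W)" "indicat_real O' \<in> borel_measurable (c2.graph_measure W)" for k
      using O'b by (simp_all cong: measurable_cong_sets)
    have "(\<lambda>k. \<integral>x. \<zeta> k x \<partial>c1.graph_measure W) \<longlonglongrightarrow> (\<integral>x. indicator O' x \<partial>c1.graph_measure W)"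
      by (rule integral_dominated_convergence[where w="\<lambda>_. 1"]) (use lim ms \<zeta>1 in auto)
    moreover have "(\<lambda>k. \<integral>x. \<zeta> k x \<partial>c2.graph_measure W) \<longlonglongrightarrow> (\<integral>x. indicator O' x \<partial>c2.graph_measure W)"
      by (rule integral_dominated_convergence[where w="\<lambda>_. 1"]) (use lim ms \<zeta>1 in auto)
    ultimately have "(\<integral>x. indicator O' x \<partial>c1.graph_measure W) = (\<integral>x. indicator O' x \<partial>c2.graph_measure W :: real)"
      using same LIMSEQ_unique by simp
    then have "measure (c1.graph_measure W) O' = measure (c2.graph_measure W) O'" using O'b by simp
    then have "emeasure (c1.graph_measure W) O' = emeasure (c2.graph_measure W) O'"
      by (simp add: f1.emeasure_eq_measure f2.emeasure_eq_measure)
    moreover have "Q \<inter> W = O' \<inter> W" using R by (auto simp: O'_def W_def)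
    ultimately show ?thesis
      using c1.emeasure_graph_measure_Int[OF Wb _ Wb, of Q O'] c2.emeasure_graph_measure_Int[OF Wb _ Wb, of Q O'] O'b Q by simp
  qed
  show ?thesis
  proof (rule measure_eqI_generator_eq[where E="{S. open S}" and \<Omega>=UNIV and A="\<lambda>_. UNIV"])
    show "Int_stable {S :: 'a set. open S}" by (auto simp: Int_stable_def)
    show "sets (c1.graph_measure W) = sigma_sets UNIV {S. open S}" "sets (c2.graph_measure W) = sigma_sets UNIV {S. open S}"
      by (simp_all add: borel_def)
  qed (use eq f1.emeasure_finite in auto)
qed

text \<open>Compactness of the frontier. The charts are numbered so that the pieces they cover can
  be made disjoint by subtracting the earlier ones.\<close>

lemma chart_cover:
  fixes \<Omega> :: "'a::euclidean_space set"
  assumes "bounded \<Omega>" "smooth_boundary \<Omega>"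
  shows "\<exists>(n::nat) e g U. (\<forall>i<n. graph_chart \<Omega> (e i) (g i) (U i)) \<and> frontier \<Omega> \<subseteq> (\<Union>i<n. U i)"
proof -
  obtain e g U where c: "\<And>p. p \<in> frontier \<Omega> \<Longrightarrow> p \<in> U p \<and> graph_chart \<Omega> (e p) (g p) (U p)"
    using assms(2) unfolding smooth_boundary_def by metis
  have "compact (frontier \<Omega>)" using assms(1) by (simp add: compact_frontier_bounded)
  moreover have "open (U p)" if "p \<in> frontier \<Omega>" for p using c[OF that] by (simp add: graph_chart_def)
  moreover have "frontier \<Omega> \<subseteq> (\<Union>p\<in>frontier \<Omega>. U p)" using c by blast
  ultimately obtain C where C: "C \<subseteq> frontier \<Omega>" "finite C" "frontier \<Omega> \<subseteq> (\<Union>p\<in>C. U p)"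
    by (rule compactE_image)
  obtain n and h :: "nat \<Rightarrow> 'a" where h: "C = h ` {i. i < n}"
    using finite_imp_nat_seg_image_inj_on[OF C(2)] by blast
  show ?thesis
    by (rule exI[of _ n], rule exI[of _ "e \<circ> h"], rule exI[of _ "g \<circ> h"], rule exI[of _ "U \<circ> h"])
      (use c C h in auto)
qed

locale smooth_domain =
  fixes \<Omega> :: "'a::euclidean_space set"
  assumes open_\<Omega>: "open \<Omega>" and bounded_\<Omega>: "bounded \<Omega>" and nonempty_\<Omega>: "\<Omega> \<noteq> {}"
    and smooth_\<Omega>: "smooth_boundary \<Omega>"
begin

lemma chartI: "graph_chart \<Omega> e g U \<Longrightarrow> chart \<Omega> e g U"
  using open_\<Omega> by unfold_locales

lemma frontier_borel [measurable]: "frontier \<Omega> \<in> sets borel"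
  by (simp add: frontier_closed)

text \<open>Cut the frontier into disjoint pieces, each inside one chart of a finite cover, and
  measure every piece in its own chart. That the result obeys the formula in every further chart is
  \<open>graph_measure_unique\<close>.\<close>

lemma surface_measure_exists: "\<exists>\<sigma>. is_surface_measure \<Omega> \<sigma>"
proof -
  let ?F = "frontier \<Omega>"
  obtain n :: nat and e g U where c: "\<And>i. i < n \<Longrightarrow> graph_chart \<Omega> (e i) (g i) (U i)" "?F \<subseteq> (\<Union>i<n. U i)"
    using chart_cover[OF bounded_\<Omega> smooth_\<Omega>] by blast
  have oU: "open (U i)" if "i < n" for i using c(1)[OF that] by (simp add: graph_chart_def)
  define B where "B i = ?F \<inter> U i - (\<Union>j<i. U j)" for i
  have Bb: "B i \<in> sets borel" if "i < n" for i
    unfolding B_def using oU that by (intro sets.Diff sets.Int sets.finite_UN) auto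
  have Bdisj: "disjoint_family_on B {..<n}"
    unfolding disjoint_family_on_def B_def by (auto simp: neq_iff)
  have BU: "(\<Union>i<n. B i) = ?F"
  proof
    show "?F \<subseteq> (\<Union>i<n. B i)"
    proof
      fix x assume x: "x \<in> ?F"
      then have ex: "\<exists>i. i < n \<and> x \<in> U i" using c(2) by auto
      define i where "i = (LEAST i. i < n \<and> x \<in> U i)"
      have "i < n \<and> x \<in> U i" unfolding i_def by (rule LeastI_ex[OF ex])
      moreover have "x \<notin> U j" if "j < i" for j
        using not_less_Least[of j "\<lambda>i. i < n \<and> x \<in> U i"] that calculation by (auto simp: i_def)
      ultimately show "x \<in> (\<Union>i<n. B i)" using x by (auto simp: B_def)
    qed
  qed (auto simp: B_def)
  define G where "G i = chart.graph_measure (e i) (g i) (?F \<inter> U i)" for i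
  have Gs: "sets (G i) = sets borel" if "i < n" for i
    unfolding G_def by (rule chart.sets_graph_measure[OF chartI[OF c(1)[OF that]]])
  define m where "m X = (\<Sum>i<n. emeasure (G i) (X \<inter> B i))" for X
  define \<sigma> where "\<sigma> = measure_of UNIV (sets borel) m"
  have ca: "countably_additive (sets borel) m"
  proof (rule countably_additiveI)
    fix A :: "nat \<Rightarrow> 'a set" assume A: "range A \<subseteq> sets borel" "disjoint_family A"
    have "(\<Sum>k. emeasure (G i) (A k \<inter> B i)) = emeasure (G i) ((\<Union>k. A k) \<inter> B i)" if "i < n" for i
    proof -
      have "(\<Sum>k. emeasure (G i) (A k \<inter> B i)) = emeasure (G i) (\<Union>k. A k \<inter> B i)"
        using A Bb[OF that] Gs[OF that]
        by (intro suminf_emeasure) (auto simp: disjoint_family_on_def)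
      then show ?thesis by simp
    qed
    then have "m (\<Union>k. A k) = (\<Sum>i<n. \<Sum>k. emeasure (G i) (A k \<inter> B i))" by (simp add: m_def)
    also have "\<dots> = (\<Sum>k. \<Sum>i<n. emeasure (G i) (A k \<inter> B i))"
      by (rule suminf_sum[symmetric]) simp
    finally show "(\<Sum>k. m (A k)) = m (\<Union>k. A k)" by (simp add: m_def)
  qed
  have \<sigma>s: "sets \<sigma> = sets borel" unfolding \<sigma>_def by (simp add: sets_measure_of_conv sets.space_closed[of borel, simplified] sets.sigma_sets_eq[of borel, simplified])
  have em: "emeasure \<sigma> X = m X" if "X \<in> sets borel" for X
  proof (rule emeasure_measure_of[OF \<sigma>_def])
    show "positive (sets \<sigma>) m" by (simp add: positive_def m_def)
    show "countably_additive (sets \<sigma>) m" using ca \<sigma>s by simp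
  qed (use that \<sigma>s in auto)
  have "is_surface_measure \<Omega> \<sigma>"
    unfolding is_surface_measure_def
  proof (intro conjI allI impI ballI \<sigma>s)
    have "- ?F \<inter> B i = {}" for i by (auto simp: B_def)
    then show "emeasure \<sigma> (- ?F) = 0" by (subst em) (auto simp: m_def)
    fix e' g' U' X assume c': "graph_chart \<Omega> e' g' U'" and X: "X \<in> sets borel" "X \<subseteq> ?F \<inter> U'"
    interpret c': chart \<Omega> e' g' U' by (rule chartI[OF c'])
    have F': "?F \<inter> U' \<in> sets borel" using c'.open_U by auto
    let ?G = "c'.graph_measure (?F \<inter> U')"
    have "emeasure (G i) (X \<inter> B i) = emeasure ?G (X \<inter> B i)" if i: "i < n" for i
    proof -
      interpret ci: chart \<Omega> "e i" "g i" "U i" by (rule chartI[OF c(1)[OF i]])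
      let ?W = "?F \<inter> U i \<inter> U'"
      have b: "?F \<inter> U i \<in> sets borel" "?W \<in> sets borel" "X \<inter> B i \<in> sets borel"
        using ci.open_U c'.open_U Bb[OF i] X by auto
      have XW: "X \<inter> B i \<subseteq> ?W" using X by (auto simp: B_def)
      have "emeasure (G i) (X \<inter> B i) = emeasure (ci.graph_measure ?W) (X \<inter> B i)"
        unfolding G_def by (rule ci.emeasure_graph_measure_Int[OF b(1,3,2) _ b(3)]) (use XW in blast)
      also have "ci.graph_measure ?W = c'.graph_measure ?W"
        by (rule graph_measure_unique[OF ci.chart_axioms c'.chart_axioms bounded_\<Omega> nonempty_\<Omega>])
      also have "emeasure (c'.graph_measure ?W) (X \<inter> B i) = emeasure ?G (X \<inter> B i)"
        by (rule c'.emeasure_graph_measure_Int[OF b(2,3) F' _ b(3)]) (use XW in blast)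
      finally show ?thesis .
    qed
    then have "emeasure \<sigma> X = (\<Sum>i<n. emeasure ?G (X \<inter> B i))" using X by (simp add: em m_def)
    also have "\<dots> = emeasure ?G (\<Union>i<n. X \<inter> B i)"
      using Bb X Bdisj by (intro sum_emeasure) (auto simp: disjoint_family_on_def)
    also have "(\<Union>i<n. X \<inter> B i) = X" using BU X by blast
    also have "emeasure ?G X = (\<integral>\<^sup>+ x \<in> {x. 0 \<le> x \<bullet> e' \<and> x \<bullet> e' \<le> 1 \<and> x + (g' x - x \<bullet> e') *\<^sub>R e' \<in> X \<inter> (?F \<inter> U')}.
             ennreal (sqrt (1 + (norm (grad g' x))\<^sup>2)) \<partial>lborel)"
      by (rule c'.emeasure_graph_measure[OF F' X(1)])
    also have "X \<inter> (?F \<inter> U') = X" using X by blast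
    finally show "emeasure \<sigma> X = (\<integral>\<^sup>+ x \<in> {x. 0 \<le> x \<bullet> e' \<and> x \<bullet> e' \<le> 1 \<and> x + (g' x - x \<bullet> e') *\<^sub>R e' \<in> X}.
             ennreal (sqrt (1 + (norm (grad g' x))\<^sup>2)) \<partial>lborel)" .
  qed
  then show ?thesis by blast
qed

lemma surface_measure_chart:
  assumes \<sigma>: "is_surface_measure \<Omega> \<sigma>" and c: "graph_chart \<Omega> e g U" and X: "X \<in> sets borel"
  shows "emeasure \<sigma> (X \<inter> (frontier \<Omega> \<inter> U)) = emeasure (chart.graph_measure e g (frontier \<Omega> \<inter> U)) X"
proof -
  interpret chart \<Omega> e g U by (rule chartI[OF c])
  have F': "frontier \<Omega> \<inter> U \<in> sets borel" using open_U by auto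
  show ?thesis
    using \<sigma>[unfolded is_surface_measure_def, THEN conjunct2, THEN conjunct2, rule_format, OF c, of "X \<inter> (frontier \<Omega> \<inter> U)"] X F'
    by (simp only: emeasure_graph_measure[OF F' X]) blast
qed

text \<open>The chart formulas determine the measure on each disjoint piece of the frontier, and its
  complement is null.\<close>

lemma surface_measure_unique:
  assumes "is_surface_measure \<Omega> \<sigma>" "is_surface_measure \<Omega> \<sigma>'"
  shows "\<sigma> = \<sigma>'"
proof -
  let ?F = "frontier \<Omega>"
  obtain n :: nat and e g U where c: "\<And>i. i < n \<Longrightarrow> graph_chart \<Omega> (e i) (g i) (U i)" "?F \<subseteq> (\<Union>i<n. U i)"
    using chart_cover[OF bounded_\<Omega> smooth_\<Omega>] by blast
  have oU: "open (U i)" if "i < n" for i using c(1)[OF that] by (simp add: graph_chart_def)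
  define B where "B i X = (X \<inter> ?F) \<inter> U i - (\<Union>j<i. U j)" for i X
  have *: "emeasure \<tau> X = (\<Sum>i<n. emeasure (chart.graph_measure (e i) (g i) (?F \<inter> U i)) (B i X))"
    if \<tau>: "is_surface_measure \<Omega> \<tau>" and X: "X \<in> sets borel" for \<tau> X
  proof -
    have s: "sets \<tau> = sets borel" and z: "emeasure \<tau> (- ?F) = 0" using \<tau> by (auto simp: is_surface_measure_def)
    have Bb: "B i X \<in> sets borel" if "i < n" for i
      unfolding B_def using oU that X by (intro sets.Diff sets.Int sets.finite_UN) auto
    have BU: "(\<Union>i<n. B i X) = X \<inter> ?F"
    proof
      show "X \<inter> ?F \<subseteq> (\<Union>i<n. B i X)"
      proof
        fix x assume x: "x \<in> X \<inter> ?F"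
        then have ex: "\<exists>i. i < n \<and> x \<in> U i" using c(2) by auto
        define i where "i = (LEAST i. i < n \<and> x \<in> U i)"
        have "i < n \<and> x \<in> U i" unfolding i_def by (rule LeastI_ex[OF ex])
        moreover have "x \<notin> U j" if "j < i" for j
          using not_less_Least[of j "\<lambda>i. i < n \<and> x \<in> U i"] that calculation by (auto simp: i_def)
        ultimately show "x \<in> (\<Union>i<n. B i X)" using x by (auto simp: B_def)
      qed
    qed (auto simp: B_def)
    have "emeasure \<tau> X = emeasure \<tau> (X \<inter> ?F)"
      using X s z by (intro emeasure_eq_AE AE_I[of _ _ "- ?F"]) auto
    also have "\<dots> = (\<Sum>i<n. emeasure \<tau> (B i X))"
    proof -
      have "disjoint_family_on (\<lambda>i. B i X) {..<n}" unfolding disjoint_family_on_def B_def by (auto simp: neq_iff)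
      then show ?thesis unfolding BU[symmetric] using Bb s by (intro sum_emeasure[symmetric]) auto
    qed
    also have "\<dots> = (\<Sum>i<n. emeasure (chart.graph_measure (e i) (g i) (?F \<inter> U i)) (B i X))"
    proof (rule sum.cong[OF refl])
      fix i assume i: "i \<in> {..<n}"
      have "B i X = B i X \<inter> (?F \<inter> U i)" by (auto simp: B_def)
      then show "emeasure \<tau> (B i X) = emeasure (chart.graph_measure (e i) (g i) (?F \<inter> U i)) (B i X)"
        using surface_measure_chart[OF \<tau> c(1) Bb, of i i] i by simp
    qed
    finally show ?thesis .
  qed
  show ?thesis
  proof (rule measure_eqI)
    show s: "sets \<sigma> = sets \<sigma>'" using assms by (simp add: is_surface_measure_def)
    fix X assume "X \<in> sets \<sigma>"
    then have "X \<in> sets borel" using assms(1) by (simp add: is_surface_measure_def)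
    then show "emeasure \<sigma> X = emeasure \<sigma>' X" by (simp only: *[OF assms(1)] *[OF assms(2)])
  qed
qed

lemma is_surface_measure_surface_measure: "is_surface_measure \<Omega> (surface_measure \<Omega>)"
proof -
  obtain \<sigma> where \<sigma>: "is_surface_measure \<Omega> \<sigma>" using surface_measure_exists by blast
  then have "\<exists>!\<sigma>. is_surface_measure \<Omega> \<sigma>" using surface_measure_unique by blast
  then show ?thesis unfolding surface_measure_def by (rule theI')
qed

lemma sets_surface_measure [simp, measurable_cong]: "sets (surface_measure \<Omega>) = sets borel"
  using is_surface_measure_surface_measure by (simp add: is_surface_measure_def)

lemma AE_surface_measure: "AE x in surface_measure \<Omega>. x \<in> frontier \<Omega>"
  using is_surface_measure_surface_measure sets_eq_imp_space_eq[OF sets_surface_measure]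
  by (intro AE_I[of _ _ "- frontier \<Omega>"]) (auto simp: is_surface_measure_def)

lemma finite_surface_measure: "finite_measure (surface_measure \<Omega>)"
proof
  let ?F = "frontier \<Omega>" and ?\<sigma> = "surface_measure \<Omega>"
  obtain n :: nat and e g U where c: "\<And>i. i < n \<Longrightarrow> graph_chart \<Omega> (e i) (g i) (U i)" "?F \<subseteq> (\<Union>i<n. U i)"
    using chart_cover[OF bounded_\<Omega> smooth_\<Omega>] by blast
  have fin: "emeasure ?\<sigma> (?F \<inter> U i) < \<infinity>" and b: "?F \<inter> U i \<in> sets borel" if i: "i < n" for i
  proof -
    interpret chart \<Omega> "e i" "g i" "U i" by (rule chartI[OF c(1)[OF i]])
    show b: "?F \<inter> U i \<in> sets borel" using open_U by auto
    interpret finite_measure "graph_measure (?F \<inter> U i)"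
      by (intro finite_graph_measure b bounded_subset[OF bounded_frontier[OF bounded_\<Omega>]]) auto
    show "emeasure ?\<sigma> (?F \<inter> U i) < \<infinity>"
    proof -
      have "emeasure ?\<sigma> (?F \<inter> U i) = emeasure (graph_measure (?F \<inter> U i)) UNIV"
        using surface_measure_chart[OF is_surface_measure_surface_measure c(1)[OF i], of UNIV] by simp
      then show ?thesis using emeasure_finite[of UNIV]
        by (simp only: top.not_eq_extremum infinity_ennreal_def)
    qed
  qed
  have "emeasure ?\<sigma> (space ?\<sigma>) = emeasure ?\<sigma> (\<Union>i<n. ?F \<inter> U i)"
  proof (rule emeasure_eq_AE)
    show "AE x in ?\<sigma>. (x \<in> space ?\<sigma>) = (x \<in> (\<Union>i<n. ?F \<inter> U i))"
      using AE_surface_measure AE_space by eventually_elim (use c(2) in auto)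
    show "space ?\<sigma> \<in> sets ?\<sigma>" by (rule sets.top)
    show "(\<Union>i<n. ?F \<inter> U i) \<in> sets ?\<sigma>" unfolding sets_surface_measure using b by (intro sets.finite_UN) auto
  qed
  also have "\<dots> \<le> (\<Sum>i<n. emeasure ?\<sigma> (?F \<inter> U i))"
    using b by (intro emeasure_subadditive_finite) auto
  also have "\<dots> < \<infinity>" using fin by simp
  finally show "emeasure ?\<sigma> (space ?\<sigma>) \<noteq> \<infinity>" by simp
qed

text \<open>Restricted to a chart, the surface measure is the graph measure. This gives the limit in
  \<open>layer_limit\<close> an intrinsic meaning, which permits summation over charts.\<close>

lemma integral_surface_measure:
  fixes \<zeta> :: "'a \<Rightarrow> real"
  assumes c: "graph_chart \<Omega> e g U" and \<zeta> [measurable]: "\<zeta> \<in> borel_measurable borel" and supp: "\<And>x. \<zeta> x \<noteq> 0 \<Longrightarrow> x \<in> U"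
  shows "(\<integral>x. \<zeta> x \<partial>surface_measure \<Omega>)
    = (\<integral>x. indicator (chart.slab e) x * (\<zeta> (chart.foot e g x) / chart.slope g x) \<partial>lborel)"
proof -
  interpret chart \<Omega> e g U by (rule chartI[OF c])
  let ?S = "frontier \<Omega> \<inter> U" and ?\<sigma> = "surface_measure \<Omega>"
  have S [measurable]: "?S \<in> sets borel" using open_U by auto
  have "graph_measure ?S = density ?\<sigma> (\<lambda>x. ennreal (indicator ?S x))"
  proof (rule measure_eqI)
    fix X assume "X \<in> sets (graph_measure ?S)"
    then have X: "X \<in> sets borel" by simp
    have "emeasure (density ?\<sigma> (\<lambda>x. ennreal (indicator ?S x))) X = (\<integral>\<^sup>+x. ennreal (indicator ?S x) * indicator X x \<partial>?\<sigma>)"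
      using X by (intro emeasure_density) auto
    also have "\<dots> = (\<integral>\<^sup>+x. indicator (X \<inter> ?S) x \<partial>?\<sigma>)"
      by (intro nn_integral_cong) (auto split: split_indicator)
    also have "\<dots> = emeasure ?\<sigma> (X \<inter> ?S)" using X S by (intro nn_integral_indicator) auto
    finally show "emeasure (graph_measure ?S) X = emeasure (density ?\<sigma> (\<lambda>x. ennreal (indicator ?S x))) X"
      using surface_measure_chart[OF is_surface_measure_surface_measure c X] by simp
  qed simp
  then have "(\<integral>x. \<zeta> x \<partial>graph_measure ?S) = (\<integral>x. indicator ?S x *\<^sub>R \<zeta> x \<partial>?\<sigma>)"
    using integral_density[of \<zeta> ?\<sigma> "\<lambda>x. indicator ?S x"] by simp
  also have "\<dots> = (\<integral>x. \<zeta> x \<partial>?\<sigma>)"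
  proof (rule integral_cong_AE)
    show "AE x in ?\<sigma>. indicator ?S x *\<^sub>R \<zeta> x = \<zeta> x"
      using AE_surface_measure by eventually_elim (use supp in \<open>auto split: split_indicator\<close>)
  qed auto
  moreover have "(\<integral>x. \<zeta> x \<partial>graph_measure ?S) = (\<integral>x. indicator slab x * (\<zeta> (foot x) / slope x) \<partial>lborel)"
    by (rule integral_graph_measure_support[OF S \<zeta> supp]) auto
  ultimately show ?thesis by simp
qed

text \<open>Together with the chart-wise limits, a partition of unity gives the total mass of a layer.\<close>

lemma boundary_layer_limit:
  fixes \<psi> :: "nat \<Rightarrow> 'a \<Rightarrow> real"
  assumes lam: "\<And>n. lam n > 0" "lam \<longlonglongrightarrow> 0"
    and \<psi>m: "\<And>n. (\<lambda>x. indicator \<Omega> x * \<psi> n x) \<in> borel_measurable borel"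
    and bnd: "\<And>n x. x \<in> \<Omega> \<Longrightarrow> \<bar>\<psi> n x\<bar> \<le> C * exp (- (\<mu> * infdist x (frontier \<Omega>) / lam n))" and \<mu>: "\<mu> > 0"
    and lim: "\<And>e g U z \<tau>. graph_chart \<Omega> e g U \<Longrightarrow> z \<in> frontier \<Omega> \<Longrightarrow> z \<in> U \<Longrightarrow> \<tau> > 0 \<Longrightarrow>
      (\<lambda>n. \<psi> n (z - (lam n * \<tau>) *\<^sub>R e)) \<longlonglongrightarrow> \<psi>0 (chart.slope g z * \<tau>)"
  shows "(\<lambda>n. (\<integral>x. indicator \<Omega> x * \<psi> n x \<partial>lborel) / lam n)
    \<longlonglongrightarrow> surface_area \<Omega> * (\<integral>t. indicator {0<..} t * \<psi>0 t \<partial>lborel)"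
proof -
  let ?F = "frontier \<Omega>" and ?\<sigma> = "surface_measure \<Omega>" and ?I = "\<integral>t. indicator {0<..} t * \<psi>0 t \<partial>lborel"
  interpret \<sigma>: finite_measure ?\<sigma> by (rule finite_surface_measure)
  have ne: "?F \<noteq> {}" by (rule frontier_nonempty[OF bounded_\<Omega> nonempty_\<Omega>])
  have Fc: "compact ?F" using bounded_\<Omega> by (simp add: compact_frontier_bounded)
  have "\<exists>e g U r. p \<in> U \<and> graph_chart \<Omega> e g U \<and> r > 0 \<and> cball p r \<subseteq> U" if p: "p \<in> ?F" for p
  proof -
    obtain e g U where *: "p \<in> U" "graph_chart \<Omega> e g U" using smooth_\<Omega> p unfolding smooth_boundary_def by blast
    then have "open U" by (simp add: graph_chart_def)
    then obtain r where "r > 0" "cball p r \<subseteq> U" using *(1) open_contains_cball by blast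
    then show ?thesis using * by blast
  qed
  then obtain e g U r where c: "\<And>p. p \<in> ?F \<Longrightarrow> graph_chart \<Omega> (e p) (g p) (U p) \<and> r p > (0::real) \<and> cball p (r p) \<subseteq> U p"
    by metis
  have "?F \<subseteq> (\<Union>p\<in>?F. ball p (r p))" using c by force
  then obtain D where D: "D \<subseteq> ?F" "finite D" "?F \<subseteq> (\<Union>p\<in>D. ball p (r p))"
    using compactE_image[OF Fc, of ?F "\<lambda>p. ball p (r p)"] by auto
  define \<phi> where "\<phi> p x = max 0 (r p - dist p x)" for p x
  define \<Phi> where "\<Phi> x = (\<Sum>p\<in>D. \<phi> p x)" for x
  have c\<phi>: "continuous_on UNIV (\<phi> p)" for p unfolding \<phi>_def by (intro continuous_intros)
  have c\<Phi>: "continuous_on UNIV \<Phi>" unfolding \<Phi>_def by (intro continuous_intros c\<phi>)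
  have \<phi>0: "\<phi> p x \<ge> 0" for p x by (simp add: \<phi>_def)
  have \<Phi>pos: "\<Phi> x > 0" if x: "x \<in> ?F" for x
  proof -
    obtain p where p: "p \<in> D" "x \<in> ball p (r p)" using D x by blast
    then have "0 < \<phi> p x" by (simp add: \<phi>_def)
    also have "\<dots> \<le> \<Phi> x" unfolding \<Phi>_def using p D \<phi>0 by (intro member_le_sum) auto
    finally show ?thesis .
  qed
  obtain x0 where x0: "x0 \<in> ?F" "\<And>x. x \<in> ?F \<Longrightarrow> \<Phi> x0 \<le> \<Phi> x"
    using continuous_attains_inf[OF Fc ne continuous_on_subset[OF c\<Phi>]] by blast
  define c1 where "c1 = \<Phi> x0 / 2"
  have c1: "c1 > 0" using \<Phi>pos[OF x0(1)] by (simp add: c1_def)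
  \<comment> \<open>The maximum with \<open>c1\<close>, half the minimum of \<Phi> on the frontier,
    keeps the quotient continuous where \<Phi> vanishes; where \<open>\<Phi> > c1\<close>, in
    particular near the frontier, these functions sum to one.\<close>
  define \<zeta> where "\<zeta> p x = \<phi> p x / max (\<Phi> x) c1" for p x
  have mx: "max (\<Phi> x) c1 > 0" for x using c1 by auto
  have c\<zeta>: "continuous_on UNIV (\<zeta> p)" for p
    unfolding \<zeta>_def using mx by (intro continuous_intros c\<phi> c\<Phi>) (auto simp: less_le)
  have [measurable]: "\<zeta> p \<in> borel_measurable borel" for p by (rule borel_measurable_continuous_onI[OF c\<zeta>])
  have \<zeta>0: "\<zeta> p x \<ge> 0" for p x using \<phi>0[of p x] mx[of x] by (simp add: \<zeta>_def)
  have supp: "\<zeta> p x = 0" if "x \<notin> cball p (r p)" for p x using that by (simp add: \<zeta>_def \<phi>_def)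
  have sum\<zeta>: "(\<Sum>p\<in>D. \<zeta> p x) = \<Phi> x / max (\<Phi> x) c1" for x
    by (simp add: \<zeta>_def \<Phi>_def sum_divide_distrib)
  have \<Phi>0: "\<Phi> x \<ge> 0" for x unfolding \<Phi>_def by (intro sum_nonneg \<phi>0)
  have sum\<zeta>1: "(\<Sum>p\<in>D. \<zeta> p x) \<le> 1" for x unfolding sum\<zeta> using mx[of x] \<Phi>0[of x] by (simp add: divide_le_eq)
  define N where "N = {x. \<Phi> x > c1}"
  have N: "open N" unfolding N_def by (intro open_Collect_less continuous_intros c\<Phi>)
  have FN: "?F \<subseteq> N" using x0 c1 \<Phi>pos[OF x0(1)] by (force simp: N_def c1_def)
  have sumN: "(\<Sum>p\<in>D. \<zeta> p x) = 1" if "x \<in> N" for x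
    using that c1 unfolding sum\<zeta> by (simp add: N_def)
  obtain d0 where d0: "d0 > 0" "(\<Union>x\<in>?F. ball x d0) \<subseteq> N"
    using compact_subset_open_imp_ball_epsilon_subset[OF Fc N FN] by blast
  \<comment> \<open>The functions fail to sum to one only at a fixed distance from the frontier,
    where the decay makes the contribution negligible.\<close>
  have far: "infdist x ?F \<ge> d0" if "x \<notin> N" for x
  proof -
    obtain w where w: "w \<in> ?F" "infdist x ?F = dist x w" using infdist_attains_inf[OF _ ne, of x] by auto
    have "x \<notin> ball w d0" using d0 w that by blast
    then show ?thesis using w by (simp add: dist_commute)
  qed
  define H where "H n x = indicator \<Omega> x * \<psi> n x" for n x
  have Hm [measurable]: "H n \<in> borel_measurable borel" for n unfolding H_def by (rule \<psi>m)
  have fin\<Omega>: "emeasure lborel \<Omega> < \<infinity>" by (rule emeasure_bounded_finite[OF bounded_\<Omega>])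
  have C0: "\<bar>\<psi> n x\<bar> \<le> \<bar>C\<bar>" if "x \<in> \<Omega>" for n x
  proof -
    have "C * exp (- (\<mu> * infdist x ?F / lam n)) \<le> \<bar>C\<bar> * 1"
      using \<mu> lam(1)[of n] by (intro mult_mono) (auto simp: infdist_nonneg)
    then show ?thesis using bnd[OF that, of n] by simp
  qed
  have dom: "integrable lborel (\<lambda>x. \<bar>C\<bar> * indicator \<Omega> x)"
    using fin\<Omega> open_\<Omega> by (intro integrable_mult_right integrable_real_indicator) auto
  have Hi: "integrable lborel (H n)" for n
    by (rule Bochner_Integration.integrable_bound[OF dom]) (use C0 in \<open>auto simp: H_def split: split_indicator\<close>)
  have \<zeta>1: "\<zeta> p x \<le> 1" if "p \<in> D" for p x
    using member_le_sum[of p D "\<lambda>p. \<zeta> p x"] that D \<zeta>0 sum\<zeta>1[of x] by simp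
  have \<zeta>Hi: "integrable lborel (\<lambda>x. \<zeta> p x * H n x)" if "p \<in> D" for p n
    by (rule Bochner_Integration.integrable_bound[OF Hi[of n]])
      (use \<zeta>0 \<zeta>1[OF that] in \<open>auto simp: abs_mult intro!: mult_left_le_one_le\<close>)
  have lim_p: "(\<lambda>n. (\<integral>x. \<zeta> p x * H n x \<partial>lborel) / lam n) \<longlonglongrightarrow> (\<integral>x. \<zeta> p x \<partial>?\<sigma>) * ?I" if p: "p \<in> D" for p
  proof -
    have cp: "graph_chart \<Omega> (e p) (g p) (U p)" "cball p (r p) \<subseteq> U p" using c p D by auto
    interpret chart \<Omega> "e p" "g p" "U p" by (rule chartI[OF cp(1)])
    have eq: "(\<integral>x. \<zeta> p x \<partial>?\<sigma>) = (\<integral>x. indicator slab x * (\<zeta> p (foot x) / slope x) \<partial>lborel)"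
      by (rule integral_surface_measure[OF cp(1)]) (use supp cp(2) in \<open>auto, blast\<close>)
    show ?thesis unfolding eq H_def
      by (rule layer_limit[OF ne compact_cball cp(2) c\<zeta> supp lam \<psi>m bnd \<mu> lim[OF cp(1)]])
  qed
  let ?R = "\<lambda>n x. (1 - (\<Sum>p\<in>D. \<zeta> p x)) * H n x"
  have split: "(\<integral>x. H n x \<partial>lborel) = (\<Sum>p\<in>D. \<integral>x. \<zeta> p x * H n x \<partial>lborel) + (\<integral>x. ?R n x \<partial>lborel)" for n
  proof -
    have "integrable lborel (?R n)"
      unfolding left_diff_distrib sum_distrib_right using Hi \<zeta>Hi by (auto intro!: Bochner_Integration.integrable_diff)
    then have "(\<integral>x. (\<Sum>p\<in>D. \<zeta> p x * H n x) + ?R n x \<partial>lborel) = (\<integral>x. (\<Sum>p\<in>D. \<zeta> p x * H n x) \<partial>lborel) + (\<integral>x. ?R n x \<partial>lborel)"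
      using \<zeta>Hi by (intro Bochner_Integration.integral_add) auto
    moreover have "(\<Sum>p\<in>D. \<zeta> p x * H n x) + ?R n x = H n x" for x
      by (simp add: sum_distrib_right left_diff_distrib)
    ultimately show ?thesis using \<zeta>Hi by (simp add: Bochner_Integration.integral_sum)
  qed
  have rest: "(\<lambda>n. (\<integral>x. ?R n x \<partial>lborel) / lam n) \<longlonglongrightarrow> 0"
  proof (rule Lim_null_comparison)
    define a where "a = \<mu> * d0"
    have a: "a > 0" using \<mu> d0 by (simp add: a_def)
    have bR: "norm (?R n x) \<le> \<bar>C\<bar> * exp (- (a / lam n)) * indicator \<Omega> x" for n x
    proof (cases "x \<in> \<Omega> \<and> x \<notin> N")
      case True
      have "\<bar>\<psi> n x\<bar> \<le> C * exp (- (\<mu> * infdist x ?F / lam n))" using bnd True by blast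
      also have "\<dots> \<le> \<bar>C\<bar> * exp (- (a / lam n))"
        using far[of x] True \<mu> lam(1)[of n] by (intro mult_mono) (auto simp: a_def divide_right_mono)
      finally have "\<bar>H n x\<bar> \<le> \<bar>C\<bar> * exp (- (a / lam n))" using True by (simp add: H_def)
      moreover have "\<bar>1 - (\<Sum>p\<in>D. \<zeta> p x)\<bar> \<le> 1" using sum\<zeta>1[of x] \<zeta>0 by (simp add: sum_nonneg)
      ultimately have "\<bar>1 - (\<Sum>p\<in>D. \<zeta> p x)\<bar> * \<bar>H n x\<bar> \<le> 1 * (\<bar>C\<bar> * exp (- (a / lam n)))"
        by (intro mult_mono) auto
      then show ?thesis using True by (simp add: abs_mult)
    next
      case False
      then have "?R n x = 0" using sumN[of x] by (auto simp: H_def)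
      then show ?thesis by (simp only: norm_zero) simp
    qed
    have "norm ((\<integral>x. ?R n x \<partial>lborel) / lam n) \<le> 2 * \<bar>C\<bar> * measure lborel \<Omega> / a\<^sup>2 * lam n" for n
    proof -
      have l: "lam n > 0" by (rule lam)
      have ib: "integrable lborel (\<lambda>x. \<bar>C\<bar> * exp (- (a / lam n)) * indicator \<Omega> x)"
        using fin\<Omega> open_\<Omega> by (intro integrable_mult_right integrable_real_indicator) auto
      have "norm (\<integral>x. ?R n x \<partial>lborel) \<le> (\<integral>x. \<bar>C\<bar> * exp (- (a / lam n)) * indicator \<Omega> x \<partial>lborel)"
      proof (rule Bochner_Integration.integral_norm_bound_integral[OF _ ib])
        show "integrable lborel (?R n)" by (rule Bochner_Integration.integrable_bound[OF ib]) (use bR in auto)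
      qed (use bR in auto)
      also have "\<dots> = \<bar>C\<bar> * measure lborel \<Omega> * exp (- (a / lam n))"
        using open_\<Omega> by simp
      also have "\<dots> \<le> \<bar>C\<bar> * measure lborel \<Omega> * (2 * (lam n)\<^sup>2 / a\<^sup>2)"
      proof (rule mult_left_mono)
        \<comment> \<open>A quadratic lower bound for the exponential is enough: after division by
          \<open>lam n\<close> a factor \<open>lam n\<close> is left.\<close>
        have "(a / lam n)\<^sup>2 / 2 \<le> exp (a / lam n)"
          using exp_lower_Taylor_quadratic[of "a / lam n"] a l by (smt (verit) divide_nonneg_nonneg)
        then show "exp (- (a / lam n)) \<le> 2 * (lam n)\<^sup>2 / a\<^sup>2"
          using a l by (simp add: exp_minus field_simps)
      qed simp
      finally have "norm (\<integral>x. ?R n x \<partial>lborel) / lam n \<le> \<bar>C\<bar> * measure lborel \<Omega> * (2 * (lam n)\<^sup>2 / a\<^sup>2) / lam n"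
        using l by (intro divide_right_mono) auto
      then show ?thesis using l by (simp add: power2_eq_square mult_ac)
    qed
    then show "\<forall>\<^sub>F n in sequentially. norm ((\<integral>x. ?R n x \<partial>lborel) / lam n) \<le> 2 * \<bar>C\<bar> * measure lborel \<Omega> / a\<^sup>2 * lam n"
      by (intro always_eventually) blast
    show "(\<lambda>n. 2 * \<bar>C\<bar> * measure lborel \<Omega> / a\<^sup>2 * lam n) \<longlonglongrightarrow> 0"
      using tendsto_mult[OF tendsto_const lam(2), of "2 * \<bar>C\<bar> * measure lborel \<Omega> / a\<^sup>2"] by simp
  qed
  have "(\<lambda>n. (\<Sum>p\<in>D. (\<integral>x. \<zeta> p x * H n x \<partial>lborel) / lam n) + (\<integral>x. ?R n x \<partial>lborel) / lam n)
      \<longlonglongrightarrow> (\<Sum>p\<in>D. (\<integral>x. \<zeta> p x \<partial>?\<sigma>) * ?I) + 0"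
    by (intro tendsto_add tendsto_sum lim_p rest)
  moreover have "(\<Sum>p\<in>D. (\<integral>x. \<zeta> p x \<partial>?\<sigma>) * ?I) = surface_area \<Omega> * ?I"
  proof -
    have "integrable ?\<sigma> (\<zeta> p)" if "p \<in> D" for p
      by (rule \<sigma>.integrable_const_bound[of _ 1]) (use \<zeta>0 \<zeta>1[OF that] in auto)
    then have "(\<Sum>p\<in>D. \<integral>x. \<zeta> p x \<partial>?\<sigma>) = (\<integral>x. (\<Sum>p\<in>D. \<zeta> p x) \<partial>?\<sigma>)"
      by (simp add: Bochner_Integration.integral_sum)
    also have "\<dots> = (\<integral>x. indicator ?F x \<partial>?\<sigma>)"
    proof (rule integral_cong_AE)
      show "AE x in ?\<sigma>. (\<Sum>p\<in>D. \<zeta> p x) = indicator ?F x"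
        using AE_surface_measure by eventually_elim (use sumN FN in auto)
    qed auto
    also have "\<dots> = surface_area \<Omega>" by (simp add: surface_area_def)
    finally show ?thesis by (simp add: sum_distrib_right[symmetric])
  qed
  ultimately show ?thesis
    by (simp add: split H_def[symmetric] add_divide_distrib sum_divide_distrib)
qed

end

section \<open>One-dimensional profiles\<close>

lemma interval_integral_has_derivative:
  fixes f :: "real \<Rightarrow> real"
  assumes cont: "continuous_on {a..b} f" and c: "a \<le> c" "c \<le> b" and x: "a < x" "x < b"
  shows "((\<lambda>u. LBINT y=ereal c..ereal u. f y) has_real_derivative f x) (at x)"
proof -
  have "((\<lambda>u. LBINT y=ereal c..ereal u. f y) has_vector_derivative f x) (at x within {a..b})"
    using c x by (intro interval_integral_FTC2 cont) auto
  moreover have "at x within {a..b} = at x" using x by (intro at_within_interior) auto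
  ultimately show ?thesis by (simp add: has_real_derivative_iff_has_vector_derivative)
qed

text \<open>The time an orbit of \<open>W' = - p (W)\<close> needs between two values. The base
  point is interior because \<open>1 / p\<close> need not be integrable at zero.\<close>

lemma inverse_antiderivative_exists:
  fixes p :: "real \<Rightarrow> real"
  assumes cont: "continuous_on {0<..<B} p" and pos: "\<And>s. 0 < s \<Longrightarrow> s < B \<Longrightarrow> p s > 0" and B: "B > 0"
  shows "\<exists>T. \<forall>s. 0 < s \<longrightarrow> s < B \<longrightarrow> (T has_real_derivative - (1 / p s)) (at s)"
proof (intro exI allI impI)
  fix s assume s: "0 < s" "s < B"
  have cont1: "continuous_on {0<..<B} (\<lambda>y. 1 / p y)"
    using pos by (intro continuous_intros cont) force
  define a where "a = min s (B / 2) / 2"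
  define b where "b = (max s (B / 2) + B) / 2"
  have ab: "0 < a" "a < s" "a < B / 2" "s < b" "B / 2 < b" "b < B" using s by (auto simp: a_def b_def)
  have "continuous_on {a..b} (\<lambda>y. 1 / p y)" by (rule continuous_on_subset[OF cont1]) (use ab in auto)
  then show "((\<lambda>s. - (LBINT y=ereal (B / 2)..ereal s. 1 / p y)) has_real_derivative - (1 / p s)) (at s)"
    using ab by (intro DERIV_minus interval_integral_has_derivative[of a b]) auto
qed

text \<open>Separation of variables: \<open>W\<close> inverts \<open>T\<close>. The linear bound on
  \<open>p\<close> makes \<open>T\<close> grow at least like \<open>- ln s / L\<close> near zero, so
  \<open>W\<close> reaches zero at no finite time and exists for all positive times.\<close>

lemma profile_exists:
  fixes p :: "real \<Rightarrow> real"
  assumes \<beta>: "0 < \<beta>" "\<beta> < B"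
    and pos: "\<And>s. 0 < s \<Longrightarrow> s < B \<Longrightarrow> p s > 0" and lin: "\<And>s. 0 < s \<Longrightarrow> s < B \<Longrightarrow> p s \<le> L * s" and L: "L > 0"
    and T1': "\<And>s. 0 < s \<Longrightarrow> s < B \<Longrightarrow> (T1 has_real_derivative - (1 / p s)) (at s)"
  obtains W t0 where "t0 < 0" "W 0 = \<beta>" "\<And>t. t > t0 \<Longrightarrow> 0 < W t \<and> W t < B"
    "\<And>t. t > t0 \<Longrightarrow> (W has_real_derivative - p (W t)) (at t)"
    "\<And>t. t > t0 \<Longrightarrow> T1 (W t) = T1 \<beta> + t"
proof -
  define T where "T s = T1 s - T1 \<beta>" for s
  have T': "(T has_real_derivative - (1 / p s)) (at s)" if s: "0 < s" "s < B" for s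
    using DERIV_diff[OF T1'[OF s] DERIV_const[of "T1 \<beta>"]] by (simp add: T_def[abs_def])
  have T\<beta>: "T \<beta> = 0" by (simp add: T_def)
  have dec: "T s > T s'" if "0 < s" "s < s'" "s' < B" for s s'
  proof (rule DERIV_neg_imp_decreasing[OF that(2)])
    fix x assume "s \<le> x" "x \<le> s'"
    then have "0 < x" "x < B" using that by auto
    then show "\<exists>y. (T has_real_derivative y) (at x) \<and> y < 0"
      using T' pos by (intro exI[of _ "- (1 / p x)"]) auto
  qed
  \<comment> \<open>Starting above \<open>\<beta>\<close> gives the profile a past up to the
    negative time \<open>T b\<close>, so that it has a two-sided derivative at time zero.\<close>
  define b where "b = (\<beta> + B) / 2"
  have b: "\<beta> < b" "b < B" "0 < b" using \<beta> by (auto simp: b_def)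
  define t0 where "t0 = T b"
  have t0: "t0 < 0" using dec[OF \<beta>(1) b(1,2)] by (simp add: t0_def T\<beta>)
  have low: "T s \<ge> (ln \<beta> - ln s) / L" if s: "0 < s" "s \<le> \<beta>" for s
  proof -
    have "(\<lambda>s. T s + ln s / L) \<beta> \<le> (\<lambda>s. T s + ln s / L) s"
    proof (rule DERIV_nonpos_imp_nonincreasing[OF s(2)])
      fix x assume "s \<le> x" "x \<le> \<beta>"
      then have x: "0 < x" "x < B" using s \<beta> by auto
      have "((\<lambda>s. T s + ln s / L) has_real_derivative - (1 / p x) + (1 / x) / L) (at x)"
        using x by (intro DERIV_add T' DERIV_cdivide DERIV_ln_divide)
      moreover have "- (1 / p x) + (1 / x) / L \<le> 0"
        using lin[OF x] pos[OF x] L x by (simp add: field_simps)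
      ultimately show "\<exists>y. ((\<lambda>s. T s + ln s / L) has_real_derivative y) (at x) \<and> y \<le> 0" by blast
    qed
    then show ?thesis by (simp add: T\<beta> diff_divide_distrib)
  qed
  have ex: "\<exists>s. 0 < s \<and> s < b \<and> T s = t" if t: "t > t0" for t
  proof -
    \<comment> \<open>Solves \<open>(ln \<beta> - ln s0) / L = max t 0\<close>, so the bound
      \<open>low\<close> gives \<open>t \<le> T s0\<close> and the intermediate value theorem
      applies on \<open>{s0..b}\<close>.\<close>
    define s0 where "s0 = \<beta> * exp (- (L * max t 0))"
    have s0: "0 < s0" "s0 \<le> \<beta>" using \<beta> L by (auto simp: s0_def mult_le_cancel_left1)
    have "ln s0 = ln \<beta> - L * max t 0" using \<beta> by (simp add: s0_def ln_mult)
    then have "t \<le> T s0" using low[OF s0] L by simp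
    moreover have "continuous_on {s0..b} T"
    proof (rule DERIV_continuous_on)
      fix s assume "s \<in> {s0..b}"
      then show "(T has_real_derivative - (1 / p s)) (at s within {s0..b})"
        using s0 b by (intro T'[THEN has_field_derivative_at_within]) auto
    qed
    ultimately obtain s where s: "s0 \<le> s" "s \<le> b" "T s = t"
      using IVT2'[of T b t s0] t s0 b by (auto simp: t0_def)
    then have "s \<noteq> b" using t by (auto simp: t0_def)
    then show ?thesis using s s0 by (intro exI[of _ s]) auto
  qed
  define W where "W t = (SOME s. 0 < s \<and> s < b \<and> T s = t)" for t
  have W: "0 < W t" "W t < b" "T (W t) = t" if "t > t0" for t
    using someI_ex[OF ex[OF that]] by (auto simp: W_def)
  have inj: "s = s'" if "0 < s" "s < B" "0 < s'" "s' < B" "T s = T s'" for s s'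
    using dec[of s s'] dec[of s' s] that by (cases s s' rule: linorder_cases) auto
  have WT: "W (T s) = s" if s: "0 < s" "s < b" for s
  proof -
    have "T s > t0" unfolding t0_def using dec s b by auto
    from W[OF this] show ?thesis using inj[of "W (T s)" s] s b by auto
  qed
  have W': "(W has_real_derivative - p (W t)) (at t)" if t: "t > t0" for t
  proof -
    note Wt = W[OF t]
    define d where "d = min (W t) (b - W t) / 2"
    have d: "0 < d" using Wt by (simp add: d_def)
    have "2 * d \<le> W t" "2 * d \<le> b - W t" by (auto simp: d_def)
    then have dd: "0 < z \<and> z < b" if "\<bar>z - W t\<bar> \<le> d" for z
      using that Wt abs_ge_self[of "z - W t"] abs_ge_minus_self[of "z - W t"] by (intro conjI; linarith)
    have WB: "W t < B" using Wt b by linarith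
    have "isCont W (T (W t))"
    proof (rule isCont_inverse_function[where f=T and g=W and x="W t", OF d])
      fix z assume "\<bar>z - W t\<bar> \<le> d"
      then show "W (T z) = z" "isCont T z" using dd[of z] WT T'[THEN DERIV_isCont] b by auto
    qed
    then have "isCont W t" using Wt by simp
    then have "(W has_real_derivative inverse (- (1 / p (W t)))) (at t)"
      using T'[OF Wt(1) WB] pos[OF Wt(1) WB] W(3) t
      by (intro DERIV_inverse_function[where f=T and a=t0 and b="t + 1"]) auto
    then show ?thesis by (simp add: inverse_eq_divide)
  qed
  have W0: "W 0 = \<beta>" using WT[of \<beta>] \<beta> b by (simp add: T\<beta>)
  show ?thesis
  proof (rule that)
    show "t0 < 0" by (rule t0)
    show "W 0 = \<beta>" by (rule W0)
    show "0 < W t \<and> W t < B" if "t > t0" for t using W(1,2)[OF that] b(2) by linarith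
    show "(W has_real_derivative - p (W t)) (at t)" if "t > t0" for t by (rule W'[OF that])
    show "T1 (W t) = T1 \<beta> + t" if "t > t0" for t using W(3)[OF that] by (simp add: T_def)
  qed
qed

section \<open>The nonlinearity, its primitive and the speeds of the profiles\<close>

locale nonlinearity =
  fixes f :: "real \<Rightarrow> real" and m :: real
  assumes f': "\<And>t. (f has_real_derivative deriv f t) (at t)" and m: "m > 0" and m_le: "\<And>t. m \<le> deriv f t"
    and cont_f': "continuous_on UNIV (deriv f)" and f0: "f 0 = 0"
begin

lemma f_diff_ge: "x \<le> y \<Longrightarrow> m * (y - x) \<le> f y - f x"
proof -
  assume "x \<le> y"
  then have "(\<lambda>t. f t - m * t) x \<le> (\<lambda>t. f t - m * t) y"
  proof (rule DERIV_nonneg_imp_nondecreasing)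
    fix t
    have "((\<lambda>t. f t - m * t) has_real_derivative deriv f t - m * 1) (at t)"
      by (intro DERIV_diff f' DERIV_cmult DERIV_ident)
    then show "\<exists>y. ((\<lambda>t. f t - m * t) has_real_derivative y) (at t) \<and> 0 \<le> y" using m_le[of t] by auto
  qed
  then show ?thesis by (simp add: algebra_simps)
qed

lemma strict_mono_f: "strict_mono f"
proof (rule strict_monoI)
  fix x y :: real assume "x < y"
  then have "0 < m * (y - x)" using m by simp
  then show "f x < f y" using f_diff_ge[of x y] \<open>x < y\<close> by linarith
qed

lemma f_ge: "0 \<le> s \<Longrightarrow> m * s \<le> f s"
  using f_diff_ge[of 0 s] f0 by simp

lemma f_nonneg: "0 \<le> s \<Longrightarrow> 0 \<le> f s"
  using f_ge[of s] mult_nonneg_nonneg[of m s] m by linarith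

lemma cont_f: "continuous_on S f"
  using DERIV_continuous_on[of S f "deriv f"] f' has_field_derivative_at_within by blast

lemma f_le_linear: "\<exists>L\<ge>m. \<forall>s. 0 \<le> s \<longrightarrow> s \<le> B \<longrightarrow> f s \<le> L * s"
proof (cases "B \<ge> 0")
  case False
  then show ?thesis by (intro exI[of _ m]) auto
next
  case True
  have "continuous_on {0..B} (deriv f)" using cont_f' continuous_on_subset by blast
  then obtain L where L: "\<And>t. t \<in> {0..B} \<Longrightarrow> deriv f t \<le> L"
    using continuous_attains_sup[of "{0..B}" "deriv f"] True by (metis compact_Icc atLeastAtMost_iff empty_iff order_refl)
  have "f s \<le> L * s" if "0 \<le> s" "s \<le> B" for s
  proof -
    have "(\<lambda>t. f t - L * t) 0 \<ge> (\<lambda>t. f t - L * t) s"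
    proof (rule DERIV_nonpos_imp_nonincreasing[OF that(1)])
      fix t assume "0 \<le> t" "t \<le> s"
      then have "deriv f t - L * 1 \<le> 0" using L[of t] that by auto
      moreover have "((\<lambda>t. f t - L * t) has_real_derivative deriv f t - L * 1) (at t)"
        by (intro DERIV_diff f' DERIV_cmult DERIV_ident)
      ultimately show "\<exists>y. ((\<lambda>t. f t - L * t) has_real_derivative y) (at t) \<and> y \<le> 0" by blast
    qed
    then show ?thesis using f0 by simp
  qed
  moreover have "m \<le> L" using L[of 0] m_le[of 0] True by auto
  ultimately show ?thesis by blast
qed

abbreviation "F \<equiv> primitive f"

lemma F_deriv: "(F has_real_derivative f t) (at t)"
  unfolding primitive_def[abs_def] zero_ereal_def
  by (rule interval_integral_has_derivative[of "- \<bar>t\<bar> - 1" "\<bar>t\<bar> + 1"]) (auto intro: cont_f)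

lemma F_0 [simp]: "F 0 = 0"
  by (simp add: primitive_def zero_ereal_def)

lemma F_ge: "0 \<le> s \<Longrightarrow> m * s\<^sup>2 / 2 \<le> F s"
proof -
  assume s: "0 \<le> s"
  have "(\<lambda>t. F t - m * t\<^sup>2 / 2) 0 \<le> (\<lambda>t. F t - m * t\<^sup>2 / 2) s"
  proof (rule DERIV_nonneg_imp_nondecreasing[OF s])
    fix t :: real assume "0 \<le> t"
    have "((\<lambda>t. F t - m * t\<^sup>2 / 2) has_real_derivative f t - m * t) (at t)"
      by (auto intro!: derivative_eq_intros F_deriv)
    then show "\<exists>y. ((\<lambda>t. F t - m * t\<^sup>2 / 2) has_real_derivative y) (at t) \<and> 0 \<le> y" using f_ge[OF \<open>0 \<le> t\<close>] by auto
  qed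
  then show ?thesis by simp
qed

lemma F_nonneg: "0 \<le> s \<Longrightarrow> 0 \<le> F s"
proof -
  assume s: "0 \<le> s"
  have "0 \<le> m * s\<^sup>2 / 2" using m by simp
  then show ?thesis using F_ge[OF s] by linarith
qed

lemma F_le:
  assumes L: "\<And>s. 0 \<le> s \<Longrightarrow> s \<le> B \<Longrightarrow> f s \<le> L * s" and s: "0 \<le> s" "s \<le> B"
  shows "F s \<le> L * s\<^sup>2 / 2"
proof -
  have "(\<lambda>t. F t - L * t\<^sup>2 / 2) 0 \<ge> (\<lambda>t. F t - L * t\<^sup>2 / 2) s"
  proof (rule DERIV_nonpos_imp_nonincreasing[OF s(1)])
    fix t :: real assume t: "0 \<le> t" "t \<le> s"
    have "((\<lambda>t. F t - L * t\<^sup>2 / 2) has_real_derivative f t - L * t) (at t)"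
      by (auto intro!: derivative_eq_intros F_deriv)
    then show "\<exists>y. ((\<lambda>t. F t - L * t\<^sup>2 / 2) has_real_derivative y) (at t) \<and> y \<le> 0" using L[of t] t s by auto
  qed
  then show ?thesis by simp
qed

text \<open>The speed of the decaying solution of \<open>W'' = f (W)\<close> as a function of its
  value: the energy identity is \<open>W'\<^sup>2 = 2 F (W)\<close>.\<close>

definition p0 :: "real \<Rightarrow> real" where "p0 s = sqrt (2 * F s)"
definition P0 :: "real \<Rightarrow> real" where "P0 s = (LBINT y=0..s. p0 y)"
text \<open>Inserting \<open>p = p0 - l \<kappa> p1\<close> into
  \<open>p p' + l \<kappa> p = f\<close> and comparing the terms of order \<open>l\<close> leaves
  \<open>(p0 p1)' = p0\<close>.\<close>

definition p1 :: "real \<Rightarrow> real" where "p1 s = P0 s / p0 s"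

lemma F_pos: "s > 0 \<Longrightarrow> F s > 0"
proof -
  assume s: "s > 0"
  then have "0 < m * s\<^sup>2 / 2" using m by simp
  then show ?thesis using F_ge[of s] s by linarith
qed

lemma p0_pos: "s > 0 \<Longrightarrow> p0 s > 0"
  by (simp add: p0_def F_pos)

lemma p0_sq: "s \<ge> 0 \<Longrightarrow> p0 s * p0 s = 2 * F s"
  using F_nonneg[of s] by (simp add: p0_def)

lemma p0_ge: "s \<ge> 0 \<Longrightarrow> sqrt m * s \<le> p0 s"
proof -
  assume s: "s \<ge> 0"
  have "sqrt (m * s\<^sup>2) \<le> sqrt (2 * F s)" using F_ge[OF s] by simp
  then show ?thesis using s by (simp add: p0_def real_sqrt_mult)
qed

lemma p0_le:
  assumes "\<And>s. 0 \<le> s \<Longrightarrow> s \<le> B \<Longrightarrow> f s \<le> L * s" "0 \<le> s" "s \<le> B"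
  shows "p0 s \<le> sqrt L * s"
proof -
  have "sqrt (2 * F s) \<le> sqrt (L * s\<^sup>2)" using F_le[OF assms] by simp
  then show ?thesis using assms(2) by (simp add: p0_def real_sqrt_mult)
qed

lemma p0_deriv: "s > 0 \<Longrightarrow> (p0 has_real_derivative f s / p0 s) (at s)"
  unfolding p0_def[abs_def] using F_pos[of s]
  by (auto intro!: derivative_eq_intros F_deriv simp: field_simps)

lemma cont_p0: "continuous_on S p0"
proof -
  have "continuous_on S F" using DERIV_continuous_on[of S F f] F_deriv has_field_derivative_at_within by blast
  then show ?thesis unfolding p0_def by (intro continuous_intros)
qed

lemma P0_deriv: "(P0 has_real_derivative p0 s) (at s)"
  unfolding P0_def[abs_def] zero_ereal_def
  by (rule interval_integral_has_derivative[of "- \<bar>s\<bar> - 1" "\<bar>s\<bar> + 1"]) (auto intro: cont_p0)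

lemma P0_0 [simp]: "P0 0 = 0"
  by (simp add: P0_def zero_ereal_def)

lemma p0_mono: "0 < s \<Longrightarrow> s \<le> s' \<Longrightarrow> p0 s \<le> p0 s'"
proof (rule DERIV_nonneg_imp_nondecreasing[of s s' p0])
  fix x assume "0 < s" "s \<le> x"
  then have "x > 0" by simp
  then show "\<exists>y. (p0 has_real_derivative y) (at x) \<and> 0 \<le> y"
    using p0_deriv p0_pos[of x] f_nonneg[of x] by (intro exI[of _ "f x / p0 x"]) auto
qed

lemma P0_bounds: "s > 0 \<Longrightarrow> 0 \<le> P0 s \<and> P0 s \<le> s * p0 s"
proof -
  assume s: "s > 0"
  have "\<exists>z>0. z < s \<and> P0 s - P0 0 = (s - 0) * p0 z" by (rule MVT2[OF s]) (rule P0_deriv)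
  then obtain z where z: "0 < z" "z < s" "P0 s = s * p0 z" by auto
  then show ?thesis using p0_mono[of z s] p0_pos[of z] s by simp
qed

lemma p1_bounds: "s > 0 \<Longrightarrow> 0 \<le> p1 s \<and> p1 s \<le> s"
  using P0_bounds[of s] p0_pos[of s] by (simp add: p1_def divide_le_eq)

lemma p1_deriv: "s > 0 \<Longrightarrow> (p1 has_real_derivative 1 - p1 s * f s / (p0 s * p0 s)) (at s)"
proof -
  assume s: "s > 0"
  have "(p1 has_real_derivative (p0 s * p0 s - P0 s * (f s / p0 s)) / (p0 s * p0 s)) (at s)"
    unfolding p1_def[abs_def] using p0_pos[OF s] by (intro DERIV_divide P0_deriv p0_deriv s) auto
  moreover have "(p0 s * p0 s - P0 s * (f s / p0 s)) / (p0 s * p0 s) = 1 - p1 s * f s / (p0 s * p0 s)"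
    using p0_pos[OF s] by (simp add: p1_def field_simps)
  ultimately show ?thesis by simp
qed

text \<open>The quotient compares \<open>p1 s * f s\<close>, at most \<open>L * s\<^sup>2\<close>,
  with the square of \<open>p0 s\<close>, at least \<open>m * s\<^sup>2\<close>; the powers of
  \<open>s\<close> cancel, so the bound is uniform down to zero.\<close>

lemma p1_deriv_bound:
  assumes L: "\<And>s. 0 \<le> s \<Longrightarrow> s \<le> B \<Longrightarrow> f s \<le> L * s" and s: "0 < s" "s \<le> B"
  shows "\<bar>1 - p1 s * f s / (p0 s * p0 s)\<bar> \<le> 1 + L / m"
proof -
  have ms: "m * s\<^sup>2 \<le> p0 s * p0 s" using p0_sq[of s] F_ge[of s] s by simp
  have pos: "m * s\<^sup>2 > 0" using m s by simp
  have fs: "0 \<le> f s" using f_nonneg s by simp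
  have "p1 s * f s \<le> s * (L * s)" using p1_bounds[OF s(1)] L[of s] fs s by (intro mult_mono) auto
  moreover have "0 \<le> s * (L * s)" using L[of s] fs s by auto
  ultimately have "p1 s * f s / (p0 s * p0 s) \<le> s * (L * s) / (m * s\<^sup>2)"
    using ms pos by (intro frac_le) auto
  also have "\<dots> = L / m" using s m by (simp add: power2_eq_square)
  finally have "p1 s * f s / (p0 s * p0 s) \<le> L / m" .
  moreover have "0 \<le> p1 s * f s / (p0 s * p0 s)"
    using p1_bounds[OF s(1)] fs by simp
  ultimately show ?thesis by linarith
qed

text \<open>The first order profile: \<open>p = p0 - l \<kappa> p1\<close> solves \<open>p p' + l \<kappa> p = f\<close> up to order \<open>l\<^sup>2\<close>, so a
  shift of \<open>\<kappa>\<close> by \<open>\<sigma> \<delta>\<close> makes the error one-signed.\<close>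

lemma corrected_profile:
  assumes B: "B > 0" and \<delta>: "\<delta> > 0" and \<sigma>: "\<sigma> = 1 \<or> \<sigma> = -1"
  shows "\<exists>l0>0. \<exists>L>0. \<forall>l. 0 < l \<longrightarrow> l < l0 \<longrightarrow> (\<forall>s. 0 < s \<longrightarrow> s < B \<longrightarrow>
    (let p = \<lambda>s. p0 s - l * \<kappa> * p1 s; p' = f s / p0 s - l * \<kappa> * (1 - p1 s * f s / (p0 s * p0 s)) in
      (p has_real_derivative p') (at s) \<and> p s > 0 \<and> p s \<le> L * s \<and> p s * p' \<ge> 0 \<and>
      \<sigma> * (p s * p' + l * (\<kappa> - \<sigma> * \<delta>) * p s - f s) \<le> 0))"
proof -
  obtain L where L: "L \<ge> m" "\<And>s. 0 \<le> s \<Longrightarrow> s \<le> B \<Longrightarrow> f s \<le> L * s" using f_le_linear[of B] by blast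
  have Lpos: "L > 0" using L(1) m by linarith
  define D where "D = 1 + L / m"
  define K where "K = \<bar>\<kappa>\<bar> + 1"
  have D: "D > 0" using Lpos m by (simp add: D_def add_pos_pos)
  have K: "K > 0" by (simp add: K_def)
  define E where "E = K * (K + \<delta>) + K * K * D"
  have E: "E > 0" unfolding E_def using K D \<delta> by (intro add_pos_pos mult_pos_pos) auto
  \<comment> \<open>The three bounds keep \<open>p\<close> positive, keep its derivative
    nonnegative, and let the shift by \<delta> dominate the remainder of order
    \<open>l\<^sup>2\<close>.\<close>
  define l0 where "l0 = min (sqrt m / K) (min (m / (sqrt L * (K * D))) (\<delta> * sqrt m / E))"
  have l0: "l0 > 0" unfolding l0_def using m K D E Lpos \<delta> by simp
  show ?thesis
  proof (rule exI[of _ l0], rule conjI[OF l0], rule exI[of _ "sqrt L + l0 * K"], intro conjI allI impI)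
    show "sqrt L + l0 * K > 0" using Lpos l0 K by (simp add: add_pos_nonneg)
    fix l s assume l: "0 < l" "l < l0" and s: "0 < s" "s < B"
    define d where "d = 1 - p1 s * f s / (p0 s * p0 s)"
    have l1: "l * K < sqrt m" using l K by (simp add: l0_def field_simps)
    have l2: "l * (K * D) * sqrt L < m" using l K D Lpos by (simp add: l0_def field_simps)
    have l3: "l * E < \<delta> * sqrt m" using l E by (simp add: l0_def field_simps)
    have d: "\<bar>d\<bar> \<le> D" unfolding d_def D_def by (rule p1_deriv_bound[OF L(2)]) (use s in auto)
    have q0: "p0 s > 0" "sqrt m * s \<le> p0 s" "p0 s \<le> sqrt L * s"
      using p0_pos p0_ge[of s] p0_le[OF L(2), of s] s by auto
    have q1: "0 \<le> p1 s" "p1 s \<le> s" using p1_bounds s by auto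
    have \<kappa>: "\<bar>\<kappa>\<bar> \<le> K" by (simp add: K_def)
    have lp1: "\<bar>l * \<kappa> * p1 s\<bar> \<le> l * K * s"
      unfolding abs_mult using l \<kappa> q1 by (intro mult_mono) auto
    have "l * K * s < sqrt m * s" using l1 s by simp
    then have ppos: "p0 s - l * \<kappa> * p1 s > 0" using lp1 q0(2) by linarith
    have pder: "((\<lambda>s. p0 s - l * \<kappa> * p1 s) has_real_derivative f s / p0 s - l * \<kappa> * d) (at s)"
      unfolding d_def by (intro DERIV_diff DERIV_cmult p0_deriv p1_deriv s)
    have fs: "m * s \<le> f s" using f_ge[of s] s by simp
    have "m / sqrt L \<le> f s / p0 s"
    proof -
      have "m * p0 s \<le> f s * sqrt L"
      proof -
        have "m * p0 s \<le> m * (sqrt L * s)" using q0(3) m by (intro mult_left_mono) auto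
        also have "\<dots> = m * s * sqrt L" by simp
        also have "\<dots> \<le> f s * sqrt L" using fs Lpos by (intro mult_right_mono) auto
        finally show ?thesis .
      qed
      then show ?thesis using q0(1) Lpos by (simp add: field_simps)
    qed
    moreover have "\<bar>l * \<kappa> * d\<bar> \<le> l * (K * D)"
      unfolding abs_mult mult.assoc using l \<kappa> d D by (intro mult_mono) auto
    moreover have "l * (K * D) < m / sqrt L" using l2 Lpos by (simp add: field_simps)
    ultimately have p'pos: "f s / p0 s - l * \<kappa> * d \<ge> 0" by linarith
    have "p0 s - l * \<kappa> * p1 s \<le> sqrt L * s + l0 * K * s"
    proof -
      have "l * K * s \<le> l0 * K * s" using l K s by simp
      then show ?thesis using lp1 q0(3) by linarith
    qed
    then have plin: "p0 s - l * \<kappa> * p1 s \<le> (sqrt L + l0 * K) * s" by (simp add: algebra_simps)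
    \<comment> \<open>By the formula for \<open>d\<close> all terms of order \<open>l\<close> cancel
      except the one from the shift; the rest carries \<open>l\<^sup>2 * p1 s\<close>, and both
      \<open>p1 s\<close> and \<open>p0 s\<close> are comparable with or bounded by multiples of
      \<open>s\<close>.\<close>
    have expand: "(p0 s - l * \<kappa> * p1 s) * (f s / p0 s - l * \<kappa> * d) + l * (\<kappa> - \<sigma> * \<delta>) * (p0 s - l * \<kappa> * p1 s) - f s
       = - (l * \<sigma> * \<delta> * p0 s) - l * l * \<kappa> * (\<kappa> - \<sigma> * \<delta>) * p1 s + l * l * \<kappa> * \<kappa> * d * p1 s"
      using q0(1) unfolding d_def by (simp add: field_simps)
    have \<sigma>1: "\<bar>\<sigma>\<bar> = 1" using \<sigma> by auto
    have "\<sigma> * ((p0 s - l * \<kappa> * p1 s) * (f s / p0 s - l * \<kappa> * d) + l * (\<kappa> - \<sigma> * \<delta>) * (p0 s - l * \<kappa> * p1 s) - f s)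
       = - (l * \<delta> * p0 s) + \<sigma> * (l * l * (\<kappa> * \<kappa> * d - \<kappa> * (\<kappa> - \<sigma> * \<delta>)) * p1 s)"
      unfolding expand using \<sigma> by (auto simp: algebra_simps)
    also have "\<dots> \<le> - (l * \<delta> * p0 s) + l * l * E * s"
    proof -
      have "\<bar>\<kappa> * \<kappa> * d - \<kappa> * (\<kappa> - \<sigma> * \<delta>)\<bar> \<le> \<bar>\<kappa> * \<kappa> * d\<bar> + \<bar>\<kappa> * (\<kappa> - \<sigma> * \<delta>)\<bar>" by (rule abs_triangle_ineq4)
      also have "\<bar>\<kappa> * \<kappa> * d\<bar> \<le> K * K * D" unfolding abs_mult using \<kappa> d K by (intro mult_mono) auto
      also have "\<bar>\<kappa> * (\<kappa> - \<sigma> * \<delta>)\<bar> \<le> K * (K + \<delta>)"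
        unfolding abs_mult
      proof (rule mult_mono)
        have "\<bar>\<sigma> * \<delta>\<bar> = \<delta>" using \<sigma>1 \<delta> by (simp add: abs_mult)
        then show "\<bar>\<kappa> - \<sigma> * \<delta>\<bar> \<le> K + \<delta>" using \<kappa> by linarith
      qed (use \<kappa> K in auto)
      finally have "\<bar>\<kappa> * \<kappa> * d - \<kappa> * (\<kappa> - \<sigma> * \<delta>)\<bar> \<le> E" unfolding E_def by linarith
      then have "\<bar>\<sigma> * (l * l * (\<kappa> * \<kappa> * d - \<kappa> * (\<kappa> - \<sigma> * \<delta>)) * p1 s)\<bar> \<le> l * l * E * s"
        unfolding abs_mult \<sigma>1 using l q1 E by (auto intro!: mult_mono)
      then show ?thesis by linarith
    qed
    also have "\<dots> \<le> 0"
    proof -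
      have "l * (l * E) * s \<le> l * (\<delta> * sqrt m) * s" using l l3 s by (intro mult_right_mono mult_left_mono) auto
      also have "\<dots> = l * \<delta> * (sqrt m * s)" by simp
      also have "\<dots> \<le> l * \<delta> * p0 s" using q0(2) l \<delta> by (intro mult_left_mono) auto
      finally show ?thesis by (simp add: mult.assoc)
    qed
    finally have "\<sigma> * ((p0 s - l * \<kappa> * p1 s) * (f s / p0 s - l * \<kappa> * d) + l * (\<kappa> - \<sigma> * \<delta>) * (p0 s - l * \<kappa> * p1 s) - f s) \<le> 0" .
    then show "let p = \<lambda>s. p0 s - l * \<kappa> * p1 s; p' = f s / p0 s - l * \<kappa> * (1 - p1 s * f s / (p0 s * p0 s)) in
      (p has_real_derivative p') (at s) \<and> p s > 0 \<and> p s \<le> (sqrt L + l0 * K) * s \<and> p s * p' \<ge> 0 \<and>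
      \<sigma> * (p s * p' + l * (\<kappa> - \<sigma> * \<delta>) * p s - f s) \<le> 0"
      unfolding Let_def d_def[symmetric]
      using pder ppos plin p'pos by (auto intro!: mult_nonneg_nonneg)
  qed
qed

end

section \<open>Barriers for the boundary value problem\<close>

lemma grad_norm_square: "grad (\<lambda>x. (norm (x - z))\<^sup>2) x = 2 *\<^sub>R (x - z)"
proof (rule grad_eqI)
  have "((\<lambda>y. (norm (y - z))\<^sup>2) has_derivative (\<lambda>h. (x - z) \<bullet> (h - 0) + (h - 0) \<bullet> (x - z))) (at x)"
    unfolding power2_norm_eq_inner
    by (intro has_derivative_inner has_derivative_diff has_derivative_ident has_derivative_const)
  then show "((\<lambda>x. (norm (x - z))\<^sup>2) has_derivative (\<lambda>v. (2 *\<^sub>R (x - z)) \<bullet> v)) (at x)"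
    by (rule has_derivative_eq_rhs) (simp add: fun_eq_iff inner_commute)
qed

lemma holder_on_continuous:
  assumes "holder_on \<alpha> h S" "\<alpha> > 0"
  shows "continuous_on S h"
proof -
  obtain C where C: "\<And>x y. x \<in> S \<Longrightarrow> y \<in> S \<Longrightarrow> \<bar>h x - h y\<bar> \<le> C * dist x y powr \<alpha>"
    using assms(1) unfolding holder_on_def by blast
  show ?thesis
    unfolding continuous_on_def
  proof
    fix x assume x: "x \<in> S"
    have "((\<lambda>y. dist y x) \<longlongrightarrow> dist x x) (at x within S)" by (intro tendsto_intros)
    then have "((\<lambda>y. dist y x) \<longlongrightarrow> 0) (at x within S)" by simp
    then have "((\<lambda>y. dist y x powr \<alpha>) \<longlongrightarrow> 0) (at x within S)"
      using tendsto_powr'[of "\<lambda>y. dist y x" 0 "at x within S" "\<lambda>_. \<alpha>" \<alpha>] assms(2) by simp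
    then have z: "((\<lambda>y. C * dist y x powr \<alpha>) \<longlongrightarrow> 0) (at x within S)"
      using tendsto_mult_right_zero by blast
    have "((\<lambda>y. h y - h x) \<longlongrightarrow> 0) (at x within S)"
      by (rule Lim_null_comparison[OF _ z]) (use C[OF _ x] in \<open>auto simp: eventually_at_filter\<close>)
    then show "(h \<longlongrightarrow> h x) (at x within S)" by (simp add: LIM_zero_iff)
  qed
qed

section \<open>Normal derivatives of solutions at the boundary\<close>

context smooth_domain
begin

text \<open>The gradient extends continuously to the closure, so the derivative along the normal ray
  has a limit at the boundary point; the mean value theorem turns this limit into the one-sided
  derivative.\<close>

lemma normal_deriv_exists:
  assumes u: "C1_holder_closure \<alpha> u \<Omega>" "\<alpha> > 0" and x: "x \<in> frontier \<Omega>"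
  shows "((\<lambda>t. u (x + t *\<^sub>R outward_normal \<Omega> x)) has_vector_derivative normal_deriv \<Omega> u x) (at_left 0)"
proof -
  let ?n = "outward_normal \<Omega> x"
  let ?\<phi> = "\<lambda>t. u (x + t *\<^sub>R ?n)"
  have xc: "x \<in> closure \<Omega>" using x by (simp add: frontier_def)
  obtain h where h: "\<And>i y. i \<in> Basis \<Longrightarrow> y \<in> \<Omega> \<Longrightarrow> h i y = pd i u y" "\<And>i. i \<in> Basis \<Longrightarrow> holder_on \<alpha> (h i) (closure \<Omega>)"
    using u(1) unfolding C1_holder_closure_def by metis
  have du: "u differentiable at y" if "y \<in> \<Omega>" for y
    using u(1) Ck_on_differentiable[of 0 u \<Omega> y] open_\<Omega> that by (simp add: C1_holder_closure_def)
  obtain d where d: "d < 0" "\<And>t. d < t \<Longrightarrow> t < 0 \<Longrightarrow> x + t *\<^sub>R ?n \<in> \<Omega>"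
    using eventually_inside_normal[OF open_\<Omega> smooth_\<Omega> x] unfolding eventually_at_left_field by blast
  have \<phi>': "(?\<phi> has_real_derivative grad u (x + t *\<^sub>R ?n) \<bullet> ?n) (at t)" if "d < t" "t < 0" for t
    by (rule has_derivative_along_line[OF du[OF d(2)[OF that]]])
  define D where "D = (\<Sum>i\<in>Basis. (?n \<bullet> i) * h i x)"
  have ray: "((\<lambda>t. x + t *\<^sub>R ?n) \<longlongrightarrow> x) (at_left 0)"
  proof -
    have "((\<lambda>t. x + t *\<^sub>R ?n) \<longlongrightarrow> x + 0 *\<^sub>R ?n) (at_left 0)" by (intro tendsto_intros)
    then show ?thesis by simp
  qed
  have inside: "\<forall>\<^sub>F t in at_left 0. x + t *\<^sub>R ?n \<in> \<Omega>"
    by (rule eventually_inside_normal[OF open_\<Omega> smooth_\<Omega> x])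
  have ray_lim: "((\<lambda>t. g (x + t *\<^sub>R ?n)) \<longlongrightarrow> g x) (at_left 0)" if g: "continuous_on (closure \<Omega>) g" for g :: "'a \<Rightarrow> real"
    by (rule continuous_on_tendsto_compose[OF g ray xc])
      (use inside in eventually_elim, use closure_subset in blast)
  have hl: "((\<lambda>t. h i (x + t *\<^sub>R ?n)) \<longlongrightarrow> h i x) (at_left 0)" if "i \<in> Basis" for i
    by (rule ray_lim[OF holder_on_continuous[OF h(2)[OF that] u(2)]])
  have "((\<lambda>t. \<Sum>i\<in>Basis. (?n \<bullet> i) * h i (x + t *\<^sub>R ?n)) \<longlongrightarrow> D) (at_left 0)"
    unfolding D_def by (intro tendsto_sum tendsto_mult tendsto_const hl)
  then have gl: "((\<lambda>t. grad u (x + t *\<^sub>R ?n) \<bullet> ?n) \<longlongrightarrow> D) (at_left 0)"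
  proof (rule Lim_transform_eventually)
    show "\<forall>\<^sub>F t in at_left 0. (\<Sum>i\<in>Basis. (?n \<bullet> i) * h i (x + t *\<^sub>R ?n)) = grad u (x + t *\<^sub>R ?n) \<bullet> ?n"
      using inside by eventually_elim (simp add: grad_inner h(1))
  qed
  have \<phi>0: "(?\<phi> \<longlongrightarrow> u x) (at_left 0)"
    using u(1) by (intro ray_lim) (simp add: C1_holder_closure_def)
  have "((\<lambda>t. (?\<phi> t - ?\<phi> 0) / (t - 0)) \<longlongrightarrow> D) (at_left 0)"
  proof (rule tendstoI)
    fix \<epsilon> :: real assume "\<epsilon> > 0"
    then have "\<forall>\<^sub>F t in at_left 0. dist (grad u (x + t *\<^sub>R ?n) \<bullet> ?n) D < \<epsilon>" using tendstoD[OF gl] by blast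
    then obtain b where b: "b < 0" "\<And>t. b < t \<Longrightarrow> t < 0 \<Longrightarrow> dist (grad u (x + t *\<^sub>R ?n) \<bullet> ?n) D < \<epsilon>"
      unfolding eventually_at_left_field by blast
    show "\<forall>\<^sub>F t in at_left 0. dist ((?\<phi> t - ?\<phi> 0) / (t - 0)) D < \<epsilon>"
      unfolding eventually_at_left_field
    proof (intro exI[of _ "max b d"] conjI allI impI)
      show "max b d < 0" using b d by simp
      fix t assume t: "max b d < t" "t < 0"
      have "continuous_on {t..0} ?\<phi>"
      proof (rule continuous_on_IccI)
        show "(?\<phi> \<longlongrightarrow> ?\<phi> t) (at_right t)"
          using DERIV_isCont[OF \<phi>'[of t]] t by (simp add: isCont_def filterlim_at_split)
        show "(?\<phi> \<longlongrightarrow> ?\<phi> 0) (at_left 0)" using \<phi>0 by simp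
        show "?\<phi> \<midarrow>s\<rightarrow> ?\<phi> s" if "t < s" "s < 0" for s
          using DERIV_isCont[OF \<phi>'[of s]] t that by (simp add: isCont_def)
      qed (use t in auto)
      moreover have "\<And>s. t < s \<Longrightarrow> s < 0 \<Longrightarrow> ?\<phi> differentiable (at s)"
        using \<phi>' t unfolding real_differentiable_def by (meson max_less_iff_conj order.strict_trans)
      ultimately obtain l s where s: "t < s" "s < 0" "(?\<phi> has_real_derivative l) (at s)" "?\<phi> 0 - ?\<phi> t = (0 - t) * l"
        using MVT[OF t(2), of ?\<phi>] by blast
      have "l = grad u (x + s *\<^sub>R ?n) \<bullet> ?n"
        using DERIV_unique[OF s(3) \<phi>'[of s]] s t by simp
      moreover have "(?\<phi> t - ?\<phi> 0) / (t - 0) = l" using s(4) t by (simp add: field_simps)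
      ultimately show "dist ((?\<phi> t - ?\<phi> 0) / (t - 0)) D < \<epsilon>" using b(2)[of s] s t by simp
    qed
  qed
  then have "(?\<phi> has_vector_derivative D) (at_left 0)"
    by (simp add: has_real_derivative_iff_has_vector_derivative[symmetric] has_field_derivative_iff)
  then show ?thesis
    using vector_derivative_within[of 0 "{..<0}" ?\<phi> D] by (simp add: normal_deriv_def trivial_limit_at_left_real)
qed

text \<open>The problem with the nonlocal coefficient frozen to the constant \<open>c\<close>, with
  just the regularity used in comparisons; the one-sided derivative is required to exist because
  \<open>normal_deriv\<close> alone does not say so.\<close>

definition solves :: "real \<Rightarrow> real \<Rightarrow> (real \<Rightarrow> real) \<Rightarrow> real \<Rightarrow> ('a \<Rightarrow> real) \<Rightarrow> bool" where
  "solves c k f b0 u \<longleftrightarrow> diff2_on u \<Omega> \<and> continuous_on (closure \<Omega>) u \<and> (\<forall>x\<in>\<Omega>. c * laplacian u x = f (u x)) \<and>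
     (\<forall>x\<in>frontier \<Omega>. ((\<lambda>t. u (x + t *\<^sub>R outward_normal \<Omega> x)) has_vector_derivative normal_deriv \<Omega> u x) (at_left 0) \<and>
        u x + k * normal_deriv \<Omega> u x = b0)"

lemma bvp_solution_solves:
  assumes "bvp_solution \<Omega> A q f \<gamma> b0 \<epsilon> u"
  shows "solves (\<epsilon>\<^sup>2 * A (average \<Omega> (\<lambda>y. q (u y)))) (\<epsilon> * \<gamma>) f b0 u"
proof -
  obtain \<alpha> where \<alpha>: "0 < \<alpha>" "C2_holder \<alpha> u \<Omega>" "C1_holder_closure \<alpha> u \<Omega>"
    using assms by (auto simp: bvp_solution_def)
  show ?thesis
    using assms \<alpha> normal_deriv_exists[OF \<alpha>(3,1)] Ck_on_2_diff2_on[OF _ open_\<Omega>]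
    by (simp add: solves_def bvp_solution_def C2_holder_def C1_holder_closure_def)
qed

lemma closure_cases: "x \<in> closure \<Omega> \<Longrightarrow> x \<in> \<Omega> \<or> x \<in> frontier \<Omega>"
  using open_\<Omega> by (auto simp: frontier_def interior_open)

end

locale reaction_domain = smooth_domain \<Omega> + nonlinearity f m for \<Omega> :: "'a::euclidean_space set" and f m
begin

text \<open>Comparison with the constants zero and \<open>b0\<close> in a ball containing the
  closure of \<open>\<Omega>\<close>, where the condition on the sphere is void.\<close>

lemma solves_bounds:
  assumes u: "solves c k f b0 u" and c: "c > 0" and k: "k \<ge> 0" and b0: "b0 \<ge> 0" and x: "x \<in> closure \<Omega>"
  shows "0 \<le> u x" "u x \<le> b0"
proof -
  have "bounded (closure \<Omega>)" using bounded_\<Omega> by (rule bounded_closure)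
  then obtain R where R: "closure \<Omega> \<subseteq> ball 0 R" using bounded_subset_ballD by blast
  have sph: "closure \<Omega> \<inter> sphere 0 R = {}" using R by auto
  have xR: "x \<in> closure \<Omega> \<inter> cball 0 R" using x R by auto
  have du: "diff2_on u (\<Omega> \<inter> ball 0 R)" using u by (auto simp: solves_def intro: diff2_on_subset)
  have cu: "continuous_on (closure \<Omega> \<inter> cball 0 R) u" using u by (auto simp: solves_def intro: continuous_on_subset)
  show "0 \<le> u x"
  proof (rule comparison_principle[OF open_\<Omega> smooth_\<Omega> strict_mono_f c k _ cu _ du _ _ _ _ xR, where v="\<lambda>x. 0"])
    show "f 0 \<le> c * laplacian (\<lambda>x. 0) y" for y :: 'a using f0 by simp
    show "c * laplacian u y \<le> f (u y)" if "y \<in> \<Omega> \<inter> ball 0 R" for y using u that by (simp add: solves_def)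
    show "\<exists>a b. ((\<lambda>t. 0) has_vector_derivative a) (at_left 0) \<and>
      ((\<lambda>t. u (y + t *\<^sub>R outward_normal \<Omega> y)) has_vector_derivative b) (at_left 0) \<and> 0 + k * a \<le> u y + k * b"
      if "y \<in> frontier \<Omega> \<inter> ball 0 R" for y
      by (rule exI[of _ 0], rule exI[of _ "normal_deriv \<Omega> u y"]) (use u that b0 in \<open>auto simp: solves_def\<close>)
  qed (use sph in auto)
  show "u x \<le> b0"
  proof (rule comparison_principle[OF open_\<Omega> smooth_\<Omega> strict_mono_f c k cu _ du _ _ _ _ _ xR, where w="\<lambda>x. b0"])
    have "f b0 \<ge> 0" by (rule f_nonneg[OF b0])
    then show "c * laplacian (\<lambda>x. b0) y \<le> f b0" for y :: 'a by simp
    show "f (u y) \<le> c * laplacian u y" if "y \<in> \<Omega> \<inter> ball 0 R" for y using u that by (simp add: solves_def)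
    show "\<exists>a b. ((\<lambda>t. u (y + t *\<^sub>R outward_normal \<Omega> y)) has_vector_derivative a) (at_left 0) \<and>
      ((\<lambda>t. b0) has_vector_derivative b) (at_left 0) \<and> u y + k * a \<le> b0 + k * b"
      if "y \<in> frontier \<Omega> \<inter> ball 0 R" for y
      by (rule exI[of _ "normal_deriv \<Omega> u y"], rule exI[of _ 0]) (use u that b0 in \<open>auto simp: solves_def\<close>)
  qed (use sph in auto)
qed

text \<open>A ball that misses the frontier is connected, hence lies in \<open>\<Omega>\<close> once
  its centre does.\<close>

lemma ball_infdist_subset:
  assumes "x \<in> \<Omega>"
  shows "ball x (infdist x (frontier \<Omega>)) \<subseteq> \<Omega>"
proof -
  let ?B = "ball x (infdist x (frontier \<Omega>))"
  have "?B \<inter> frontier \<Omega> = {}" using infdist_le[of _ "frontier \<Omega>" x] by force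
  moreover have "x \<in> ?B \<or> ?B = {}" using infdist_nonneg[of x "frontier \<Omega>"] by auto
  ultimately show ?thesis using connected_Int_frontier[of ?B \<Omega>] assms connected_ball[of x] by blast
qed

text \<open>By comparison with \<open>exp (\<mu> (\<bar>y - x\<bar>\<^sup>2 - d\<^sup>2) / (d l))\<close> on the largest ball around \<open>x\<close>.\<close>

lemma solves_decay:
  assumes b0: "b0 \<ge> 0"
  obtains C \<mu> where "\<mu> > 0" "C \<ge> 0"
    "\<And>l k u x. solves (l\<^sup>2) k f b0 u \<Longrightarrow> l > 0 \<Longrightarrow> k \<ge> 0 \<Longrightarrow> x \<in> \<Omega> \<Longrightarrow> u x \<le> C * exp (- (\<mu> * infdist x (frontier \<Omega>) / l))"
proof -
  define N where "N = real DIM('a)"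
  have N: "N \<ge> 0" by (simp add: N_def)
  \<comment> \<open>Chosen for \<open>4 * \<mu>\<^sup>2 + 2 * N * \<mu> \<le> m\<close>: this is the
    supersolution inequality of the exponential on a ball of radius at least
    \<open>l\<close>.\<close>
  define \<mu> where "\<mu> = min 1 (m / (4 + 2 * N))"
  have \<mu>: "\<mu> > 0" "\<mu> \<le> 1" using m N by (auto simp: \<mu>_def)
  have "\<mu> \<le> m / (4 + 2 * N)" by (simp add: \<mu>_def)
  then have "\<mu> * (4 + 2 * N) \<le> m" using N by (simp add: pos_le_divide_eq)
  moreover have "4 * \<mu>\<^sup>2 \<le> 4 * \<mu>" using \<mu> by (simp add: power2_eq_square mult_left_le)
  ultimately have \<mu>m: "4 * \<mu>\<^sup>2 + 2 * N * \<mu> \<le> m" by (simp add: algebra_simps)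
  show ?thesis
  proof (rule that[of \<mu> "b0 * exp \<mu>"])
    fix l k u x
    assume u: "solves (l\<^sup>2) k f b0 u" and l: "l > (0::real)" and k: "k \<ge> 0" and x: "x \<in> \<Omega>"
    define d where "d = infdist x (frontier \<Omega>)"
    have xc: "x \<in> closure \<Omega>" using x closure_subset by blast
    have l2: "l\<^sup>2 > 0" using l by simp
    have "u x \<le> b0 * exp (\<mu> - \<mu> * d / l)"
    \<comment> \<open>Closer than \<open>l\<close> to the boundary the factor
      \<open>exp \<mu>\<close> makes the claim weaker than \<open>u x \<le> b0\<close>; farther away
      \<open>l / d \<le> 1\<close> controls the first-order term of the Laplacian.\<close>
    proof (cases "d < l")
      case True
      then have "\<mu> * d / l \<le> \<mu>" using \<mu> l by (simp add: field_simps)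
      then have "b0 * 1 \<le> b0 * exp (\<mu> - \<mu> * d / l)" using b0 by (intro mult_left_mono) auto
      then show ?thesis using solves_bounds(2)[OF u l2 k b0 xc] by simp
    next
      case False
      then have d: "l \<le> d" "d > 0" using l by auto
      define \<theta> where "\<theta> = \<mu> / (d * l)"
      have \<theta>: "\<theta> > 0" using \<mu> d l by (simp add: \<theta>_def)
      let ?s = "\<lambda>y. (norm (y - x))\<^sup>2"
      define W where "W t = b0 * exp (\<theta> * (t - d\<^sup>2))" for t
      have W': "(W has_real_derivative \<theta> * W t) (at t)" for t
        unfolding W_def[abs_def] by (auto intro!: derivative_eq_intros)
      have W'': "((\<lambda>t. \<theta> * W t) has_real_derivative \<theta> * (\<theta> * W t)) (at t)" for t
        by (intro DERIV_cmult W')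
      have W0: "W t \<ge> 0" for t using b0 by (simp add: W_def)
      have sub: "ball x d \<subseteq> \<Omega>" unfolding d_def by (rule ball_infdist_subset[OF x])
      have ds: "diff2_on ?s (\<Omega> \<inter> ball x d)" by (rule smooth_diff2_on[OF laplacian_norm_square(1)])
      have op: "open (\<Omega> \<inter> ball x d)" using open_\<Omega> by blast
      note dW = diff2_on_compose[where W=W and W'="\<lambda>t. \<theta> * W t" and W''="\<lambda>t. \<theta> * (\<theta> * W t)", OF op ds W' W'']
      have "u x \<le> W (?s x)"
      proof (rule comparison_principle[OF open_\<Omega> smooth_\<Omega> strict_mono_f l2 k _ _ _ dW(1)])
        show "continuous_on (closure \<Omega> \<inter> cball x d) u" using u by (auto simp: solves_def intro: continuous_on_subset)
        show "continuous_on (closure \<Omega> \<inter> cball x d) (\<lambda>y. W (?s y))" unfolding W_def by (intro continuous_intros)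
        show "diff2_on u (\<Omega> \<inter> ball x d)" using u by (auto simp: solves_def intro: diff2_on_subset)
        show "f (u y) \<le> l\<^sup>2 * laplacian u y" if "y \<in> \<Omega> \<inter> ball x d" for y using u that by (simp add: solves_def)
        show "l\<^sup>2 * laplacian (\<lambda>y. W (?s y)) y \<le> f (W (?s y))" if y: "y \<in> \<Omega> \<inter> ball x d" for y
        proof -
          let ?W = "W (?s y)"
          have "gdot ?s ?s y = 4 * ?s y"
            by (simp only: gdot_eq_inner grad_norm_square) (simp add: power2_norm_eq_inner)
          then have e: "laplacian (\<lambda>y. W (?s y)) y = \<theta> * (\<theta> * ?W) * (4 * ?s y) + \<theta> * ?W * (2 * N)"
            using dW(2)[OF y] by (simp add: laplacian_norm_square(2) N_def)
          have "norm (y - x) \<le> d" using y by (simp add: dist_norm norm_minus_commute)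
          then have "?s y \<le> d\<^sup>2" by (intro power_mono) auto
          then have "laplacian (\<lambda>y. W (?s y)) y \<le> \<theta> * (\<theta> * ?W) * (4 * d\<^sup>2) + \<theta> * ?W * (2 * N)"
            unfolding e using \<theta> W0 by (intro add_right_mono mult_left_mono) auto
          then have "l\<^sup>2 * laplacian (\<lambda>y. W (?s y)) y \<le> l\<^sup>2 * (\<theta> * (\<theta> * ?W) * (4 * d\<^sup>2) + \<theta> * ?W * (2 * N))"
            by (intro mult_left_mono) auto
          also have "\<dots> = (4 * \<mu>\<^sup>2 + 2 * N * \<mu> * (l / d)) * ?W"
            using l d by (simp add: \<theta>_def field_simps power2_eq_square)
          also have "\<dots> \<le> m * ?W"
          proof (rule mult_right_mono[OF _ W0])
            have "2 * N * \<mu> * (l / d) \<le> 2 * N * \<mu> * 1" using N \<mu> d l by (intro mult_left_mono) auto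
            then show "4 * \<mu>\<^sup>2 + 2 * N * \<mu> * (l / d) \<le> m" using \<mu>m by linarith
          qed
          also have "\<dots> \<le> f ?W" by (rule f_ge[OF W0])
          finally show ?thesis .
        qed
        show "u y \<le> W (?s y)" if "y \<in> closure \<Omega> \<inter> sphere x d" for y
        proof -
          have "?s y = d\<^sup>2" using that by (simp add: dist_norm norm_minus_commute)
          then show ?thesis using solves_bounds(2)[OF u l2 k b0, of y] that by (simp add: W_def)
        qed
        show "x \<in> closure \<Omega> \<inter> cball x d" using xc d by simp
        fix y assume "y \<in> frontier \<Omega> \<inter> ball x d"
        then have False using sub open_\<Omega> by (auto simp: frontier_def interior_open)
        then show "\<exists>a b. ((\<lambda>t. u (y + t *\<^sub>R outward_normal \<Omega> y)) has_vector_derivative a) (at_left 0) \<and>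
          ((\<lambda>t. W (?s (y + t *\<^sub>R outward_normal \<Omega> y))) has_vector_derivative b) (at_left 0) \<and> u y + k * a \<le> W (?s y) + k * b" ..
      qed
      also have "W (?s x) = b0 * exp (- (\<mu> * d / l))" using d l by (simp add: W_def \<theta>_def power2_eq_square)
      also have "\<dots> \<le> b0 * exp (\<mu> - \<mu> * d / l)" using b0 \<mu> by (intro mult_left_mono) auto
      finally show ?thesis .
    qed
    then show "u x \<le> b0 * exp \<mu> * exp (- (\<mu> * infdist x (frontier \<Omega>) / l))"
      by (simp add: d_def exp_diff exp_minus divide_inverse mult.assoc)
  qed (use \<mu> b0 in auto)
qed

text \<open>The localising term \<open>M \<bar>x - z\<bar>\<^sup>2 / r\<^sup>2\<close> dominates the trivial bound on the sphere, and costs only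
  \<open>O(l\<^sup>2)\<close> in the equation and \<open>O(k\<^sup>2)\<close> in the boundary condition.\<close>

lemma barrier:
  fixes z :: 'a and N :: real
  defines "N \<equiv> real DIM('a)"
  assumes u: "solves (l\<^sup>2) k f b0 u" and l: "l > 0" and k: "k \<ge> 0" and b0: "b0 \<ge> 0" and \<sigma>: "\<sigma> = 1 \<or> \<sigma> = -1"
    and \<rho>: "defining_function \<Omega> V \<sigma> \<rho>" and z: "z \<in> frontier \<Omega>" and r: "r > 0" "cball z r \<subseteq> V"
    and \<kappa>: "\<And>x. x \<in> ball z r \<Longrightarrow> - \<sigma> * laplacian \<rho> x \<le> \<sigma> * \<kappa>"
    and t0: "t0 < 0" and W': "\<And>t. t > t0 \<Longrightarrow> (W has_real_derivative - p (W t)) (at t)"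
    and WM: "\<And>t. t \<ge> 0 \<Longrightarrow> 0 < W t \<and> W t \<le> M" and M: "b0 \<le> M"
    and p': "\<And>t. t > 0 \<Longrightarrow> (p has_real_derivative p' (W t)) (at (W t))"
    and p: "\<And>t. t > 0 \<Longrightarrow> p (W t) > 0 \<and> p (W t) * p' (W t) \<ge> 0 \<and>
      \<sigma> * (p (W t) * p' (W t) + l * \<kappa> * p (W t) - f (W t)) \<le> 0"
    and robin: "\<sigma> * (W 0 + k / l * p (W 0) - b0) \<ge> M * k\<^sup>2 / r\<^sup>2 - 2 * N * M / (m * r\<^sup>2) * l\<^sup>2"
  defines "C \<equiv> 2 * N * M / (m * r\<^sup>2)"
  shows "x \<in> closure \<Omega> \<Longrightarrow> x \<in> cball z r \<Longrightarrow>
      \<sigma> * u x \<le> \<sigma> * W (\<rho> x / l) + M / r\<^sup>2 * (norm (x - z))\<^sup>2 + C * l\<^sup>2"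
    and "\<sigma> * u z = \<sigma> * W 0 + C * l\<^sup>2 \<Longrightarrow> \<sigma> * normal_deriv \<Omega> u z \<ge> \<sigma> * (p (W 0) / l)"
proof -
  let ?D = "\<Omega> \<inter> ball z r" and ?s = "\<lambda>y. (norm (y - z))\<^sup>2"
  let ?n = "outward_normal \<Omega>"
  \<comment> \<open>Multiplication by \<sigma> turns the lower barrier into an upper one:
    \<open>\<sigma> * u\<close> solves the equation with the nonlinearity
    \<open>\<sigma> * f (\<sigma> * t)\<close>, which is increasing again.\<close>
  define w where "w x = \<sigma> * W (\<rho> x / l) + (M / r\<^sup>2 * ?s x + C * l\<^sup>2)" for x
  have l2: "l\<^sup>2 > 0" using l by simp
  have M0: "M \<ge> 0" using b0 M by linarith
  have C0: "C \<ge> 0" using M0 m by (simp add: C_def N_def)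
  have \<sigma>\<sigma>: "\<sigma> * \<sigma> = 1" using \<sigma> by auto
  have \<rho>s: "smooth \<rho>" and \<rho>F: "\<And>x. x \<in> V \<Longrightarrow> x \<in> frontier \<Omega> \<Longrightarrow> \<rho> x = 0 \<and> grad \<rho> x = - ?n x"
    and \<rho>\<Omega>: "\<And>x. x \<in> V \<Longrightarrow> x \<in> \<Omega> \<Longrightarrow> \<rho> x > 0" and \<rho>g: "\<And>x. x \<in> V \<Longrightarrow> \<sigma> * (gdot \<rho> \<rho> x - 1) \<le> 0"
    using \<rho> by (auto simp: defining_function_def)
  have \<rho>0: "\<rho> x \<ge> 0" if "x \<in> closure \<Omega>" "x \<in> cball z r" for x
    using closure_cases[OF that(1)] \<rho>F[of x] \<rho>\<Omega>[of x] r(2) that(2) by fastforce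
  have f\<sigma>: "strict_mono (\<lambda>t. \<sigma> * f (\<sigma> * t))"
    using strict_mono_f \<sigma> by (auto simp: strict_mono_def)
  have op: "open ?D" using open_\<Omega> by blast
  define Wl where "Wl t = W (t / l)" for t
  have Wl': "(Wl has_real_derivative - p (W (t / l)) / l) (at t)" if "t / l > t0" for t
  proof -
    have "((\<lambda>t. t / l) has_real_derivative 1 / l) (at t)" by (intro DERIV_cdivide DERIV_ident)
    from DERIV_chain2[OF W'[OF that] this] show ?thesis by (simp add: Wl_def[abs_def])
  qed
  have Wl'': "((\<lambda>t. - p (W (t / l)) / l) has_real_derivative p (W (t / l)) * p' (W (t / l)) / l\<^sup>2) (at t)" if t: "t > 0" for t
  proof -
    have tl: "t / l > 0" using t l by simp
    then have tl2: "t / l > t0" using t0 by linarith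
    have "((\<lambda>t. - p (W (t / l)) / l) has_real_derivative - (p' (W (t / l)) * (- p (W (t / l)) / l)) / l) (at t)"
      using DERIV_chain2[OF p'[OF tl] Wl'[OF tl2, unfolded Wl_def[abs_def]]] by (intro DERIV_cdivide DERIV_minus)
    then show ?thesis by (simp add: power2_eq_square mult.commute)
  qed
  have Dpos: "\<rho> x > 0" if "x \<in> ?D" for x using that \<rho>\<Omega> r(2) by (auto simp: subset_iff)
  note d\<rho> = smooth_diff2_on[OF \<rho>s, of ?D]
  have dW: "diff2_on (\<lambda>x. Wl (\<rho> x)) ?D"
    "x \<in> ?D \<Longrightarrow> laplacian (\<lambda>x. Wl (\<rho> x)) x = p (W (\<rho> x / l)) * p' (W (\<rho> x / l)) / l\<^sup>2 * gdot \<rho> \<rho> x + - p (W (\<rho> x / l)) / l * laplacian \<rho> x" for x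
  proof -
    have 1: "(Wl has_real_derivative - p (W (\<rho> x / l)) / l) (at (\<rho> x))" if "x \<in> ?D" for x
    proof (rule Wl')
      have "0 < \<rho> x / l" using Dpos[OF that] l by simp
      then show "t0 < \<rho> x / l" using t0 by linarith
    qed
    have 2: "((\<lambda>t. - p (W (t / l)) / l) has_real_derivative p (W (\<rho> x / l)) * p' (W (\<rho> x / l)) / l\<^sup>2) (at (\<rho> x))" if "x \<in> ?D" for x
      by (rule Wl''[OF Dpos[OF that]])
    note c = diff2_on_compose[where W=Wl and W'="\<lambda>t. - p (W (t / l)) / l" and W''="\<lambda>t. p (W (t / l)) * p' (W (t / l)) / l\<^sup>2", OF op d\<rho> 1 2]
    show "diff2_on (\<lambda>x. Wl (\<rho> x)) ?D" by (rule c(1))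
    show "x \<in> ?D \<Longrightarrow> laplacian (\<lambda>x. Wl (\<rho> x)) x = p (W (\<rho> x / l)) * p' (W (\<rho> x / l)) / l\<^sup>2 * gdot \<rho> \<rho> x + - p (W (\<rho> x / l)) / l * laplacian \<rho> x" for x
      by (rule c(2))
  qed
  have sE: "smooth (\<lambda>x. M / r\<^sup>2 * ?s x + C * l\<^sup>2)"
    by (intro smooth_add smooth_mult smooth_const laplacian_norm_square(1))
  have lE: "laplacian (\<lambda>x. M / r\<^sup>2 * ?s x + C * l\<^sup>2) x = M / r\<^sup>2 * (2 * N)" for x
  proof -
    have "laplacian (\<lambda>x. M / r\<^sup>2 * ?s x + C * l\<^sup>2) x = laplacian (\<lambda>x. M / r\<^sup>2 * ?s x) x + laplacian (\<lambda>x. C * l\<^sup>2) x"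
      by (intro laplacian_smooth_simps smooth_mult smooth_const laplacian_norm_square(1))
    also have "laplacian (\<lambda>x. M / r\<^sup>2 * ?s x) x = M / r\<^sup>2 * laplacian ?s x"
      by (rule diff2_on_cmult(2)[OF open_UNIV smooth_diff2_on[OF laplacian_norm_square(1)] UNIV_I])
    finally show ?thesis by (simp add: laplacian_norm_square(2) N_def)
  qed
  have w_eq: "w = (\<lambda>x. \<sigma> * Wl (\<rho> x) + (M / r\<^sup>2 * ?s x + C * l\<^sup>2))" by (rule ext) (simp add: w_def Wl_def)
  note d\<sigma>W = diff2_on_cmult[where c=\<sigma>, OF op dW(1)]
  note dw = diff2_on_add[OF op d\<sigma>W(1) smooth_diff2_on[OF sE], folded w_eq]
  have w_ineq: "l\<^sup>2 * laplacian w x \<le> \<sigma> * f (\<sigma> * w x)" if x: "x \<in> ?D" for x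
  proof -
    define a where "a = W (\<rho> x / l)"
    have t: "\<rho> x / l > 0" using Dpos[OF x] l by simp
    have xV: "x \<in> V" "x \<in> ball z r" using x r(2) by auto
    note pa = p[OF t, folded a_def]
    have "laplacian w x = \<sigma> * (p a * p' a / l\<^sup>2 * gdot \<rho> \<rho> x - p a / l * laplacian \<rho> x) + M / r\<^sup>2 * (2 * N)"
      unfolding dw(2)[OF x] d\<sigma>W(2)[OF x] dW(2)[OF x] lE by (simp add: a_def)
    then have "l\<^sup>2 * laplacian w x = \<sigma> * (p a * p' a * gdot \<rho> \<rho> x) + (- \<sigma> * laplacian \<rho> x) * (l * p a) + m * (C * l\<^sup>2)"
      using l m r(1) by (simp add: C_def field_simps power2_eq_square)
    also have "\<dots> \<le> \<sigma> * (p a * p' a) + \<sigma> * \<kappa> * (l * p a) + m * (C * l\<^sup>2)"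
    proof -
      have "(p a * p' a) * (\<sigma> * (gdot \<rho> \<rho> x - 1)) \<le> 0"
        using pa \<rho>g[OF xV(1)] mult_nonneg_nonpos[of "p a * p' a" "\<sigma> * (gdot \<rho> \<rho> x - 1)"] by blast
      moreover have "(- \<sigma> * laplacian \<rho> x) * (l * p a) \<le> \<sigma> * \<kappa> * (l * p a)"
        using \<kappa>[OF xV(2)] pa l by (intro mult_right_mono) auto
      ultimately show ?thesis by (simp add: algebra_simps)
    qed
    also have "\<dots> \<le> \<sigma> * f a + m * (C * l\<^sup>2)" using pa by (simp add: algebra_simps)
    also have "\<dots> \<le> \<sigma> * f (\<sigma> * w x)"
    proof -
      define E where "E = M / r\<^sup>2 * ?s x + C * l\<^sup>2"
      have E: "C * l\<^sup>2 \<le> E" "0 \<le> C * l\<^sup>2" using M0 C0 by (auto simp: E_def)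
      have wE: "\<sigma> * w x = a + \<sigma> * E"
        using \<sigma>\<sigma> by (simp add: w_def E_def a_def distrib_left mult.assoc[symmetric])
      \<comment> \<open>The growth of \<open>f\<close> at rate \<open>m\<close> pays for the
        localising term: \<open>C\<close> is such that \<open>m * (C * l\<^sup>2)\<close> equals
        \<open>l\<^sup>2\<close> times its Laplacian.\<close>
      have "m * E \<le> \<sigma> * f (a + \<sigma> * E) - \<sigma> * f a"
        using \<sigma> f_diff_ge[of a "a + E"] f_diff_ge[of "a - E" a] E by auto
      moreover have "m * (C * l\<^sup>2) \<le> m * E" using E m by (intro mult_left_mono) auto
      ultimately show ?thesis unfolding wE by linarith
    qed
    finally show ?thesis .
  qed
  have cW: "continuous_on (closure \<Omega> \<inter> cball z r) (\<lambda>x. W (\<rho> x / l))"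
  proof (rule continuous_on_compose2[of "{0..}" W])
    show "continuous_on {0..} W"
      using W' t0 by (intro DERIV_continuous_on[where D="\<lambda>t. - p (W t)"]) (auto intro!: DERIV_subset[OF W'])
    show "continuous_on (closure \<Omega> \<inter> cball z r) (\<lambda>x. \<rho> x / l)"
      using l by (intro continuous_intros smooth_continuous[OF \<rho>s]) auto
    show "(\<lambda>x. \<rho> x / l) ` (closure \<Omega> \<inter> cball z r) \<subseteq> {0..}" using \<rho>0 l by auto
  qed
  have cw: "continuous_on (closure \<Omega> \<inter> cball z r) w"
    unfolding w_def by (intro continuous_intros cW)
  have nd_w: "((\<lambda>t. w (y + t *\<^sub>R ?n y)) has_vector_derivative \<sigma> * (p (W 0) / l) + 2 * M / r\<^sup>2 * ((y - z) \<bullet> ?n y)) (at_left 0)"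
    if y: "y \<in> frontier \<Omega>" "y \<in> cball z r" for y
  proof -
    have yV: "y \<in> V" using y r(2) by blast
    have \<rho>y: "\<rho> y = 0" "grad \<rho> y = - ?n y" using \<rho>F[OF yV y(1)] by auto
    have nn: "?n y \<bullet> ?n y = 1" using norm_outward_normal[OF open_\<Omega> smooth_\<Omega> y(1)] by (simp add: norm_eq_1)
    have "((\<lambda>t. \<rho> (y + t *\<^sub>R ?n y)) has_real_derivative grad \<rho> (y + 0 *\<^sub>R ?n y) \<bullet> ?n y) (at 0)"
      by (rule has_derivative_along_line[OF smooth_differentiable[OF \<rho>s]])
    then have r1: "((\<lambda>t. \<rho> (y + t *\<^sub>R ?n y)) has_real_derivative - 1) (at 0)" using \<rho>y nn by simp
    have W1: "(Wl has_real_derivative - p (W 0) / l) (at (\<rho> (y + 0 *\<^sub>R ?n y)))"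
      using Wl'[of 0] t0 by (simp add: \<rho>y)
    have "((\<lambda>t. Wl (\<rho> (y + t *\<^sub>R ?n y))) has_real_derivative (- p (W 0) / l) * (- 1)) (at 0)"
      by (rule DERIV_chain2[where f=Wl and g="\<lambda>t. \<rho> (y + t *\<^sub>R ?n y)", OF W1 r1])
    from DERIV_cmult[OF this, of \<sigma>]
    have 1: "((\<lambda>t. \<sigma> * Wl (\<rho> (y + t *\<^sub>R ?n y))) has_real_derivative \<sigma> * (p (W 0) / l)) (at 0)" by simp
    have "((\<lambda>t. ?s (y + t *\<^sub>R ?n y)) has_real_derivative grad ?s (y + 0 *\<^sub>R ?n y) \<bullet> ?n y) (at 0)"
      by (rule has_derivative_along_line[OF smooth_differentiable[OF laplacian_norm_square(1)]])
    then have "((\<lambda>t. ?s (y + t *\<^sub>R ?n y)) has_real_derivative 2 * ((y - z) \<bullet> ?n y)) (at 0)" by (simp add: grad_norm_square)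
    from DERIV_add[OF 1 DERIV_add[OF DERIV_cmult[OF this, of "M / r\<^sup>2"] DERIV_const[of "C * l\<^sup>2"]]]
    have "((\<lambda>t. w (y + t *\<^sub>R ?n y)) has_real_derivative \<sigma> * (p (W 0) / l) + 2 * M / r\<^sup>2 * ((y - z) \<bullet> ?n y)) (at 0)"
      by (simp add: w_eq mult_ac)
    then show ?thesis by (simp add: has_real_derivative_iff_has_vector_derivative has_vector_derivative_at_within)
  qed
  have nd_u: "((\<lambda>t. \<sigma> * u (y + t *\<^sub>R ?n y)) has_vector_derivative \<sigma> * normal_deriv \<Omega> u y) (at_left 0)"
    if y: "y \<in> frontier \<Omega>" for y
  proof -
    have "((\<lambda>t. u (y + t *\<^sub>R ?n y)) has_vector_derivative normal_deriv \<Omega> u y) (at_left 0)" using u y by (simp add: solves_def)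
    from has_vector_derivative_mult_right[OF this, of \<sigma>] show ?thesis by simp
  qed
  have main: "\<sigma> * u x \<le> w x" if x: "x \<in> closure \<Omega> \<inter> cball z r" for x
  proof (rule comparison_principle[OF open_\<Omega> smooth_\<Omega> f\<sigma> l2 k _ cw _ dw(1) _ _ _ _ x])
    show "continuous_on (closure \<Omega> \<inter> cball z r) (\<lambda>x. \<sigma> * u x)"
      using u by (intro continuous_intros) (auto simp: solves_def intro: continuous_on_subset)
    have du: "diff2_on u ?D" using u by (auto simp: solves_def intro: diff2_on_subset)
    show "diff2_on (\<lambda>x. \<sigma> * u x) ?D" by (rule diff2_on_cmult(1)[OF op du])
    show "\<sigma> * f (\<sigma> * (\<sigma> * u y)) \<le> l\<^sup>2 * laplacian (\<lambda>x. \<sigma> * u x) y" if y: "y \<in> ?D" for y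
    proof -
      have 1: "\<sigma> * (\<sigma> * u y) = u y" using \<sigma>\<sigma> by (simp add: mult.assoc[symmetric])
      have 2: "l\<^sup>2 * laplacian u y = f (u y)" using u y by (simp add: solves_def)
      have "l\<^sup>2 * laplacian (\<lambda>x. \<sigma> * u x) y = \<sigma> * (l\<^sup>2 * laplacian u y)"
        using diff2_on_cmult(2)[where c=\<sigma>, OF op du y] by (simp add: mult.left_commute)
      then show ?thesis unfolding 1 2 by simp
    qed
    show "l\<^sup>2 * laplacian w y \<le> \<sigma> * f (\<sigma> * w y)" if "y \<in> ?D" for y by (rule w_ineq[OF that])
    show "\<sigma> * u y \<le> w y" if y: "y \<in> closure \<Omega> \<inter> sphere z r" for y
    proof -
      have yr: "norm (y - z) = r" using y by (simp add: dist_norm norm_minus_commute)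
      have "\<rho> y / l \<ge> 0" using \<rho>0[of y] y l by auto
      note WM[OF this]
      moreover have "M / r\<^sup>2 * ?s y = M" using r(1) yr by simp
      moreover have "C * l\<^sup>2 \<ge> 0" using C0 by simp
      moreover have "0 \<le> u y" "u y \<le> b0" using solves_bounds[OF u l2 k b0] y by auto
      ultimately show ?thesis using \<sigma> M by (auto simp: w_def)
    qed
    show "\<exists>a b. ((\<lambda>t. \<sigma> * u (y + t *\<^sub>R ?n y)) has_vector_derivative a) (at_left 0) \<and>
        ((\<lambda>t. w (y + t *\<^sub>R ?n y)) has_vector_derivative b) (at_left 0) \<and> \<sigma> * u y + k * a \<le> w y + k * b"
      if y: "y \<in> frontier \<Omega> \<inter> ball z r" for y
    proof (intro exI conjI)
      have yF: "y \<in> frontier \<Omega>" "y \<in> cball z r" using y by auto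
      show "((\<lambda>t. \<sigma> * u (y + t *\<^sub>R ?n y)) has_vector_derivative \<sigma> * normal_deriv \<Omega> u y) (at_left 0)" by (rule nd_u[OF yF(1)])
      show "((\<lambda>t. w (y + t *\<^sub>R ?n y)) has_vector_derivative \<sigma> * (p (W 0) / l) + 2 * M / r\<^sup>2 * ((y - z) \<bullet> ?n y)) (at_left 0)"
        by (rule nd_w[OF yF])
      have yV: "y \<in> V" using yF r(2) by blast
      have wy: "w y = \<sigma> * W 0 + (M / r\<^sup>2 * ?s y + C * l\<^sup>2)" using \<rho>F[OF yV yF(1)] by (simp add: w_def)
      have "\<sigma> * u y + k * (\<sigma> * normal_deriv \<Omega> u y) = \<sigma> * b0"
      proof -
        have "u y + k * normal_deriv \<Omega> u y = b0" using u yF by (simp add: solves_def)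
        then show ?thesis by (metis distrib_left mult.left_commute)
      qed
      also have "\<dots> \<le> \<sigma> * (W 0 + k / l * p (W 0)) - M * k\<^sup>2 / r\<^sup>2 + C * l\<^sup>2"
        using robin unfolding C_def by (simp add: algebra_simps)
      also have "\<dots> \<le> w y + k * (\<sigma> * (p (W 0) / l) + 2 * M / r\<^sup>2 * ((y - z) \<bullet> ?n y))"
      proof -
        define a where "a = norm (y - z)"
        have "\<bar>(y - z) \<bullet> ?n y\<bar> \<le> a * norm (?n y)" unfolding a_def by (rule Cauchy_Schwarz_ineq2)
        then have an: "- a \<le> (y - z) \<bullet> ?n y" using norm_outward_normal[OF open_\<Omega> smooth_\<Omega> yF(1)] by simp
        \<comment> \<open>Completing the square: the localising term may have normal derivative as
          low as \<open>- 2 * M * a / r\<^sup>2\<close>, but its own value compensates this up to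
          \<open>M * k\<^sup>2 / r\<^sup>2\<close>, the amount reserved in
          \<open>robin\<close>.\<close>
        have "0 \<le> M / r\<^sup>2 * (a - k)\<^sup>2" using M0 by simp
        also have "\<dots> = M / r\<^sup>2 * a\<^sup>2 + M * k\<^sup>2 / r\<^sup>2 + k * (2 * M / r\<^sup>2 * (- a))"
          by (simp add: power2_diff algebra_simps)
        also have "k * (2 * M / r\<^sup>2 * (- a)) \<le> k * (2 * M / r\<^sup>2 * ((y - z) \<bullet> ?n y))"
          using an k M0 by (intro mult_left_mono) auto
        finally have "0 \<le> M / r\<^sup>2 * a\<^sup>2 + M * k\<^sup>2 / r\<^sup>2 + k * (2 * M / r\<^sup>2 * ((y - z) \<bullet> ?n y))" by simp
        then show ?thesis unfolding wy a_def by (simp add: algebra_simps)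
      qed
      finally show "\<sigma> * u y + k * (\<sigma> * normal_deriv \<Omega> u y) \<le> w y + k * (\<sigma> * (p (W 0) / l) + 2 * M / r\<^sup>2 * ((y - z) \<bullet> ?n y))" .
    qed
  qed
  show "\<sigma> * u x \<le> \<sigma> * W (\<rho> x / l) + M / r\<^sup>2 * (norm (x - z))\<^sup>2 + C * l\<^sup>2" if "x \<in> closure \<Omega>" "x \<in> cball z r" for x
    using main[of x] that by (simp add: w_def)
  show "\<sigma> * normal_deriv \<Omega> u z \<ge> \<sigma> * (p (W 0) / l)" if touch: "\<sigma> * u z = \<sigma> * W 0 + C * l\<^sup>2"
  proof -
    \<comment> \<open>The difference of \<open>\<sigma> * u\<close> and \<open>w\<close> is
      nonpositive and vanishes at \<open>z\<close>, so its left derivative along the normal there is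
      nonnegative; the localising term has derivative zero at its centre.\<close>
    have zz: "z \<in> cball z r" using r(1) by simp
    have "\<rho> z = 0" using \<rho>F[of z] z r zz by blast
    then have wz: "w z = \<sigma> * u z" using touch by (simp add: w_def)
    have "((\<lambda>t. \<sigma> * u (z + t *\<^sub>R ?n z) - w (z + t *\<^sub>R ?n z)) has_vector_derivative
        \<sigma> * normal_deriv \<Omega> u z - (\<sigma> * (p (W 0) / l) + 2 * M / r\<^sup>2 * ((z - z) \<bullet> ?n z))) (at_left 0)"
      by (rule has_vector_derivative_diff[OF nd_u[OF z] nd_w[OF z zz]])
    moreover have "\<forall>\<^sub>F t in at_left 0. \<sigma> * u (z + t *\<^sub>R ?n z) - w (z + t *\<^sub>R ?n z) \<le> \<sigma> * u (z + 0 *\<^sub>R ?n z) - w (z + 0 *\<^sub>R ?n z)"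
    proof -
      have lim: "((\<lambda>t. z + t *\<^sub>R ?n z) \<longlongrightarrow> z + 0 *\<^sub>R ?n z) (at_left 0)" by (intro tendsto_intros)
      have "\<forall>\<^sub>F t in at_left 0. z + t *\<^sub>R ?n z \<in> ball z r"
        by (rule topological_tendstoD[OF lim open_ball]) (use r(1) in simp)
      then show ?thesis using eventually_inside_normal[OF open_\<Omega> smooth_\<Omega> z]
      proof eventually_elim
        case (elim t)
        then have "z + t *\<^sub>R ?n z \<in> closure \<Omega> \<inter> cball z r" using closure_subset by fastforce
        from main[OF this] show ?case using wz by simp
      qed
    qed
    ultimately have "\<sigma> * normal_deriv \<Omega> u z - (\<sigma> * (p (W 0) / l) + 2 * M / r\<^sup>2 * ((z - z) \<bullet> ?n z)) \<ge> 0"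
      by (rule left_derivative_at_max)
    then show ?thesis by simp
  qed
qed

end

section \<open>Asymptotics along a sequence\<close>

lemma profile_antitone:
  fixes W :: "real \<Rightarrow> real"
  assumes "\<And>t. t \<ge> 0 \<Longrightarrow> (W has_real_derivative - p (W t)) (at t)" "\<And>t. t \<ge> 0 \<Longrightarrow> p (W t) \<ge> 0" and t: "0 \<le> s" "s \<le> t"
  shows "W t \<le> W s"
proof (rule DERIV_nonpos_imp_nonincreasing[OF t(2)])
  fix x assume "s \<le> x"
  then have "x \<ge> 0" using t by simp
  then show "\<exists>y. (W has_real_derivative y) (at x) \<and> y \<le> 0" using assms(1,2)[of x] by (intro exI[of _ "- p (W x)"]) auto
qed

text \<open>Caratheodory's form of the derivative avoids division by \<open>x n - a\<close>, which
  may vanish.\<close>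

lemma difference_quotient_compose:
  fixes G :: "real \<Rightarrow> real"
  assumes G: "(G has_real_derivative G') (at a)" and x: "x \<longlonglongrightarrow> a" and q: "(\<lambda>n. (x n - a) / e n) \<longlonglongrightarrow> D"
  shows "(\<lambda>n. (G (x n) - G a) / e n) \<longlonglongrightarrow> G' * D"
proof -
  obtain g where g: "\<And>z. G z - G a = g z * (z - a)" "isCont g a" "g a = G'"
    using G CARAT_DERIV[of G G' a] by auto
  have "(\<lambda>n. g (x n)) \<longlonglongrightarrow> G'" using isCont_tendsto_compose[OF g(2) x] g(3) by simp
  from tendsto_mult[OF this q] show ?thesis by (simp add: g(1))
qed

lemma measure_open_pos:
  fixes S :: "'a::euclidean_space set"
  assumes S: "open S" "bounded S" "S \<noteq> {}"
  shows "measure lborel S > 0"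
proof -
  obtain x r where r: "r > 0" "ball x r \<subseteq> S" using S open_contains_ball by blast
  have "0 < measure lborel (ball x r)" using content_ball_pos[OF r(1)] by simp
  also have "\<dots> \<le> measure lborel S"
    using S emeasure_bounded_finite[OF S(2)] by (intro measure_mono_fmeasurable r(2)) (auto simp: fmeasurable_def)
  finally show ?thesis .
qed

section \<open>The average of \<open>q (u)\<close> along a sequence of solutions\<close>

locale bvp_sequence = reaction_domain \<Omega> f m for \<Omega> :: "'a::euclidean_space set" and f m +
  fixes A q :: "real \<Rightarrow> real" and \<gamma> b0 bs :: real and \<epsilon> :: "nat \<Rightarrow> real" and u :: "nat \<Rightarrow> 'a \<Rightarrow> real"
  assumes dim: "DIM('a) \<ge> 2" and \<gamma>: "\<gamma> \<ge> 0" and b0: "b0 > 0"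
    and A: "\<And>t. A t > 0" and A': "\<And>t. (A has_real_derivative deriv A t) (at t)"
    and q': "\<And>t. (q has_real_derivative deriv q t) (at t)" and cont_q': "continuous_on UNIV (deriv q)"
    and bs: "0 < bs" "bs \<le> b0" "bs + \<gamma> * sqrt (2 * primitive f bs / A (q 0)) = b0"
    and \<epsilon>: "\<And>n. \<epsilon> n > 0" "\<epsilon> \<longlonglongrightarrow> 0"
    and sol: "\<And>n. bvp_solution \<Omega> A q f \<gamma> b0 (\<epsilon> n) (u n)"
begin

definition "avg n = average \<Omega> (\<lambda>y. q (u n y))"
definition "a n = sqrt (A (avg n))"
definition "l n = \<epsilon> n * a n"
definition "a0 = sqrt (A (q 0))"

lemma a_pos: "a n > 0" and a0_pos: "a0 > 0" and l_pos: "l n > 0"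
  using A \<epsilon> by (auto simp: a_def a0_def l_def)

lemma solves_u: "solves ((l n)\<^sup>2) (\<epsilon> n * \<gamma>) f b0 (u n)"
proof -
  have "(l n)\<^sup>2 = (\<epsilon> n)\<^sup>2 * A (avg n)" using A[of "avg n"] by (simp add: l_def a_def power_mult_distrib)
  then show ?thesis using bvp_solution_solves[OF sol[of n]] by (simp add: avg_def)
qed

lemma u_range: "x \<in> closure \<Omega> \<Longrightarrow> 0 \<le> u n x" "x \<in> closure \<Omega> \<Longrightarrow> u n x \<le> b0"
proof -
  have "(l n)\<^sup>2 > 0" "\<epsilon> n * \<gamma> \<ge> 0" "b0 \<ge> 0" using l_pos[of n] \<epsilon>(1)[of n] \<gamma> b0 by simp_all
  note * = solves_bounds[OF solves_u this]
  show "x \<in> closure \<Omega> \<Longrightarrow> 0 \<le> u n x" "x \<in> closure \<Omega> \<Longrightarrow> u n x \<le> b0" by (fact *)+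
qed

lemma q_lipschitz: "\<exists>Lq\<ge>0. \<forall>s. 0 \<le> s \<longrightarrow> s \<le> B \<longrightarrow> \<bar>q s - q 0\<bar> \<le> Lq * s"
proof -
  have "compact {0..B}" by simp
  then have "bounded (deriv q ` {0..B})"
    using cont_q' continuous_on_subset by (intro compact_imp_bounded compact_continuous_image) auto
  then obtain K where K: "K > 0" "\<And>t. t \<in> {0..B} \<Longrightarrow> \<bar>deriv q t\<bar> \<le> K" unfolding bounded_pos by auto
  have "\<bar>q s - q 0\<bar> \<le> K * s" if s: "0 \<le> s" "s \<le> B" for s
  proof -
    have "norm (q s - q 0) \<le> K * norm (s - 0)"
      by (rule field_differentiable_bound[of "{0..B}" q "deriv q"])
        (use s K q'[THEN has_field_derivative_at_within] in auto)
    then show ?thesis using s by simp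
  qed
  then show ?thesis using K(1) by (intro exI[of _ K]) auto
qed

lemma cont_q: "continuous_on S q"
  using DERIV_continuous_on[of S q "deriv q"] q' has_field_derivative_at_within by blast

lemma q_diff_measurable: "(\<lambda>x. indicator \<Omega> x * (q (u n x) - q 0)) \<in> borel_measurable borel"
proof -
  have "continuous_on \<Omega> (u n)"
    using solves_u[of n] closure_subset by (auto simp: solves_def intro: continuous_on_subset)
  then have "continuous_on \<Omega> (\<lambda>x. q (u n x) - q 0)"
    by (intro continuous_intros continuous_on_compose2[OF cont_q[of UNIV]]) auto
  then have "(\<lambda>x. indicator \<Omega> x *\<^sub>R (q (u n x) - q 0)) \<in> borel_measurable borel"
    using open_\<Omega> by (intro borel_measurable_continuous_on_indicator) auto
  then show ?thesis by simp
qed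

lemma integrable_indicator_\<Omega>: "integrable lborel (\<lambda>x. indicator \<Omega> x * (c::real))"
  using emeasure_bounded_finite[OF bounded_\<Omega>] open_\<Omega> by (intro integrable_mult_left integrable_real_indicator) auto

lemma avg_diff: "avg n - q 0 = (\<integral>x. indicator \<Omega> x * (q (u n x) - q 0) \<partial>lborel) / measure lborel \<Omega>"
  and avg_bound: "\<exists>Q. \<forall>n. \<bar>avg n\<bar> \<le> Q"
proof -
  obtain Lq where Lq: "Lq \<ge> 0" "\<And>s. 0 \<le> s \<Longrightarrow> s \<le> b0 \<Longrightarrow> \<bar>q s - q 0\<bar> \<le> Lq * s" using q_lipschitz[of b0] by blast
  have mpos: "measure lborel \<Omega> > 0" by (rule measure_open_pos[OF open_\<Omega> bounded_\<Omega> nonempty_\<Omega>])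
  have b: "norm (indicator \<Omega> x * (q (u n x) - q 0)) \<le> indicator \<Omega> x * (Lq * b0)" for n x
  proof (cases "x \<in> \<Omega>")
    case True
    then have "0 \<le> u n x" "u n x \<le> b0" using u_range closure_subset by blast+
    then show ?thesis using Lq(2)[of "u n x"] mult_left_mono[of "u n x" b0 Lq] Lq(1) True by simp
  qed simp
  have i: "integrable lborel (\<lambda>x. indicator \<Omega> x * (q (u n x) - q 0))" for n
    by (rule Bochner_Integration.integrable_bound[OF integrable_indicator_\<Omega>[of "Lq * b0"]])
      (use q_diff_measurable b Lq b0 in auto)
  have "(LINT x:\<Omega>|lborel. q (u n x)) = (\<integral>x. indicator \<Omega> x * (q (u n x) - q 0) + indicator \<Omega> x * q 0 \<partial>lborel)" for n
    unfolding set_lebesgue_integral_def by (intro Bochner_Integration.integral_cong) (auto simp: algebra_simps)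
  also have "\<dots> n = (\<integral>x. indicator \<Omega> x * (q (u n x) - q 0) \<partial>lborel) + (\<integral>x. indicator \<Omega> x * q 0 \<partial>lborel)" for n
    by (rule Bochner_Integration.integral_add[OF i integrable_indicator_\<Omega>])
  finally have e: "(LINT x:\<Omega>|lborel. q (u n x)) = (\<integral>x. indicator \<Omega> x * (q (u n x) - q 0) \<partial>lborel) + measure lborel \<Omega> * q 0" for n
    using open_\<Omega> by simp
  show ad: "avg n - q 0 = (\<integral>x. indicator \<Omega> x * (q (u n x) - q 0) \<partial>lborel) / measure lborel \<Omega>" for n
    unfolding avg_def average_def e using mpos by (simp add: field_simps)
  have "\<bar>avg n\<bar> \<le> \<bar>q 0\<bar> + Lq * b0" for n
  proof -
    have "norm (\<integral>x. indicator \<Omega> x * (q (u n x) - q 0) \<partial>lborel) \<le> (\<integral>x. indicator \<Omega> x * (Lq * b0) \<partial>lborel)"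
      by (rule Bochner_Integration.integral_norm_bound_integral[OF i integrable_indicator_\<Omega> b])
    also have "\<dots> = measure lborel \<Omega> * (Lq * b0)" using open_\<Omega> by simp
    finally have "\<bar>avg n - q 0\<bar> \<le> Lq * b0" unfolding ad using mpos by (simp add: field_simps)
    then show ?thesis by linarith
  qed
  then show "\<exists>Q. \<forall>n. \<bar>avg n\<bar> \<le> Q" by blast
qed

lemma cont_A: "continuous_on S A"
  using DERIV_continuous_on[of S A "deriv A"] A' has_field_derivative_at_within by blast

lemma l_tendsto: "l \<longlonglongrightarrow> 0"
proof -
  obtain Q where Q: "\<And>n. \<bar>avg n\<bar> \<le> Q" using avg_bound by blast
  have "continuous_on {-Q..Q} (\<lambda>t. sqrt (A t))" by (intro continuous_intros cont_A)
  then have "bounded ((\<lambda>t. sqrt (A t)) ` {-Q..Q})" by (intro compact_imp_bounded compact_continuous_image) auto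
  then obtain K where "\<forall>y\<in>(\<lambda>t. sqrt (A t)) ` {-Q..Q}. norm y \<le> K" unfolding bounded_iff by blast
  then have K: "\<bar>sqrt (A t)\<bar> \<le> K" if "t \<in> {-Q..Q}" for t using that by force
  have ak: "a n \<le> K" for n using K[of "avg n"] Q[of n] by (simp add: a_def abs_le_iff)
  have "(\<lambda>n. \<epsilon> n * K) \<longlonglongrightarrow> 0" using tendsto_mult[OF \<epsilon>(2) tendsto_const, of K] by simp
  then show ?thesis
  proof (rule Lim_null_comparison[rotated])
    have "norm (l n) \<le> \<epsilon> n * K" for n
      using ak[of n] a_pos[of n] \<epsilon>(1)[of n] by (simp add: l_def abs_mult)
    then show "\<forall>\<^sub>F n in sequentially. norm (l n) \<le> \<epsilon> n * K" by (intro always_eventually) blast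
  qed
qed

lemma u_decay: "\<exists>C \<mu>. \<mu> > 0 \<and> (\<forall>n. \<forall>x\<in>\<Omega>. \<bar>q (u n x) - q 0\<bar> \<le> C * exp (- (\<mu> * infdist x (frontier \<Omega>) / l n)))"
proof -
  obtain Lq where Lq: "Lq \<ge> 0" "\<And>s. 0 \<le> s \<Longrightarrow> s \<le> b0 \<Longrightarrow> \<bar>q s - q 0\<bar> \<le> Lq * s" using q_lipschitz[of b0] by blast
  obtain \<mu> C where C: "\<mu> > 0" "C \<ge> 0"
    "\<And>l k u x. solves (l\<^sup>2) k f b0 u \<Longrightarrow> l > 0 \<Longrightarrow> k \<ge> 0 \<Longrightarrow> x \<in> \<Omega> \<Longrightarrow> u x \<le> C * exp (- (\<mu> * infdist x (frontier \<Omega>) / l))"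
    by (rule solves_decay[OF less_imp_le[OF b0]], rule that)
  have "\<bar>q (u n x) - q 0\<bar> \<le> Lq * C * exp (- (\<mu> * infdist x (frontier \<Omega>) / l n))" if x: "x \<in> \<Omega>" for n x
  proof -
    have "0 \<le> u n x" "u n x \<le> b0" using u_range x closure_subset by blast+
    then have "\<bar>q (u n x) - q 0\<bar> \<le> Lq * u n x" by (rule Lq(2))
    also have "\<dots> \<le> Lq * (C * exp (- (\<mu> * infdist x (frontier \<Omega>) / l n)))"
      using C(3)[OF solves_u l_pos _ x, of n] \<epsilon>(1)[of n] \<gamma> Lq(1) by (intro mult_left_mono) auto
    finally show ?thesis by (simp add: mult.assoc)
  qed
  then show ?thesis using C(1) by blast
qed

text \<open>The decay makes the integrand vanish pointwise in the limit, since points of the open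
  set have positive distance to the frontier; a constant dominates on the bounded domain.\<close>

lemma avg_tendsto: "avg \<longlonglongrightarrow> q 0"
proof -
  obtain C \<mu> where C: "\<mu> > 0" "\<And>n x. x \<in> \<Omega> \<Longrightarrow> \<bar>q (u n x) - q 0\<bar> \<le> C * exp (- (\<mu> * infdist x (frontier \<Omega>) / l n))"
    using u_decay by blast
  have ne: "frontier \<Omega> \<noteq> {}" by (rule frontier_nonempty[OF bounded_\<Omega> nonempty_\<Omega>])
  have ul: "(\<lambda>n. indicator \<Omega> x * (q (u n x) - q 0)) \<longlonglongrightarrow> 0" for x
  proof (cases "x \<in> \<Omega>")
    case True
    define d where "d = infdist x (frontier \<Omega>)"
    have "x \<notin> frontier \<Omega>" using True open_\<Omega> by (simp add: frontier_def interior_open)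
    then have d: "d > 0" using in_closed_iff_infdist_zero[OF frontier_closed ne, of x] infdist_nonneg[of x "frontier \<Omega>"]
      by (auto simp: d_def less_le)
    have "filterlim (\<lambda>n. inverse (l n)) at_top sequentially"
      by (rule filterlim_inverse_at_top[OF l_tendsto]) (use l_pos in \<open>auto intro: always_eventually\<close>)
    then have "filterlim (\<lambda>n. (\<mu> * d) * inverse (l n)) at_top sequentially"
      using C d by (intro filterlim_tendsto_pos_mult_at_top[OF tendsto_const]) auto
    then have "filterlim (\<lambda>n. - (\<mu> * d / l n)) at_bot sequentially"
      by (simp add: filterlim_uminus_at_bot divide_inverse)
    then have "(\<lambda>n. exp (- (\<mu> * d / l n))) \<longlonglongrightarrow> 0" by (rule filterlim_compose[OF exp_at_bot])
    from tendsto_mult[OF tendsto_const this, of C] have "(\<lambda>n. C * exp (- (\<mu> * d / l n))) \<longlonglongrightarrow> 0" by simp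
    then show ?thesis
      by (rule Lim_null_comparison[rotated]) (use C(2)[OF True] True in \<open>auto simp: d_def intro!: always_eventually\<close>)
  qed simp
  have "(\<lambda>n. \<integral>x. indicator \<Omega> x * (q (u n x) - q 0) \<partial>lborel) \<longlonglongrightarrow> (\<integral>x. 0 \<partial>(lborel :: 'a measure))"
  proof (rule integral_dominated_convergence[where w="\<lambda>x. indicator \<Omega> x * \<bar>C\<bar>"])
    show "AE x in lborel. norm (indicator \<Omega> x * (q (u n x) - q 0)) \<le> indicator \<Omega> x * \<bar>C\<bar>" for n
    proof (rule AE_I2)
      fix x
      have "x \<in> \<Omega> \<Longrightarrow> C * exp (- (\<mu> * infdist x (frontier \<Omega>) / l n)) \<le> \<bar>C\<bar> * 1"
        using C(1) l_pos[of n] by (intro mult_mono) (auto simp: infdist_nonneg)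
      then show "norm (indicator \<Omega> x * (q (u n x) - q 0)) \<le> indicator \<Omega> x * \<bar>C\<bar>"
        using C(2)[of x n] by (cases "x \<in> \<Omega>") auto
    qed
  qed (use q_diff_measurable integrable_indicator_\<Omega> ul in auto)
  then have "(\<lambda>n. avg n - q 0) \<longlonglongrightarrow> 0 / measure lborel \<Omega>"
    unfolding avg_diff using measure_open_pos[OF open_\<Omega> bounded_\<Omega> nonempty_\<Omega>] by (intro tendsto_divide tendsto_const) auto
  then show ?thesis by (simp add: LIM_zero_iff)
qed

lemma a_tendsto: "a \<longlonglongrightarrow> a0"
proof -
  have "isCont A (q 0)" using A' DERIV_isCont by blast
  from isCont_tendsto_compose[OF this avg_tendsto] show ?thesis
    unfolding a_def[abs_def] a0_def by (rule tendsto_real_sqrt)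
qed

lemma bs_eq: "bs + \<gamma> * (p0 bs / a0) = b0"
  using bs(3) by (simp add: p0_def a0_def real_sqrt_divide)

text \<open>Continuity of the Laplacian lets a single constant \<kappa> serve in the whole ball of a
  barrier.\<close>

lemma defining_function_near:
  assumes z: "z \<in> frontier \<Omega>" and \<sigma>: "\<sigma> = 1 \<or> \<sigma> = -1" and \<delta>: "\<delta> > 0"
  obtains V \<rho> r where "defining_function \<Omega> V \<sigma> \<rho>" "r > 0" "cball z r \<subseteq> V"
    "\<And>x. x \<in> cball z r \<Longrightarrow> \<bar>laplacian \<rho> x - laplacian \<rho> z\<bar> \<le> \<delta>"
proof -
  obtain e g U where c: "z \<in> U" "graph_chart \<Omega> e g U" using smooth_\<Omega> z by (auto simp: smooth_boundary_def)
  obtain V \<rho> where V: "z \<in> V" "defining_function \<Omega> V \<sigma> \<rho>"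
    using chart.defining_function_exists[OF chartI[OF c(2)] c(1) z dim \<sigma>] by blast
  have "isCont (laplacian \<rho>) z" using V(2) by (intro smooth_isCont smooth_laplacian) (simp add: defining_function_def)
  then obtain r1 where r1: "r1 > 0" "\<And>x. dist x z < r1 \<Longrightarrow> dist (laplacian \<rho> x) (laplacian \<rho> z) < \<delta>"
    using \<delta> unfolding continuous_at_eps_delta by blast
  have "open V" using V(2) by (simp add: defining_function_def)
  then obtain r2 where r2: "r2 > 0" "cball z r2 \<subseteq> V" using V(1) open_contains_cball by blast
  show ?thesis
  proof (rule that[OF V(2)])
    show "min (r1 / 2) r2 > 0" using r1 r2 by simp
    show "cball z (min (r1 / 2) r2) \<subseteq> V" using r2 by auto
    show "\<bar>laplacian \<rho> x - laplacian \<rho> z\<bar> \<le> \<delta>" if "x \<in> cball z (min (r1 / 2) r2)" for x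
      using r1(2)[of x] that r1(1) by (simp add: dist_commute dist_real_def)
  qed
qed

lemma defining_function_laplacian:
  "defining_function \<Omega> V \<sigma> \<rho> \<Longrightarrow> x \<in> V \<Longrightarrow> x \<in> frontier \<Omega> \<Longrightarrow>
    laplacian \<rho> x = - ((real DIM('a) - 1) * mean_curvature \<Omega> x)"
  by (auto simp: defining_function_def)

text \<open>With one antiderivative fixed, all leading order profiles are time shifts of one
  another, and differences of its values are the shifts.\<close>

definition "T0 = (SOME T. \<forall>s. 0 < s \<longrightarrow> s < b0 + 2 \<longrightarrow> (T has_real_derivative - (1 / p0 s)) (at s))"

lemma T0_deriv: "0 < s \<Longrightarrow> s < b0 + 2 \<Longrightarrow> (T0 has_real_derivative - (1 / p0 s)) (at s)"
proof -
  have "\<exists>T. \<forall>s. 0 < s \<longrightarrow> s < b0 + 2 \<longrightarrow> (T has_real_derivative - (1 / p0 s)) (at s)"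
    by (rule inverse_antiderivative_exists) (use p0_pos cont_p0 b0 in auto)
  from someI_ex[OF this] show "0 < s \<Longrightarrow> s < b0 + 2 \<Longrightarrow> (T0 has_real_derivative - (1 / p0 s)) (at s)"
    unfolding T0_def by blast
qed

lemma T0_decreasing: "0 < s \<Longrightarrow> s < s' \<Longrightarrow> s' < b0 + 2 \<Longrightarrow> T0 s' < T0 s"
proof (rule DERIV_neg_imp_decreasing[of s s' T0])
  fix x assume "0 < s" "s' < b0 + 2" "s \<le> x" "x \<le> s'"
  then have "0 < x" "x < b0 + 2" by auto
  then show "\<exists>y. (T0 has_real_derivative y) (at x) \<and> y < 0"
    using T0_deriv p0_pos[of x] by (intro exI[of _ "- (1 / p0 x)"]) auto
qed

text \<open>The leading order profile, started at \<open>b0 + 1\<close>; other initial values are reached by shifts.\<close>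

lemma master_profile:
  obtains W t0 where "t0 < 0" "W 0 = b0 + 1" "\<And>t. t > t0 \<Longrightarrow> 0 < W t \<and> W t < b0 + 2"
    "\<And>t. t > t0 \<Longrightarrow> (W has_real_derivative - p0 (W t)) (at t)"
    "\<And>\<beta>. 0 < \<beta> \<Longrightarrow> \<beta> \<le> b0 + 1 \<Longrightarrow> T0 \<beta> - T0 (b0 + 1) \<ge> 0 \<and> W (T0 \<beta> - T0 (b0 + 1)) = \<beta>"
proof -
  obtain L where L: "L \<ge> m" "\<And>s. 0 \<le> s \<Longrightarrow> s \<le> b0 + 2 \<Longrightarrow> f s \<le> L * s" using f_le_linear[of "b0 + 2"] by blast
  have lin: "p0 s \<le> sqrt L * s" if "0 < s" "s < b0 + 2" for s
    by (rule p0_le[OF L(2)]) (use that in auto)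
  obtain W t0 where W: "t0 < 0" "W 0 = b0 + 1" "\<And>t. t > t0 \<Longrightarrow> 0 < W t \<and> W t < b0 + 2"
    "\<And>t. t > t0 \<Longrightarrow> (W has_real_derivative - p0 (W t)) (at t)" "\<And>t. t > t0 \<Longrightarrow> T0 (W t) = T0 (b0 + 1) + t"
    by (rule profile_exists[of "b0 + 1" "b0 + 2" p0 "sqrt L" T0]) (use b0 L m p0_pos lin T0_deriv in auto)
  show ?thesis
  proof (rule that[OF W(1-4)])
    fix \<beta> assume \<beta>: "0 < \<beta>" "\<beta> \<le> b0 + 1"
    define s where "s = T0 \<beta> - T0 (b0 + 1)"
    have s: "s \<ge> 0" using T0_decreasing[of \<beta> "b0 + 1"] \<beta> by (cases "\<beta> = b0 + 1") (auto simp: s_def)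
    then have st: "s > t0" using W(1) by linarith
    have "T0 (W s) = T0 \<beta>" using W(5)[OF st] by (simp add: s_def)
    moreover have "0 < W s" "W s < b0 + 2" using W(3)[OF st] by auto
    ultimately have "W s = \<beta>" using T0_decreasing[of "W s" \<beta>] T0_decreasing[of \<beta> "W s"] \<beta>
      by (cases "W s" \<beta> rule: linorder_cases) auto
    then show "T0 \<beta> - T0 (b0 + 1) \<ge> 0 \<and> W (T0 \<beta> - T0 (b0 + 1)) = \<beta>" using s by (simp add: s_def)
  qed
qed

end

section \<open>Leading order profile and expansion of the average\<close>

context bvp_sequence
begin

lemma k_over_l: "\<epsilon> n * \<gamma> / l n = \<gamma> / a n"
  using \<epsilon>(1)[of n] by (simp add: l_def)

lemma robin_error_tendsto: "(\<lambda>n. c * (\<epsilon> n * \<gamma>)\<^sup>2 / r - C * (l n)\<^sup>2) \<longlonglongrightarrow> 0"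
proof -
  have "(\<lambda>n. c * (\<epsilon> n * \<gamma>)\<^sup>2 * (1 / r) - C * (l n)\<^sup>2) \<longlonglongrightarrow> c * (0 * \<gamma>)\<^sup>2 * (1 / r) - C * 0\<^sup>2"
    by (intro tendsto_intros \<epsilon>(2) l_tendsto)
  then show ?thesis by simp
qed

text \<open>The barrier starts at \<open>bs + \<sigma> * \<delta>\<close> and runs at speed
  \<open>\<theta> * p0\<close> with \<open>\<theta> = 1 - \<sigma> * c * \<delta>\<close>. For fixed
  \<delta> this leaves room in the equation for the curvature term, of order \<open>l n\<close>, and
  in the Robin condition for all errors tending to zero; afterwards \<delta> is small enough for the
  tolerance \<open>e0\<close>.\<close>

lemma leading_barrier:
  assumes c: "graph_chart \<Omega> e g U" and z: "z \<in> frontier \<Omega>" "z \<in> U" and \<tau>: "\<tau> > 0" and \<sigma>: "\<sigma> = 1 \<or> \<sigma> = -1"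
    and W: "t0 < 0" "W 0 = b0 + 1" "\<And>t. t > t0 \<Longrightarrow> 0 < W t \<and> W t < b0 + 2"
      "\<And>t. t > t0 \<Longrightarrow> (W has_real_derivative - p0 (W t)) (at t)"
      "\<And>\<beta>. 0 < \<beta> \<Longrightarrow> \<beta> \<le> b0 + 1 \<Longrightarrow> T0 \<beta> - T0 (b0 + 1) \<ge> 0 \<and> W (T0 \<beta> - T0 (b0 + 1)) = \<beta>"
    and e: "e0 > 0"
  shows "\<forall>\<^sub>F n in sequentially. \<sigma> * u n (z - (l n * \<tau>) *\<^sub>R e)
    \<le> \<sigma> * W (chart.slope g z * \<tau> + (T0 bs - T0 (b0 + 1))) + e0"
proof -
  interpret chart \<Omega> e g U by (rule chartI[OF c])
  define t where "t = slope z * \<tau>"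
  have t: "t > 0" using slope_pos \<tau> by (simp add: t_def)
  have \<sigma>\<sigma>: "\<sigma> * \<sigma> = 1" "\<bar>\<sigma>\<bar> = 1" using \<sigma> by auto
  define M where "M = b0 + 1"
  have M: "M > 0" using b0 by (simp add: M_def)
  \<comment> \<open>The changed speed costs at most
    \<open>c * \<delta> * (\<gamma> / a0 * p0 M)\<close> in the Robin condition; this
    \<open>c\<close> keeps the cost below half of the gain \<delta> from the starting value.\<close>
  define c where "c = 1 / (2 * (\<gamma> / a0 * p0 M + 1))"
  have ga: "\<gamma> / a0 * p0 M \<ge> 0" using \<gamma> a0_pos p0_pos[OF M] by simp
  have c: "0 < c" "c \<le> 1 / 2" "c * (\<gamma> / a0 * p0 M) \<le> 1 / 2"
  proof -
    define G where "G = \<gamma> / a0 * p0 M"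
    have "G \<ge> 0" using ga by (simp add: G_def)
    then show "0 < c" "c \<le> 1 / 2" "c * (\<gamma> / a0 * p0 M) \<le> 1 / 2"
      unfolding c_def G_def[symmetric] by (simp_all add: field_simps)
  qed
  \<comment> \<open>The limit of the barrier at the stretched depth \<open>t\<close> as a function
    of \<delta>; its continuity at zero makes the perturbation cost less than
    \<open>e0\<close>.\<close>
  define h where "h \<delta> = W ((1 - \<sigma> * c * \<delta>) * t + (T0 (bs + \<sigma> * \<delta>) - T0 M))" for \<delta>
  have h0: "h 0 = W (t + (T0 bs - T0 M))" by (simp add: h_def)
  have bsM: "bs < M" "bs < b0 + 2" using bs b0 by (auto simp: M_def)
  have sbs: "T0 bs - T0 M \<ge> 0" using W(5)[of bs] bs bsM by (simp add: M_def)
  have "isCont h 0"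
  proof -
    have 1: "isCont T0 (bs + \<sigma> * 0)" using T0_deriv[of bs] bs bsM DERIV_isCont by simp
    have "isCont (\<lambda>\<delta>. T0 (bs + \<sigma> * \<delta>)) 0"
      by (rule isCont_o2[where f="\<lambda>\<delta>. bs + \<sigma> * \<delta>" and g=T0]) (use 1 in \<open>auto intro!: continuous_intros\<close>)
    then have 2: "isCont (\<lambda>\<delta>. (1 - \<sigma> * c * \<delta>) * t + (T0 (bs + \<sigma> * \<delta>) - T0 M)) 0" by (intro continuous_intros)
    have "t0 < t + (T0 bs - T0 M)" using t sbs W(1) by linarith
    then have 3: "isCont W ((1 - \<sigma> * c * 0) * t + (T0 (bs + \<sigma> * 0) - T0 M))"
      using DERIV_isCont[OF W(4)] by simp
    show ?thesis unfolding h_def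
      by (rule isCont_o2[where f="\<lambda>\<delta>. (1 - \<sigma> * c * \<delta>) * t + (T0 (bs + \<sigma> * \<delta>) - T0 M)" and g=W, OF 2 3])
  qed
  then obtain d where d: "d > 0" "\<And>\<delta>. \<bar>\<delta>\<bar> < d \<Longrightarrow> \<bar>h \<delta> - h 0\<bar> < e0 / 2"
    unfolding continuous_at_eps_delta dist_real_def using e by (metis diff_zero half_gt_zero)
  define \<delta> where "\<delta> = min (d / 2) (min (bs / 2) (1 / 2))"
  have \<delta>: "0 < \<delta>" "\<delta> \<le> 1 / 2" "\<delta> < bs" "\<bar>\<delta>\<bar> < d" using d bs by (auto simp: \<delta>_def)
  define \<theta> where "\<theta> = 1 - \<sigma> * c * \<delta>"
  define \<beta> where "\<beta> = bs + \<sigma> * \<delta>"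
  have cd: "0 < c * \<delta>" "c * \<delta> \<le> 1 / 2" using c \<delta> mult_mono[of c "1/2" \<delta> "1/2"] by auto
  have \<theta>: "1 / 2 \<le> \<theta>" "\<theta> \<le> 2" using \<sigma> cd by (auto simp: \<theta>_def)
  have \<beta>: "0 < \<beta>" "\<beta> \<le> M" using \<sigma> \<delta> bs bsM by (auto simp: \<beta>_def M_def)
  define sb where "sb = T0 \<beta> - T0 M"
  have sb: "sb \<ge> 0" "W sb = \<beta>" using W(5)[of \<beta>] \<beta> by (auto simp: sb_def M_def)
  define W1 where "W1 s = W (\<theta> * s + sb)" for s
  have W10: "W1 0 = \<beta>" by (simp add: W1_def sb)
  have dom: "\<theta> * s + sb > t0" if "s > t0 / \<theta>" for s
  proof -
    have "\<theta> * s > t0" using that \<theta> by (simp add: field_simps)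
    then show ?thesis using sb by linarith
  qed
  have t0': "t0 / \<theta> < 0" using W(1) \<theta> by (simp add: divide_neg_pos)
  have W1': "(W1 has_real_derivative - (\<theta> * p0 (W1 s))) (at s)" if "s > t0 / \<theta>" for s
  proof -
    have "((\<lambda>s. \<theta> * s + sb) has_real_derivative \<theta>) (at s)" by (auto intro!: derivative_eq_intros)
    from DERIV_chain2[OF W(4)[OF dom[OF that]] this] show ?thesis by (simp add: W1_def[abs_def] mult.commute)
  qed
  have W1pos: "0 < W1 s" "W1 s < b0 + 2" if "s > t0 / \<theta>" for s using W(3)[OF dom[OF that]] by (auto simp: W1_def)
  have ge0: "s > t0 / \<theta>" if "s \<ge> 0" for s using that t0' by linarith
  have W1M: "0 < W1 s \<and> W1 s \<le> M" if s: "s \<ge> 0" for s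
  proof -
    have "W1 s \<le> W1 0"
    proof (rule profile_antitone[where W=W1 and p="\<lambda>x. \<theta> * p0 x" and s=0 and t=s])
      show "(W1 has_real_derivative - (\<theta> * p0 (W1 y))) (at y)" if "y \<ge> 0" for y using W1'[OF ge0[OF that]] .
      show "\<theta> * p0 (W1 y) \<ge> 0" if "y \<ge> 0" for y using p0_pos[OF W1pos(1)[OF ge0[OF that]]] \<theta> by simp
    qed (use s in auto)
    then show ?thesis using W1pos(1)[OF ge0[OF s]] \<beta> W10 by simp
  qed
  obtain V \<rho> r where V: "defining_function \<Omega> V \<sigma> \<rho>" "r > 0" "cball z r \<subseteq> V"
    "\<And>x. x \<in> cball z r \<Longrightarrow> \<bar>laplacian \<rho> x - laplacian \<rho> z\<bar> \<le> 1"
    using defining_function_near[OF z(1) \<sigma>, of 1] by auto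
  define \<kappa> where "\<kappa> = - laplacian \<rho> z + \<sigma>"
  have \<kappa>: "- \<sigma> * laplacian \<rho> x \<le> \<sigma> * \<kappa>" if "x \<in> ball z r" for x
    using V(4)[of x] that \<sigma> by (auto simp: \<kappa>_def)
  define C where "C = 2 * real DIM('a) * M / (m * r\<^sup>2)"
  obtain L where L: "L \<ge> m" "\<And>s. 0 \<le> s \<Longrightarrow> s \<le> b0 + 2 \<Longrightarrow> f s \<le> L * s" using f_le_linear[of "b0 + 2"] by blast
  have smallL: "\<forall>\<^sub>F n in sequentially. l n * (2 * \<bar>\<kappa>\<bar> * sqrt L) < c * \<delta> * m"
    using order_tendstoD(2)[OF tendsto_mult[OF l_tendsto tendsto_const[of "2 * \<bar>\<kappa>\<bar> * sqrt L"]], of "c * \<delta> * m"] cd m by simp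
  have ode: "\<theta> * p0 s > 0 \<and> \<theta> * p0 s * (\<theta> * (f s / p0 s)) \<ge> 0 \<and>
      \<sigma> * (\<theta> * p0 s * (\<theta> * (f s / p0 s)) + l n * \<kappa> * (\<theta> * p0 s) - f s) \<le> 0"
    if s: "0 < s" "s < b0 + 2" and small: "l n * (2 * \<bar>\<kappa>\<bar> * sqrt L) < c * \<delta> * m" for s n
  proof -
    have ps: "p0 s > 0" by (rule p0_pos[OF s(1)])
    have fs: "f s \<ge> m * s" "f s \<ge> 0" using f_ge f_nonneg s by auto
    have e1: "\<theta> * p0 s * (\<theta> * (f s / p0 s)) = \<theta> * \<theta> * f s" using ps by simp
    \<comment> \<open>The speed \<open>\<theta> * p0\<close> leaves the residual
      \<open>(\<theta> * \<theta> - 1) * f\<close>, which has the favourable sign and size at least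
      \<open>c * \<delta> * m * s\<close>; the curvature term is at most \<open>l n\<close> times a
      multiple of \<open>s\<close>.\<close>
    have "\<sigma> * (\<theta> * \<theta> - 1) \<le> - (c * \<delta>)"
    proof -
      have "\<sigma> * (\<theta> * \<theta> - 1) = - 2 * (c * \<delta>) + \<sigma> * ((c * \<delta>) * (c * \<delta>))"
        using \<sigma> by (auto simp: \<theta>_def algebra_simps)
      moreover have "\<sigma> * ((c * \<delta>) * (c * \<delta>)) \<le> 1 * (c * \<delta>)"
      proof -
        have *: "(c * \<delta>) * (c * \<delta>) \<le> c * \<delta>" "0 \<le> (c * \<delta>) * (c * \<delta>)"
          using cd mult_left_le[of "c * \<delta>" "c * \<delta>"] by auto
        show ?thesis using \<sigma>
        proof
          assume "\<sigma> = 1" then show ?thesis using * by simp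
        next
          assume "\<sigma> = -1"
          then have "\<sigma> * ((c * \<delta>) * (c * \<delta>)) = - ((c * \<delta>) * (c * \<delta>))" by simp
          then show ?thesis using * cd(1) by linarith
        qed
      qed
      ultimately show ?thesis by linarith
    qed
    then have "\<sigma> * (\<theta> * \<theta> - 1) * f s \<le> - (c * \<delta>) * f s" using fs by (intro mult_right_mono) auto
    also have "\<dots> \<le> - (c * \<delta>) * (m * s)" using fs cd by (intro mult_left_mono_neg) auto
    finally have 1: "\<sigma> * (\<theta> * \<theta> - 1) * f s \<le> - (c * \<delta> * m * s)" by simp
    have "\<sigma> * (l n * \<kappa> * (\<theta> * p0 s)) \<le> l n * (2 * \<bar>\<kappa>\<bar> * sqrt L) * s"
    proof -
      have "\<bar>\<sigma> * (l n * \<kappa> * (\<theta> * p0 s))\<bar> = l n * \<bar>\<kappa>\<bar> * (\<theta> * p0 s)"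
        using \<sigma>\<sigma> l_pos[of n] \<theta> ps by (simp add: abs_mult)
      also have "\<dots> \<le> l n * \<bar>\<kappa>\<bar> * (2 * (sqrt L * s))"
        using l_pos[of n] \<theta> ps p0_le[OF L(2), of s] s by (intro mult_left_mono mult_mono) auto
      finally show ?thesis by (simp add: mult_ac)
    qed
    also have "\<dots> \<le> c * \<delta> * m * s" using small s by (intro mult_right_mono) auto
    finally have "\<sigma> * (\<theta> * \<theta> - 1) * f s + \<sigma> * (l n * \<kappa> * (\<theta> * p0 s)) \<le> 0" using 1 by linarith
    then have "\<sigma> * (\<theta> * \<theta> * f s + l n * \<kappa> * (\<theta> * p0 s) - f s) \<le> 0" by (simp add: algebra_simps)
    then show ?thesis unfolding e1 using ps \<theta> fs by simp
  qed
  have robin: "\<forall>\<^sub>F n in sequentially. \<sigma> * (\<beta> + \<epsilon> n * \<gamma> / l n * (\<theta> * p0 \<beta>) - b0) \<ge> M * (\<epsilon> n * \<gamma>)\<^sup>2 / r\<^sup>2 - C * (l n)\<^sup>2"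
  proof -
    have "\<sigma> * (\<beta> + \<gamma> / a0 * (\<theta> * p0 \<beta>) - b0) \<ge> \<delta> / 2"
    proof -
      have b: "b0 = bs + \<gamma> / a0 * p0 bs" using bs_eq by simp
      have "\<sigma> * (\<beta> + \<gamma> / a0 * (\<theta> * p0 \<beta>) - b0) = \<delta> + \<gamma> / a0 * (\<sigma> * (p0 \<beta> - p0 bs)) - \<delta> * (c * (\<gamma> / a0 * p0 \<beta>))"
        using \<sigma> by (elim disjE) (simp_all add: b \<beta>_def \<theta>_def algebra_simps)
      moreover have "\<sigma> * (p0 \<beta> - p0 bs) \<ge> 0"
        using \<sigma>
      proof
        assume "\<sigma> = 1"
        then show ?thesis using p0_mono[of bs \<beta>] bs \<delta> by (simp add: \<beta>_def)
      next
        assume "\<sigma> = -1"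
        then show ?thesis using p0_mono[of \<beta> bs] \<beta> \<delta> by (simp add: \<beta>_def)
      qed
      then have "\<gamma> / a0 * (\<sigma> * (p0 \<beta> - p0 bs)) \<ge> 0"
        using \<gamma> a0_pos mult_nonneg_nonneg[of "\<gamma> / a0" "\<sigma> * (p0 \<beta> - p0 bs)"] by simp
      moreover have "\<delta> * (c * (\<gamma> / a0 * p0 \<beta>)) \<le> \<delta> * (1 / 2)"
      proof (rule mult_left_mono)
        have "c * (\<gamma> / a0 * p0 \<beta>) \<le> c * (\<gamma> / a0 * p0 M)"
          using c \<gamma> a0_pos p0_mono[OF \<beta>] by (intro mult_left_mono) auto
        then show "c * (\<gamma> / a0 * p0 \<beta>) \<le> 1 / 2" using c(3) by linarith
      qed (use \<delta> in auto)
      ultimately show ?thesis by linarith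
    qed
    then have pos: "0 < \<sigma> * (\<beta> + \<gamma> / a0 * (\<theta> * p0 \<beta>) - b0)" using \<delta> by linarith
    have "(\<lambda>n. \<sigma> * (\<beta> + \<gamma> / a n * (\<theta> * p0 \<beta>) - b0) - (M * (\<epsilon> n * \<gamma>)\<^sup>2 / r\<^sup>2 - C * (l n)\<^sup>2))
        \<longlonglongrightarrow> \<sigma> * (\<beta> + \<gamma> / a0 * (\<theta> * p0 \<beta>) - b0) - 0"
      by (intro tendsto_intros a_tendsto robin_error_tendsto) (use a0_pos in auto)
    then have "\<forall>\<^sub>F n in sequentially. 0 < \<sigma> * (\<beta> + \<gamma> / a n * (\<theta> * p0 \<beta>) - b0) - (M * (\<epsilon> n * \<gamma>)\<^sup>2 / r\<^sup>2 - C * (l n)\<^sup>2)"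
      using pos by (intro order_tendstoD(1)) auto
    then show ?thesis by eventually_elim (simp add: k_over_l)
  qed
  define x where "x n = z - (l n * \<tau>) *\<^sub>R e" for n
  have lr: "filterlim (\<lambda>n. l n * \<tau>) (at_right 0) sequentially"
    using tendsto_mult[OF l_tendsto tendsto_const, of \<tau>] l_pos \<tau>
    by (auto simp: filterlim_at intro!: always_eventually mult_pos_pos dest: less_imp_neq[symmetric])
  have hz: "height z = 0" using frontier_iff[OF z(2)] z(1) by simp
  have "\<forall>\<^sub>F h in at_right 0. z + h *\<^sub>R - e \<in> \<Omega>"
    using nu_e[of z] slope_pos[of z] by (intro eventually_inside z hz) (simp add: inner_commute)
  then have x\<Omega>: "\<forall>\<^sub>F n in sequentially. x n \<in> \<Omega>"
    using filterlim_iff[THEN iffD1, OF lr] by (auto simp: x_def)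
  have xz: "x \<longlonglongrightarrow> z"
  proof -
    have "(\<lambda>n. z - (l n * \<tau>) *\<^sub>R e) \<longlonglongrightarrow> z - (0 * \<tau>) *\<^sub>R e" by (intro tendsto_intros l_tendsto)
    then show ?thesis by (simp add: x_def[abs_def])
  qed
  have xr: "\<forall>\<^sub>F n in sequentially. x n \<in> cball z r"
    using tendstoD[OF xz V(2)] by eventually_elim (simp add: dist_commute)
  have zV: "z \<in> V" using V(2,3) by auto
  have \<rho>z: "smooth \<rho>" "\<rho> z = 0" "grad \<rho> z = - nu z"
    using V(1) zV z(1) outward_normal_eq[OF z(2,1)] by (auto simp: defining_function_def)
  \<comment> \<open>The defining function has gradient \<open>- nu z\<close> at \<open>z\<close>, so
    along \<open>- e\<close> it grows at the rate \<open>slope z\<close>.\<close>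
  have \<rho>l: "(\<lambda>n. \<rho> (x n) / l n) \<longlonglongrightarrow> t"
  proof -
    have "((\<lambda>h. \<rho> (z + h *\<^sub>R - e)) has_real_derivative grad \<rho> (z + 0 *\<^sub>R - e) \<bullet> - e) (at 0)"
      by (rule has_derivative_along_line[OF smooth_differentiable[OF \<rho>z(1)]])
    then have "((\<lambda>h. \<rho> (z + h *\<^sub>R - e) / h) \<longlongrightarrow> slope z) (at 0)"
      using \<rho>z nu_e by (simp add: DERIV_def)
    then have "((\<lambda>h. \<rho> (z + h *\<^sub>R - e) / h) \<longlongrightarrow> slope z) (at_right 0)" by (simp add: filterlim_at_split)
    from tendsto_mult[OF filterlim_compose[OF this lr] tendsto_const[of \<tau>]]
    show ?thesis using \<tau> by (simp add: x_def t_def)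
  qed
  have W1c: "(\<lambda>n. W1 (\<rho> (x n) / l n)) \<longlonglongrightarrow> W1 t"
    using DERIV_isCont[OF W1'[OF ge0[of t]]] t by (intro isCont_tendsto_compose[OF _ \<rho>l]) auto
  define E where "E n = \<sigma> * W1 (\<rho> (x n) / l n) + M / r\<^sup>2 * (norm (x n - z))\<^sup>2 + C * (l n)\<^sup>2" for n
  have "E \<longlonglongrightarrow> \<sigma> * W1 t + M / r\<^sup>2 * (norm (z - z))\<^sup>2 + C * 0\<^sup>2"
    unfolding E_def by (intro tendsto_intros W1c xz l_tendsto)
  then have El: "E \<longlonglongrightarrow> \<sigma> * h \<delta>" by (simp add: W1_def h_def \<theta>_def sb_def \<beta>_def)
  have "\<sigma> * h \<delta> < \<sigma> * h 0 + e0"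
  proof -
    have "h \<delta> - h 0 < e0" "h 0 - h \<delta> < e0" using d(2)[OF \<delta>(4)] e by linarith+
    then show ?thesis using \<sigma> by auto
  qed
  then have "\<forall>\<^sub>F n in sequentially. E n < \<sigma> * h 0 + e0" by (rule order_tendstoD(2)[OF El])
  then have "\<forall>\<^sub>F n in sequentially. \<sigma> * u n (x n) \<le> \<sigma> * h 0 + e0"
    using smallL robin x\<Omega> xr
  proof eventually_elim
    case (elim n)
    have s: "0 < W1 s" "W1 s < b0 + 2" if "s > 0" for s using W1pos[OF ge0[of s]] that by auto
    have "\<sigma> * u n (x n) \<le> \<sigma> * W1 (\<rho> (x n) / l n) + M / r\<^sup>2 * (norm (x n - z))\<^sup>2 + C * (l n)\<^sup>2"
      unfolding C_def
    proof (rule barrier(1)[OF solves_u l_pos _ _ \<sigma> V(1) z(1) V(2,3) \<kappa> t0' W1' W1M, where p'="\<lambda>s. \<theta> * (f s / p0 s)"])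
      show "\<epsilon> n * \<gamma> \<ge> 0" using \<epsilon>(1)[of n] \<gamma> by simp
      show "b0 \<ge> 0" "b0 \<le> M" using b0 by (auto simp: M_def)
      show "((\<lambda>s. \<theta> * p0 s) has_real_derivative \<theta> * (f (W1 s) / p0 (W1 s))) (at (W1 s))" if "s > 0" for s
        by (rule DERIV_cmult[OF p0_deriv[OF s(1)[OF that]]])
      show "\<theta> * p0 (W1 s) > 0 \<and> \<theta> * p0 (W1 s) * (\<theta> * (f (W1 s) / p0 (W1 s))) \<ge> 0 \<and>
        \<sigma> * (\<theta> * p0 (W1 s) * (\<theta> * (f (W1 s) / p0 (W1 s))) + l n * \<kappa> * (\<theta> * p0 (W1 s)) - f (W1 s)) \<le> 0" if "s > 0" for s
        by (rule ode[OF s[OF that] elim(2)])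
      show "\<sigma> * (W1 0 + \<epsilon> n * \<gamma> / l n * (\<theta> * p0 (W1 0)) - b0) \<ge> M * (\<epsilon> n * \<gamma>)\<^sup>2 / r\<^sup>2 - 2 * real DIM('a) * M / (m * r\<^sup>2) * (l n)\<^sup>2"
        using elim(3) by (simp add: W10 C_def)
      show "x n \<in> closure \<Omega>" using elim(4) closure_subset by blast
      show "x n \<in> cball z r" by (rule elim(5))
    qed
    then show ?case using elim(1) by (simp add: E_def)
  qed
  then show ?thesis by (simp add: h0 x_def t_def M_def)
qed

text \<open>Both signs of \<open>leading_barrier\<close> squeeze the solution. The limit is the
  master profile shifted to start at \<open>bs\<close>.\<close>

lemma leading_profile:
  obtains \<Phi> t0 where "t0 < 0" "\<Phi> 0 = bs" "\<And>t. t > t0 \<Longrightarrow> 0 < \<Phi> t \<and> \<Phi> t < b0 + 2"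
    "\<And>t. t > t0 \<Longrightarrow> (\<Phi> has_real_derivative - p0 (\<Phi> t)) (at t)"
    "\<And>e g U z \<tau>. graph_chart \<Omega> e g U \<Longrightarrow> z \<in> frontier \<Omega> \<Longrightarrow> z \<in> U \<Longrightarrow> \<tau> > 0 \<Longrightarrow>
      (\<lambda>n. u n (z - (l n * \<tau>) *\<^sub>R e)) \<longlonglongrightarrow> \<Phi> (chart.slope g z * \<tau>)"
proof -
  obtain W t0 where W: "t0 < 0" "W 0 = b0 + 1" "\<And>t. t > t0 \<Longrightarrow> 0 < W t \<and> W t < b0 + 2"
      "\<And>t. t > t0 \<Longrightarrow> (W has_real_derivative - p0 (W t)) (at t)"
      "\<And>\<beta>. 0 < \<beta> \<Longrightarrow> \<beta> \<le> b0 + 1 \<Longrightarrow> T0 \<beta> - T0 (b0 + 1) \<ge> 0 \<and> W (T0 \<beta> - T0 (b0 + 1)) = \<beta>"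
    by (rule master_profile, rule that)
  define s where "s = T0 bs - T0 (b0 + 1)"
  have s: "s \<ge> 0" "W s = bs" using W(5)[of bs] bs by (auto simp: s_def)
  show ?thesis
  proof (rule that[of t0 "\<lambda>t. W (t + s)"])
    show "t0 < 0" by (rule W(1))
    show "W (0 + s) = bs" using s by simp
    show "0 < W (t + s) \<and> W (t + s) < b0 + 2" if "t > t0" for t using W(3)[of "t + s"] that s by simp
    show "((\<lambda>t. W (t + s)) has_real_derivative - p0 (W (t + s))) (at t)" if "t > t0" for t
    proof -
      have "t + s > t0" using that s by simp
      from W(4)[OF this] show ?thesis by (simp add: DERIV_shift)
    qed
    fix e g U z \<tau> assume c: "graph_chart \<Omega> e g U" "z \<in> frontier \<Omega>" "z \<in> U" "\<tau> > (0::real)"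
    show "(\<lambda>n. u n (z - (l n * \<tau>) *\<^sub>R e)) \<longlonglongrightarrow> W (chart.slope g z * \<tau> + s)"
    proof (rule tendstoI)
      fix \<delta> :: real assume \<delta>: "\<delta> > 0"
      let ?l = "W (chart.slope g z * \<tau> + s)"
      have "\<forall>\<^sub>F n in sequentially. 1 * u n (z - (l n * \<tau>) *\<^sub>R e) \<le> 1 * ?l + \<delta> / 2"
        unfolding s_def by (rule leading_barrier[OF c _ W]) (use \<delta> in auto)
      moreover have "\<forall>\<^sub>F n in sequentially. -1 * u n (z - (l n * \<tau>) *\<^sub>R e) \<le> -1 * ?l + \<delta> / 2"
        unfolding s_def by (rule leading_barrier[OF c _ W]) (use \<delta> in auto)
      ultimately show "\<forall>\<^sub>F n in sequentially. dist (u n (z - (l n * \<tau>) *\<^sub>R e)) ?l < \<delta>"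
        by eventually_elim (use \<delta> in \<open>auto simp: dist_real_def abs_less_iff\<close>)
    qed
  qed
qed

text \<open>The substitution \<open>s = \<Phi> t\<close> with
  \<open>ds = - p0 (\<Phi> t) dt\<close>. Near zero \<open>q s - q 0\<close> is at most a multiple
  of \<open>s\<close> and \<open>p0 s\<close> at least one, so the integrand of \<open>Q_F\<close>
  is bounded; exponential decay of \<Phi> gives integrability in \<open>t\<close>.\<close>

lemma Q_F_integral:
  assumes \<Phi>: "t0 < 0" "\<Phi> 0 = bs" "\<And>t. t > t0 \<Longrightarrow> 0 < \<Phi> t \<and> \<Phi> t < b0 + 2"
    "\<And>t. t > t0 \<Longrightarrow> (\<Phi> has_real_derivative - p0 (\<Phi> t)) (at t)"
  shows "(\<integral>t. indicator {0<..} t * (q (\<Phi> t) - q 0) \<partial>lborel) = Q_F q f bs"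
proof -
  define B where "B = b0 + 2"
  obtain Lq where Lq: "Lq \<ge> 0" "\<And>s. 0 \<le> s \<Longrightarrow> s \<le> B \<Longrightarrow> \<bar>q s - q 0\<bar> \<le> Lq * s" using q_lipschitz[of B] by blast
  define k where "k s = (q s - q 0) / p0 s" for s
  have sm: "sqrt m > 0" using m by simp
  have kb: "\<bar>k s\<bar> \<le> Lq / sqrt m" if s: "0 < s" "s < B" for s
  proof -
    have "\<bar>q s - q 0\<bar> / p0 s \<le> (Lq * s) / (sqrt m * s)"
      using Lq(2)[of s] p0_ge[of s] Lq(1) s sm by (intro frac_le) auto
    then show ?thesis using s p0_pos[of s] by (simp add: k_def)
  qed
  have ck: "continuous_on {0<..<B} k"
    unfolding k_def using p0_pos by (intro continuous_intros cont_q cont_p0) force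
  have kint: "set_integrable lborel {0<..<s} k" if "s < B" for s
  proof (cases "0 < s")
    case True
    have "(\<lambda>x. indicator {0<..<s} x *\<^sub>R k x) \<in> borel_measurable borel"
      using that by (intro borel_measurable_continuous_on_indicator continuous_on_subset[OF ck]) auto
    then have meas: "(\<lambda>x. indicator {0<..<s} x *\<^sub>R k x) \<in> borel_measurable lborel" by simp
    have "integrable lborel (\<lambda>x. indicator {0<..<s} x * (Lq / sqrt m))"
      using True by (intro integrable_mult_left integrable_real_indicator) auto
    then show ?thesis
      unfolding set_integrable_def
    proof (rule Bochner_Integration.integrable_bound[OF _ meas])
      have "0 \<le> Lq / sqrt m" using Lq(1) sm by simp
      then show "AE x in lborel. norm (indicator {0<..<s} x *\<^sub>R k x) \<le> norm (indicator {0<..<s} x * (Lq / sqrt m))"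
        using kb that Lq(1) sm by (intro AE_I2) (simp split: split_indicator)
    qed
  qed (simp add: set_integrable_def)
  define K where "K s = (LBINT y=0..s. k y)" for s
  have K_bound: "\<bar>K s\<bar> \<le> Lq / sqrt m * s" if s: "0 < s" "s < B" for s
  proof -
    have "K s = (\<integral>x. indicator {0<..<s} x *\<^sub>R k x \<partial>lborel)"
      using s by (simp add: K_def zero_ereal_def interval_lebesgue_integral_def set_lebesgue_integral_def einterval_eq)
    moreover have "norm (\<integral>x. indicator {0<..<s} x *\<^sub>R k x \<partial>lborel) \<le> (\<integral>x. indicator {0<..<s} x * (Lq / sqrt m) \<partial>lborel)"
    proof (rule Bochner_Integration.integral_norm_bound_integral)
      show "integrable lborel (\<lambda>x. indicator {0<..<s} x *\<^sub>R k x)" using kint[OF s(2)] by (simp add: set_integrable_def)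
      show "integrable lborel (\<lambda>x. indicator {0<..<s} x * (Lq / sqrt m))"
        using s by (intro integrable_mult_left integrable_real_indicator) auto
      show "norm (indicator {0<..<s} x *\<^sub>R k x) \<le> indicator {0<..<s} x * (Lq / sqrt m)" for x
        using kb[of x] s by (auto split: split_indicator)
    qed
    ultimately show ?thesis using s by (simp add: mult.commute)
  qed
  have K': "(K has_real_derivative k s) (at s)" if s: "0 < s" "s < B" for s
  proof -
    \<comment> \<open>Continuity of \<open>k\<close> is known on the open interval only, so the
      integral is split at \<open>s / 2\<close> and differentiated away from zero.\<close>
    define a where "a = s / 2"
    define b where "b = (s + B) / 2"
    have ab: "0 < a" "a < s" "s < b" "b < B" using s by (auto simp: a_def b_def)
    have ck': "continuous_on {a..b} k" by (rule continuous_on_subset[OF ck]) (use ab in auto)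
    have d: "((\<lambda>y. (LBINT x=ereal 0..ereal a. k x) + (LBINT x=ereal a..ereal y. k x)) has_real_derivative 0 + k s) (at s)"
      by (intro DERIV_add DERIV_const interval_integral_has_derivative[OF ck']) (use ab in auto)
    have e: "(LBINT x=ereal 0..ereal a. k x) + (LBINT x=ereal a..ereal y. k x) = K y" if y: "a < y" "y < b" for y
      unfolding K_def zero_ereal_def
      using ab y kint[of y] by (intro interval_integral_sum)
        (auto simp: interval_lebesgue_integrable_def einterval_eq min_def max_def)
    show ?thesis
      by (rule has_field_derivative_transform_within_open[OF d[simplified], of "{a<..<b}"]) (use ab e in auto)
  qed
  have decay: "\<Phi> t \<le> bs * exp (- (sqrt m * t))" if t: "t \<ge> 0" for t
  proof -
    have "(\<lambda>t. \<Phi> t * exp (sqrt m * t)) t \<le> (\<lambda>t. \<Phi> t * exp (sqrt m * t)) 0"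
    proof (rule DERIV_nonpos_imp_nonincreasing[OF t])
      fix x :: real assume "0 \<le> x"
      then have x: "x > t0" using \<Phi>(1) by linarith
      have "((\<lambda>t. \<Phi> t * exp (sqrt m * t)) has_real_derivative - p0 (\<Phi> x) * exp (sqrt m * x) + (sqrt m * exp (sqrt m * x)) * \<Phi> x) (at x)"
        by (rule DERIV_mult[OF \<Phi>(4)[OF x]]) (auto intro!: derivative_eq_intros)
      moreover have "- p0 (\<Phi> x) * exp (sqrt m * x) + (sqrt m * exp (sqrt m * x)) * \<Phi> x = (sqrt m * \<Phi> x - p0 (\<Phi> x)) * exp (sqrt m * x)"
        by (simp add: algebra_simps)
      moreover have "\<dots> \<le> 0" using p0_ge[of "\<Phi> x"] \<Phi>(3)[OF x] by (intro mult_nonpos_nonneg) auto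
      ultimately show "\<exists>y. ((\<lambda>t. \<Phi> t * exp (sqrt m * t)) has_real_derivative y) (at x) \<and> y \<le> 0" by metis
    qed
    then show ?thesis using \<Phi>(2) by (simp add: exp_minus field_simps)
  qed
  have c\<Phi>: "isCont \<Phi> t" if "t \<ge> 0" for t using \<Phi>(1,4) that DERIV_isCont by (metis order.strict_trans2)
  have \<Phi>0: "0 < \<Phi> t" "\<Phi> t < B" if "t \<ge> 0" for t using \<Phi>(3)[of t] \<Phi>(1) that by (auto simp: B_def)
  have set: "einterval (ereal 0) \<infinity> = {0<..}" by (simp add: einterval_eq)
  have si: "set_integrable lborel {0<..} (\<lambda>t. q (\<Phi> t) - q 0)"
  proof -
    have "integrable lborel (\<lambda>t. (Lq * bs) * (indicator {0..} t * exp (- (sqrt m * t))))"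
      by (intro integrable_mult_right exp_integral_atLeast(2)[OF sm])
    then show ?thesis unfolding set_integrable_def
    proof (rule Bochner_Integration.integrable_bound)
      have "continuous_on {0<..} (\<lambda>t. q (\<Phi> t) - q 0)"
        by (intro continuous_intros continuous_on_compose2[OF cont_q[of UNIV]])
          (auto intro!: continuous_at_imp_continuous_on c\<Phi>)
      then show "(\<lambda>t. indicator {0<..} t *\<^sub>R (q (\<Phi> t) - q 0)) \<in> borel_measurable lborel"
        using borel_measurable_continuous_on_indicator[of "{0<..}" "\<lambda>t. q (\<Phi> t) - q 0"] by simp
      show "AE t in lborel. norm (indicator {0<..} t *\<^sub>R (q (\<Phi> t) - q 0)) \<le> norm ((Lq * bs) * (indicator {0..} t * exp (- (sqrt m * t))))"
      proof (rule AE_I2)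
        fix t :: real
        show "norm (indicator {0<..} t *\<^sub>R (q (\<Phi> t) - q 0)) \<le> norm ((Lq * bs) * (indicator {0..} t * exp (- (sqrt m * t))))"
        proof (cases "t > 0")
          case True
          then have "\<bar>q (\<Phi> t) - q 0\<bar> \<le> Lq * \<Phi> t" using \<Phi>0[of t] by (intro Lq(2)) auto
          also have "\<dots> \<le> Lq * (bs * exp (- (sqrt m * t)))" using decay[of t] True Lq(1) by (intro mult_left_mono) auto
          finally show ?thesis using True Lq(1) bs(1) by (simp add: abs_mult mult.assoc)
        qed simp
      qed
    qed
  qed
  have "(LBINT t=ereal 0..\<infinity>. q (\<Phi> t) - q 0) = 0 - (- K bs)"
  proof (rule interval_integral_FTC_integrable[where F="\<lambda>t. - K (\<Phi> t)"])
    show "((\<lambda>t. - K (\<Phi> t)) has_vector_derivative q (\<Phi> t) - q 0) (at t)" if "ereal 0 < ereal t" for t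
    proof -
      have t: "t \<ge> 0" "t > t0" using that \<Phi>(1) by auto
      note p = \<Phi>0[OF t(1)]
      have "((\<lambda>t. - K (\<Phi> t)) has_real_derivative - (k (\<Phi> t) * (- p0 (\<Phi> t)))) (at t)"
        by (intro DERIV_minus DERIV_chain2[OF K'[OF p] \<Phi>(4)[OF t(2)]])
      moreover have "- (k (\<Phi> t) * (- p0 (\<Phi> t))) = q (\<Phi> t) - q 0" using p0_pos[OF p(1)] by (simp add: k_def)
      ultimately show ?thesis by (simp add: has_real_derivative_iff_has_vector_derivative)
    qed
    show "isCont (\<lambda>t. q (\<Phi> t) - q 0) t" if "ereal 0 < ereal t" for t
      using that by (intro continuous_intros isCont_o2[OF c\<Phi>] DERIV_isCont[OF q']) auto
    show "set_integrable lborel (einterval (ereal 0) \<infinity>) (\<lambda>t. q (\<Phi> t) - q 0)" unfolding set by (rule si)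
    have "isCont (\<lambda>t. - K (\<Phi> t)) 0"
      using \<Phi>0[of 0] by (intro continuous_intros isCont_o2[OF c\<Phi>] DERIV_isCont[OF K']) auto
    then have "((\<lambda>t. - K (\<Phi> t)) \<longlongrightarrow> - K bs) (at_right 0)"
      using \<Phi>(2) by (simp add: isCont_def filterlim_at_split)
    then show "(((\<lambda>t. - K (\<Phi> t)) \<circ> real_of_ereal) \<longlongrightarrow> - K bs) (at_right (ereal 0))"
      by (simp add: ereal_tendsto_simps)
    have "((\<lambda>t. - K (\<Phi> t)) \<longlongrightarrow> 0) at_top"
    proof (rule Lim_null_comparison)
      show "\<forall>\<^sub>F t in at_top. norm (- K (\<Phi> t)) \<le> (Lq / sqrt m * bs) * exp (- (sqrt m * t))"
        using eventually_ge_at_top[of 0]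
      proof eventually_elim
        case (elim t)
        have "\<bar>K (\<Phi> t)\<bar> \<le> Lq / sqrt m * \<Phi> t" using \<Phi>0[OF elim] by (rule K_bound)
        also have "\<dots> \<le> Lq / sqrt m * (bs * exp (- (sqrt m * t)))"
          using decay[OF elim] Lq(1) sm by (intro mult_left_mono) auto
        finally show ?case by (simp add: mult.assoc)
      qed
      have "filterlim (\<lambda>t. sqrt m * t) at_top at_top"
        by (rule filterlim_tendsto_pos_mult_at_top[OF tendsto_const sm filterlim_ident])
      then have "filterlim (\<lambda>t. - (sqrt m * t)) at_bot at_top" by (simp add: filterlim_uminus_at_bot)
      then have "((\<lambda>t. exp (- (sqrt m * t))) \<longlongrightarrow> 0) at_top" by (rule filterlim_compose[OF exp_at_bot])
      from tendsto_mult[OF tendsto_const this, of "Lq / sqrt m * bs"]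
      show "((\<lambda>t. (Lq / sqrt m * bs) * exp (- (sqrt m * t))) \<longlongrightarrow> 0) at_top" by simp
    qed
    then show "(((\<lambda>t. - K (\<Phi> t)) \<circ> real_of_ereal) \<longlongrightarrow> 0) (at_left \<infinity>)"
      by (simp add: ereal_tendsto_simps)
  qed simp
  moreover have "(LBINT t=ereal 0..\<infinity>. q (\<Phi> t) - q 0) = (\<integral>t. indicator {0<..} t * (q (\<Phi> t) - q 0) \<partial>lborel)"
    by (simp add: interval_lebesgue_integral_def set set_lebesgue_integral_def)
  moreover have "K bs = Q_F q f bs" by (simp add: K_def Q_F_def k_def p0_def)
  ultimately show ?thesis by simp
qed

text \<open>The integrand \<open>q (u) - q 0\<close> is concentrated in a layer of width
  \<open>l n\<close>, whose mass is given by \<open>boundary_layer_limit\<close>; the factor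
  \<open>a0\<close> comes from \<open>l n = \<epsilon> n * a n\<close>.\<close>

lemma average_expansion:
  "(\<lambda>n. (avg n - q 0) / \<epsilon> n) \<longlonglongrightarrow> a0 * surface_area \<Omega> * Q_F q f bs / measure lborel \<Omega>"
proof -
  obtain \<Phi> t0 where \<Phi>: "t0 < 0" "\<Phi> 0 = bs" "\<And>t. t > t0 \<Longrightarrow> 0 < \<Phi> t \<and> \<Phi> t < b0 + 2"
    "\<And>t. t > t0 \<Longrightarrow> (\<Phi> has_real_derivative - p0 (\<Phi> t)) (at t)"
    "\<And>e g U z \<tau>. graph_chart \<Omega> e g U \<Longrightarrow> z \<in> frontier \<Omega> \<Longrightarrow> z \<in> U \<Longrightarrow> \<tau> > 0 \<Longrightarrow>
      (\<lambda>n. u n (z - (l n * \<tau>) *\<^sub>R e)) \<longlonglongrightarrow> \<Phi> (chart.slope g z * \<tau>)"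
    by (rule leading_profile, rule that)
  obtain C \<mu> where C: "\<mu> > 0" "\<And>n x. x \<in> \<Omega> \<Longrightarrow> \<bar>q (u n x) - q 0\<bar> \<le> C * exp (- (\<mu> * infdist x (frontier \<Omega>) / l n))"
    using u_decay by blast
  have "(\<lambda>n. (\<integral>x. indicator \<Omega> x * (q (u n x) - q 0) \<partial>lborel) / l n)
      \<longlonglongrightarrow> surface_area \<Omega> * (\<integral>t. indicator {0<..} t * (q (\<Phi> t) - q 0) \<partial>lborel)"
  proof (rule boundary_layer_limit[OF l_pos l_tendsto q_diff_measurable C(2) C(1)])
    fix e g U z \<tau> assume c: "graph_chart \<Omega> e g U" "z \<in> frontier \<Omega>" "z \<in> U" "\<tau> > (0::real)"
    show "(\<lambda>n. q (u n (z - (l n * \<tau>) *\<^sub>R e)) - q 0) \<longlonglongrightarrow> q (\<Phi> (chart.slope g z * \<tau>)) - q 0"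
      by (rule tendsto_diff[OF isCont_tendsto_compose[OF DERIV_isCont[OF q'] \<Phi>(5)[OF c]] tendsto_const])
  qed
  then have "(\<lambda>n. (\<integral>x. indicator \<Omega> x * (q (u n x) - q 0) \<partial>lborel) / l n) \<longlonglongrightarrow> surface_area \<Omega> * Q_F q f bs"
    by (simp add: Q_F_integral[OF \<Phi>(1-4)])
  from tendsto_mult[OF tendsto_mult[OF a_tendsto this] tendsto_const[of "1 / measure lborel \<Omega>"]]
  have "(\<lambda>n. a n * ((\<integral>x. indicator \<Omega> x * (q (u n x) - q 0) \<partial>lborel) / l n) * (1 / measure lborel \<Omega>))
    \<longlonglongrightarrow> a0 * (surface_area \<Omega> * Q_F q f bs) * (1 / measure lborel \<Omega>)" .
  moreover have "a n * ((\<integral>x. indicator \<Omega> x * (q (u n x) - q 0) \<partial>lborel) / l n) * (1 / measure lborel \<Omega>) = (avg n - q 0) / \<epsilon> n" for n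
    using a_pos[of n] by (simp add: avg_diff l_def field_simps)
  ultimately show ?thesis by (simp add: mult.assoc)
qed

lemma inverse_a_expansion:
  "(\<lambda>n. (1 / a n - 1 / a0) / \<epsilon> n)
    \<longlonglongrightarrow> - (surface_area \<Omega> * deriv A (q 0) * Q_F q f bs / (2 * A (q 0) * measure lborel \<Omega>))"
proof -
  have d: "((\<lambda>t. 1 / sqrt (A t)) has_real_derivative - (deriv A (q 0) / (2 * A (q 0) * a0))) (at (q 0))"
    unfolding a0_def using A[of "q 0"]
    by (auto intro!: derivative_eq_intros A' simp: field_simps)
  have "(\<lambda>n. (1 / sqrt (A (avg n)) - 1 / sqrt (A (q 0))) / \<epsilon> n)
    \<longlonglongrightarrow> - (deriv A (q 0) / (2 * A (q 0) * a0)) * (a0 * surface_area \<Omega> * Q_F q f bs / measure lborel \<Omega>)"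
    by (rule difference_quotient_compose[OF d avg_tendsto average_expansion])
  then show ?thesis using a0_pos by (simp add: a_def a0_def[symmetric] mult_ac)
qed

end

section \<open>The first-order expansion\<close>

context bvp_sequence
begin

text \<open>Equals \<open>p0 bs\<close> times the derivative at \<open>bs\<close> of
  \<open>\<beta> + \<gamma> * p0 \<beta> / a0\<close>, the leading order of the left side of the
  Robin condition.\<close>

definition "den = \<gamma> * f bs / a0 + p0 bs"
text \<open>The coefficient of \<open>\<epsilon> n\<close> in \<open>1 / a n\<close>, by
  \<open>inverse_a_expansion\<close>.\<close>

definition "D2 = - (surface_area \<Omega> * deriv A (q 0) * Q_F q f bs / (2 * A (q 0) * measure lborel \<Omega>))"
definition "h x = (real DIM('a) - 1) * mean_curvature \<Omega> x"

lemma den_pos: "den > 0"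
proof -
  have "\<gamma> * f bs / a0 \<ge> 0" using \<gamma> f_nonneg[of bs] bs a0_pos by simp
  then show ?thesis using p0_pos[OF bs(1)] by (simp add: den_def)
qed

text \<open>Since \<open>p0 bs * p0 bs = 2 * F bs\<close>, the nonlocal summand is the contribution
  of \<open>D2\<close>; in this form it matches what the barriers produce.\<close>

lemma G_term_eq: "G_term \<Omega> A q f bs x = h x * P0 bs - p0 bs * p0 bs * D2"
proof -
  have "P0 bs = (LBINT s=0..bs. sqrt (2 * primitive f s))" unfolding P0_def p0_def ..
  then show ?thesis using p0_sq[of bs] bs by (simp add: G_term_def h_def D2_def field_simps)
qed

text \<open>Three independent contributions of order \<open>\<epsilon> n\<close>: the changed
  starting value, the changed diffusion coefficient, and the curvature.\<close>

lemma flux_expansion: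
  assumes \<beta>: "\<beta> \<longlonglongrightarrow> bs" "(\<lambda>n. (\<beta> n - bs) / \<epsilon> n) \<longlonglongrightarrow> y"
  shows "(\<lambda>n. ((p0 (\<beta> n) - l n * \<kappa> * p1 (\<beta> n)) / a n - p0 bs / a0) / \<epsilon> n)
    \<longlonglongrightarrow> f bs / p0 bs * y / a0 + p0 bs * D2 - \<kappa> * p1 bs"
proof -
  have p1: "(\<lambda>n. p1 (\<beta> n)) \<longlonglongrightarrow> p1 bs"
    by (rule isCont_tendsto_compose[OF DERIV_isCont[OF p1_deriv[OF bs(1)]] \<beta>(1)])
  have "(\<lambda>n. (p0 (\<beta> n) - p0 bs) / \<epsilon> n) \<longlonglongrightarrow> f bs / p0 bs * y"
    by (rule difference_quotient_compose[OF p0_deriv[OF bs(1)] \<beta>])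
  then have "(\<lambda>n. (p0 (\<beta> n) - p0 bs) / \<epsilon> n / a n + p0 bs * ((1 / a n - 1 / a0) / \<epsilon> n) - \<kappa> * p1 (\<beta> n))
    \<longlonglongrightarrow> f bs / p0 bs * y / a0 + p0 bs * D2 - \<kappa> * p1 bs"
    unfolding D2_def using a0_pos by (intro tendsto_intros inverse_a_expansion a_tendsto p1) auto
  moreover have "(p0 (\<beta> n) - p0 bs) / \<epsilon> n / a n + p0 bs * ((1 / a n - 1 / a0) / \<epsilon> n) - \<kappa> * p1 (\<beta> n)
      = ((p0 (\<beta> n) - l n * \<kappa> * p1 (\<beta> n)) / a n - p0 bs / a0) / \<epsilon> n" for n
    using a_pos[of n] \<epsilon>(1)[of n] a0_pos by (simp add: l_def field_simps)
  ultimately show ?thesis by simp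
qed

text \<open>The barrier starts at the predicted boundary value, shifted by a multiple of \<delta>.
  For \<open>\<gamma> > 0\<close> the shift leaves a first-order margin in the Robin condition. For
  \<open>\<gamma> = 0\<close> the boundary value is prescribed, the barrier touches \<open>u\<close>
  at its centre, and the touching part of \<open>barrier\<close> bounds the normal
  derivative.\<close>

lemma one_sided_expansion:
  assumes p: "p \<in> frontier \<Omega>" and \<sigma>: "\<sigma> = 1 \<or> \<sigma> = -1" and \<delta>: "\<delta> > 0"
  defines "G \<equiv> G_term \<Omega> A q f bs"
  shows "\<exists>r>0. (\<forall>x\<in>frontier \<Omega> \<inter> ball p r. \<bar>G x - G p\<bar> \<le> \<delta> * P0 bs) \<and>
    (\<forall>\<^sub>F n in sequentially. \<forall>x\<in>frontier \<Omega> \<inter> ball p r.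
      \<sigma> * ((u n x - bs) / \<epsilon> n - \<gamma> * G p / den) \<le> \<gamma> * (3 * \<delta> * (P0 bs + 1) / den) \<and>
      (\<gamma> = 0 \<longrightarrow> \<sigma> * (normal_deriv \<Omega> (u n) x - (p0 bs / (a0 * \<epsilon> n) - G p / den)) \<ge> - (\<delta> * (2 * p1 bs + 1))))"
proof -
  obtain V \<rho> r0 where V: "defining_function \<Omega> V \<sigma> \<rho>" "r0 > 0" "cball p r0 \<subseteq> V"
    "\<And>x. x \<in> cball p r0 \<Longrightarrow> \<bar>laplacian \<rho> x - laplacian \<rho> p\<bar> \<le> \<delta>"
    using defining_function_near[OF p \<sigma> \<delta>] by auto
  \<comment> \<open>Balls of radius \<open>r\<close> around all centres within \<open>r\<close> of
    \<open>p\<close> stay where the defining function is controlled, so the estimates are uniform in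
    the centre.\<close>
  define r where "r = r0 / 2"
  have r: "r > 0" using V by (simp add: r_def)
  have pV: "p \<in> V" using V(2,3) by auto
  have lap: "laplacian \<rho> x = - h x" if "x \<in> frontier \<Omega>" "x \<in> V" for x
    using defining_function_laplacian[OF V(1) that(2,1)] by (simp add: h_def)
  have \<sigma>\<sigma>: "\<sigma> * \<sigma> = 1" using \<sigma> by auto
  have P0: "P0 bs \<ge> 0" using P0_bounds[OF bs(1)] by simp
  have ps: "p0 bs > 0" by (rule p0_pos[OF bs(1)])
  \<comment> \<open>Makes \<open>d * (den / p0 bs) - 2 * \<delta> * p1 bs\<close> equal to
    \<open>\<delta> * (P0 bs + 3) / p0 bs\<close>, hence positive.\<close>
  define d where "d = 3 * \<delta> * (P0 bs + 1) / den"
  \<comment> \<open>One \<delta> covers the variation of the Laplacian in the ball, the other is the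
    margin required by \<open>corrected_profile\<close>.\<close>
  define \<kappa> where "\<kappa> = h p + 2 * \<sigma> * \<delta>"
  define M where "M = b0 + 1"
  define C where "C = 2 * real DIM('a) * M / (m * r\<^sup>2)"
  define y where "y = \<gamma> * G p / den + \<sigma> * \<gamma> * d"
  \<comment> \<open>The last term cancels the constant \<open>C * (l n)\<^sup>2\<close> that
    \<open>barrier\<close> adds, so the bound at the centre is exactly
    \<open>bs + \<epsilon> n * y\<close>, up to the sign \<sigma>.\<close>
  define \<beta> where "\<beta> n = bs + \<epsilon> n * y - \<sigma> * C * (l n)\<^sup>2" for n
  define P where "P n s = p0 s - l n * \<kappa> * p1 s" for n s
  define P' where "P' n s = f s / p0 s - l n * \<kappa> * (1 - p1 s * f s / (p0 s * p0 s))" for n s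
  define Z where "Z = f bs / p0 bs * y / a0 + p0 bs * D2 - \<kappa> * p1 bs"
  have G: "\<bar>G x - G p\<bar> \<le> \<delta> * P0 bs" if x: "x \<in> frontier \<Omega> \<inter> ball p r" for x
  proof -
    have xc: "x \<in> cball p r0" using x V(2) by (simp add: r_def)
    then have "\<bar>h x - h p\<bar> \<le> \<delta>" using V(3,4) lap[of x] lap[OF p pV] x by fastforce
    then have "\<bar>h x - h p\<bar> * P0 bs \<le> \<delta> * P0 bs" using P0 by (intro mult_right_mono)
    moreover have "G x - G p = (h x - h p) * P0 bs" by (simp add: G_def G_term_eq algebra_simps)
    ultimately show ?thesis using P0 by (simp add: abs_mult)
  qed
  have \<beta>_lim: "\<beta> \<longlonglongrightarrow> bs"
  proof -
    have "\<beta> \<longlonglongrightarrow> bs + 0 * y - \<sigma> * C * 0\<^sup>2" unfolding \<beta>_def[abs_def] by (intro tendsto_intros \<epsilon>(2) l_tendsto)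
    then show ?thesis by simp
  qed
  have l2: "(\<lambda>n. (l n)\<^sup>2 / \<epsilon> n) \<longlonglongrightarrow> 0"
  proof -
    have "(\<lambda>n. l n * a n) \<longlonglongrightarrow> 0 * a0" by (intro tendsto_intros l_tendsto a_tendsto)
    moreover have "(l n)\<^sup>2 / \<epsilon> n = l n * a n" for n using \<epsilon>(1)[of n] by (simp add: l_def power2_eq_square)
    ultimately show ?thesis by simp
  qed
  have \<beta>_quot: "(\<lambda>n. (\<beta> n - bs) / \<epsilon> n) \<longlonglongrightarrow> y"
  proof -
    have "(\<lambda>n. y - \<sigma> * C * ((l n)\<^sup>2 / \<epsilon> n)) \<longlonglongrightarrow> y - \<sigma> * C * 0" by (intro tendsto_intros l2)
    moreover have "(\<beta> n - bs) / \<epsilon> n = y - \<sigma> * C * ((l n)\<^sup>2 / \<epsilon> n)" for n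
      using \<epsilon>(1)[of n] by (simp add: \<beta>_def field_simps)
    ultimately show ?thesis by simp
  qed
  have flux: "(\<lambda>n. (P n (\<beta> n) / a n - p0 bs / a0) / \<epsilon> n) \<longlonglongrightarrow> Z"
    unfolding P_def Z_def by (rule flux_expansion[OF \<beta>_lim \<beta>_quot])
  have Z: "Z = f bs / (p0 bs * a0) * y - G p / p0 bs - 2 * \<sigma> * \<delta> * p1 bs"
    using ps a0_pos by (simp add: Z_def G_def G_term_eq \<kappa>_def p1_def field_simps)
  have den: "den / p0 bs = 1 + \<gamma> * f bs / (p0 bs * a0)" using ps by (simp add: den_def field_simps)
  \<comment> \<open>\<open>y + \<gamma> * Z\<close> is the coefficient of
    \<open>\<epsilon> n\<close> in the Robin expression of the barrier; the predicted terms cancel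
    and only the margins remain, times \<gamma>.\<close>
  have yZ: "\<sigma> * (y + \<gamma> * Z) = \<gamma> * (d * (den / p0 bs) - 2 * \<delta> * p1 bs)"
  proof -
    have "y + \<gamma> * Z = y * (den / p0 bs) - \<gamma> * G p / p0 bs - 2 * \<sigma> * \<gamma> * \<delta> * p1 bs"
      by (simp add: Z den algebra_simps)
    also have "y * (den / p0 bs) = \<gamma> * G p / p0 bs + \<sigma> * \<gamma> * d * (den / p0 bs)"
      using den_pos ps by (simp add: y_def add_divide_distrib distrib_right)
    finally have "y + \<gamma> * Z = \<sigma> * (\<gamma> * (d * (den / p0 bs) - 2 * \<delta> * p1 bs))" by (simp add: algebra_simps)
    then have "\<sigma> * (y + \<gamma> * Z) = (\<sigma> * \<sigma>) * (\<gamma> * (d * (den / p0 bs) - 2 * \<delta> * p1 bs))" by (simp only: mult.assoc)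
    then show ?thesis by (simp add: \<sigma>\<sigma>)
  qed
  have robin: "\<forall>\<^sub>F n in sequentially. \<sigma> * (\<beta> n + \<epsilon> n * \<gamma> / l n * P n (\<beta> n) - b0)
      \<ge> M * (\<epsilon> n * \<gamma>)\<^sup>2 / r\<^sup>2 - 2 * real DIM('a) * M / (m * r\<^sup>2) * (l n)\<^sup>2"
  proof (cases "\<gamma> = 0")
    case True
    have "\<sigma> * (\<beta> n - b0) = - (C * (l n)\<^sup>2)" for n
    proof -
      have "\<beta> n - b0 = - (\<sigma> * (C * (l n)\<^sup>2))" using bs_eq True by (simp add: \<beta>_def y_def)
      then have "\<sigma> * (\<beta> n - b0) = - ((\<sigma> * \<sigma>) * (C * (l n)\<^sup>2))" by (simp only: mult_minus_right mult.assoc)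
      then show ?thesis by (simp add: \<sigma>\<sigma>)
    qed
    then show ?thesis using True by (simp add: C_def)
  next
    case False
    then have \<gamma>0: "\<gamma> > 0" using \<gamma> by simp
    have "d * (den / p0 bs) - 2 * \<delta> * p1 bs = \<delta> * (P0 bs + 3) / p0 bs"
      using den_pos ps by (simp add: d_def p1_def field_simps)
    then have pos: "\<sigma> * (y + \<gamma> * Z) > 0" unfolding yZ using \<gamma>0 \<delta> P0 ps by simp
    have "(\<lambda>n. \<sigma> * ((\<beta> n - bs) / \<epsilon> n + \<gamma> * ((P n (\<beta> n) / a n - p0 bs / a0) / \<epsilon> n))
        - (M * \<gamma>\<^sup>2 * \<epsilon> n * (1 / r\<^sup>2) - C * ((l n)\<^sup>2 / \<epsilon> n)))
      \<longlonglongrightarrow> \<sigma> * (y + \<gamma> * Z) - (M * \<gamma>\<^sup>2 * 0 * (1 / r\<^sup>2) - C * 0)"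
      by (intro tendsto_intros \<beta>_quot flux \<epsilon>(2) l2)
    then have "\<forall>\<^sub>F n in sequentially. 0 < \<sigma> * ((\<beta> n - bs) / \<epsilon> n + \<gamma> * ((P n (\<beta> n) / a n - p0 bs / a0) / \<epsilon> n))
        - (M * \<gamma>\<^sup>2 * \<epsilon> n * (1 / r\<^sup>2) - C * ((l n)\<^sup>2 / \<epsilon> n))"
      using pos by (intro order_tendstoD(1)) auto
    then show ?thesis
    proof eventually_elim
      case (elim n)
      have e: "\<epsilon> n > 0" by (rule \<epsilon>(1))
      have "0 < \<epsilon> n * (\<sigma> * ((\<beta> n - bs) / \<epsilon> n + \<gamma> * ((P n (\<beta> n) / a n - p0 bs / a0) / \<epsilon> n))
        - (M * \<gamma>\<^sup>2 * \<epsilon> n * (1 / r\<^sup>2) - C * ((l n)\<^sup>2 / \<epsilon> n)))"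
        by (rule mult_pos_pos[OF e elim])
      also have "\<dots> = \<sigma> * (\<epsilon> n * ((\<beta> n - bs) / \<epsilon> n) + \<gamma> * (\<epsilon> n * ((P n (\<beta> n) / a n - p0 bs / a0) / \<epsilon> n)))
        - (M * (\<epsilon> n * \<gamma>)\<^sup>2 * (1 / r\<^sup>2) - C * (\<epsilon> n * ((l n)\<^sup>2 / \<epsilon> n)))"
        by (simp only: power2_eq_square algebra_simps)
      also have "\<dots> = \<sigma> * (\<beta> n - bs + \<gamma> * (P n (\<beta> n) / a n - p0 bs / a0)) - (M * (\<epsilon> n * \<gamma>)\<^sup>2 / r\<^sup>2 - C * (l n)\<^sup>2)"
        using e by simp
      also have "\<beta> n - bs + \<gamma> * (P n (\<beta> n) / a n - p0 bs / a0) = \<beta> n + \<gamma> / a n * P n (\<beta> n) - b0"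
        using bs_eq by (simp add: algebra_simps)
      finally show ?case by (simp add: k_over_l C_def)
    qed
  qed
  have B: "b0 + 2 > 0" using b0 by simp
  obtain l0 L where l0: "l0 > 0" "L > 0" and cp0: "\<forall>l. 0 < l \<longrightarrow> l < l0 \<longrightarrow> (\<forall>s. 0 < s \<longrightarrow> s < b0 + 2 \<longrightarrow>
    (let p = \<lambda>s. p0 s - l * \<kappa> * p1 s; p' = f s / p0 s - l * \<kappa> * (1 - p1 s * f s / (p0 s * p0 s)) in
      (p has_real_derivative p') (at s) \<and> p s > 0 \<and> p s \<le> L * s \<and> p s * p' \<ge> 0 \<and>
      \<sigma> * (p s * p' + l * (\<kappa> - \<sigma> * \<delta>) * p s - f s) \<le> 0))"
    using corrected_profile[OF B \<delta> \<sigma>, of \<kappa>] by blast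
  have cp: "\<And>n s. l n < l0 \<Longrightarrow> 0 < s \<Longrightarrow> s < b0 + 2 \<Longrightarrow>
      (P n has_real_derivative P' n s) (at s) \<and> P n s > 0 \<and> P n s \<le> L * s \<and> P n s * P' n s \<ge> 0 \<and>
      \<sigma> * (P n s * P' n s + l n * (\<kappa> - \<sigma> * \<delta>) * P n s - f s) \<le> 0"
    using cp0 l_pos unfolding P_def[abs_def] P'_def Let_def by blast
  have ev1: "\<forall>\<^sub>F n in sequentially. l n < l0" using order_tendstoD(2)[OF l_tendsto l0(1)] .
  have ev2: "\<forall>\<^sub>F n in sequentially. 0 < \<beta> n" using order_tendstoD(1)[OF \<beta>_lim bs(1)] .
  have ev3: "\<forall>\<^sub>F n in sequentially. \<beta> n < M" using order_tendstoD(2)[OF \<beta>_lim, of M] bs by (simp add: M_def)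
  have ev4: "\<forall>\<^sub>F n in sequentially. \<sigma> * Z - \<delta> < \<sigma> * ((P n (\<beta> n) / a n - p0 bs / a0) / \<epsilon> n)"
    by (rule order_tendstoD(1)[OF tendsto_mult[OF tendsto_const flux]]) (use \<delta> in simp)
  have "\<forall>\<^sub>F n in sequentially. \<forall>x\<in>frontier \<Omega> \<inter> ball p r.
      \<sigma> * ((u n x - bs) / \<epsilon> n - \<gamma> * G p / den) \<le> \<gamma> * d \<and>
      (\<gamma> = 0 \<longrightarrow> \<sigma> * (normal_deriv \<Omega> (u n) x - (p0 bs / (a0 * \<epsilon> n) - G p / den)) \<ge> - (\<delta> * (2 * p1 bs + 1)))"
    using robin ev1 ev2 ev3 ev4
  proof eventually_elim
    case (elim n)
    have e: "\<epsilon> n > 0" by (rule \<epsilon>(1))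
    have ln: "l n > 0" by (rule l_pos)
    note cpn = cp[OF elim(2)]
    have MB: "M < b0 + 2" by (simp add: M_def)
    have \<beta>B: "\<beta> n < b0 + 2" using elim(4) MB by linarith
    have cont: "continuous_on {0<..<b0 + 2} (P n)"
    proof (rule DERIV_continuous_on)
      fix s assume "s \<in> {0<..<b0 + 2}"
      then have "(P n has_real_derivative P' n s) (at s)" using cpn[of s] by simp
      then show "(P n has_real_derivative P' n s) (at s within {0<..<b0 + 2})" by (rule has_field_derivative_at_within)
    qed
    obtain T where T: "\<And>s. 0 < s \<Longrightarrow> s < b0 + 2 \<Longrightarrow> (T has_real_derivative - (1 / P n s)) (at s)"
      using inverse_antiderivative_exists[OF cont _ B] cpn by blast
    obtain W t0 where W: "t0 < 0" "W 0 = \<beta> n" "\<And>t. t > t0 \<Longrightarrow> 0 < W t \<and> W t < b0 + 2"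
        "\<And>t. t > t0 \<Longrightarrow> (W has_real_derivative - P n (W t)) (at t)"
      by (rule profile_exists[of "\<beta> n" "b0 + 2" "P n" L T]) (use elim(3) \<beta>B cpn l0 T in auto)
    have W0: "0 < W t \<and> W t \<le> M" if t: "t \<ge> 0" for t
    proof -
      have "W t \<le> W 0"
      proof (rule profile_antitone[where W=W and p="P n" and s=0 and t=t])
        show "(W has_real_derivative - P n (W s)) (at s)" if "s \<ge> 0" for s using W(1) that by (intro W(4)) linarith
        show "P n (W s) \<ge> 0" if "s \<ge> 0" for s
        proof -
          have "0 < W s \<and> W s < b0 + 2" using W(1) that by (intro W(3)) linarith
          then show ?thesis using cpn[of "W s"] by auto
        qed
      qed (use t in auto)
      moreover have "0 < W t" using W(3)[of t] W(1) t by auto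
      ultimately show ?thesis using W(2) elim(4) by auto
    qed
    have WB: "0 < W t" "W t < b0 + 2" if "t > 0" for t using W0[of t] that MB by auto
    have k: "\<epsilon> n * \<gamma> \<ge> 0" using e \<gamma> by simp
    show ?case
    proof
      fix x assume x: "x \<in> frontier \<Omega> \<inter> ball p r"
      then have xF: "x \<in> frontier \<Omega>" and xp: "dist p x < r" by auto
      have sub: "cball x r \<subseteq> cball p r0"
      proof
        fix z assume "z \<in> cball x r"
        then have "dist x z \<le> r" by simp
        then have "dist p z \<le> r0" using dist_triangle[of p z x] xp r_def by linarith
        then show "z \<in> cball p r0" by simp
      qed
      have xV: "x \<in> V" using sub r V(3) by (meson centre_in_cball less_imp_le subsetD)
      have subV: "cball x r \<subseteq> V" using sub V(3) by blast
      have \<rho>x: "\<rho> x = 0" using V(1) xV xF by (auto simp: defining_function_def)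
      have \<kappa>: "- \<sigma> * laplacian \<rho> z \<le> \<sigma> * (\<kappa> - \<sigma> * \<delta>)" if "z \<in> ball x r" for z
      proof -
        have "z \<in> cball p r0" using that sub ball_subset_cball by blast
        then have "\<bar>laplacian \<rho> z + h p\<bar> \<le> \<delta>" using V(4)[of z] lap[OF p pV] by simp
        then show ?thesis using \<sigma> by (auto simp: \<kappa>_def)
      qed
      have rob: "\<sigma> * (W 0 + \<epsilon> n * \<gamma> / l n * P n (W 0) - b0)
          \<ge> M * (\<epsilon> n * \<gamma>)\<^sup>2 / r\<^sup>2 - 2 * real DIM('a) * M / (m * r\<^sup>2) * (l n)\<^sup>2"
        unfolding W(2) by (rule elim(1))
      have bM: "b0 \<le> M" by (simp add: M_def)
      note bar = barrier[OF solves_u ln k less_imp_le[OF b0] \<sigma> V(1) xF r subV \<kappa> W(1,4) W0 bM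
         _ _ rob, where p'="P' n", folded C_def]
      have xc: "x \<in> closure \<Omega>" using xF by (simp add: frontier_def)
      have "\<sigma> * u n x \<le> \<sigma> * W (\<rho> x / l n) + M / r\<^sup>2 * (norm (x - x))\<^sup>2 + C * (l n)\<^sup>2"
        by (rule bar(1)) (use cpn WB xc r in auto)
      then have "\<sigma> * u n x \<le> \<sigma> * \<beta> n + C * (l n)\<^sup>2" by (simp add: \<rho>x W(2))
      also have "\<sigma> * \<beta> n + C * (l n)\<^sup>2 = \<sigma> * bs + \<epsilon> n * (\<sigma> * y) + (1 - \<sigma> * \<sigma>) * (C * (l n)\<^sup>2)"
        by (simp add: \<beta>_def algebra_simps)
      finally have ux: "\<sigma> * u n x \<le> \<sigma> * bs + \<epsilon> n * (\<sigma> * y)" by (simp add: \<sigma>\<sigma>)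
      have "\<sigma> * (u n x - bs) \<le> \<epsilon> n * (\<sigma> * y)" using ux by (simp add: right_diff_distrib)
      then have "\<sigma> * (u n x - bs) / \<epsilon> n \<le> \<sigma> * y" using e by (simp add: pos_divide_le_eq mult.commute)
      moreover have "\<sigma> * y = \<sigma> * (\<gamma> * G p / den) + (\<sigma> * \<sigma>) * (\<gamma> * d)" by (simp add: y_def algebra_simps)
      ultimately have 1: "\<sigma> * ((u n x - bs) / \<epsilon> n - \<gamma> * G p / den) \<le> \<gamma> * d"
        by (simp add: \<sigma>\<sigma> right_diff_distrib)
      have 2: "\<sigma> * (normal_deriv \<Omega> (u n) x - (p0 bs / (a0 * \<epsilon> n) - G p / den)) \<ge> - (\<delta> * (2 * p1 bs + 1))" if \<gamma>0: "\<gamma> = 0"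
      proof -
        have "u n x = b0" using solves_u[of n] xF \<gamma>0 by (simp add: solves_def)
        then have "u n x = bs" using bs_eq \<gamma>0 by simp
        moreover have y0: "y = 0" using \<gamma>0 by (simp add: y_def)
        moreover have "\<sigma> * \<beta> n + C * (l n)\<^sup>2 = \<sigma> * bs + \<epsilon> n * (\<sigma> * y) + (1 - \<sigma> * \<sigma>) * (C * (l n)\<^sup>2)"
          by (simp add: \<beta>_def algebra_simps)
        ultimately have eq: "\<sigma> * u n x = \<sigma> * W 0 + C * (l n)\<^sup>2" by (simp add: W(2) \<sigma>\<sigma>)
        have "\<sigma> * normal_deriv \<Omega> (u n) x \<ge> \<sigma> * (P n (W 0) / l n)"
          by (rule bar(2)) (use cpn WB eq in auto)
        then have nd: "\<sigma> * normal_deriv \<Omega> (u n) x \<ge> \<sigma> * (P n (\<beta> n) / l n)" by (simp add: W(2))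
        have "\<sigma> * Z = - (\<sigma> * (G p / p0 bs)) - (\<sigma> * \<sigma>) * (2 * \<delta> * p1 bs)" by (simp add: Z y0 algebra_simps)
        then have \<sigma>Z: "\<sigma> * Z = - (\<sigma> * (G p / p0 bs)) - 2 * \<delta> * p1 bs" by (simp add: \<sigma>\<sigma>)
        have "(P n (\<beta> n) / a n - p0 bs / a0) / \<epsilon> n = P n (\<beta> n) / l n - p0 bs / (a0 * \<epsilon> n)"
          by (simp add: l_def diff_divide_distrib mult.commute)
        then have "\<sigma> * Z - \<delta> < \<sigma> * (P n (\<beta> n) / l n) - \<sigma> * (p0 bs / (a0 * \<epsilon> n))"
          using elim(5) by (simp add: right_diff_distrib)
        then have "- (\<sigma> * (G p / p0 bs)) - 2 * \<delta> * p1 bs - \<delta> \<le> \<sigma> * normal_deriv \<Omega> (u n) x - \<sigma> * (p0 bs / (a0 * \<epsilon> n))"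
          using nd \<sigma>Z by linarith
        moreover have "den = p0 bs" unfolding den_def using \<gamma>0 by simp
        ultimately show ?thesis by (simp add: algebra_simps)
      qed
      show "\<sigma> * ((u n x - bs) / \<epsilon> n - \<gamma> * G p / den) \<le> \<gamma> * d \<and>
        (\<gamma> = 0 \<longrightarrow> \<sigma> * (normal_deriv \<Omega> (u n) x - (p0 bs / (a0 * \<epsilon> n) - G p / den)) \<ge> - (\<delta> * (2 * p1 bs + 1)))"
        using 1 2 by blast
    qed
  qed
  then show ?thesis unfolding d_def using r G by blast
qed

definition "expansion_error n x =
  \<bar>(u n x - bs) / \<epsilon> n - \<gamma> * G_term \<Omega> A q f bs x / den\<bar> +
  \<bar>normal_deriv \<Omega> (u n) x - (p0 bs / (a0 * \<epsilon> n) - G_term \<Omega> A q f bs x / den)\<bar>"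

text \<open>Combines both signs. For \<open>\<gamma> > 0\<close> the normal derivative is read off
  from the Robin condition; for \<open>\<gamma> = 0\<close> its two-sided bound comes from the
  touching barriers.\<close>

lemma local_expansion:
  assumes p: "p \<in> frontier \<Omega>" and e: "e > 0"
  shows "\<exists>r>0. \<forall>\<^sub>F n in sequentially. \<forall>x\<in>frontier \<Omega> \<inter> ball p r. expansion_error n x \<le> e"
proof -
  define G where "G = G_term \<Omega> A q f bs"
  have P0: "P0 bs \<ge> 0" and p1: "p1 bs \<ge> 0" using P0_bounds[OF bs(1)] p1_bounds[OF bs(1)] by auto
  define D where "D = 3 * (P0 bs + 1) / den"
  have D: "D \<ge> 0" using P0 den_pos by (simp add: D_def)
  \<comment> \<open>Collects the coefficients of \<delta> in the final estimate; the last summand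
    accounts for replacing \<open>G p\<close> by \<open>G x\<close>.\<close>
  define K where "K = (\<gamma> + 1) * D + (2 * p1 bs + 1) + (\<gamma> + 1) * P0 bs / den"
  have "(\<gamma> + 1) * D \<ge> 0" "(\<gamma> + 1) * P0 bs / den \<ge> 0" using \<gamma> D P0 den_pos by auto
  then have K: "K > 0" using p1 by (simp add: K_def)
  define \<delta> where "\<delta> = e / K"
  have \<delta>: "\<delta> > 0" "\<delta> * K = e" using e K by (auto simp: \<delta>_def)
  obtain r1 where r1: "r1 > 0" "\<And>x. x \<in> frontier \<Omega> \<inter> ball p r1 \<Longrightarrow> \<bar>G x - G p\<bar> \<le> \<delta> * P0 bs"
    and ev1: "\<forall>\<^sub>F n in sequentially. \<forall>x\<in>frontier \<Omega> \<inter> ball p r1.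
      1 * ((u n x - bs) / \<epsilon> n - \<gamma> * G p / den) \<le> \<gamma> * (3 * \<delta> * (P0 bs + 1) / den) \<and>
      (\<gamma> = 0 \<longrightarrow> 1 * (normal_deriv \<Omega> (u n) x - (p0 bs / (a0 * \<epsilon> n) - G p / den)) \<ge> - (\<delta> * (2 * p1 bs + 1)))"
    using one_sided_expansion[OF p _ \<delta>(1), of 1] unfolding G_def by auto
  obtain r2 where r2: "r2 > 0"
    and ev2: "\<forall>\<^sub>F n in sequentially. \<forall>x\<in>frontier \<Omega> \<inter> ball p r2.
      -1 * ((u n x - bs) / \<epsilon> n - \<gamma> * G p / den) \<le> \<gamma> * (3 * \<delta> * (P0 bs + 1) / den) \<and>
      (\<gamma> = 0 \<longrightarrow> -1 * (normal_deriv \<Omega> (u n) x - (p0 bs / (a0 * \<epsilon> n) - G p / den)) \<ge> - (\<delta> * (2 * p1 bs + 1)))"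
    using one_sided_expansion[OF p _ \<delta>(1), of "-1"] unfolding G_def by auto
  have "\<forall>\<^sub>F n in sequentially. \<forall>x\<in>frontier \<Omega> \<inter> ball p (min r1 r2). expansion_error n x \<le> e"
    using ev1 ev2
  proof eventually_elim
    case (elim n)
    show ?case
    proof
      fix x assume x: "x \<in> frontier \<Omega> \<inter> ball p (min r1 r2)"
      define X where "X = (u n x - bs) / \<epsilon> n - \<gamma> * G p / den"
      define Y where "Y = normal_deriv \<Omega> (u n) x - (p0 bs / (a0 * \<epsilon> n) - G p / den)"
      define g where "g = (G x - G p) / den"
      have x1: "x \<in> frontier \<Omega> \<inter> ball p r1" and x2: "x \<in> frontier \<Omega> \<inter> ball p r2" using x by auto
      have dD: "3 * \<delta> * (P0 bs + 1) / den = \<delta> * D" by (simp add: D_def)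
      note b1 = elim(1)[rule_format, OF x1, folded X_def Y_def, unfolded dD]
      note b2 = elim(2)[rule_format, OF x2, folded X_def Y_def, unfolded dD]
      have en: "\<epsilon> n > 0" by (rule \<epsilon>(1))
      have X: "\<bar>X\<bar> \<le> \<gamma> * (\<delta> * D)" using b1 b2 by (simp add: abs_le_iff)
      have Y: "\<bar>Y\<bar> \<le> \<delta> * D + \<delta> * (2 * p1 bs + 1)"
      proof (cases "\<gamma> = 0")
        case True
        then have "\<bar>Y\<bar> \<le> \<delta> * (2 * p1 bs + 1)" using b1 b2 by (simp add: abs_le_iff)
        moreover have "\<delta> * D \<ge> 0" using \<delta>(1) D by simp
        ultimately show ?thesis by linarith
      next
        case False
        then have \<gamma>0: "\<gamma> > 0" using \<gamma> by simp
        have rob: "u n x + \<epsilon> n * \<gamma> * normal_deriv \<Omega> (u n) x = b0" using solves_u[of n] x1 by (auto simp: solves_def)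
        have "\<epsilon> n * \<gamma> * (normal_deriv \<Omega> (u n) x) = \<gamma> * (p0 bs / a0) - (u n x - bs)" using rob bs_eq by linarith
        then have "normal_deriv \<Omega> (u n) x = (\<gamma> * (p0 bs / a0) - (u n x - bs)) / (\<epsilon> n * \<gamma>)"
          using en \<gamma>0 by (simp add: eq_divide_eq mult.commute)
        also have "\<dots> = p0 bs / (a0 * \<epsilon> n) - (u n x - bs) / \<epsilon> n / \<gamma>"
          using en \<gamma>0 a0_pos by (simp add: field_simps)
        \<comment> \<open>The bound on \<open>X\<close> carries a factor \<gamma>, so the division
          by \<gamma> costs nothing.\<close>
        finally have "Y = - (X / \<gamma>)" using \<gamma>0 by (simp add: X_def Y_def diff_divide_distrib)
        then have "\<bar>Y\<bar> = \<bar>X\<bar> / \<gamma>" using \<gamma>0 by simp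
        also have "\<dots> \<le> \<delta> * D" using X \<gamma>0 by (simp add: pos_divide_le_eq mult.commute)
        finally have "\<bar>Y\<bar> \<le> \<delta> * D" .
        moreover have "\<delta> * (2 * p1 bs + 1) \<ge> 0" using \<delta>(1) p1 by simp
        ultimately show ?thesis by linarith
      qed
      have g: "\<bar>g\<bar> \<le> \<delta> * P0 bs / den"
        using divide_right_mono[OF r1(2)[OF x1], of den] den_pos by (simp add: g_def)
      have "expansion_error n x = \<bar>X - \<gamma> * g\<bar> + \<bar>Y + g\<bar>"
        by (simp add: expansion_error_def X_def Y_def g_def G_def diff_divide_distrib right_diff_distrib)
      also have "\<dots> \<le> \<bar>X\<bar> + \<gamma> * \<bar>g\<bar> + (\<bar>Y\<bar> + \<bar>g\<bar>)"
      proof -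
        have "\<bar>\<gamma> * g\<bar> = \<gamma> * \<bar>g\<bar>" using \<gamma> by (simp add: abs_mult)
        then show ?thesis using abs_triangle_ineq4[of X "\<gamma> * g"] abs_triangle_ineq[of Y g] by linarith
      qed
      also have "\<dots> \<le> \<gamma> * (\<delta> * D) + \<gamma> * (\<delta> * P0 bs / den) + (\<delta> * D + \<delta> * (2 * p1 bs + 1) + \<delta> * P0 bs / den)"
        using X Y g mult_left_mono[OF g \<gamma>] by linarith
      also have "\<dots> = \<delta> * K" by (simp add: K_def algebra_simps add_divide_distrib)
      finally show "expansion_error n x \<le> e" using \<delta>(2) by simp
    qed
  qed
  then show ?thesis using r1(1) r2 by (intro exI[of _ "min r1 r2"]) auto
qed

lemma uniform_expansion:
  assumes e: "e > 0"
  shows "\<forall>\<^sub>F n in sequentially. \<forall>x\<in>frontier \<Omega>. expansion_error n x \<le> e"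
proof -
  obtain r where r: "\<And>p. p \<in> frontier \<Omega> \<Longrightarrow> r p > 0"
    "\<And>p. p \<in> frontier \<Omega> \<Longrightarrow> \<forall>\<^sub>F n in sequentially. \<forall>x\<in>frontier \<Omega> \<inter> ball p (r p). expansion_error n x \<le> e"
    using bchoice[of "frontier \<Omega>" "\<lambda>p r. r > 0 \<and> (\<forall>\<^sub>F n in sequentially. \<forall>x\<in>frontier \<Omega> \<inter> ball p r. expansion_error n x \<le> e)"]
      local_expansion[OF _ e] by blast
  have "compact (frontier \<Omega>)" using bounded_\<Omega> by (rule compact_frontier_bounded)
  moreover have "frontier \<Omega> \<subseteq> (\<Union>p\<in>frontier \<Omega>. ball p (r p))" using r(1) by force
  ultimately obtain S where S: "S \<subseteq> frontier \<Omega>" "finite S" "frontier \<Omega> \<subseteq> (\<Union>p\<in>S. ball p (r p))"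
    using compactE_image[of "frontier \<Omega>" "frontier \<Omega>" "\<lambda>p. ball p (r p)"] by blast
  have "\<forall>\<^sub>F n in sequentially. \<forall>p\<in>S. \<forall>x\<in>frontier \<Omega> \<inter> ball p (r p). expansion_error n x \<le> e"
    using S r(2) by (intro eventually_ball_finite) auto
  then show ?thesis by eventually_elim (use S(3) in blast)
qed

end

section \<open>Passage from sequences to the limit\<close>

lemma Ck_on_Suc_real:
  fixes g :: "real \<Rightarrow> real"
  assumes "Ck_on (Suc k) g UNIV"
  shows "(g has_real_derivative deriv g t) (at t)" "Ck_on k (deriv g) UNIV"
proof -
  have d: "(g has_real_derivative deriv g t) (at t)" for t
    using assms by (simp add: DERIV_deriv_iff_real_differentiable differentiable_on_def)
  then show "(g has_real_derivative deriv g t) (at t)" .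
  have "pd 1 g = deriv g"
  proof
    fix t
    show "pd 1 g t = deriv g t" using pd_eqI[OF d[of t, unfolded has_field_derivative_def], of 1] by simp
  qed
  then show "Ck_on k (deriv g) UNIV" using assms by simp
qed

theorem corollary1p4:
  fixes \<Omega> :: "'a::euclidean_space set"
    and q A f :: "real \<Rightarrow> real"
    and \<gamma> b0 bs :: real
    and u :: "real \<Rightarrow> 'a \<Rightarrow> real"
  assumes "DIM('a) \<ge> 2"
    and "open \<Omega>" and "connected \<Omega>" and "\<Omega> \<noteq> {}" and "bounded \<Omega>" and "smooth_boundary \<Omega>"
    and "\<gamma> \<ge> 0" and "b0 > 0"
    and "Ck_on 1 q UNIV"
    and "Ck_on 3 A UNIV" and "\<And>t. A t > 0"
    and "Ck_on 2 f UNIV" and "bdd_below (range (deriv f))" and "(INF t. deriv f t) > 0"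
    and "f 0 = 0"
    and "0 < bs" and "bs \<le> b0"
    and "bs + \<gamma> * sqrt (2 * primitive f bs / A (q 0)) = b0"
    and "\<forall>\<^sub>F \<epsilon> in at_right 0. bvp_solution \<Omega> A q f \<gamma> b0 \<epsilon> (u \<epsilon>)"
  shows "uniform_limit (frontier \<Omega>)
    (\<lambda>\<epsilon> x.
      \<bar>(u \<epsilon> x - bs) / \<epsilon>
        - \<gamma> * G_term \<Omega> A q f bs x
            / (\<gamma> * f bs / sqrt (A (q 0)) + sqrt (2 * primitive f bs))\<bar>
      + \<bar>normal_deriv \<Omega> (u \<epsilon>) x
          - (1 / \<epsilon> * sqrt (2 * primitive f bs / A (q 0))
             - G_term \<Omega> A q f bs x
                 / (\<gamma> * f bs / sqrt (A (q 0)) + sqrt (2 * primitive f bs)))\<bar>)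
    (\<lambda>x. 0) (at_right 0)"
proof -
  let ?G = "G_term \<Omega> A q f bs" and ?s = "sqrt (2 * primitive f bs)"
  let ?E = "\<lambda>\<epsilon> x. \<bar>(u \<epsilon> x - bs) / \<epsilon> - \<gamma> * ?G x / (\<gamma> * f bs / sqrt (A (q 0)) + ?s)\<bar>
      + \<bar>normal_deriv \<Omega> (u \<epsilon>) x - (1 / \<epsilon> * sqrt (2 * primitive f bs / A (q 0))
             - ?G x / (\<gamma> * f bs / sqrt (A (q 0)) + ?s))\<bar>"
  have f2: "Ck_on (Suc 1) f UNIV" and A3: "Ck_on (Suc 2) A UNIV" and q1: "Ck_on (Suc 0) q UNIV"
    using assms(9,10,12) by (simp_all add: numeral_2_eq_2 numeral_3_eq_3)
  define m where "m = (INF t. deriv f t)"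
  have m: "m > 0" "\<And>t. m \<le> deriv f t" using assms(13,14) by (auto simp: m_def intro: cINF_lower)
  have "\<forall>\<^sub>F \<epsilon> in at_right 0. \<forall>x\<in>frontier \<Omega>. ?E \<epsilon> x < e" if e: "e > 0" for e
  \<comment> \<open>A property that holds eventually along every sequence of positive numbers
    tending to zero holds eventually at zero from the right.\<close>
  proof (rule sequentially_imp_eventually_within, intro allI impI)
    fix X :: "nat \<Rightarrow> real"
    assume X: "(\<forall>n. X n \<in> {0<..} \<and> X n \<noteq> 0) \<and> X \<longlonglongrightarrow> 0"
    then have "filterlim X (at_right 0) sequentially" by (auto simp: filterlim_at)
    then have "\<forall>\<^sub>F n in sequentially. bvp_solution \<Omega> A q f \<gamma> b0 (X n) (u (X n))"
      using eventually_compose_filterlim[OF assms(19)] by blast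
    then obtain k where k: "\<And>n. n \<ge> k \<Longrightarrow> bvp_solution \<Omega> A q f \<gamma> b0 (X n) (u (X n))"
      unfolding eventually_sequentially by blast
    \<comment> \<open>Dropping the first \<open>k\<close> terms leaves only parameters for which the
      function is a solution, as the locale demands of every index.\<close>
    interpret bvp_sequence \<Omega> f m A q \<gamma> b0 bs "\<lambda>n. X (n + k)" "\<lambda>n. u (X (n + k))"
    proof unfold_locales
      show "continuous_on UNIV (deriv f)" by (rule Ck_on_continuous[OF Ck_on_Suc_real(2)[OF f2]])
      show "continuous_on UNIV (deriv q)" by (rule Ck_on_continuous[OF Ck_on_Suc_real(2)[OF q1]])
      show "(\<lambda>n. X (n + k)) \<longlonglongrightarrow> 0" using X by (intro LIMSEQ_ignore_initial_segment) simp
    qed (use assms m X k Ck_on_Suc_real(1)[OF f2] Ck_on_Suc_real(1)[OF A3] Ck_on_Suc_real(1)[OF q1] in auto)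
    have "expansion_error n x = ?E (X (n + k)) x" for n x
      by (simp add: expansion_error_def den_def a0_def p0_def real_sqrt_divide mult.commute[of _ "X (n + k)"])
    then have "\<forall>\<^sub>F n in sequentially. \<forall>x\<in>frontier \<Omega>. ?E (X (n + k)) x \<le> e / 2"
      using uniform_expansion[of "e / 2"] e by simp
    then have "\<forall>\<^sub>F n in sequentially. \<forall>x\<in>frontier \<Omega>. ?E (X n) x \<le> e / 2"
      using eventually_sequentially_seg[of "\<lambda>n. \<forall>x\<in>frontier \<Omega>. ?E (X n) x \<le> e / 2" k] by simp
    then show "\<forall>\<^sub>F n in sequentially. \<forall>x\<in>frontier \<Omega>. ?E (X n) x < e"
      by eventually_elim (use e in force)
  qed
  then show ?thesis by (simp add: uniform_limit_iff dist_real_def)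
qed


end
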